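(* Let $n\ge 3$, let $\Gamma_1,\Gamma_2$ be torsion-free cocompact lattices in $\mathrm{Isom}(\mathbb{H}^n)$, and let $M=(\mathbb{H}^n\times\mathbb{H}^n)/(\Gamma_1\times\Gamma_2)$. Denote by $g_0$ the product metric on $\mathbb{H}^n\times\mathbb{H}^n$ and also the metric it induces on $M$. Then there exists a sequence of Riemannian metrics $\{g_i\}$ on $M$ with $\mathrm{Vol}(M,g_i)=\mathrm{Vol}(M,g_0)$ for all $i$ such that: (1) $h(g_i)\to h(g_0)$ as $i\to\infty$; and (2) there does not exist a sequence of smooth subsets $Z_i\subset M$ with $$\lim_{i\to\infty}\mathrm{Vol}(Z_i,g_i)=\lim_{i\to\infty}\mathrm{Area}(\partial Z_i,g_i)=0$$ such that $(M\setminus Z_i,\,d_{g_i|_{M\setminus Z_i}},\,d\mathrm{vol}_{g_i})$ converges to $(M,d_{g_0},d\mathrm{vol}_{g_0})$ in the measured Gromov-Hausdorff topology.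
   Context: $\mathbb{H}^n$ is real hyperbolic $n$-space of curvature $-1$. Volume entropy: for a Riemannian metric $g$ on a closed manifold $M$ with universal cover $(\tilde M,\tilde g)$ (pulled-back metric), $h(g):=\lim_{R\to\infty}\frac1R\log\mathrm{Vol}(B_{\tilde g}(o,R),\tilde g)$, where $B_{\tilde g}(o,R)$ is the ball of radius $R$ about $o\in\tilde M$; this is independent of $o$. $\mathrm{Vol}(Z,g)$ denotes the top-dimensional volume (dimension $\dim M$) of $Z\subset M$ with respect to $g$, and $\mathrm{Area}(\partial Z,g)$ denotes the $(\dim M-1)$-dimensional volume of its boundary $\partial Z$ with respect to $g$ (here $\dim M=2n$). A smooth subset is a (possibly empty) codimension-$0$ region of $M$ with smooth (possibly empty) boundary. For a subset $A\subset M$, $d_{g|_A}$ is the intrinsic length distance: $d_{g|_A}(x,y)=\inf_\gamma \mathrm{Length}(\gamma,g)$ over all rectifiable curves $\gamma$ contained in $A$ joining $x$ to $y$ (not the restriction of the ambient distance of $(M,g)$). $d_{g_0}$ and $d\mathrm{vol}_{g}$ are the Riemannian distance and the Riemannian volume measure. *)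

theory Defs
  imports "HOL-Analysis.Analysis" "HOL-Algebra.Bij" "HOL-Algebra.Coset"
begin

section \<open>Smooth maps and Riemannian metrics on open sets\<close>

text \<open>Class C-infinity on an open set: all iterated directional derivatives exist as Frechet
  derivatives and are continuous.\<close>

primrec Ck_on :: "nat \<Rightarrow> 'a::euclidean_space set \<Rightarrow> ('a \<Rightarrow> 'b::real_normed_vector) \<Rightarrow> bool" where
  "Ck_on 0 X f \<longleftrightarrow> continuous_on X f"
| "Ck_on (Suc k) X f \<longleftrightarrow>
     (\<forall>x\<in>X. f differentiable (at x)) \<and> (\<forall>v. Ck_on k X (\<lambda>x. frechet_derivative f (at x) v))"

definition smooth_on :: "'a::euclidean_space set \<Rightarrow> ('a \<Rightarrow> 'b::real_normed_vector) \<Rightarrow> bool" where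
  "smooth_on X f \<longleftrightarrow> (\<forall>k. Ck_on k X f)"

text \<open>A metric tensor assigns to a point \<open>x\<close> and tangent vectors \<open>u\<close>, \<open>v\<close> the number \<open>g x u v\<close>;
  values at points outside the open set in question are never used.\<close>

type_synonym 'a tensor2 = "'a \<Rightarrow> 'a \<Rightarrow> 'a \<Rightarrow> real"

definition riemannian_metric :: "'a::euclidean_space set \<Rightarrow> 'a tensor2 \<Rightarrow> bool" where
  "riemannian_metric X g \<longleftrightarrow>
     (\<forall>x\<in>X. bilinear (g x) \<and> (\<forall>u v. g x u v = g x v u) \<and> (\<forall>u. u \<noteq> 0 \<longrightarrow> g x u u > 0)) \<and>
     (\<forall>u v. smooth_on X (\<lambda>x. g x u v))"

definition preserves_metric :: "'a::euclidean_space set \<Rightarrow> 'a tensor2 \<Rightarrow> ('a \<Rightarrow> 'a) \<Rightarrow> bool" where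
  "preserves_metric X g f \<longleftrightarrow>
     (\<forall>x\<in>X. \<forall>u v. g (f x) (frechet_derivative f (at x) u) (frechet_derivative f (at x) v) = g x u v)"

text \<open>The length of a piecewise C1 path is a nonnegative Lebesgue integral, because
  \<open>piecewise_C1_differentiable_on\<close> does not bound the derivative near the exceptional points:
  such a path may have infinite length.\<close>

definition path_length :: "'a::euclidean_space tensor2 \<Rightarrow> (real \<Rightarrow> 'a) \<Rightarrow> ennreal" where
  "path_length g c =
     (\<integral>\<^sup>+t\<in>{0..1}. ennreal (sqrt (g (c t) (vector_derivative c (at t)) (vector_derivative c (at t)))) \<partial>lborel)"

definition riem_dist :: "'a::euclidean_space set \<Rightarrow> 'a tensor2 \<Rightarrow> 'a \<Rightarrow> 'a \<Rightarrow> ennreal" where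
  "riem_dist X g x y =
     (INF c \<in> {c. c piecewise_C1_differentiable_on {0..1} \<and> c ` {0..1} \<subseteq> X \<and> c 0 = x \<and> c 1 = y}.
        path_length g c)"

text \<open>The Leibniz formula for the determinant of the matrix of \<open>g x\<close> in the standard
  orthonormal basis (\<open>det\<close> is restricted to matrices indexed by a finite type).\<close>

definition gram_det :: "'a::euclidean_space tensor2 \<Rightarrow> 'a \<Rightarrow> real" where
  "gram_det g x = (\<Sum>p | p permutes Basis. of_int (sign p) * (\<Prod>b\<in>Basis. g x b (p b)))"

definition riem_vol :: "'a::euclidean_space set \<Rightarrow> 'a tensor2 \<Rightarrow> 'a measure" where
  "riem_vol X g = density (restrict_space lborel X) (\<lambda>x. ennreal (sqrt (gram_det g x)))"

definition volume_entropy :: "'a::euclidean_space set \<Rightarrow> 'a tensor2 \<Rightarrow> real" where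
  "volume_entropy X g =
     (THE h. \<forall>o'\<in>X.
        ((\<lambda>R. ln (measure (riem_vol X g) {y\<in>X. riem_dist X g o' y < ennreal R}) / R) \<longlongrightarrow> h) at_top)"


section \<open>Quotient manifolds\<close>

definition quotient_topology :: "'a topology \<Rightarrow> ('a \<Rightarrow> 'b) \<Rightarrow> 'b topology" where
  "quotient_topology T q =
     topology (\<lambda>U. U \<subseteq> q ` topspace T \<and> openin T {x \<in> topspace T. q x \<in> U})"

lemma openin_quotient_topology:
  "openin (quotient_topology T q) U \<longleftrightarrow>
     U \<subseteq> q ` topspace T \<and> openin T {x \<in> topspace T. q x \<in> U}"
proof -
  have "istopology (\<lambda>U. U \<subseteq> q ` topspace T \<and> openin T {x \<in> topspace T. q x \<in> U})"
    unfolding istopology_def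
  proof (intro conjI allI impI)
    fix S U
    assume "S \<subseteq> q ` topspace T \<and> openin T {x \<in> topspace T. q x \<in> S}"
      "U \<subseteq> q ` topspace T \<and> openin T {x \<in> topspace T. q x \<in> U}"
    moreover have "{x \<in> topspace T. q x \<in> S \<inter> U} =
        {x \<in> topspace T. q x \<in> S} \<inter> {x \<in> topspace T. q x \<in> U}" by blast
    ultimately show "S \<inter> U \<subseteq> q ` topspace T" "openin T {x \<in> topspace T. q x \<in> S \<inter> U}"
      by auto
  next
    fix K
    assume K: "\<forall>S\<in>K. S \<subseteq> q ` topspace T \<and> openin T {x \<in> topspace T. q x \<in> S}"
    have "{x \<in> topspace T. q x \<in> \<Union>K} = (\<Union>S\<in>K. {x \<in> topspace T. q x \<in> S})" by blast
    with K show "\<Union>K \<subseteq> q ` topspace T" "openin T {x \<in> topspace T. q x \<in> \<Union>K}"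
      by auto
  qed
  then show ?thesis
    by (simp add: quotient_topology_def topology_inverse')
qed

text \<open>Throughout, \<open>X\<close> is an open set and \<open>D\<close> a set of maps acting on it, meant to be a group of
  deck transformations acting smoothly, freely and properly discontinuously. Points of the
  quotient \<open>X/D\<close> are the orbits. The local inverses of the projection \<open>orb D\<close> are smooth charts
  of \<open>X/D\<close> whose transition maps are restrictions of elements of \<open>D\<close>.\<close>

definition orb :: "('a \<Rightarrow> 'a) set \<Rightarrow> 'a \<Rightarrow> 'a set" where
  "orb D x = (\<lambda>\<gamma>. \<gamma> x) ` D"

definition quot :: "'a set \<Rightarrow> ('a \<Rightarrow> 'a) set \<Rightarrow> 'a set set" where
  "quot X D = orb D ` X"

definition quot_top :: "'a::euclidean_space set \<Rightarrow> ('a \<Rightarrow> 'a) set \<Rightarrow> 'a set topology" where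
  "quot_top X D = quotient_topology (top_of_set X) (orb D)"

text \<open>A Riemannian metric on \<open>X/D\<close>, written in the charts above, is a Riemannian metric on \<open>X\<close>
  compatible with the transition maps. The same tensor \<open>g\<close> is thus the metric on \<open>X/D\<close> and its
  pull-back to \<open>X\<close>; when \<open>X\<close> is simply connected, \<open>volume_entropy X g\<close> is the entropy of \<open>X/D\<close>.\<close>

definition quot_riemannian_metric ::
    "'a::euclidean_space set \<Rightarrow> ('a \<Rightarrow> 'a) set \<Rightarrow> 'a tensor2 \<Rightarrow> bool" where
  "quot_riemannian_metric X D g \<longleftrightarrow> riemannian_metric X g \<and> (\<forall>\<gamma>\<in>D. preserves_metric X g \<gamma>)"

text \<open>Piecewise C1 paths in \<open>X/D\<close> are the projections of piecewise C1 paths in \<open>X\<close>.\<close>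

definition quot_dist ::
    "'a::euclidean_space set \<Rightarrow> ('a \<Rightarrow> 'a) set \<Rightarrow> 'a tensor2 \<Rightarrow> 'a set \<Rightarrow> 'a set \<Rightarrow> ennreal" where
  "quot_dist X D g p q = (INF (x, y) \<in> p \<times> q. riem_dist X g x y)"

text \<open>The Riemannian volume on the Borel sets of \<open>X/D\<close>: the projection is a local isometry, so it
  preserves the volume of the Borel sets on which it is injective. The supremum is attained at
  the part of a Borel fundamental domain lying over \<open>B\<close>.\<close>

definition quot_vol ::
    "'a::euclidean_space set \<Rightarrow> ('a \<Rightarrow> 'a) set \<Rightarrow> 'a tensor2 \<Rightarrow> 'a set measure" where
  "quot_vol X D g =
     measure_of (quot X D) {U. openin (quot_top X D) U}
       (\<lambda>B. SUP E \<in> {E \<in> sets (riem_vol X g). inj_on (orb D) E \<and> orb D ` E \<subseteq> B}.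
          emeasure (riem_vol X g) E)"

text \<open>Closed regions with smooth boundary, i.e. codimension-0 submanifolds with boundary: locally
  at the boundary, sublevel sets of a smooth function with nonvanishing differential.\<close>

definition smooth_region :: "'a::euclidean_space set \<Rightarrow> ('a \<Rightarrow> 'a) set \<Rightarrow> 'a set set \<Rightarrow> bool" where
  "smooth_region X D Z \<longleftrightarrow>
     closedin (quot_top X D) Z \<and>
     (\<forall>x\<in>X. orb D x \<in> (quot_top X D) frontier_of Z \<longrightarrow>
        (\<exists>U f. open U \<and> x \<in> U \<and> U \<subseteq> X \<and> smooth_on U (f :: 'a \<Rightarrow> real) \<and>
           f x = 0 \<and> (\<exists>v. frechet_derivative f (at x) v \<noteq> 0) \<and>
           (\<forall>y\<in>U. orb D y \<in> Z \<longleftrightarrow> f y \<le> 0)))"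


section \<open>Metric notions, for distances with values in \<open>[0,\<infinity>]\<close>\<close>

definition curve_length :: "('p \<Rightarrow> 'p \<Rightarrow> ennreal) \<Rightarrow> (real \<Rightarrow> 'p) \<Rightarrow> ennreal" where
  "curve_length d c =
     (SUP (t, k) \<in> {t :: nat \<Rightarrow> real. incseq t \<and> range t \<subseteq> {0..1}} \<times> UNIV.
        \<Sum>i<k. d (c (t i)) (c (t (Suc i))))"

text \<open>Since non-rectifiable curves have length \<open>\<infinity>\<close>, the infimum is effectively over the rectifiable
  ones, and it is \<open>\<infinity>\<close> if there are none.\<close>

definition intrinsic_dist ::
    "'p topology \<Rightarrow> ('p \<Rightarrow> 'p \<Rightarrow> ennreal) \<Rightarrow> 'p set \<Rightarrow> 'p \<Rightarrow> 'p \<Rightarrow> ennreal" where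
  "intrinsic_dist T d A p q =
     (INF c \<in> {c. pathin (subtopology T A) c \<and> c 0 = p \<and> c 1 = q}. curve_length d c)"

definition ediam :: "('p \<Rightarrow> 'p \<Rightarrow> ennreal) \<Rightarrow> 'p set \<Rightarrow> ennreal" where
  "ediam d C = (SUP x\<in>C. SUP y\<in>C. d x y)"

text \<open>\<open>k\<close>-dimensional Hausdorff measure of a subset \<open>A\<close> of the space \<open>S\<close>, normalised to agree with
  the Riemannian \<open>k\<close>-volume on smooth \<open>k\<close>-dimensional submanifolds.\<close>

definition hausdorff_meas :: "nat \<Rightarrow> 'p set \<Rightarrow> ('p \<Rightarrow> 'p \<Rightarrow> ennreal) \<Rightarrow> 'p set \<Rightarrow> ennreal" where
  "hausdorff_meas k S d A =
     (SUP \<delta>\<in>{0<..}.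
        INF C \<in> {C :: nat \<Rightarrow> 'p set. A \<subseteq> (\<Union>j. C j) \<and> (\<forall>j. C j \<subseteq> S \<and> ediam d (C j) \<le> ennreal \<delta>)}.
          \<Sum>j. if C j = {} then 0 else ennreal (unit_ball_vol (real k)) * (ediam d (C j) / 2) ^ k)"

definition boundary_area ::
    "'a::euclidean_space set \<Rightarrow> ('a \<Rightarrow> 'a) set \<Rightarrow> 'a tensor2 \<Rightarrow> 'a set set \<Rightarrow> ennreal" where
  "boundary_area X D g Z =
     hausdorff_meas (DIM('a) - 1) (quot X D) (quot_dist X D g) (quot_top X D frontier_of Z)"

definition metric_continuous :: "'p set \<Rightarrow> ('p \<Rightarrow> 'p \<Rightarrow> ennreal) \<Rightarrow> ('p \<Rightarrow> real) \<Rightarrow> bool" where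
  "metric_continuous Y d \<phi> \<longleftrightarrow>
     (\<forall>x\<in>Y. \<forall>\<epsilon>>0. \<exists>\<delta>>0. \<forall>y\<in>Y. d x y < ennreal \<delta> \<longrightarrow> \<bar>\<phi> y - \<phi> x\<bar> < \<epsilon>)"

definition gh_approximation ::
    "real \<Rightarrow> 'p set \<Rightarrow> ('p \<Rightarrow> 'p \<Rightarrow> ennreal) \<Rightarrow> 'q set \<Rightarrow> ('q \<Rightarrow> 'q \<Rightarrow> ennreal) \<Rightarrow> ('p \<Rightarrow> 'q) \<Rightarrow> bool" where
  "gh_approximation \<epsilon> X d\<^sub>X Y d\<^sub>Y f \<longleftrightarrow>
     f ` X \<subseteq> Y \<and>
     (\<forall>x\<in>X. \<forall>x'\<in>X. d\<^sub>Y (f x) (f x') \<le> d\<^sub>X x x' + ennreal \<epsilon> \<and> d\<^sub>X x x' \<le> d\<^sub>Y (f x) (f x') + ennreal \<epsilon>) \<and>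
     (\<forall>y\<in>Y. \<exists>x\<in>X. d\<^sub>Y (f x) y \<le> ennreal \<epsilon>)"

text \<open>Measured Gromov-Hausdorff convergence in the sense of Fukaya, to a compact limit: measurable
  \<open>\<epsilon>\<^sub>i\<close>-approximations with \<open>\<epsilon>\<^sub>i \<rightarrow> 0\<close> under which the push-forward measures converge weakly.\<close>

definition mgh_converges ::
    "(nat \<Rightarrow> 'p set) \<Rightarrow> (nat \<Rightarrow> 'p \<Rightarrow> 'p \<Rightarrow> ennreal) \<Rightarrow> (nat \<Rightarrow> 'p measure) \<Rightarrow>
     'q set \<Rightarrow> ('q \<Rightarrow> 'q \<Rightarrow> ennreal) \<Rightarrow> 'q measure \<Rightarrow> bool" where
  "mgh_converges X d \<mu> Y d' \<nu> \<longleftrightarrow>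
     (\<exists>f. (\<forall>\<epsilon>>0. \<forall>\<^sub>F i in sequentially. gh_approximation \<epsilon> (X i) (d i) Y d' (f i)) \<and>
          (\<forall>\<^sub>F i in sequentially. f i \<in> measurable (\<mu> i) \<nu>) \<and>
          (\<forall>\<phi>. metric_continuous Y d' \<phi> \<and> bounded (\<phi> ` Y) \<longrightarrow>
             (\<lambda>i. integral\<^sup>L (distr (\<mu> i) \<nu> (f i)) \<phi>) \<longlonglongrightarrow> integral\<^sup>L \<nu> \<phi>))"


section \<open>Hyperbolic space and cocompact lattices\<close>

text \<open>Poincare ball model: the unit ball with a metric of constant curvature \<open>-1\<close>.\<close>

abbreviation hyp_space :: "(real ^ 'n::finite) set" where
  "hyp_space \<equiv> ball 0 1"

definition hyp_metric :: "(real ^ 'n::finite) tensor2" where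
  "hyp_metric x u v = 4 * (u \<bullet> v) / (1 - (norm x)\<^sup>2)\<^sup>2"

text \<open>The Riemannian isometries, as a subgroup of the bijections of \<open>X\<close>. Smoothness of the inverse
  is automatic since the differentials are invertible.\<close>

definition isom_group :: "'a::euclidean_space set \<Rightarrow> 'a tensor2 \<Rightarrow> ('a \<Rightarrow> 'a) monoid" where
  "isom_group X g = (BijGroup X)\<lparr>carrier := {f \<in> Bij X. smooth_on X f \<and> preserves_metric X g f}\<rparr>"

text \<open>The compact-open topology.\<close>

definition isom_topology :: "'a::euclidean_space set \<Rightarrow> 'a tensor2 \<Rightarrow> ('a \<Rightarrow> 'a) topology" where
  "isom_topology X g =
     topology_generated_by
       {{f \<in> carrier (isom_group X g). f ` K \<subseteq> U} | K U. compact K \<and> K \<subseteq> X \<and> open U}"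

definition cocompact_lattice :: "'a::euclidean_space set \<Rightarrow> 'a tensor2 \<Rightarrow> ('a \<Rightarrow> 'a) set \<Rightarrow> bool" where
  "cocompact_lattice X g \<Gamma> \<longleftrightarrow>
     subgroup \<Gamma> (isom_group X g) \<and>
     subtopology (isom_topology X g) \<Gamma> = discrete_topology \<Gamma> \<and>
     compact_space (quotient_topology (isom_topology X g) (\<lambda>f. f <#\<^bsub>isom_group X g\<^esub> \<Gamma>))"

definition torsion_free :: "('g, 'm) monoid_scheme \<Rightarrow> 'g set \<Rightarrow> bool" where
  "torsion_free G \<Gamma> \<longleftrightarrow> (\<forall>\<gamma>\<in>\<Gamma>. \<forall>k::nat. k > 0 \<and> \<gamma> [^]\<^bsub>G\<^esub> k = \<one>\<^bsub>G\<^esub> \<longrightarrow> \<gamma> = \<one>\<^bsub>G\<^esub>)"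

definition hyp_prod :: "((real ^ 'n::finite) \<times> (real ^ 'n)) set" where
  "hyp_prod = hyp_space \<times> hyp_space"

definition hyp_prod_metric :: "((real ^ 'n::finite) \<times> (real ^ 'n)) tensor2" where
  "hyp_prod_metric x u v =
     hyp_metric (fst x) (fst u) (fst v) + hyp_metric (snd x) (snd u) (snd v)"

definition prod_action :: "('a \<Rightarrow> 'a) set \<Rightarrow> ('b \<Rightarrow> 'b) set \<Rightarrow> ('a \<times> 'b \<Rightarrow> 'a \<times> 'b) set" where
  "prod_action \<Gamma>\<^sub>1 \<Gamma>\<^sub>2 = {map_prod \<gamma>\<^sub>1 \<gamma>\<^sub>2 | \<gamma>\<^sub>1 \<gamma>\<^sub>2. \<gamma>\<^sub>1 \<in> \<Gamma>\<^sub>1 \<and> \<gamma>\<^sub>2 \<in> \<Gamma>\<^sub>2}"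

end

theory Submission
 imports Defs "HOL-Real_Asymp.Real_Asymp"
begin

text \<open>Let \<open>s = 1/n\<close>. Around the \<open>\<Gamma>\<^sub>2\<close>-translates of a small sphere \<open>|y| = r\<close> in the second factor take
 thin shells. Inside them the first factor of the metric is divided by \<open>1 + s\<close>, the second by \<open>1 - s\<close>, and the
 direction normal to the spheres is shrunk further so that the volume density is unchanged.

 Entropy: as the shells get thin, on a fixed small scale the new distance is at most the product distance plus
 \<open>o(1)\<close>, and at least the sum of the two hyperbolic distances divided by \<open>sqrt 2\<close>, minus \<open>o(1)\<close>. Chaining at that
 scale, and since the balls of the two comparison distances have the same exponential growth, the entropies converge.

 No convergence: with \<open>t = 1/sqrt (1 + s)\<close>, walking along the shell in the first factor costs only the fraction \<open>t\<close> of
 the length. Take \<open>A\<close>, \<open>B\<close>, \<open>B'\<close> over the sphere, \<open>A\<close> midway between \<open>B\<close> and \<open>B'\<close>, and \<open>C\<close> radially outside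
 \<open>A\<close> at such a height that the shortest way from \<open>C\<close> to \<open>B\<close> uses the shell all along the first factor. Their six
 distances violate the parallelogram law by a definite amount, while \<open>g\<^sub>0\<close> is almost Euclidean on small
 balls. Removing \<open>Z\<^sub>i\<close> does not help: its boundary is covered by balls that are small in the sense of
 (dim - 1)-dimensional measure, so some two-dimensional slice meets balls of small total radius only, and there the
 path along the shell can go around them.\<close>

text \<open>Why the entropy survives: if one factor grows at rate \<open>h\<close>, the product ball
  of radius \<open>T\<close> contains the pairs with both distances below \<open>T / sqrt 2\<close>,
  so it grows at rate at least \<open>sqrt 2 h\<close>; the l1 ball of radius
  \<open>sqrt 2 T\<close> also grows at rate \<open>sqrt 2 h\<close>. A distance squeezed between
  the two keeps this rate, so there is room for shrinking as long as the norm stays above the l1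
  norm over \<open>sqrt 2\<close>. The factors \<open>1 + s\<close> and \<open>1 - s\<close> sum to
  2, and by Cauchy-Schwarz this is that bound. Keeping the volume density then forces the extra
  normal shrinking. This violates the bound inside the shell, but it is felt only when crossing,
  which a thin shell makes cheap. The value \<open>1/n\<close> is the largest \<open>s\<close> for
  which Bernoulli's inequality keeps normal vectors at no less than their hyperbolic length, so that
  projection to the second factor stays 1-Lipschitz. The obstacle in the second half is that a small
  boundary area bounds neither the number nor the diameter of the removed pieces: thin tubes may be
  long and dense. Only in a two-dimensional slice do they appear as small spots.\<close>

type_synonym 'n pt = "(real, 'n) vec \<times> (real, 'n) vec"

section \<open>Path lengths and the Riemannian distance\<close>

abbreviation "HS == hyp_space"
abbreviation "hm == hyp_metric"
abbreviation "HP == hyp_prod"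
abbreviation "g0 == hyp_prod_metric"
abbreviation "FD f x == frechet_derivative f (at x)"

text \<open>Continuity is asked for one direction \<open>v\<close> at a time; in finite dimension
  this yields joint continuity through \<open>continuous_on_lin_family\<close>. The derivative is a
  parameter, so that explicit formulas can be supplied for it.\<close>

definition C1_map :: "'a::euclidean_space set => ('a => 'b::real_normed_vector) => ('a => 'a => 'b) => bool" where
 "C1_map U F F' \<longleftrightarrow> (ALL x:U. (F has_derivative F' x) (at x)) & (ALL v. continuous_on U (%x. F' x v))"

text \<open>What makes the speed of a C1 path continuous and nonnegative, hence lengths measurable
  and additive over pieces.\<close>

definition semi_metric :: "'a::euclidean_space set => 'a tensor2 => bool" where
 "semi_metric X g \<longleftrightarrow> (ALL x:X. bilinear (g x) & (ALL v. 0 <= g x v v)) &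
   (ALL u v. continuous_on X (%x. g x u v))"

definition speed :: "'a::euclidean_space tensor2 => (real => 'a) => real => real" where
 "speed g c t = sqrt (g (c t) (vector_derivative c (at t)) (vector_derivative c (at t)))"

definition plen :: "'a::euclidean_space tensor2 => (real => 'a) => real => real => ennreal" where
 "plen g c a b = (\<integral>\<^sup>+t\<in>{a..b}. ennreal (speed g c t) \<partial>lborel)"

lemma path_length_plen: "path_length g c = plen g c 0 1"
 by (simp add: path_length_def plen_def speed_def)

text \<open>Expanding the argument in the basis leaves a finite sum of products of continuous
  functions.\<close>

lemma continuous_on_lin_family:
 fixes A :: "'t::topological_space => 'a::euclidean_space => 'b::real_normed_vector"
 assumes "!!t. t : S ==> linear (A t)" and "!!v. continuous_on S (%t. A t v)" and "continuous_on S w"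
 shows "continuous_on S (%t. A t (w t))"
proof -
 have "A t (w t) = (\<Sum>b\<in>Basis. (w t \<bullet> b) *\<^sub>R A t b)" if "t : S" for t
 proof -
  interpret linear "A t" using assms(1)[OF that] .
  have "A t (w t) = A t (\<Sum>b\<in>Basis. (w t \<bullet> b) *\<^sub>R b)" by (simp add: euclidean_representation)
  also have "... = (\<Sum>b\<in>Basis. (w t \<bullet> b) *\<^sub>R A t b)" by (simp add: sum scale)
  finally show ?thesis .
 qed
 moreover have "continuous_on S (%t. \<Sum>b\<in>Basis. (w t \<bullet> b) *\<^sub>R A t b)"
  by (intro continuous_intros assms)
 ultimately show ?thesis by (simp cong: continuous_on_cong)
qed

lemma continuous_on_bilinear_family:
 fixes g :: "'t::topological_space => 'a::euclidean_space => 'a => real"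
 assumes "!!t. t : S ==> bilinear (g t)" and "!!u v. continuous_on S (%t. g t u v)"
  and "continuous_on S u" "continuous_on S v"
 shows "continuous_on S (%t. g t (u t) (v t))"
proof -
 have "continuous_on S (%t. g t (u t) w)" for w
  by (rule continuous_on_lin_family[where A="%t x. g t x w"])
   (use assms in "auto simp: bilinear_def")
 moreover have "linear (g t (u t))" if "t : S" for t
  using assms(1)[OF that] by (simp add: bilinear_def)
 ultimately show ?thesis
  using continuous_on_lin_family[where A="%t. g t (u t)" and S=S and w=v] assms(4) by blast
qed

lemma valid_path_C1:
 assumes "valid_path c"
 obtains S where "finite S" "c C1_differentiable_on {0..1} - S" "0 : S" "1 : S" "continuous_on {0..1} c"
proof -
 obtain S where S: "finite S" "c C1_differentiable_on {0..1} - S" and "continuous_on {0..1} c"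
  using assms by (auto simp: valid_path_def piecewise_C1_differentiable_on_def)
 then show thesis
  by (intro that[of "insert 0 (insert 1 S)"]) (auto elim: C1_differentiable_on_subset)
qed

lemma speed_continuous:
 assumes g: "semi_metric X g" and c: "c C1_differentiable_on T" "c ` T \<subseteq> X"
 shows "continuous_on T (speed g c)"
proof -
 have cc: "continuous_on T c"
  using C1_differentiable_imp_continuous_on[OF c(1)] .
 have "continuous_on T (%t. g (c t) (vector_derivative c (at t)) (vector_derivative c (at t)))"
 proof (rule continuous_on_bilinear_family[where g="%t. g (c t)"])
  show "continuous_on T (%t. g (c t) u v)" for u v
   using g cc c(2) continuous_on_compose2[of X "%x. g x u v" T c] by (simp add: semi_metric_def)
  show "continuous_on T (%t. vector_derivative c (at t))"
   using c(1) by (simp add: C1_differentiable_on_eq)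
 qed (use g c in "auto simp: semi_metric_def C1_differentiable_on_eq")
 then show ?thesis
  unfolding speed_def by (intro continuous_intros)
qed

text \<open>At the exceptional parameters of a piecewise C1 path \<open>vector_derivative\<close>
  may be an unspecified value, so the finitely many values there are split off as multiples of
  indicators of points.\<close>

lemma measurable_off_finite:
 fixes f :: "real => real"
 assumes "finite S" "continuous_on ({0..1} - S) f"
 shows "(%t. indicator {0..1} t * f t) : borel_measurable borel"
proof -
 have "(%t. if t : {0..1} - S then f t else 0) : borel_measurable borel"
  by (rule borel_measurable_continuous_on_if) (use assms in "auto simp: finite_imp_closed")
 then have 1: "(%t. indicator ({0..1} - S) t * f t) : borel_measurable borel"
  by (rule back_subst[where P="%f. f : borel_measurable borel"]) (auto simp: fun_eq_iff indicator_def)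
 have 2: "(%t. \<Sum>s\<in>S \<inter> {0..1}. indicator {s} t * f s) : borel_measurable borel"
  by measurable
 have "indicator {0..1} t * f t = indicator ({0..1} - S) t * f t + (\<Sum>s\<in>S \<inter> {0..1}. indicator {s} t * f s)" for t
 proof -
  have "(\<Sum>s\<in>S \<inter> {0..1}. indicator {s} t * f s) = (\<Sum>s\<in>S \<inter> {0..1}. if t = s then f s else 0)"
   by (intro sum.cong) (auto simp: indicator_def)
  also have "... = (if t : S \<inter> {0..1} then f t else 0)"
   using assms(1) by simp
  finally show ?thesis by (auto simp: indicator_def)
 qed
 then show ?thesis using borel_measurable_add[OF 1 2] by simp
qed

lemma speed_measurable:
 assumes "semi_metric X g" "valid_path c" "c ` {0..1} \<subseteq> X"
 shows "(%t. indicator {0..1} t * speed g c t) : borel_measurable borel"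
proof -
 obtain S where "finite S" "c C1_differentiable_on {0..1} - S"
  using valid_path_C1[OF assms(2)] by metis
 with assms show ?thesis
  by (intro measurable_off_finite speed_continuous[where X=X]) auto
qed

lemma nn_integral_mult_indicator_ennreal:
 "(\<integral>\<^sup>+t\<in>A. ennreal (f t) \<partial>M) = (\<integral>\<^sup>+t. ennreal (indicator A t * f t) \<partial>M)"
 by (intro nn_integral_cong) (auto simp: indicator_def)

lemma plen_cong_measurable:
 assumes "0 <= a" "b <= 1"
 shows "plen g c a b = (\<integral>\<^sup>+t\<in>{a..b}. ennreal (indicator {0..1} t * speed g c t) \<partial>lborel)"
 unfolding plen_def using assms by (intro nn_integral_cong) (auto simp: indicator_def)

lemma nn_integral_cong_point:
 fixes f h :: "real => ennreal"
 assumes "!!t. t ~= b ==> f t = h t"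
 shows "(\<integral>\<^sup>+t. f t \<partial>lborel) = (\<integral>\<^sup>+t. h t \<partial>lborel)"
proof (rule nn_integral_cong_AE)
 show "AE t in lborel. f t = h t"
  by (rule AE_mp[OF AE_lborel_singleton[of b]]) (use assms in auto)
qed

lemma plen_point: "plen g c v v = 0"
proof -
 have "{v} : null_sets lborel" by (intro finite_imp_null_set_lborel) simp
 then show ?thesis unfolding plen_def by (simp add: nn_integral_null_set)
qed

lemma plen_add:
 assumes "semi_metric X g" "valid_path c" "c ` {0..1} \<subseteq> X" "0 <= a" "a <= b" "b <= d" "d <= 1"
 shows "plen g c a b + plen g c b d = plen g c a d"
proof -
 have [measurable]: "(%t. indicator {0..1} t * speed g c t) : borel_measurable borel"
  by (rule speed_measurable[OF assms(1-3)])
 define f where "f = (%t. ennreal (indicator {0..1} t * speed g c t))"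
 have [measurable]: "f : borel_measurable borel" unfolding f_def by measurable
 \<comment> \<open>Replacing \<open>{b..d}\<close> by \<open>{b<..d}\<close> makes the two pieces
   disjoint; the point \<open>b\<close> is a null set.\<close>
 have "plen g c b d = (\<integral>\<^sup>+t\<in>{b<..d}. f t \<partial>lborel)"
  unfolding plen_def f_def using assms
  by (intro nn_integral_cong_point[of b]) (auto simp: indicator_def)
 moreover have "plen g c a b = (\<integral>\<^sup>+t\<in>{a..b}. f t \<partial>lborel)"
  using assms by (simp add: plen_cong_measurable f_def)
 moreover have "(\<integral>\<^sup>+t\<in>{a..b}. f t \<partial>lborel) + (\<integral>\<^sup>+t\<in>{b<..d}. f t \<partial>lborel) = (\<integral>\<^sup>+t\<in>{a..b} \<union> {b<..d}. f t \<partial>lborel)"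
  by (intro nn_integral_disjoint_pair[symmetric]) auto
 moreover have "{a..b} \<union> {b<..d} = {a..d}" using assms by auto
 ultimately show ?thesis
  using assms by (simp add: plen_cong_measurable f_def)
qed

lemma vector_derivative_affine:
 fixes c :: "real => 'a::real_normed_vector"
 assumes "c differentiable (at (m * t + b))"
 shows "((%t. c (m * t + b)) has_vector_derivative m *\<^sub>R vector_derivative c (at (m * t + b))) (at t)"
proof -
 have "((%t. m * t + b) has_vector_derivative m) (at t)"
  by (auto intro!: derivative_eq_intros)
 moreover have "(c has_vector_derivative vector_derivative c (at (m * t + b))) (at (m * t + b))"
  using assms vector_derivative_works by blast
 ultimately show ?thesis
  using vector_diff_chain_at[of "%t. m * t + b" m t c] by (simp add: o_def)
qed

lemma speed_affine:
 assumes g: "semi_metric X g" and "c differentiable (at (m * t + b))" "c (m * t + b) : X"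
 shows "speed g (%t. c (m * t + b)) t = \<bar>m\<bar> * speed g c (m * t + b)"
proof -
 have "vector_derivative (%t. c (m * t + b)) (at t) = m *\<^sub>R vector_derivative c (at (m * t + b))"
  using vector_derivative_affine[OF assms(2)] by (rule vector_derivative_at)
 then have "speed g (%t. c (m * t + b)) t = sqrt (m^2 * g (c (m * t + b)) (vector_derivative c (at (m * t + b))) (vector_derivative c (at (m * t + b))))"
  using g assms(3) by (auto simp: speed_def semi_metric_def bilinear_lmul bilinear_rmul power2_eq_square mult.assoc)
 then show ?thesis by (simp add: speed_def real_sqrt_mult)
qed

text \<open>One change of variables for subpaths, joins and, with \<open>m = -1\<close>, reversal.
  Since \<open>m\<close> may be negative, the parameter interval is given through its image.\<close>

lemma plen_affine:
 assumes g: "semi_metric X g" and c: "valid_path c" "c ` {0..1} \<subseteq> X"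
  and m: "m ~= 0" "(%t. m * t + b) ` {u..v} = {u'..v'}" "{u'..v'} \<subseteq> {0..1}"
 shows "plen g (%t. c (m * t + b)) u v = plen g c u' v'"
proof -
 obtain S where S: "finite S" "c C1_differentiable_on {0..1} - S"
  using valid_path_C1[OF c(1)] by metis
 have [measurable]: "(%t. indicator {0..1} t * speed g c t) : borel_measurable borel"
  by (rule speed_measurable[OF g c])
 have "plen g c u' v' = (\<integral>\<^sup>+t\<in>{u'..v'}. ennreal (indicator {0..1} t * speed g c t) \<partial>lborel)"
  unfolding plen_def using m(3) by (intro nn_integral_cong) (auto simp: indicator_def)
 also have "... = ennreal \<bar>m\<bar> * (\<integral>\<^sup>+t. ennreal (indicator {0..1} (b + m * t) * speed g c (b + m * t)) * indicator {u'..v'} (b + m * t) \<partial>lborel)"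
  by (subst nn_integral_real_affine[OF _ m(1), where t=b]) auto
 also have "... = (\<integral>\<^sup>+t. ennreal \<bar>m\<bar> * (ennreal (indicator {0..1} (b + m * t) * speed g c (b + m * t)) * indicator {u'..v'} (b + m * t)) \<partial>lborel)"
  by (subst nn_integral_cmult) auto
 also have "... = (\<integral>\<^sup>+t\<in>{u..v}. ennreal (speed g (%t. c (m * t + b)) t) \<partial>lborel)"
 proof (rule nn_integral_cong_AE)
  \<comment> \<open>The chain rule can fail only at preimages of the exceptional points, a finite
    and therefore null set.\<close>
  have "finite ((%t. m * t + b) -` S)"
   by (rule finite_vimageI) (use S m in "auto simp: inj_on_def")
  then have "AE t in lborel. t ~: (%t. m * t + b) -` S"
   by (intro AE_not_in finite_imp_null_set_lborel)
  then show "AE t in lborel. ennreal \<bar>m\<bar> * (ennreal (indicator {0..1} (b + m * t) * speed g c (b + m * t)) * indicator {u'..v'} (b + m * t)) =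
   ennreal (speed g (%t. c (m * t + b)) t) * indicator {u..v} t"
  proof (rule AE_mp, intro AE_I2 impI)
   fix t assume t: "t ~: (%t. m * t + b) -` S"
   have iff: "m * t + b : {u'..v'} \<longleftrightarrow> t : {u..v}"
    using m(1) unfolding m(2)[symmetric] by auto
   show "ennreal \<bar>m\<bar> * (ennreal (indicator {0..1} (b + m * t) * speed g c (b + m * t)) * indicator {u'..v'} (b + m * t)) =
    ennreal (speed g (%t. c (m * t + b)) t) * indicator {u..v} t"
   proof (cases "t : {u..v}")
    case True
    then have in1: "m * t + b : {0..1}" using iff m(3) by auto
    then have "c differentiable (at (m * t + b))"
     using S(2) t by (auto simp: C1_differentiable_on_eq)
    then have "speed g (%t. c (m * t + b)) t = \<bar>m\<bar> * speed g c (m * t + b)"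
     by (rule speed_affine[OF g]) (use in1 c(2) in auto)
    then show ?thesis using True iff in1
     by (simp add: add.commute ennreal_mult')
   next
    case False
    then show ?thesis using iff by (auto simp: add.commute indicator_def)
   qed
  qed
 qed
 finally show ?thesis by (simp add: plen_def)
qed

lemma path_length_subpath:
 assumes "semi_metric X g" "valid_path c" "c ` {0..1} \<subseteq> X" "0 <= u" "u <= v" "v <= 1"
 shows "path_length g (subpath u v c) = plen g c u v"
proof (cases "u = v")
 case True
 have "speed g (subpath v v c) t = 0" for t
  using assms by (auto simp: speed_def subpath_def bilinear_def semi_metric_def linear_0 image_subset_iff)
 then have "plen g (subpath v v c) 0 1 = 0" unfolding plen_def by simp
 then show ?thesis using True by (simp add: path_length_plen plen_point)
next
 case False
 have "(%t. (v - u) * t + u) ` {0..1} = {u..v}"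
  using assms False by (auto simp: image_affinity_atLeastAtMost)
 then show ?thesis
  unfolding path_length_plen subpath_def
  by (intro plen_affine[OF assms(1-3)]) (use assms False in auto)
qed

lemma path_length_reversepath:
 assumes "semi_metric X g" "valid_path c" "c ` {0..1} \<subseteq> X"
 shows "path_length g (reversepath c) = path_length g c"
proof -
 have "(%t. (-1) * t + 1) ` {0..1} = {0..1::real}"
  using image_affinity_atLeastAtMost[of "-1" 1 0 1] by simp
 then have "plen g (%t. c ((-1) * t + 1)) 0 1 = plen g c 0 1"
  by (intro plen_affine[OF assms]) auto
 then show ?thesis by (simp add: path_length_plen reversepath_def)
qed

lemma path_length_join:
 assumes g: "semi_metric X g" and c: "valid_path c" "c ` {0..1} \<subseteq> X" and d: "valid_path d" "d ` {0..1} \<subseteq> X"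
  and cd: "c 1 = d 0"
 shows "path_length g (c +++ d) = path_length g c + path_length g d"
proof -
 let ?j = "c +++ d"
 have j: "valid_path ?j" "?j ` {0..1} \<subseteq> X"
  using valid_path_join[OF c(1) d(1)] cd path_image_join_subset[of c d] c(2) d(2)
  by (auto simp: pathfinish_def pathstart_def path_image_def)
 have "plen g ?j 0 1 = plen g ?j 0 (1/2) + plen g ?j (1/2) 1"
  by (rule plen_add[symmetric, OF g j]) auto
 also have "plen g ?j 0 (1/2) = plen g (%t. c (2 * t + 0)) 0 (1/2)"
 proof -
  have "speed g ?j t = speed g (%t. c (2 * t + 0)) t" if "t < 1/2" for t
  proof -
   have "eventually (%t. ?j t = c (2 * t + 0)) (nhds t)"
    using eventually_nhds_in_open[of "{..<1/2}" t] that
    by (auto simp: joinpaths_def elim!: eventually_mono)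
   then have "vector_derivative ?j (at t) = vector_derivative (%t. c (2 * t + 0)) (at t)"
    by (intro vector_derivative_cong_eq) auto
   then show ?thesis using that by (simp add: speed_def joinpaths_def)
  qed
  then show ?thesis unfolding plen_def
   by (intro nn_integral_cong_point[of "1/2"]) (auto simp: indicator_def)
 qed
 also have "... = plen g c 0 1"
  by (rule plen_affine[OF g c]) (auto simp: image_affinity_atLeastAtMost)
 also have "plen g ?j (1/2) 1 = plen g (%t. d (2 * t + (-1))) (1/2) 1"
 proof -
  have "speed g ?j t = speed g (%t. d (2 * t + (-1))) t" if "t > 1/2" for t
  proof -
   have "eventually (%t. ?j t = d (2 * t + (-1))) (nhds t)"
    using eventually_nhds_in_open[of "{1/2<..}" t] that
    by (auto simp: joinpaths_def elim!: eventually_mono)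
   then have "vector_derivative ?j (at t) = vector_derivative (%t. d (2 * t + (-1))) (at t)"
    by (intro vector_derivative_cong_eq) auto
   then show ?thesis using that by (simp add: speed_def joinpaths_def)
  qed
  then show ?thesis unfolding plen_def
   by (intro nn_integral_cong_point[of "1/2"]) (auto simp: indicator_def)
 qed
 also have "... = plen g d 0 1"
  by (rule plen_affine[OF g d]) (use image_affinity_atLeastAtMost[of 2 "-1" "1/2" 1] in auto)
 finally show ?thesis by (simp add: path_length_plen)
qed

lemma plen_mono_bounds:
 assumes "semi_metric X g" "valid_path c" "c ` {0..1} \<subseteq> X" "0 <= a'" "a' <= a" "a <= b" "b <= b'" "b' <= 1"
 shows "plen g c a b <= plen g c a' b'"
 unfolding plen_def by (intro nn_integral_mono) (use assms in "auto simp: indicator_def")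

lemma riem_dist_le_path_length:
 assumes "valid_path c" "c ` {0..1} \<subseteq> X"
 shows "riem_dist X g (c 0) (c 1) <= path_length g c"
 unfolding riem_dist_def using assms by (intro INF_lower) (auto simp: valid_path_def)

lemma riem_dist_lessE:
 assumes "riem_dist X g p q < L"
 obtains c where "valid_path c" "c ` {0..1} \<subseteq> X" "c 0 = p" "c 1 = q" "path_length g c < L"
 using assms unfolding riem_dist_def valid_path_def[symmetric] by (auto simp: INF_less_iff)

lemma riem_dist_greatest:
 assumes "!!c. valid_path c ==> c ` {0..1} \<subseteq> X ==> c 0 = p ==> c 1 = q ==> L <= path_length g c"
 shows "L <= riem_dist X g p q"
 unfolding riem_dist_def valid_path_def[symmetric] by (rule INF_greatest) (use assms in auto)

lemma riem_dist_le_plen: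
 assumes "semi_metric X g" "valid_path c" "c ` {0..1} \<subseteq> X" "0 <= u" "u <= v" "v <= 1"
 shows "riem_dist X g (c u) (c v) <= plen g c u v"
proof -
 have "subpath u v c ` {0..1} \<subseteq> X"
  using path_image_subpath_subset[of u v c] assms by (auto simp: path_image_def)
 moreover have "valid_path (subpath u v c)" using assms by (simp add: valid_path_subpath)
 ultimately show ?thesis
  using riem_dist_le_path_length[of "subpath u v c" X g] path_length_subpath[OF assms]
  by (simp add: subpath_def)
qed

lemma riem_dist_refl:
 assumes "semi_metric X g" "p : X" shows "riem_dist X g p p = 0"
proof -
 have v: "valid_path (%_. p)" using valid_path_linepath[of p p] by (simp add: linepath_refl)
 have "riem_dist X g p p <= plen g (%_. p) 0 0"
  using riem_dist_le_plen[OF assms(1) v, of 0 0] assms(2) by auto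
 then show ?thesis by (simp add: plen_point)
qed

lemma riem_dist_sym_le:
 assumes "semi_metric X g" shows "riem_dist X g q p <= riem_dist X g p q"
proof (rule riem_dist_greatest)
 fix c assume c: "valid_path c" "c ` {0..1} \<subseteq> X" "c 0 = p" "c 1 = q"
 have "reversepath c ` {0..1} = c ` {0..1}"
  using path_image_reversepath[of c] by (simp add: path_image_def)
 then show "riem_dist X g q p <= path_length g c"
  using riem_dist_le_path_length[of "reversepath c" X g] c path_length_reversepath[OF assms c(1,2)]
   valid_path_reversepath[of c] by (simp add: reversepath_def del: valid_path_reversepath)
qed

lemma riem_dist_sym:
 assumes "semi_metric X g" shows "riem_dist X g p q = riem_dist X g q p"
 using riem_dist_sym_le[OF assms] by (intro antisym)

text \<open>The infima need not be attained, so paths slightly longer than the two distances are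
  joined; \<open>dense_ge\<close> removes the slack.\<close>

lemma riem_dist_triangle:
 assumes "semi_metric X g" shows "riem_dist X g p r <= riem_dist X g p q + riem_dist X g q r"
proof (rule dense_ge)
 fix L assume L: "riem_dist X g p q + riem_dist X g q r < L"
 then have fin: "riem_dist X g p q < \<infinity>" "riem_dist X g q r < \<infinity>"
  by (auto simp: less_top[symmetric] top_unique)
 obtain a b where ab: "riem_dist X g p q < a" "riem_dist X g q r < b" "a + b <= L"
 proof -
  obtain x y where xy: "riem_dist X g p q = ennreal x" "0 <= x" "riem_dist X g q r = ennreal y" "0 <= y"
   using fin by (cases "riem_dist X g p q"; cases "riem_dist X g q r") auto
  obtain z where z: "ennreal (x + y) < ennreal z" "ennreal z <= L" "0 <= z"
  proof (cases L)
   case (real l)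
   then show ?thesis using that[of l] L xy by (simp add: ennreal_plus[symmetric] del: ennreal_plus)
  next
   case top
   then show ?thesis using that[of "x + y + 1"] xy by (simp add: ennreal_lessI)
  qed
  have "x + y < z" using z(1) xy by (subst (asm) ennreal_less_iff) auto
  define e where "e = (z - x - y) / 2"
  have e: "e > 0" "(x + e) + (y + e) = z" using \<open>x + y < z\<close> by (auto simp: e_def field_simps)
  show ?thesis
   by (rule that[of "ennreal (x + e)" "ennreal (y + e)"])
    (use xy e z in "auto simp: ennreal_less_iff ennreal_plus[symmetric] simp del: ennreal_plus")
 qed
 obtain c where c: "valid_path c" "c ` {0..1} \<subseteq> X" "c 0 = p" "c 1 = q" "path_length g c < a"
  using riem_dist_lessE[OF ab(1)] by metis
 obtain d where d: "valid_path d" "d ` {0..1} \<subseteq> X" "d 0 = q" "d 1 = r" "path_length g d < b"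
  using riem_dist_lessE[OF ab(2)] by metis
 have "riem_dist X g ((c +++ d) 0) ((c +++ d) 1) <= path_length g (c +++ d)"
 proof (rule riem_dist_le_path_length)
  show "valid_path (c +++ d)"
   using valid_path_join[OF c(1) d(1)] c d by (simp add: pathstart_def pathfinish_def)
  show "(c +++ d) ` {0..1} \<subseteq> X"
   using path_image_join_subset[of c d] c d unfolding path_image_def by blast
 qed
 then have "riem_dist X g p r <= path_length g (c +++ d)"
  using c d by (simp add: joinpaths_def)
 also have "... = path_length g c + path_length g d"
  using path_length_join[OF assms c(1,2) d(1,2)] c d by simp
 also have "... <= a + b" using c d by (intro add_mono) auto
 finally show "riem_dist X g p r <= L" using ab by simp
qed

lemma path_length_split:
 assumes "semi_metric X g" "valid_path c" "c ` {0..1} \<subseteq> X" "0 <= t" "t <= 1"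
 shows "riem_dist X g (c 0) (c t) + riem_dist X g (c t) (c 1) <= path_length g c"
proof -
 have "path_length g c = plen g c 0 t + plen g c t 1"
  using plen_add[OF assms(1-3), of 0 t 1] assms by (simp add: path_length_plen)
 then show ?thesis
  using riem_dist_le_plen[OF assms(1-3), of 0 t] riem_dist_le_plen[OF assms(1-3), of t 1] assms
  by (auto intro: add_mono)
qed

lemma integral_nonneg_always:
 fixes f :: "real => real"
 assumes "!!x. 0 <= f x" shows "0 <= integral S f"
 using assms by (cases "f integrable_on S") (auto simp: not_integrable_integral intro: Henstock_Kurzweil_Integration.integral_nonneg)

text \<open>For the intermediate value argument in \<open>riem_dist_split\<close>: finite length
  means integrable speed, so the length function is an indefinite integral.\<close>

lemma plen_continuous:
 assumes g: "semi_metric X g" and c: "valid_path c" "c ` {0..1} \<subseteq> X" and fin: "path_length g c < \<infinity>"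
 shows "EX F. continuous_on {0..1} F & (ALL t:{0..1}. 0 <= F t & plen g c 0 t = ennreal (F t))"
proof -
 define f where "f = (%t. indicator {0..1} t * speed g c t)"
 have [measurable]: "f : borel_measurable borel" unfolding f_def by (rule speed_measurable[OF g c])
 have fpos: "0 <= f t" for t
  using g c(2) by (auto simp: f_def speed_def indicator_def semi_metric_def image_subset_iff)
 have pl: "plen g c 0 t = (\<integral>\<^sup>+x. ennreal (indicator {0..t} x * f x) \<partial>lborel)" if "t : {0..1}" for t
  unfolding plen_def f_def using that by (intro nn_integral_cong) (auto simp: indicator_def)
 have int: "integrable lborel f"
 proof (rule integrableI_nonneg)
  have "(\<integral>\<^sup>+x. ennreal (f x) \<partial>lborel) = plen g c 0 1"
   unfolding plen_def f_def by (intro nn_integral_cong) (auto simp: indicator_def)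
  then show "(\<integral>\<^sup>+x. ennreal (f x) \<partial>lborel) < \<infinity>" using fin by (simp add: path_length_plen)
 qed (use fpos in auto)
 then have "f integrable_on {0..1}"
  by (metis integrable_on_lborel integrable_on_subinterval subset_UNIV)
 then have cont: "continuous_on {0..1} (%t. integral {0..t} f)"
  by (rule indefinite_integral_continuous_1)
 have "plen g c 0 t = ennreal (integral {0..t} f)" if "t : {0..1}" for t
 proof -
  have i2: "integrable lborel (%x. indicator {0..t} x * f x)"
   using integrable_mult_indicator[of "{0..t}" lborel f] int by simp
  have "integral {0..t} f = (LINT x:{0..t}|lborel. f x)"
   by (rule set_borel_integral_eq_integral(2)[symmetric]) (use i2 in "simp add: set_integrable_def")
  also have "... = (\<integral>x. indicator {0..t} x * f x \<partial>lborel)" by (simp add: set_lebesgue_integral_def)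
  finally have "ennreal (integral {0..t} f) = (\<integral>\<^sup>+x. ennreal (indicator {0..t} x * f x) \<partial>lborel)"
   using nn_integral_eq_integral[OF i2] fpos by simp
  then show ?thesis using pl that by simp
 qed
 moreover have "0 <= integral {0..t} f" for t
  by (rule integral_nonneg_always) (rule fpos)
 ultimately show ?thesis using cont by blast
qed

text \<open>Takes the place of minimal geodesics: an almost minimal path is cut where its continuous
  length function takes a suitable value. The chaining arguments rest on this.\<close>

lemma riem_dist_split:
 assumes g: "semi_metric X g" and ab: "riem_dist X g p q < ennreal (a + b)" "0 < a" "0 < b"
 shows "EX w:X. riem_dist X g p w < ennreal a & riem_dist X g w q < ennreal b"
proof -
 obtain c where c: "valid_path c" "c ` {0..1} \<subseteq> X" "c 0 = p" "c 1 = q" "path_length g c < ennreal (a + b)"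
  using riem_dist_lessE[OF ab(1)] by metis
 have "path_length g c < \<infinity>" using order.strict_trans[OF c(5), of \<infinity>] by simp
 then obtain F where F: "continuous_on {0..1} F" "!!t. t : {0..1} ==> 0 <= F t & plen g c 0 t = ennreal (F t)"
  using plen_continuous[OF g c(1,2)] by metis
 have F1: "F 1 < a + b"
  using c(5) F(2)[of 1] ennreal_less_iff[of "F 1" "a + b"] by (simp add: path_length_plen)
 have F0: "F 0 = 0"
 proof -
  show ?thesis using F(2)[of 0] by (simp add: plen_point ennreal_eq_0_iff)
 qed
 obtain t where t: "0 <= t" "t <= 1" "F t < a" "F 1 - F t < b"
 proof (cases "F 1 < a")
  case True
  then show ?thesis using that[of 1] ab by simp
 next
  case False
  \<comment> \<open>The middle of the interval of admissible cuts, which lie above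
    \<open>F 1 - b\<close> and below \<open>a\<close>; it is nonempty because
    \<open>F 1 < a + b\<close>.\<close>
  define v where "v = (max 0 (F 1 - b) + a) / 2"
  have v: "0 <= v" "v < a" "F 1 - v < b" using F1 ab by (auto simp: v_def max_def field_simps)
  obtain t where "0 <= t" "t <= 1" "F t = v"
   using IVT'[of F 0 v 1] F(1) F0 v False by auto
  then show ?thesis using that[of t] v by simp
 qed
 have tt: "t : {0..1}" using t by simp
 have add: "plen g c 0 t + plen g c t 1 = plen g c 0 1"
  using plen_add[OF g c(1,2), of 0 t 1] t by simp
 have "plen g c t 1 < ennreal b"
 proof -
  have "ennreal (F t) + plen g c t 1 = ennreal (F 1)" using add F(2)[OF tt] F(2)[of 1] by simp
  moreover then obtain z where z: "plen g c t 1 = ennreal z" "0 <= z"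
   by (cases "plen g c t 1") auto
  ultimately have "F t + z = F 1" using F(2)[OF tt] F(2)[of 1]
   by (simp add: ennreal_plus[symmetric] del: ennreal_plus)
  then show ?thesis using z t ab by (simp add: ennreal_less_iff)
 qed
 moreover have "plen g c 0 t < ennreal a" using F(2)[OF tt] t by (simp add: ennreal_less_iff)
 ultimately have "riem_dist X g p (c t) < ennreal a" "riem_dist X g (c t) q < ennreal b"
  using riem_dist_le_plen[OF g c(1,2), of 0 t] riem_dist_le_plen[OF g c(1,2), of t 1] t c(3,4)
  by (auto intro: le_less_trans)
 then show ?thesis using c(2) tt by blast
qed

section \<open>Lengths and distances under C1 maps\<close>

lemma C1_map_lin: "C1_map U F F' ==> x : U ==> linear (F' x)"
 unfolding C1_map_def using has_derivative_linear by blast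

lemma C1_map_continuous: "C1_map U F F' ==> continuous_on U F"
 unfolding C1_map_def by (meson continuous_at_imp_continuous_on has_derivative_continuous)

lemma C1_map_path:
 assumes F: "C1_map U F F'" and c: "valid_path c" "c ` {0..1} \<subseteq> U"
 shows "valid_path (F \<circ> c)"
  and "EX S. finite S & (ALL t:{0..1} - S. vector_derivative (F \<circ> c) (at t) = F' (c t) (vector_derivative c (at t)))"
proof -
 obtain S where S: "finite S" "c C1_differentiable_on {0..1} - S" and cc: "continuous_on {0..1} c"
  using valid_path_C1[OF c(1)] by metis
 have d: "((F \<circ> c) has_vector_derivative F' (c t) (vector_derivative c (at t))) (at t)" if "t : {0..1} - S" for t
 proof -
  have "(c has_vector_derivative vector_derivative c (at t)) (at t)"
   using S(2) that vector_derivative_works[of c "at t"] by (auto simp: C1_differentiable_on_eq)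
  moreover have "(F has_derivative F' (c t)) (at (c t))"
   using F that c(2) unfolding C1_map_def by (meson DiffD1 image_subset_iff)
  ultimately show ?thesis
   by (metis has_derivative_at_withinI vector_derivative_diff_chain_within)
 qed
 have "continuous_on ({0..1} - S) (%t. F' (c t) (vector_derivative c (at t)))"
 proof (rule continuous_on_lin_family[where A="%t. F' (c t)"])
  show "continuous_on ({0..1} - S) (%t. F' (c t) v)" for v
   by (rule continuous_on_compose2[of U "%x. F' x v"])
    (use F c cc in "auto simp: C1_map_def intro: continuous_on_subset")
  show "linear (F' (c t))" if "t : {0..1} - S" for t
   by (rule C1_map_lin[OF F]) (use that c(2) in blast)
  show "continuous_on ({0..1} - S) (%t. vector_derivative c (at t))"
   using S(2) by (simp add: C1_differentiable_on_eq)
 qed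
 then have "(F \<circ> c) C1_differentiable_on {0..1} - S"
  unfolding C1_differentiable_on_def using d by (intro exI[of _ "%t. F' (c t) (vector_derivative c (at t))"]) simp
 moreover have "continuous_on {0..1} (F \<circ> c)"
  using continuous_on_compose[OF cc] continuous_on_subset[OF C1_map_continuous[OF F] c(2)] by blast
 ultimately show "valid_path (F \<circ> c)"
  unfolding valid_path_def piecewise_C1_differentiable_on_def using S(1) by blast
 show "EX S. finite S & (ALL t:{0..1} - S. vector_derivative (F \<circ> c) (at t) = F' (c t) (vector_derivative c (at t)))"
  using S(1) d by (intro exI[of _ S]) (auto intro: vector_derivative_at)
qed

lemma nn_integral_cong_finite:
 fixes f h :: "real => ennreal"
 assumes "finite S" "!!t. t ~: S ==> f t <= h t"
 shows "(\<integral>\<^sup>+t. f t \<partial>lborel) <= (\<integral>\<^sup>+t. h t \<partial>lborel)"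
proof (rule nn_integral_mono_AE)
 have "AE t in lborel. t ~: S"
  by (intro AE_not_in finite_imp_null_set_lborel assms)
 then show "AE t in lborel. f t <= h t" by (rule AE_mp) (use assms in auto)
qed

text \<open>The infinitesimal bound is asked for along \<open>c\<close> only, so that maps can be
  used that contract just where the path runs.\<close>

lemma path_length_map_le:
 assumes g: "semi_metric X g" and c: "valid_path c" "c ` {0..1} \<subseteq> X"
  and F: "C1_map U F F'" "c ` {0..1} \<subseteq> U" and K: "0 <= K"
  and le: "!!t v. t : {0..1} ==> g' (F (c t)) (F' (c t) v) (F' (c t) v) <= K^2 * g (c t) v v"
 shows "path_length g' (F \<circ> c) <= ennreal K * path_length g c"
proof -
 have [measurable]: "(%t. indicator {0..1} t * speed g c t) : borel_measurable borel"
  by (rule speed_measurable[OF g c])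
 obtain S where S: "finite S" "!!t. t : {0..1} - S ==> vector_derivative (F \<circ> c) (at t) = F' (c t) (vector_derivative c (at t))"
  using C1_map_path(2)[OF F(1) c(1) F(2)] by blast
 have "path_length g' (F \<circ> c) <= (\<integral>\<^sup>+t. ennreal K * ennreal (indicator {0..1} t * speed g c t) \<partial>lborel)"
  unfolding path_length_plen plen_def
 proof (rule nn_integral_cong_finite[OF S(1)])
  fix t assume t: "t ~: S"
  show "ennreal (speed g' (F \<circ> c) t) * indicator {0..1} t <= ennreal K * ennreal (indicator {0..1} t * speed g c t)"
  proof (cases "t : {0..1}")
   case True
   have "speed g' (F \<circ> c) t <= sqrt (K^2 * g (c t) (vector_derivative c (at t)) (vector_derivative c (at t)))"
    unfolding speed_def using S(2)[of t] t True le[OF True] by (simp add: o_def)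
   also have "... = K * speed g c t" using K by (simp add: speed_def real_sqrt_mult)
   finally show ?thesis using K True by (simp add: ennreal_mult'[symmetric] ennreal_leI)
  qed auto
 qed
 also have "... = ennreal K * path_length g c"
  by (subst nn_integral_cmult) (auto simp: path_length_plen plen_def nn_integral_mult_indicator_ennreal)
 finally show ?thesis .
qed

lemma riem_dist_map_le:
 assumes g: "semi_metric X g" and F: "C1_map X F F'" "F ` X \<subseteq> Y" and K: "0 < K"
  and le: "!!x v. x : X ==> g' (F x) (F' x v) (F' x v) <= K^2 * g x v v"
 shows "riem_dist Y g' (F p) (F q) <= ennreal K * riem_dist X g p q"
proof -
 have "riem_dist Y g' (F p) (F q) <= ennreal K * path_length g c"
  if c: "valid_path c" "c ` {0..1} \<subseteq> X" "c 0 = p" "c 1 = q" for c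
 proof -
  have "riem_dist Y g' ((F \<circ> c) 0) ((F \<circ> c) 1) <= path_length g' (F \<circ> c)"
   by (intro riem_dist_le_path_length C1_map_path(1)[OF F(1) c(1,2)]) (use F(2) c(2) in auto)
  also have "... <= ennreal K * path_length g c"
   by (rule path_length_map_le[OF g c(1,2) F(1) c(2) less_imp_le[OF K]]) (use le c(2) in "simp add: image_subset_iff")
  finally show ?thesis using c by simp
 qed
 note * = this
 \<comment> \<open>The factor is moved to the left because it is the bare infimum that is a greatest
   lower bound.\<close>
 have "ennreal (1 / K) * riem_dist Y g' (F p) (F q) <= riem_dist X g p q"
 proof (rule riem_dist_greatest)
  fix c assume c: "valid_path c" "c ` {0..1} \<subseteq> X" "c 0 = p" "c 1 = q"
  have "ennreal (1 / K) * riem_dist Y g' (F p) (F q) <= ennreal (1 / K) * (ennreal K * path_length g c)"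
   using *[OF c] by (rule mult_left_mono) simp
  also have "... = path_length g c"
   using K by (simp add: mult.assoc[symmetric] ennreal_mult'[symmetric])
  finally show "ennreal (1 / K) * riem_dist Y g' (F p) (F q) <= path_length g c" .
 qed
 then have "ennreal K * (ennreal (1 / K) * riem_dist Y g' (F p) (F q)) <= ennreal K * riem_dist X g p q"
  by (rule mult_left_mono) simp
 then show ?thesis
  using K by (simp add: mult.assoc[symmetric] ennreal_mult'[symmetric])
qed

text \<open>Only the velocity component along the total displacement is integrated: it is bounded by
  the speed, and by the fundamental theorem its integral is the norm. If its absolute integral is
  infinite, so is the length.\<close>

lemma FTC_norm_bound:
 fixes c :: "real => 'a::euclidean_space"
 assumes c: "valid_path c"
 shows "ennreal (norm (c 1 - c 0)) <= path_length (%_ u v. u \<bullet> v) c"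
proof (cases "c 1 = c 0")
 case False
 define w where "w = (c 1 - c 0) /\<^sub>R norm (c 1 - c 0)"
 have w: "norm w = 1" "(c 1 - c 0) \<bullet> w = norm (c 1 - c 0)"
  using False by (auto simp: w_def power2_norm_eq_inner[symmetric] power2_eq_square)
 obtain S where S: "finite S" "c C1_differentiable_on {0..1} - S" "0 : S" "1 : S" and cc: "continuous_on {0..1} c"
  using valid_path_C1[OF c(1)] by metis
 define h where "h = (%t. indicator {0..1} t * (vector_derivative c (at t) \<bullet> w))"
 have [measurable]: "h : borel_measurable borel" unfolding h_def
  by (rule measurable_off_finite[OF S(1)]) (use S in "auto simp: C1_differentiable_on_eq intro!: continuous_intros")
 have "((%t. vector_derivative c (at t) \<bullet> w) has_integral (c 1 \<bullet> w - c 0 \<bullet> w)) {0..1}"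
 proof (rule fundamental_theorem_of_calculus_interior_strong[OF S(1)])
  fix t :: real assume "t : {0<..<1} - S"
  then have "(c has_vector_derivative vector_derivative c (at t)) (at t)"
   using S(2) vector_derivative_works[of c "at t"] by (auto simp: C1_differentiable_on_eq)
  then show "((%t. c t \<bullet> w) has_vector_derivative vector_derivative c (at t) \<bullet> w) (at t)"
   by (rule bounded_linear.has_vector_derivative[OF bounded_linear_inner_left])
 qed (auto intro!: continuous_intros cc)
 then have I: "(h has_integral norm (c 1 - c 0)) {0..1}"
  using w(2) by (auto simp: h_def inner_diff_left intro: has_integral_eq)
 have le: "(\<integral>\<^sup>+t. ennreal \<bar>h t\<bar> \<partial>lborel) <= path_length (%_ u v. u \<bullet> v) c"
  unfolding path_length_plen plen_def
 proof (intro nn_integral_mono)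
  fix t
  have "\<bar>vector_derivative c (at t) \<bullet> w\<bar> <= norm (vector_derivative c (at t))"
   using Cauchy_Schwarz_ineq2[of "vector_derivative c (at t)" w] w by simp
  then show "ennreal \<bar>h t\<bar> <= ennreal (speed (%_. (\<bullet>)) c t) * indicator {0..1} t"
   by (auto simp: h_def speed_def norm_eq_sqrt_inner indicator_def intro: ennreal_leI)
 qed
 show ?thesis
 proof (cases "(\<integral>\<^sup>+t. ennreal \<bar>h t\<bar> \<partial>lborel) < \<infinity>")
  case True
  then have int: "integrable lborel h" by (intro integrableI_bounded) auto
  have "(LINT t:{0..1}|lborel. h t) = norm (c 1 - c 0)"
  proof -
   have "set_integrable lborel {0..1} h" using integrable_mult_indicator[OF _ int, of "{0..1}"] by (simp add: set_integrable_def)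
   then show ?thesis using set_borel_integral_eq_integral(2) I by (metis integral_unique)
  qed
  moreover have "(LINT t:{0..1}|lborel. h t) = (\<integral>t. h t \<partial>lborel)"
   unfolding set_lebesgue_integral_def by (intro Bochner_Integration.integral_cong) (auto simp: h_def indicator_def)
  ultimately have "ennreal (norm (c 1 - c 0)) <= (\<integral>\<^sup>+t. ennreal \<bar>h t\<bar> \<partial>lborel)"
   using integral_abs_bound[of lborel h] nn_integral_eq_integral[OF integrable_abs[OF int]] by (simp add: ennreal_leI)
  then show ?thesis using le by simp
 next
  case False
  then show ?thesis using le by (auto simp: less_top[symmetric] top_unique)
 qed
qed simp

text \<open>Lower bounds for distances are obtained by mapping to Euclidean space, where straight
  lines are shortest.\<close>

lemma riem_dist_ge_map:
 fixes F :: "'a::euclidean_space => 'b::euclidean_space"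
 assumes g: "semi_metric X g" and F: "C1_map X F F'" and K: "0 < K"
  and le: "!!x v. x : X ==> (norm (F' x v))^2 <= K^2 * g x v v"
 shows "ennreal (norm (F q - F p)) <= ennreal K * riem_dist X g p q"
proof -
 have "ennreal (norm (F q - F p)) <= riem_dist UNIV (%_ u v. u \<bullet> v) (F p) (F q)"
  by (rule riem_dist_greatest) (use FTC_norm_bound in fastforce)
 also have "... <= ennreal K * riem_dist X g p q"
  by (rule riem_dist_map_le[OF g F _ K]) (use le in "auto simp: power2_norm_eq_inner")
 finally show ?thesis .
qed

lemma riem_dist_le_segment:
 assumes "closed_segment p q \<subseteq> X" "!!z. z : closed_segment p q ==> sqrt (g z (q - p) (q - p)) <= K"
 shows "riem_dist X g p q <= ennreal K"
proof -
 have "linepath p q ` {0..1} \<subseteq> X" using assms(1) path_image_linepath[of p q] by (simp add: path_image_def)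
 then have "riem_dist X g p q <= path_length g (linepath p q)"
  using riem_dist_le_path_length[of "linepath p q" X g] by (simp add: linepath_0' linepath_1')
 also have "... <= (\<integral>\<^sup>+t. ennreal K * indicator {0..1::real} t \<partial>lborel)"
  unfolding path_length_plen plen_def
 proof (rule nn_integral_mono)
  have "speed g (linepath p q) t <= K" if "t : {0..1}" for t
   using assms(2)[of "linepath p q t"] that by (simp add: speed_def linepath_in_path)
  then show "ennreal (speed g (linepath p q) t) * indicator {0..1} t <= ennreal K * indicator {0..1} t" for t
   by (auto simp: indicator_def intro: ennreal_leI)
 qed
 also have "... = ennreal K" by (simp add: nn_integral_cmult)
 finally show ?thesis .
qed

lemma riem_dist_isometry:
 assumes g: "semi_metric X g" and F: "C1_map X F F'" "F ` X \<subseteq> X" and G: "C1_map X G G'" "G ` X \<subseteq> X"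
  and FG: "!!x. x : X ==> G (F x) = x"
  and F': "!!x v. x : X ==> g (F x) (F' x v) (F' x v) = g x v v"
  and G': "!!x v. x : X ==> g (G x) (G' x v) (G' x v) = g x v v"
  and pq: "p : X" "q : X"
 shows "riem_dist X g (F p) (F q) = riem_dist X g p q"
proof (rule antisym)
 show "riem_dist X g (F p) (F q) <= riem_dist X g p q"
  using riem_dist_map_le[OF g F, of 1 g] F' by simp
 show "riem_dist X g p q <= riem_dist X g (F p) (F q)"
  using riem_dist_map_le[OF g G, of 1 g "F p" "F q"] G' FG pq by simp
qed

section \<open>Calculus of smooth functions\<close>

lemma Ck_on_Suc_D:
 assumes "Ck_on (Suc k) X f"
 shows "x : X ==> (f has_derivative FD f x) (at x)"
  and "Ck_on k X (%x. FD f x v)"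
 using assms by (auto simp: frechet_derivative_works[symmetric])

text \<open>\<open>Ck_on\<close> refers to \<open>frechet_derivative\<close>, so a derivative known
  by a formula has to be exchanged for it on \<open>X\<close>. That congruence is a hypothesis here,
  because its own proof in \<open>Ck_on_cong'\<close> is an induction through this lemma.\<close>

lemma Ck_on_SucI:
 assumes "!!x. x : X ==> (f has_derivative f' x) (at x)" and "!!v. Ck_on k X (%x. f' x v)"
  and cong: "!!(f :: 'a::euclidean_space => 'b::real_normed_vector) g. (!!x. x : X ==> f x = g x) ==> Ck_on k X f ==> Ck_on k X g"
 shows "Ck_on (Suc k) X (f :: 'a::euclidean_space => 'b::real_normed_vector)"
proof -
 have "Ck_on k X (%x. FD f x v)" for v
  using frechet_derivative_at[OF assms(1)] by (intro cong[OF _ assms(2)[of v]]) metis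
 then show ?thesis using assms(1) by (auto simp: differentiable_def)
qed

lemma Ck_on_cong':
 fixes f g :: "'a::euclidean_space => 'b::real_normed_vector"
 assumes "open X"
 shows "(!!x. x : X ==> f x = g x) ==> Ck_on k X f ==> Ck_on k X g"
proof (induction k arbitrary: f g)
 case 0
 then show ?case by (simp cong: continuous_on_cong)
next
 case (Suc k)
 show ?case
 proof (rule Ck_on_SucI)
  fix x assume "x : X"
  then show "(g has_derivative FD f x) (at x)"
   using Ck_on_Suc_D(1)[OF Suc.prems(2)] has_derivative_transform_within_open[OF _ assms] Suc.prems(1) by metis
 next
  show "Ck_on k X (%x. FD f x v)" for v
   using Suc.prems(2) by auto
 qed (use Suc.IH in blast)
qed

lemma Ck_on_step:
 fixes f :: "'a::euclidean_space => 'b::real_normed_vector"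
 assumes "open X" "!!x. x : X ==> (f has_derivative f' x) (at x)" "!!v. Ck_on k X (%x. f' x v)"
 shows "Ck_on (Suc k) X f"
 by (rule Ck_on_SucI[OF assms(2,3)]) (assumption, rule Ck_on_cong'[OF assms(1)])

lemma Ck_on_pred:
 fixes f :: "'a::euclidean_space => 'b::real_normed_vector"
 shows "Ck_on (Suc k) X f ==> Ck_on k X f"
proof (induction k arbitrary: f)
 case 0
 then show ?case
  by (auto intro!: continuous_at_imp_continuous_on differentiable_imp_continuous_within)
next
 case (Suc k)
 then show ?case by (metis Ck_on.simps(2))
qed

lemma Ck_on_continuous: "Ck_on k X f ==> continuous_on X f"
 by (induction k) (auto dest: Ck_on_pred simp del: Ck_on.simps(2))

lemma Ck_on_subset: "Ck_on k X f ==> Y \<subseteq> X ==> Ck_on k Y f"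
 by (induction k arbitrary: f) (auto intro: continuous_on_subset)

lemma Ck_on_local:
 assumes "!!x. x : X ==> EX U. open U & x : U & Ck_on k U f"
 shows "Ck_on k X f"
 using assms
proof (induction k arbitrary: f)
 case 0
 show ?case
 proof (simp, rule continuous_at_imp_continuous_on, rule ballI)
  fix x assume "x : X"
  then obtain U where "open U" "x : U" "continuous_on U f" using 0 by auto
  then show "isCont f x" by (simp add: continuous_on_eq_continuous_at)
 qed
next
 case (Suc k)
 have "Ck_on k X (%x. FD f x v)" for v
  by (rule Suc.IH) (use Suc.prems in fastforce)
 moreover have "f differentiable (at x)" if "x : X" for x
  using Suc.prems[OF that] by auto
 ultimately show ?case by simp
qed

lemma Ck_on_const [simp]: "Ck_on k X (%_. c)"
 by (induction k arbitrary: c) (auto simp: frechet_derivative_const)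

lemma Ck_on_bounded_linear:
 assumes "open X" "bounded_linear f" shows "Ck_on k X f"
proof (cases k)
 case 0
 then show ?thesis using assms by (simp add: linear_continuous_on)
next
 case (Suc m)
 then show ?thesis using Ck_on_step[OF assms(1), of f "%_. f" m] bounded_linear_imp_has_derivative[OF assms(2)] by simp
qed

lemma Ck_on_add:
 fixes f g :: "'a::euclidean_space => 'b::real_normed_vector"
 assumes "open X"
 shows "Ck_on k X f ==> Ck_on k X g ==> Ck_on k X (%x. f x + g x)"
proof (induction k arbitrary: f g)
 case (Suc k)
 show ?case
 proof (rule Ck_on_step[OF assms])
  show "((%x. f x + g x) has_derivative (%v. FD f x v + FD g x v)) (at x)"
   if "x : X" for x
   by (intro has_derivative_add Ck_on_Suc_D(1)[OF Suc.prems(1) that] Ck_on_Suc_D(1)[OF Suc.prems(2) that])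
  show "Ck_on k X (%x. FD f x v + FD g x v)" for v
   by (intro Suc.IH Ck_on_Suc_D(2)[OF Suc.prems(1)] Ck_on_Suc_D(2)[OF Suc.prems(2)])
 qed
qed (auto intro: continuous_intros)

lemma Ck_on_sum:
 fixes f :: "'i => 'a::euclidean_space => 'b::real_normed_vector"
 assumes "open X" "!!i. i : I ==> Ck_on k X (f i)"
 shows "Ck_on k X (%x. \<Sum>i\<in>I. f i x)"
 using assms(2)
 by (induction I rule: infinite_finite_induct) (auto intro!: Ck_on_add[OF assms(1)])

lemma Ck_on_bounded_bilinear:
 fixes f :: "'a::euclidean_space => 'b::real_normed_vector" and g :: "'a => 'c::real_normed_vector"
 assumes X: "open X" and B: "bounded_bilinear (B :: 'b => 'c => 'd::real_normed_vector)"
 shows "Ck_on k X f ==> Ck_on k X g ==> Ck_on k X (%x. B (f x) (g x))"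
proof (induction k arbitrary: f g)
 case 0
 then show ?case by (auto intro: bounded_bilinear.continuous_on[OF B])
next
 case (Suc k)
 show ?case
 proof (rule Ck_on_step[OF X])
  show "((%x. B (f x) (g x)) has_derivative (%v. B (f x) (FD g x v) + B (FD f x v) (g x))) (at x)"
   if "x : X" for x
   using bounded_bilinear.FDERIV[OF B Ck_on_Suc_D(1)[OF Suc.prems(1) that] Ck_on_Suc_D(1)[OF Suc.prems(2) that]] .
  show "Ck_on k X (%x. B (f x) (FD g x v) + B (FD f x v) (g x))" for v
   by (intro Ck_on_add[OF X] Suc.IH Ck_on_pred[OF Suc.prems(1)] Ck_on_pred[OF Suc.prems(2)]
     Ck_on_Suc_D(2)[OF Suc.prems(1)] Ck_on_Suc_D(2)[OF Suc.prems(2)])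
 qed
qed

lemmas Ck_on_scaleR = Ck_on_bounded_bilinear[OF _ bounded_bilinear_scaleR]

lemmas Ck_on_inner = Ck_on_bounded_bilinear[OF _ bounded_bilinear_inner]

lemmas Ck_on_mult = Ck_on_bounded_bilinear[OF _ bounded_bilinear_mult]

lemma Ck_on_linear_comp:
 fixes f :: "'a::euclidean_space => 'b::real_normed_vector"
 assumes X: "open X" and L: "bounded_linear (L :: 'b => 'c::real_normed_vector)"
 shows "Ck_on k X f ==> Ck_on k X (%x. L (f x))"
proof (induction k arbitrary: f)
 case 0
 then show ?case by (auto intro: bounded_linear.continuous_on[OF L])
next
 case (Suc k)
 show ?case
 proof (rule Ck_on_step[OF X])
  show "((%x. L (f x)) has_derivative (%v. L (FD f x v))) (at x)" if "x : X" for x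
   by (rule bounded_linear.has_derivative[OF L Ck_on_Suc_D(1)[OF Suc.prems that]])
  show "Ck_on k X (%x. L (FD f x v))" for v
   by (rule Suc.IH[OF Ck_on_Suc_D(2)[OF Suc.prems]])
 qed
qed

text \<open>The chain rule is written in coordinates, as a sum over the basis of components of the
  derivative of \<open>G\<close> times partial derivatives of \<open>F\<close>. Each summand again
  contains a composite with the same \<open>G\<close>, so the induction varies \<open>F\<close>
  alone.\<close>

lemma Ck_on_compose:
 fixes F :: "'b::euclidean_space => 'c::real_normed_vector" and G :: "'a::euclidean_space => 'b"
 assumes X: "open X" and GY: "G ` X \<subseteq> Y"
 shows "Ck_on k Y F ==> Ck_on k X G ==> Ck_on k X (%x. F (G x))"
proof (induction k arbitrary: F)
 case 0
 then show ?case using GY by (auto intro: continuous_on_compose2)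
next
 case (Suc k)
 show ?case
 proof (rule Ck_on_step[OF X])
  fix x assume x: "x : X"
  let ?F' = "FD F (G x)" and ?G' = "FD G x"
  have F: "(F has_derivative ?F') (at (G x))" using Ck_on_Suc_D(1)[OF Suc.prems(1)] x GY by blast
  have "((%x. F (G x)) has_derivative (%v. ?F' (?G' v))) (at x)"
   by (rule has_derivative_compose[OF Ck_on_Suc_D(1)[OF Suc.prems(2) x] F])
  moreover have "?F' w = (\<Sum>b\<in>Basis. (w \<bullet> b) *\<^sub>R ?F' b)" for w
  proof -
   interpret linear ?F' using F by (rule has_derivative_linear)
   have "?F' w = ?F' (\<Sum>b\<in>Basis. (w \<bullet> b) *\<^sub>R b)" by (simp add: euclidean_representation)
   then show ?thesis by (simp add: sum scale)
  qed
  ultimately show "((%x. F (G x)) has_derivative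
    (%v. \<Sum>b\<in>Basis. (FD G x v \<bullet> b) *\<^sub>R FD F (G x) b)) (at x)"
   by (rule has_derivative_eq_rhs[OF _ ext])
 next
  fix v
  have "Ck_on k X (%x. FD G x v \<bullet> b)" for b
   by (rule Ck_on_linear_comp[OF X bounded_linear_inner_left Ck_on_Suc_D(2)[OF Suc.prems(2)]])
  then show "Ck_on k X (%x. \<Sum>b\<in>Basis. (FD G x v \<bullet> b) *\<^sub>R FD F (G x) b)"
   by (intro Ck_on_sum[OF X] Ck_on_scaleR[OF X] Suc.IH Ck_on_Suc_D(2)[OF Suc.prems(1)] Ck_on_pred[OF Suc.prems(2)])
 qed
qed

lemma Ck_on_inverse:
 fixes f :: "'a::euclidean_space => real"
 assumes X: "open X" and nz: "!!x. x : X ==> f x ~= 0"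
 shows "Ck_on k X f ==> Ck_on k X (%x. inverse (f x))"
proof (induction k)
 case 0
 then show ?case using nz by (auto intro!: continuous_intros)
next
 case (Suc k)
 have IH: "Ck_on k X (%x. inverse (f x))" using Suc.IH Ck_on_pred[OF Suc.prems] by blast
 show ?case
 proof (rule Ck_on_step[OF X])
  show "((%x. inverse (f x)) has_derivative (%v. (- 1) * (inverse (f x) * FD f x v * inverse (f x)))) (at x)"
   if "x : X" for x
   using Deriv.has_derivative_inverse[OF nz[OF that] Ck_on_Suc_D(1)[OF Suc.prems that]] by simp
  show "Ck_on k X (%x. (- 1) * (inverse (f x) * FD f x v * inverse (f x)))" for v
   by (intro Ck_on_mult[OF X] IH Ck_on_Suc_D(2)[OF Suc.prems] Ck_on_const)
 qed
qed

text \<open>For a family closed under differentiation: every derivative is again a member, so higher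
  derivatives need no formula.\<close>

lemma Ck_on_derivative_sequence:
 fixes h :: "nat => real => real"
 assumes "!!m x. (h m has_real_derivative h (Suc m) x) (at x)"
 shows "Ck_on k UNIV (h m)"
proof (induction k arbitrary: m)
 case 0
 show ?case using DERIV_isCont[OF assms] by (simp add: continuous_at_imp_continuous_on)
next
 case (Suc k)
 show ?case
 proof (rule Ck_on_step)
  show "(h m has_derivative (*) (h (Suc m) x)) (at x)" for x
   using assms by (simp add: has_field_derivative_def)
  show "Ck_on k UNIV (%x. h (Suc m) x * v)" for v
   by (intro Ck_on_mult Suc) auto
 qed simp
qed

lemma smooth_on_const [simp]: "smooth_on X (%_. c)"
 by (simp add: smooth_on_def)

lemma smooth_on_bounded_linear: "open X ==> bounded_linear f ==> smooth_on X f"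
 by (simp add: smooth_on_def Ck_on_bounded_linear)

lemma smooth_on_add: "open X ==> smooth_on X f ==> smooth_on X g ==> smooth_on X (%x. f x + g x)"
 by (simp add: smooth_on_def Ck_on_add)

lemma smooth_on_inner: "open X ==> smooth_on X f ==> smooth_on X g ==> smooth_on X (%x. f x \<bullet> g x)"
 by (simp add: smooth_on_def Ck_on_inner)

lemma smooth_on_scaleR: "open X ==> smooth_on X f ==> smooth_on X g ==> smooth_on X (%x. f x *\<^sub>R g x)"
 by (simp add: smooth_on_def Ck_on_scaleR)

lemma smooth_on_mult:
 "open X ==> smooth_on X f ==> smooth_on X g ==> smooth_on X (%x. f x * g x :: real)"
 by (simp add: smooth_on_def Ck_on_mult)

lemma smooth_on_diff:
 fixes f g :: "'a::euclidean_space => 'b::real_normed_vector"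
 assumes "open X" "smooth_on X f" "smooth_on X g" shows "smooth_on X (%x. f x - g x)"
 using smooth_on_add[OF assms(1,2) smooth_on_scaleR[OF assms(1) smooth_on_const assms(3), of "-1"]] by simp

lemma smooth_on_power: "open X ==> smooth_on X f ==> smooth_on X (%x. (f x :: real) ^ k)"
 by (induction k) (auto intro: smooth_on_mult)

lemma smooth_on_inverse:
 "open X ==> (!!x. x : X ==> f x ~= 0) ==> smooth_on X f ==> smooth_on X (%x. inverse (f x :: real))"
 by (simp add: smooth_on_def Ck_on_inverse)

lemma smooth_on_divide:
 "open X ==> smooth_on X f ==> (!!x. x : X ==> g x ~= 0) ==> smooth_on X g ==> smooth_on X (%x. f x / g x :: real)"
 unfolding divide_inverse by (intro smooth_on_mult smooth_on_inverse)

lemma smooth_on_compose: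
 fixes F :: "'b::euclidean_space => 'c::real_normed_vector" and G :: "'a::euclidean_space => 'b"
 shows "open X ==> smooth_on Y F ==> smooth_on X G ==> G ` X \<subseteq> Y ==> smooth_on X (%x. F (G x))"
 by (simp add: smooth_on_def Ck_on_compose)

lemma smooth_on_cong:
 fixes f g :: "'a::euclidean_space => 'b::real_normed_vector"
 shows "open X ==> smooth_on X f ==> (!!x. x : X ==> f x = g x) ==> smooth_on X g"
 unfolding smooth_on_def using Ck_on_cong' by blast

lemma smooth_on_subset: "smooth_on X f ==> Y \<subseteq> X ==> smooth_on Y f"
 unfolding smooth_on_def using Ck_on_subset by blast

lemma smooth_on_local:
 assumes "!!x. x : X ==> EX U. open U & x : U & smooth_on U f"
 shows "smooth_on X f"
 unfolding smooth_on_def by (intro allI Ck_on_local) (use assms in "auto simp: smooth_on_def")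

lemma smooth_on_frechet: "smooth_on X f ==> smooth_on X (%x. FD f x v)"
 unfolding smooth_on_def by (metis Ck_on.simps(2))

lemma smooth_on_has_derivative:
 "smooth_on X f ==> x : X ==> (f has_derivative FD f x) (at x)"
 unfolding smooth_on_def by (meson Ck_on_Suc_D(1))

lemma smooth_on_C1_map: "smooth_on X f ==> C1_map X f (%x. FD f x)"
 unfolding C1_map_def using smooth_on_has_derivative smooth_on_frechet
 by (metis (mono_tags, lifting) Ck_on.simps(1) smooth_on_def)

lemma smooth_on_continuous: "smooth_on X f ==> continuous_on X f"
 unfolding smooth_on_def by (meson Ck_on_continuous)

text \<open>The class of functions \<open>p (1/x) exp (-1/x)\<close>, \<open>p\<close> a polynomial, extended by 0, is closed
 under differentiation; this makes the standard cut-off function smooth.\<close>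

definition flat :: "real poly => real => real" where
 "flat p x = (if x <= 0 then 0 else poly p (1 / x) * exp (- (1 / x)))"

text \<open>The chain rule applied to \<open>p (1/x) exp (-1/x)\<close> gives
  \<open>x^-2 (p - p') (1/x) exp (-1/x)\<close>.\<close>

definition flat_deriv :: "real poly => real poly" where
 "flat_deriv p = [:0, 0, 1:] * (p - pderiv p)"

lemma flat_limit: "((%x::real. poly p (1 / x) * exp (- (1 / x))) \<longlongrightarrow> 0) (at_right 0)"
proof -
 have "((%u::real. poly p u * exp (- u)) \<longlongrightarrow> 0) at_top"
 proof -
  have "((%u::real. \<Sum>i\<le>degree p. coeff p i * (u ^ i / exp u)) \<longlongrightarrow> (\<Sum>i\<le>degree p. coeff p i * 0)) at_top"
   by (intro tendsto_intros tendsto_power_div_exp_0)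
  then show ?thesis
   by (simp add: poly_altdef exp_minus field_simps sum_distrib_right sum_divide_distrib)
 qed
 moreover have "filterlim (%x::real. 1 / x) at_top (at_right 0)"
  using filterlim_inverse_at_top_right by (simp add: inverse_eq_divide)
 ultimately show ?thesis by (rule filterlim_compose)
qed

lemma flat_DERIV: "(flat p has_real_derivative flat (flat_deriv p) x) (at x)"
proof (cases x "0::real" rule: linorder_cases)
 case less
 have "((%_. 0) has_real_derivative 0) (at x)" by simp
 then have "(flat p has_real_derivative 0) (at x)"
  by (rule has_field_derivative_transform_within_open[where S="{..<0}"]) (use less in "auto simp: flat_def")
 then show ?thesis using less by (simp add: flat_def)
next
 case greater
 have "((%x. poly p (1 / x) * exp (- (1 / x))) has_real_derivative flat (flat_deriv p) x) (at x)"
  using greater unfolding flat_def flat_deriv_def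
  by (auto intro!: derivative_eq_intros DERIV_chain2[OF poly_DERIV] simp: field_simps power2_eq_square)
 then show ?thesis
  by (rule has_field_derivative_transform_within_open[where S="{0<..}"]) (use greater in "auto simp: flat_def")
next
 case equal
 have l: "((%h. (flat p (0 + h) - flat p 0) / h) \<longlongrightarrow> 0) (at_left 0)"
  by (rule Lim_transform_eventually[OF tendsto_const])
   (auto simp: eventually_at_left_field flat_def intro!: exI[of _ "-1"])
 \<comment> \<open>To the right of 0 the difference quotient of \<open>flat p\<close> is the
   function belonging to \<open>[:0, 1:] * p\<close>, so \<open>flat_limit\<close> covers it
   too.\<close>
 have "((%x. poly ([:0, 1:] * p) (1 / x) * exp (- (1 / x))) \<longlongrightarrow> 0) (at_right 0)"
  by (rule flat_limit)
 then have r: "((%h. (flat p (0 + h) - flat p 0) / h) \<longlongrightarrow> 0) (at_right 0)"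
  by (rule Lim_transform_eventually)
   (auto simp: eventually_at_right_field flat_def field_simps intro!: exI[of _ 1])
 have "((%h. (flat p (0 + h) - flat p 0) / h) \<longlongrightarrow> 0) (at 0)"
  using l r by (simp add: filterlim_at_split)
 then have "(flat p has_real_derivative 0) (at 0)" by (simp add: DERIV_def)
 then show ?thesis using equal by (simp add: flat_def)
qed

lemma smooth_on_flat: "smooth_on UNIV (flat p)"
proof -
 have "Ck_on k UNIV (flat ((flat_deriv ^^ m) p))" for k m
  using Ck_on_derivative_sequence[of "%m. flat ((flat_deriv ^^ m) p)"] flat_DERIV by simp
 from this[of _ 0] show ?thesis by (simp add: smooth_on_def)
qed

definition bump :: "real => real => real" where
 "bump dl u = flat 1 (dl - u) * flat 1 (dl + u) / (flat 1 dl)^2"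

lemma smooth_on_bump: "smooth_on UNIV (bump dl)"
proof -
 have "smooth_on UNIV (%u. flat 1 (dl - u))" "smooth_on UNIV (%u. flat 1 (dl + u))"
  by (rule smooth_on_compose[OF _ smooth_on_flat], simp, intro smooth_on_add smooth_on_diff smooth_on_const smooth_on_bounded_linear bounded_linear_ident open_UNIV, simp)+
 then show ?thesis unfolding bump_def divide_inverse by (intro smooth_on_mult) auto
qed

lemma bump_facts:
 assumes "dl > 0"
 shows "0 <= bump dl u" "bump dl u <= 1" "bump dl 0 = 1" "dl <= \<bar>u\<bar> ==> bump dl u = 0"
proof -
 show "bump dl 0 = 1" using assms by (simp add: bump_def flat_def power2_eq_square)
 show "dl <= \<bar>u\<bar> ==> bump dl u = 0" by (auto simp: bump_def flat_def)
 show "0 <= bump dl u" by (simp add: bump_def flat_def)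
 show "bump dl u <= 1"
 proof (cases "\<bar>u\<bar> < dl")
  case True
  then have pos: "dl - u > 0" "dl + u > 0" by auto
  \<comment> \<open>The exponents add up to \<open>- 2 dl / (dl^2 - u^2)\<close>, which is largest
    at \<open>u = 0\<close>.\<close>
  have "(dl - u) * (dl + u) <= dl^2" by (simp add: algebra_simps power2_eq_square)
  then have "2 * dl / dl^2 <= 2 * dl / ((dl - u) * (dl + u))"
   using pos assms by (intro divide_left_mono) auto
  also have "... = 1 / (dl - u) + 1 / (dl + u)" using pos by (simp add: field_simps)
  finally have "2 / dl <= 1 / (dl - u) + 1 / (dl + u)" using assms by (simp add: power2_eq_square)
  then have "exp (- (1 / (dl - u))) * exp (- (1 / (dl + u))) <= exp (- (1 / dl)) * exp (- (1 / dl))"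
   by (simp add: exp_add[symmetric])
  then show ?thesis using pos assms by (simp add: bump_def flat_def power2_eq_square)
 next
  case False
  then show ?thesis using assms by (auto simp: bump_def flat_def)
 qed
qed

section \<open>Real-valued distances on convex domains\<close>

definition rdist :: "'a::euclidean_space set => 'a tensor2 => 'a => 'a => real" where
 "rdist X g p q = enn2real (riem_dist X g p q)"

text \<open>The straight segment stays in \<open>X\<close> and the metric is bounded on it by
  compactness. Hence nothing is lost in \<open>rdist\<close>, although \<open>enn2real\<close> sends
  infinity to 0.\<close>

lemma riem_dist_finite:
 assumes g: "semi_metric X g" and X: "convex X" "p : X" "q : X"
 shows "riem_dist X g p q < \<infinity>"
proof -
 have sub: "closed_segment p q \<subseteq> X" using X by (simp add: closed_segment_subset)
 have "continuous_on (closed_segment p q) (%z. sqrt (g z (q - p) (q - p)))"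
  using g continuous_on_subset[OF _ sub, of "%z. g z (q - p) (q - p)"]
  by (simp add: semi_metric_def continuous_on_real_sqrt)
 then have "compact ((%z. sqrt (g z (q - p) (q - p))) ` closed_segment p q)"
  by (rule compact_continuous_image) simp
 then have "bdd_above ((%z. sqrt (g z (q - p) (q - p))) ` closed_segment p q)"
  by (intro bounded_imp_bdd_above compact_imp_bounded)
 then obtain K where "!!z. z : closed_segment p q ==> sqrt (g z (q - p) (q - p)) <= K"
  unfolding bdd_above_def by auto
 then have "riem_dist X g p q <= ennreal K" by (rule riem_dist_le_segment[OF sub])
 then show ?thesis using le_less_trans by fastforce
qed

lemma rdist_nonneg [simp]: "0 <= rdist X g p q"
 by (simp add: rdist_def)

context
 fixes X :: "'a::euclidean_space set" and g :: "'a tensor2"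
 assumes g: "semi_metric X g" and X: "convex X"
begin

lemma riem_dist_eq_rdist: "p : X ==> q : X ==> riem_dist X g p q = ennreal (rdist X g p q)"
 using riem_dist_finite[OF g X, of p q] by (simp add: rdist_def)

lemma rdist_refl: "p : X ==> rdist X g p p = 0"
 using riem_dist_refl[OF g] by (simp add: rdist_def)

lemma rdist_sym: "rdist X g p q = rdist X g q p"
 using riem_dist_sym[OF g] by (simp add: rdist_def)

lemma rdist_triangle:
 assumes "p : X" "q : X" "r : X"
 shows "rdist X g p r <= rdist X g p q + rdist X g q r"
 using riem_dist_triangle[OF g, of p r q] assms by (simp add: riem_dist_eq_rdist ennreal_plus[symmetric] del: ennreal_plus)

lemma rdist_le_iff: "p : X ==> q : X ==> 0 <= L ==> riem_dist X g p q <= ennreal L \<longleftrightarrow> rdist X g p q <= L"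
 by (simp add: riem_dist_eq_rdist)

lemma rdist_less_iff: "p : X ==> q : X ==> riem_dist X g p q < ennreal L \<longleftrightarrow> rdist X g p q < L"
 by (simp add: riem_dist_eq_rdist ennreal_less_iff)

lemma rdist_split:
 assumes "p : X" "q : X" "rdist X g p q < a + b" "0 < a" "0 < b"
 shows "EX w:X. rdist X g p w < a & rdist X g w q < b"
 using riem_dist_split[OF g, of p q a b] assms by (auto simp: rdist_less_iff simp del: ennreal_plus)

end

lemma rdist_map_le:
 assumes g: "semi_metric X g" "convex X" and g': "semi_metric Y g'" "convex Y"
  and F: "C1_map X F F'" "F ` X \<subseteq> Y" and K: "0 < K"
  and le: "!!x v. x : X ==> g' (F x) (F' x v) (F' x v) <= K^2 * g x v v"
  and pq: "p : X" "q : X"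
 shows "rdist Y g' (F p) (F q) <= K * rdist X g p q"
proof -
 have "ennreal (rdist Y g' (F p) (F q)) <= ennreal (K * rdist X g p q)"
  using riem_dist_map_le[OF g(1) F K, of g' p q] le pq F(2) K riem_dist_eq_rdist[OF g] riem_dist_eq_rdist[OF g', of "F p" "F q"]
  by (simp add: ennreal_mult' image_subset_iff)
 then show ?thesis using K by simp
qed

lemma rdist_ge_map:
 fixes F :: "'a::euclidean_space => 'b::euclidean_space"
 assumes g: "semi_metric X g" "convex X" and F: "C1_map X F F'" and K: "0 < K"
  and le: "!!x v. x : X ==> (norm (F' x v))^2 <= K^2 * g x v v" and pq: "p : X" "q : X"
 shows "norm (F q - F p) <= K * rdist X g p q"
proof -
 have "ennreal (norm (F q - F p)) <= ennreal (K * rdist X g p q)"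
  using riem_dist_ge_map[OF g(1) F K le, of q p] riem_dist_eq_rdist[OF g pq] K
  by (simp add: ennreal_mult')
 then show ?thesis using K by simp
qed

lemma rdist_isometry:
 assumes g: "semi_metric X g" and F: "C1_map X F F'" "F ` X \<subseteq> X" and G: "C1_map X G G'" "G ` X \<subseteq> X"
  and FG: "!!x. x : X ==> G (F x) = x"
  and F': "!!x v. x : X ==> g (F x) (F' x v) (F' x v) = g x v v"
  and G': "!!x v. x : X ==> g (G x) (G' x v) (G' x v) = g x v v"
  and pq: "p : X" "q : X"
 shows "rdist X g (F p) (F q) = rdist X g p q"
proof -
 have "riem_dist X g (F p) (F q) = riem_dist X g p q"
  by (rule riem_dist_isometry[where F=F and F'=F' and G=G and G'=G']; fact)
 then show ?thesis by (simp add: rdist_def)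
qed

lemma rdist_le_segment:
 assumes "closed_segment p q \<subseteq> X" "!!z. z : closed_segment p q ==> sqrt (g z (q - p) (q - p)) <= K" and "0 <= K"
 shows "rdist X g p q <= K"
proof -
 have "riem_dist X g p q <= ennreal K" by (rule riem_dist_le_segment) (use assms in auto)
 then show ?thesis using assms(3) by (simp add: rdist_def enn2real_leI)
qed

lemma riemannian_semi_metric:
 assumes "riemannian_metric X g" shows "semi_metric X g"
proof -
 have "0 <= g x v v" if "x : X" for x v
  using assms that by (cases "v = 0") (auto simp: riemannian_metric_def bilinear_lzero less_imp_le)
 moreover have "continuous_on X (%x. g x u v)" for u v
  using assms by (intro smooth_on_continuous) (simp add: riemannian_metric_def)
 ultimately show ?thesis using assms by (simp add: riemannian_metric_def semi_metric_def)
qed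

subsection \<open>The Poincare ball\<close>

lemma norm_sq_less_1: "norm (x::'a::real_normed_vector) < 1 ==> (norm x)^2 < 1"
 by (simp add: power_less_one_iff abs_square_less_1)

lemma smooth_on_norm_sq: "open X ==> smooth_on X (%x::'a::euclidean_space. (norm x)^2)"
 unfolding power2_norm_eq_inner by (intro smooth_on_inner smooth_on_bounded_linear bounded_linear_ident)

lemma riemannian_hyp: "riemannian_metric HS (hm :: (real^'n::finite) tensor2)"
 unfolding riemannian_metric_def
proof (intro conjI ballI allI impI)
 fix x :: "real^'n" assume x: "x : HS"
 then have p: "1 - (norm x)^2 > 0" using norm_sq_less_1[of x] by simp
 show "bilinear (hm x)"
  unfolding bilinear_def hyp_metric_def
  by (auto intro!: linearI simp: inner_add_left inner_add_right algebra_simps add_divide_distrib)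
 show "hm x u v = hm x v u" for u v by (simp add: hyp_metric_def inner_commute)
 show "0 < hm x u u" if "u ~= 0" for u using that p by (simp add: hyp_metric_def)
next
 fix u v :: "real^'n"
 show "smooth_on HS (%x. hm x u v)"
  unfolding hyp_metric_def
  by (intro smooth_on_divide smooth_on_const smooth_on_power smooth_on_diff smooth_on_norm_sq open_ball)
   (use norm_sq_less_1 in fastforce)
qed

lemmas semi_hyp = riemannian_semi_metric[OF riemannian_hyp]

abbreviation hdist :: "real^'n::finite => real^'n => real" where
 "hdist == rdist HS hm"

lemmas hdist_triangle = rdist_triangle[OF semi_hyp convex_ball]

lemmas hdist_sym = rdist_sym[OF semi_hyp convex_ball]

lemmas hdist_refl = rdist_refl[OF semi_hyp convex_ball]

lemmas hdist_eq = riem_dist_eq_rdist[OF semi_hyp convex_ball]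

lemma hyp_metric_ge: "x : HS ==> 4 * (norm v)^2 <= hm x v v"
proof -
 assume "x : HS"
 then have p: "0 < 1 - (norm x)^2" "1 - (norm x)^2 <= 1" using norm_sq_less_1[of x] by auto
 have "(1 - (norm x)^2)^2 <= 1" using p by (simp add: power_le_one)
 then have "4 * (norm v)^2 / 1 <= 4 * (norm v)^2 / (1 - (norm x)^2)^2"
  using p by (intro divide_left_mono) auto
 then show ?thesis by (simp add: hyp_metric_def power2_norm_eq_inner)
qed

lemma C1_map_id: "C1_map X (%x. x) (%_ v. v)"
 by (simp add: C1_map_def)

lemma hdist_ge_norm: "p : HS ==> q : HS ==> 2 * norm (q - p) <= hdist p q"
proof -
 assume pq: "p : HS" "q : HS"
 have "(norm v)^2 <= (1 / 2)^2 * hm x v v" if "x : HS" for x v :: "real^'n"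
  using hyp_metric_ge[OF that, of v] by (simp add: power_divide)
 from rdist_ge_map[OF semi_hyp convex_ball C1_map_id _ this pq] show ?thesis by simp
qed

lemma sqrt_hyp_metric:
 assumes "x : HS" shows "sqrt (hm x v v) = 2 * norm v / (1 - (norm x)^2)"
proof -
 have "0 < 1 - (norm x)^2" using norm_sq_less_1[of x] assms by simp
 moreover have "hm x v v = (2 * norm v / (1 - (norm x)^2))^2"
  by (simp add: hyp_metric_def power2_norm_eq_inner[symmetric] power_divide power_mult_distrib)
 ultimately show ?thesis by simp
qed

lemma hdist_le_cball:
 fixes p q :: "real^'n::finite"
 assumes "norm p <= r" "norm q <= r" "r < 1"
 shows "hdist p q <= 2 / (1 - r^2) * norm (q - p)"
proof (rule rdist_le_segment)
 have r: "0 <= r" using assms norm_ge_zero order.trans by blast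
 have sub: "closed_segment p q \<subseteq> cball 0 r"
  using assms by (intro closed_segment_subset) auto
 then show "closed_segment p q \<subseteq> HS" using assms by fastforce
 fix z assume "z : closed_segment p q"
 then have z: "norm z <= r" using sub by auto
 then have "(norm z)^2 <= r^2" by (simp add: power_mono)
 moreover have "r^2 < 1" using assms r by (simp add: power_less_one_iff abs_square_less_1)
 ultimately have "2 * norm (q - p) / (1 - (norm z)^2) <= 2 * norm (q - p) / (1 - r^2)"
  by (intro divide_left_mono mult_pos_pos) auto
 then show "sqrt (hm z (q - p) (q - p)) <= 2 / (1 - r^2) * norm (q - p)"
  using sqrt_hyp_metric[of z "q - p"] z assms by simp
next
 have "0 <= r" using assms norm_ge_zero order.trans by blast
 then show "0 <= 2 / (1 - r^2) * norm (q - p)"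
  using assms by (simp add: power_le_one)
qed

text \<open>A smooth substitute for the hyperbolic distance to the origin: it is 1-Lipschitz and
  tends to infinity at the unit sphere, so it confines hyperbolically bounded sets to smaller balls
  and controls the conformal factor.\<close>

definition height :: "real^'n::finite => real" where
 "height x = - ln (1 - (norm x)^2)"

lemma height_C1: "C1_map HS height (%x v. 2 * (x \<bullet> v) / (1 - (norm x)^2))"
 unfolding C1_map_def
proof (intro conjI ballI allI)
 fix x :: "real^'n" assume "x : HS"
 then have p: "1 - x \<bullet> x > 0" using norm_sq_less_1[of x] by (simp add: power2_norm_eq_inner)
 show "(height has_derivative (%v. 2 * (x \<bullet> v) / (1 - (norm x)^2))) (at x)"
  unfolding height_def power2_norm_eq_inner
  using p by (auto intro!: derivative_eq_intros simp: inner_commute field_simps)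
next
 fix v :: "real^'n"
 show "continuous_on HS (%x. 2 * (x \<bullet> v) / (1 - (norm x)^2))"
  by (intro continuous_intros) (use norm_sq_less_1 in fastforce)
qed

lemma height_lipschitz:
 assumes "p : HS" "q : HS" shows "\<bar>height q - height p\<bar> <= hdist p q"
proof -
 have "(norm (2 * (x \<bullet> v) / (1 - (norm x)^2)))^2 <= 1^2 * hm x v v" if x: "x : HS" for x v :: "real^'n"
 proof -
  have "(x \<bullet> v)^2 <= (norm x)^2 * (norm v)^2"
   using Cauchy_Schwarz_ineq[of x v] by (simp add: power2_norm_eq_inner)
  also have "... <= 1 * (norm v)^2" using x norm_sq_less_1[of x] by (intro mult_right_mono) auto
  finally show ?thesis
   by (simp add: hyp_metric_def power_divide power_mult_distrib power2_norm_eq_inner divide_right_mono)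
 qed
 from rdist_ge_map[OF semi_hyp convex_ball height_C1 _ this assms] show ?thesis by simp
qed

lemma height_0 [simp]: "height 0 = 0" by (simp add: height_def)

lemma hdist_bound_norm:
 fixes x :: "real^'n::finite"
 assumes "x : HS" "hdist x 0 <= C" shows "norm x <= sqrt (1 - exp (- C))"
proof -
 have p: "1 - (norm x)^2 > 0" using norm_sq_less_1[of x] assms by simp
 have "height x <= C" using height_lipschitz[of x 0] assms by simp
 then have "ln (1 - (norm x)^2) >= - C" by (simp add: height_def)
 then have "1 - (norm x)^2 >= exp (- C)" using p by (metis exp_le_cancel_iff exp_ln)
 then have "(norm x)^2 <= 1 - exp (- C)" by simp
 then show ?thesis using real_le_rsqrt by blast
qed

text \<open>The inversion in the sphere about \<open>a / |a|\<^sup>2\<close> orthogonal to the unit sphere swaps \<open>0\<close> and \<open>a\<close>.\<close>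

definition invc :: "real^'n::finite => real^'n" where
 "invc a = a /\<^sub>R (norm a)^2"

text \<open>The squared radius of the sphere of inversion; orthogonality to the unit sphere says
  that it equals \<open>|invc a|^2 - 1\<close>.\<close>

definition invr :: "real^'n::finite => real" where
 "invr a = (1 - (norm a)^2) / (norm a)^2"

text \<open>For \<open>a = 0\<close> there is no such sphere; the identity serves there, as it
  exchanges \<open>0\<close> and \<open>a\<close> trivially.\<close>

definition inversion :: "real^'n::finite => real^'n => real^'n" where
 "inversion a x = (if a = 0 then x else invc a + (invr a / (norm (x - invc a))^2) *\<^sub>R (x - invc a))"

definition inversion_deriv :: "real^'n::finite => real^'n => real^'n => real^'n" where
 "inversion_deriv a x v = (if a = 0 then v else (invr a / (norm (x - invc a))^2) *\<^sub>R v
   - (2 * invr a * ((x - invc a) \<bullet> v) / ((norm (x - invc a))^2)^2) *\<^sub>R (x - invc a))"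

context
 fixes a :: "real^'n::finite"
 assumes a: "norm a < 1" "a ~= 0"
begin

lemma invc_norm: "(norm (invc a))^2 = 1 / (norm a)^2" "norm (invc a) > 1"
 using a by (auto simp: invc_def power2_eq_square field_simps)

lemma invr_pos: "invr a > 0" "invr a = (norm (invc a))^2 - 1"
 using a norm_sq_less_1[of a] by (auto simp: invr_def invc_norm field_simps)

lemma invc_ne: "norm x < 1 ==> x - invc a ~= 0"
 using invc_norm(2) by auto

text \<open>The factor is also the dilatation of the derivative in
  \<open>inversion_deriv_inner\<close>; that the two coincide is precisely the invariance of the
  hyperbolic metric.\<close>

lemma inversion_norm:
 assumes "norm x < 1"
 shows "1 - (norm (inversion a x))^2 = (1 - (norm x)^2) * (invr a / (norm (x - invc a))^2)"
proof -
 define D where "D = (norm (x - invc a))^2"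
 have D: "D > 0" using invc_ne[OF assms] by (simp add: D_def)
 define s where "s = invr a"
 have s: "s = invc a \<bullet> invc a - 1" using invr_pos(2) by (simp add: s_def power2_norm_eq_inner)
 have Dx: "D = x \<bullet> x - 2 * (x \<bullet> invc a) + invc a \<bullet> invc a"
  by (simp add: D_def power2_norm_eq_inner inner_diff_left inner_diff_right inner_commute)
 have "(norm (c + k *\<^sub>R w))^2 = c \<bullet> c + 2 * k * (c \<bullet> w) + k^2 * (w \<bullet> w)" for c w :: "real^'n" and k
  unfolding power2_norm_eq_inner
  by (simp add: inner_add_left inner_add_right inner_commute power2_eq_square)
 from this[of "invc a" "s / D" "x - invc a"]
 have "(norm (inversion a x))^2 = invc a \<bullet> invc a + 2 * (s / D) * (invc a \<bullet> (x - invc a)) + (s / D)^2 * D"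
  using a by (simp add: inversion_def D_def s_def power2_norm_eq_inner)
 also have "(s / D)^2 * D = s^2 / D" using D by (simp add: power2_eq_square)
 also have "invc a \<bullet> (x - invc a) = x \<bullet> invc a - invc a \<bullet> invc a" by (simp add: inner_diff_right inner_commute)
 finally have "1 - (norm (inversion a x))^2 = (1 - invc a \<bullet> invc a) - (s / D) * (2 * (x \<bullet> invc a) - 2 * (invc a \<bullet> invc a) + s)"
  by (simp add: algebra_simps power2_eq_square)
 then have "1 - (norm (inversion a x))^2 = - s - (s / D) * (2 * (x \<bullet> invc a) - 2 * (invc a \<bullet> invc a) + s)"
  using s by linarith
 also have "... = - (s / D) * (D + 2 * (x \<bullet> invc a) - 2 * (invc a \<bullet> invc a) + s)"
  using D by (simp add: field_simps)
 also have "D + 2 * (x \<bullet> invc a) - 2 * (invc a \<bullet> invc a) + s = x \<bullet> x - 1"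
  using Dx s by simp
 also have "- (s / D) * (x \<bullet> x - 1) = (1 - x \<bullet> x) * (s / D)"
  by (simp add: algebra_simps)
 finally show ?thesis by (simp add: D_def s_def power2_norm_eq_inner)
qed

lemma inversion_deriv_inner:
 assumes "norm x < 1"
 shows "inversion_deriv a x u \<bullet> inversion_deriv a x v = (invr a / (norm (x - invc a))^2)^2 * (u \<bullet> v)"
proof -
 define w where "w = x - invc a"
 define D where "D = (norm w)^2"
 have D: "D > 0" using invc_ne[OF assms] by (simp add: D_def w_def)
 have w: "w \<bullet> w = D" by (simp add: D_def power2_norm_eq_inner)
 define k where "k = invr a"
 have "inversion_deriv a x u = (k / D) *\<^sub>R u - (2 * k * (w \<bullet> u) / D^2) *\<^sub>R w" for u
  using a by (simp add: inversion_deriv_def D_def w_def k_def)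
 then have "inversion_deriv a x u \<bullet> inversion_deriv a x v = (k / D)^2 * (u \<bullet> v)"
  using D by (simp only: inner_diff_left inner_diff_right inner_scaleR_left inner_scaleR_right w inner_commute[of u w] inner_commute[of v w])
   (simp add: power2_eq_square field_simps)
 then show ?thesis by (simp add: k_def D_def w_def)
qed

end

lemma inversion_in_ball: "norm a < 1 ==> norm x < 1 ==> norm (inversion a x) < 1"
proof (cases "a = 0")
 case False
 assume *: "norm a < 1" "norm x < 1"
 then have "0 < (1 - (norm x)^2) * (invr a / (norm (x - invc a))^2)"
  using norm_sq_less_1[of x] invr_pos(1)[of a] invc_ne[of a x] False by simp
 then have "(norm (inversion a x))^2 < 1" using inversion_norm[of a x] * False by simp
 then show ?thesis by (simp add: abs_square_less_1)
qed (simp add: inversion_def)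

lemma inversion_metric:
 assumes "norm a < 1" "norm x < 1"
 shows "hm (inversion a x) (inversion_deriv a x u) (inversion_deriv a x v) = hm x u v"
proof (cases "a = 0")
 case True
 then show ?thesis by (simp add: inversion_def inversion_deriv_def)
next
 case False
 define k where "k = invr a / (norm (x - invc a))^2"
 have "k ~= 0"
  using invr_pos(1)[of a] invc_ne[of a x] False assms by (simp add: k_def)
 moreover have "1 - (norm (inversion a x))^2 = (1 - (norm x)^2) * k"
  "inversion_deriv a x u \<bullet> inversion_deriv a x v = k^2 * (u \<bullet> v)"
  using inversion_norm[of a x] inversion_deriv_inner[of a x u v] False assms by (auto simp: k_def)
 ultimately show ?thesis
  unfolding hyp_metric_def by (simp add: power_mult_distrib)
qed

lemma inversion_inversion:
 assumes "norm a < 1" "norm x < 1" shows "inversion a (inversion a x) = x"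
proof (cases "a = 0")
 case False
 define w where "w = x - invc a"
 define D where "D = (norm w)^2"
 have D: "D > 0" using invc_ne[of a x] assms False by (simp add: D_def w_def)
 have s: "invr a > 0" using invr_pos(1)[of a] assms False by simp
 have 1: "inversion a x - invc a = (invr a / D) *\<^sub>R w" using False by (simp add: inversion_def w_def D_def)
 have "(norm (inversion a x - invc a))^2 = (invr a / D)^2 * D"
  unfolding 1 by (simp add: D_def power_mult_distrib power_divide)
 then have "(norm (inversion a x - invc a))^2 = (invr a)^2 / D" using D by (simp add: power2_eq_square)
 then have "inversion a (inversion a x) = invc a + (invr a / ((invr a)^2 / D)) *\<^sub>R (invr a / D) *\<^sub>R w"
  using False by (subst inversion_def) (simp add: 1)
 also have "... = invc a + w" using s D by (simp add: power2_eq_square)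
 finally show ?thesis by (simp add: w_def)
qed (simp add: inversion_def)

lemma inversion_0: "norm a < 1 ==> inversion a 0 = a"
proof (cases "a = 0")
 case False
 assume "norm a < 1"
 have "invr a / (norm (invc a))^2 = 1 - (norm a)^2"
  using False by (simp add: invr_def invc_def power2_eq_square field_simps)
 then have "inversion a 0 = invc a + (1 - (norm a)^2) *\<^sub>R (- invc a)"
  using False by (simp add: inversion_def)
 then have "inversion a 0 = (norm a)^2 *\<^sub>R invc a"
  by (simp add: algebra_simps)
 then show ?thesis using False by (simp add: invc_def)
qed (simp add: inversion_def)

lemma inversion_a: "norm a < 1 ==> inversion a a = 0"
 using inversion_inversion[of a 0] inversion_0[of a] by simp

lemma smooth_on_inversion:
 assumes "norm a < 1" shows "smooth_on HS (inversion a)"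
proof (cases "a = 0")
 case True
 then have "inversion a = (%x. x)" by (simp add: inversion_def fun_eq_iff)
 then show ?thesis by (simp add: smooth_on_bounded_linear bounded_linear_ident)
next
 case False
 have 1: "smooth_on HS (%x. x - invc a)"
  by (intro smooth_on_diff smooth_on_bounded_linear bounded_linear_ident smooth_on_const open_ball)
 have 2: "smooth_on HS (%x. (norm (x - invc a))^2)"
  unfolding power2_norm_eq_inner by (intro smooth_on_inner 1 open_ball)
 have "smooth_on HS (%x. invc a + (invr a / (norm (x - invc a))^2) *\<^sub>R (x - invc a))"
  by (intro smooth_on_add smooth_on_scaleR smooth_on_divide smooth_on_const 1 2 open_ball)
   (use invc_ne[of a] assms False in auto)
 then show ?thesis using False by (simp add: inversion_def[abs_def])
qed

lemma inversion_has_derivative: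
 assumes "norm a < 1" "norm x < 1"
 shows "(inversion a has_derivative inversion_deriv a x) (at x)"
proof (cases "a = 0")
 case True
 then have "inversion a = (%x. x)" "inversion_deriv a x = (%v. v)"
  by (auto simp: inversion_def inversion_deriv_def fun_eq_iff)
 then show ?thesis by simp
next
 case False
 define c k where "c = invc a" and "k = invr a"
 have nz: "(x - c) \<bullet> (x - c) ~= 0" using invc_ne[of a x] assms False by (simp add: c_def)
 have 1: "((%x. k / ((x - c) \<bullet> (x - c))) has_derivative (%v. - (2 * k * ((x - c) \<bullet> v)) / ((x - c) \<bullet> (x - c))^2)) (at x)"
  using nz by (auto intro!: derivative_eq_intros simp: fun_eq_iff inner_commute power2_eq_square divide_inverse)
 have 2: "((%x. x - c) has_derivative (%v. v)) (at x)" by (auto intro!: derivative_eq_intros)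
 have "((%x. c + (k / ((x - c) \<bullet> (x - c))) *\<^sub>R (x - c)) has_derivative (%v. 0 +
   ((k / ((x - c) \<bullet> (x - c))) *\<^sub>R v + (- (2 * k * ((x - c) \<bullet> v)) / ((x - c) \<bullet> (x - c))^2) *\<^sub>R (x - c)))) (at x)"
  by (intro has_derivative_add has_derivative_scaleR 1 2 has_derivative_const)
 then show ?thesis
  unfolding inversion_def[abs_def] inversion_deriv_def[abs_def] power2_norm_eq_inner using False
  by (simp add: c_def k_def)
qed

section \<open>The isometry group of the ball\<close>

abbreviation hyp_isom :: "((real^'n::finite) => (real^'n)) set" where
 "hyp_isom == carrier (isom_group HS hm)"

lemma hyp_isom_iff:
 "f : hyp_isom \<longleftrightarrow> f : Bij HS & smooth_on HS f & preserves_metric HS hm f"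
 by (simp add: isom_group_def)

lemma hyp_isomD:
 assumes "f : hyp_isom"
 shows "f : Bij HS" "smooth_on HS f" "bij_betw f HS HS"
  "x : HS ==> f x : HS"
  "x : HS ==> (f has_derivative FD f x) (at x)"
  "x : HS ==> hm (f x) (FD f x u) (FD f x v) = hm x u v"
 using assms smooth_on_has_derivative[of HS f x] unfolding hyp_isom_iff
 by (auto simp: Bij_def preserves_metric_def bij_betw_def)

lemma preserves_metric_cong:
 assumes "open X" "!!x. x : X ==> f x = h x" "!!x. x : X ==> (f has_derivative f' x) (at x)"
  "!!x u v. x : X ==> g (f x) (f' x u) (f' x v) = g x u v"
 shows "preserves_metric X g h"
 unfolding preserves_metric_def
proof (intro ballI allI)
 fix x u v assume x: "x : X"
 have "(h has_derivative f' x) (at x)"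
  by (rule has_derivative_transform_within_open[OF assms(3)[OF x] assms(1) x]) (use assms(2) in auto)
 then have "FD h x = f' x" using frechet_derivative_at by metis
 then show "g (h x) (FD h x u) (FD h x v) = g x u v"
  using assms(2,4) x by simp
qed

lemma hyp_isom_compose:
 assumes f: "f : (hyp_isom :: ((real^'n::finite) => _) set)" and h: "h : hyp_isom"
 shows "compose HS f h : hyp_isom"
proof -
 have sub: "h ` HS \<subseteq> HS" using hyp_isomD(4)[OF h] by blast
 have "smooth_on HS (%x. f (h x))"
  by (rule smooth_on_compose[OF open_ball hyp_isomD(2)[OF f] hyp_isomD(2)[OF h] sub])
 then have "smooth_on HS (compose HS f h)"
  by (rule smooth_on_cong[OF open_ball]) (simp add: compose_def)
 moreover have "preserves_metric HS hm (compose HS f h)"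
 proof (rule preserves_metric_cong[OF open_ball])
  fix x :: "real^'n" assume x: "x : HS"
  show "f (h x) = compose HS f h x" using x by (simp add: compose_def)
  show "((%x. f (h x)) has_derivative (%v. FD f (h x) (FD h x v))) (at x)"
   by (rule has_derivative_compose[OF hyp_isomD(5)[OF h x] hyp_isomD(5)[OF f hyp_isomD(4)[OF h x]]])
  show "hm (f (h x)) (FD f (h x) (FD h x u))
    (FD f (h x) (FD h x v)) = hm x u v" for u v
   using hyp_isomD(6)[OF h x] hyp_isomD(6)[OF f hyp_isomD(4)[OF h x]] by simp
 qed
 ultimately show ?thesis
  using compose_Bij[OF hyp_isomD(1)[OF f] hyp_isomD(1)[OF h]] by (simp add: hyp_isom_iff)
qed

lemma hyp_isom_id: "(\<lambda>x\<in>HS. x) : (hyp_isom :: ((real^'n::finite) => _) set)"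
proof -
 have "smooth_on HS (\<lambda>x\<in>HS. x :: real^'n)"
  by (rule smooth_on_cong[OF open_ball smooth_on_bounded_linear[OF open_ball bounded_linear_ident]]) simp
 moreover have "preserves_metric HS hm (\<lambda>x\<in>HS. x :: real^'n)"
  by (rule preserves_metric_cong[OF open_ball, where f="%x. x" and f'="%_ v. v"]) auto
 ultimately show ?thesis using id_Bij by (simp add: hyp_isom_iff)
qed

text \<open>The differential of an isometry is conformal for the Euclidean inner product, so its
  inverse is an explicit multiple of its transpose. This gives a formula for the derivative of the
  inverse map, from which smoothness follows.\<close>

lemma hyp_isom_inv:
 assumes f: "f : (hyp_isom :: ((real^'n::finite) => _) set)"
 shows "(\<lambda>x\<in>HS. inv_into HS f x) : hyp_isom"
proof -
 define h where "h = inv_into HS f"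
 have hf: "h (f x) = x" "f x : HS" if "x : HS" for x
  using that hyp_isomD(3,4)[OF f] by (auto simp: h_def bij_betw_def)
 have fh: "f (h y) = y" "h y : HS" if "y : HS" for y
  using that hyp_isomD(3)[OF f] f_inv_into_f[of y f HS] inv_into_into[of y f HS]
  unfolding h_def bij_betw_def by auto
 define cf :: "real^'n => real" where "cf x = 4 / (1 - (norm x)^2)^2" for x
 have cf: "hm x u v = cf x * (u \<bullet> v)" for x u v by (simp add: hyp_metric_def cf_def)
 have cfpos: "cf x > 0" if "x : HS" for x
  using that norm_sq_less_1[of x] by (simp add: cf_def)
 let ?F = "%x. FD f x"
 \<comment> \<open>The transpose of \<open>?F (h y)\<close>, scaled by the quotient of the conformal
   factors at \<open>y\<close> and \<open>h y\<close>.\<close>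
 define A where "A y w = (cf y * inverse (cf (h y))) *\<^sub>R (\<Sum>b\<in>Basis. (?F (h y) b \<bullet> w) *\<^sub>R b)" for y w
 have inner: "cf (f x) * (?F x u \<bullet> ?F x v) = cf x * (u \<bullet> v)" if "x : HS" for x u v
  using hyp_isomD(6)[OF f that] by (simp add: cf)
 have AF: "A y (?F (h y) v) = v" if y: "y : HS" for y v
 proof -
  have "(cf y * inverse (cf (h y))) * (?F (h y) b \<bullet> ?F (h y) v) = b \<bullet> v" for b
   using inner[OF fh(2)[OF y], of b v] cfpos[OF fh(2)[OF y]] fh(1)[OF y] by (simp add: field_simps)
  then show ?thesis
   by (simp add: A_def scaleR_sum_right) (simp add: inner_commute[of _ v] euclidean_representation)
 qed
 have FA: "?F (h y) (A y w) = w" if y: "y : HS" for y w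
 proof -
  have lin: "linear (?F (h y))" using hyp_isomD(5)[OF f fh(2)[OF y]] has_derivative_linear by blast
  have "inj (?F (h y))" using AF[OF y] by (metis injI)
  then have "surj (?F (h y))" using linear_injective_imp_surjective[OF lin] by blast
  then obtain v where "w = ?F (h y) v" by (metis surjD)
  then show ?thesis using AF[OF y] by simp
 qed
 have der: "(h has_derivative A y) (at y)" if y: "y : HS" for y
 proof -
  have "(h has_derivative A y) (at (f (h y)))"
   by (rule has_derivative_inverse_strong[OF open_ball fh(2)[OF y] smooth_on_continuous[OF hyp_isomD(2)[OF f]] _ hyp_isomD(5)[OF f fh(2)[OF y]]])
    (use hf FA[OF y] in "auto simp: fun_eq_iff")
  then show ?thesis using fh(1)[OF y] by simp
 qed
 have scf: "smooth_on HS cf"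
  unfolding cf_def using norm_sq_less_1
  by (intro smooth_on_divide smooth_on_const smooth_on_power smooth_on_diff smooth_on_norm_sq open_ball) fastforce
 have hsub: "h ` HS \<subseteq> HS" using fh(2) by blast
 \<comment> \<open>Bootstrapping: the derivative of \<open>h\<close> is a smooth expression in
   \<open>h\<close>, so \<open>h\<close> is one order smoother than assumed.\<close>
 have "Ck_on k HS h" for k
 proof (induction k)
  case 0
  then show ?case
   using has_derivative_continuous[OF der] by (simp add: continuous_at_imp_continuous_on)
 next
  case (Suc k)
  have comp: "Ck_on k HS (%y. F (h y))" if "smooth_on HS F" for F :: "real^'n => 'c::real_normed_vector"
   using that Ck_on_compose[OF open_ball hsub _ Suc, of F] by (simp add: smooth_on_def)
  show ?case
  proof (rule Ck_on_step[OF open_ball der])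
   show "Ck_on k HS (%y. A y v)" for v
    unfolding A_def
   proof (intro Ck_on_scaleR Ck_on_mult Ck_on_inverse Ck_on_sum Ck_on_const Ck_on_inner open_ball)
    show "Ck_on k HS cf" using scf by (simp add: smooth_on_def)
    show "Ck_on k HS (%y. cf (h y))" by (rule comp[OF scf])
    show "Ck_on k HS (%y. ?F (h y) b)" for b
     by (rule comp[of "%x. ?F x b", OF smooth_on_frechet[OF hyp_isomD(2)[OF f]]])
   qed (use cfpos fh(2) in "simp add: less_imp_neq[symmetric]")
  qed
 qed
 then have "smooth_on HS h" by (simp add: smooth_on_def)
 then have "smooth_on HS (\<lambda>x\<in>HS. h x)"
  by (rule smooth_on_cong[OF open_ball]) simp
 moreover have "preserves_metric HS hm (\<lambda>x\<in>HS. h x)"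
 proof (rule preserves_metric_cong[OF open_ball _ der])
  fix y :: "real^'n" and u v assume y: "y : HS"
  show "hm (h y) (A y u) (A y v) = hm y u v"
   using hyp_isomD(6)[OF f fh(2)[OF y], of "A y u" "A y v"] fh(1)[OF y] FA[OF y] by simp
 qed auto
 moreover have "(\<lambda>x\<in>HS. h x) : Bij HS"
  unfolding h_def by (rule restrict_inv_into_Bij[OF hyp_isomD(1)[OF f]])
 ultimately show ?thesis by (simp add: hyp_isom_iff h_def)
qed

lemma hyp_isom_subgroup: "subgroup hyp_isom (BijGroup (HS :: (real^'n::finite) set))"
proof (rule group.subgroupI[OF group_BijGroup])
 show "hyp_isom \<subseteq> carrier (BijGroup (HS :: (real^'n) set))"
  by (auto simp: hyp_isom_iff BijGroup_def)
 show "hyp_isom ~= ({} :: ((real^'n) => _) set)" using hyp_isom_id by blast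
 show "inv\<^bsub>BijGroup HS\<^esub> f : hyp_isom" if "f : (hyp_isom :: ((real^'n) => _) set)" for f
  using hyp_isom_inv[OF that] inv_BijGroup[OF hyp_isomD(1)[OF that]] by simp
 show "f \<otimes>\<^bsub>BijGroup HS\<^esub> h : hyp_isom" if "f : (hyp_isom :: ((real^'n) => _) set)" "h : hyp_isom" for f h
  using hyp_isom_compose[OF that] hyp_isomD(1)[OF that(1)] hyp_isomD(1)[OF that(2)] by (simp add: BijGroup_def)
qed

lemma isom_group_eq:
 "isom_group HS hm = (BijGroup HS)\<lparr>carrier := (hyp_isom :: ((real^'n::finite) => _) set)\<rparr>"
 by (simp add: isom_group_def)

lemma group_isom: "group (isom_group HS (hm :: (real^'n::finite) tensor2))"
 using group.subgroup_imp_group[OF group_BijGroup hyp_isom_subgroup] isom_group_eq by metis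

lemma isom_group_inv:
 assumes "f : (hyp_isom :: ((real^'n::finite) => _) set)"
 shows "inv\<^bsub>isom_group HS hm\<^esub> f = (\<lambda>x\<in>HS. inv_into HS f x)"
 using group.m_inv_consistent[OF group_BijGroup hyp_isom_subgroup assms] inv_BijGroup[OF hyp_isomD(1)[OF assms]]
  isom_group_eq by metis

lemma isom_group_mult:
 assumes "f : hyp_isom" "h : hyp_isom" "x : HS"
 shows "(f \<otimes>\<^bsub>isom_group HS hm\<^esub> h) x = f (h x)"
 using hyp_isomD(1)[OF assms(1)] hyp_isomD(1)[OF assms(2)] assms(3)
 by (simp add: isom_group_def BijGroup_def compose_def)

lemma isom_group_one: "\<one>\<^bsub>isom_group HS hm\<^esub> = (\<lambda>x\<in>HS. x)"
 by (simp add: isom_group_def BijGroup_def)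

lemma isom_group_inv_apply:
 assumes "f : hyp_isom" "x : HS"
 shows "(inv\<^bsub>isom_group HS hm\<^esub> f) (f x) = x" "f ((inv\<^bsub>isom_group HS hm\<^esub> f) x) = x"
  "(inv\<^bsub>isom_group HS hm\<^esub> f) x : HS"
 using assms hyp_isomD(3,4)[OF assms(1)] f_inv_into_f[of x f HS] inv_into_into[of x f HS]
 by (auto simp: isom_group_inv bij_betw_def)

lemma hyp_isom_dist:
 assumes f: "f : hyp_isom" and pq: "p : HS" "q : HS"
 shows "hdist (f p) (f q) = hdist p q"
proof -
 let ?h = "inv\<^bsub>isom_group HS hm\<^esub> f"
 have h: "?h : hyp_isom" using f group.inv_closed[OF group_isom] by blast
 show ?thesis
  by (rule rdist_isometry[OF semi_hyp smooth_on_C1_map[OF hyp_isomD(2)[OF f]] _ smooth_on_C1_map[OF hyp_isomD(2)[OF h]]])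
   (use hyp_isomD(4,6)[OF f] hyp_isomD(4,6)[OF h] isom_group_inv_apply(1)[OF f] pq in auto)
qed

lemma hyp_isom_ext:
 assumes "f : hyp_isom" "h : hyp_isom" "!!x. x : HS ==> f x = h x"
 shows "f = h"
 using assms hyp_isomD(1)[OF assms(1)] hyp_isomD(1)[OF assms(2)]
 by (auto simp: Bij_def intro: extensionalityI)

lemma inversion_isom:
 assumes "norm a < 1"
 shows "(\<lambda>x\<in>HS. inversion a x) : hyp_isom"
proof -
 have "bij_betw (inversion a) HS HS"
  by (rule bij_betwI[where g="inversion a"]) (use inversion_in_ball[OF assms] inversion_inversion[OF assms] in auto)
 then have "(\<lambda>x\<in>HS. inversion a x) : Bij HS"
  using bij_betw_cong[of HS "\<lambda>x\<in>HS. inversion a x" "inversion a" HS] by (simp add: Bij_def)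
 moreover have "smooth_on HS (\<lambda>x\<in>HS. inversion a x)"
  by (rule smooth_on_cong[OF open_ball smooth_on_inversion[OF assms]]) simp
 moreover have "preserves_metric HS hm (\<lambda>x\<in>HS. inversion a x)"
  by (rule preserves_metric_cong[OF open_ball, where f="inversion a" and f'="inversion_deriv a"])
   (use inversion_has_derivative[OF assms] inversion_metric[OF assms] in auto)
 ultimately show ?thesis by (simp add: hyp_isom_iff)
qed

subsection \<open>Cocompact lattices\<close>

text \<open>Passes from the subbasic sets of the compact-open topology to a base of neighbourhoods
  of one isometry.\<close>

lemma generate_topology_on_finite_inter:
 assumes "generate_topology_on S U" "f : U"
 shows "EX F. finite F & F \<subseteq> S & f : \<Inter>F & \<Inter>F \<subseteq> U"
 using assms
proof (induction arbitrary: f rule: generate_topology_on.induct)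
 case (Int a b)
 then obtain F G where "finite F" "F \<subseteq> S" "f : \<Inter>F" "\<Inter>F \<subseteq> a" "finite G" "G \<subseteq> S" "f : \<Inter>G" "\<Inter>G \<subseteq> b"
  by (meson IntD1 IntD2)
 then show ?case by (intro exI[of _ "F \<union> G"]) auto
next
 case (UN K)
 then obtain k where "k : K" "f : k" by auto
 then show ?case using UN.IH[of k f] by (meson Sup_upper subset_trans)
next
 case (Basis s)
 then show ?case by (intro exI[of _ "{s}"]) auto
qed auto

locale lattice =
 fixes Gm :: "((real^'n::finite) => real^'n) set"
 assumes cocompact: "cocompact_lattice HS hm Gm"
  and torsion: "torsion_free (isom_group HS hm) Gm"
begin

abbreviation (input) G where "G == isom_group HS (hm :: (real^'n) tensor2)"

lemma sub: "subgroup Gm G" using cocompact by (simp add: cocompact_lattice_def)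

lemma isom: "ga : Gm ==> ga : hyp_isom" using subgroup.subset[OF sub] by blast

lemmas in_ball = hyp_isomD(4)[OF isom]

text \<open>The unit of \<open>BijGroup\<close> is the identity restricted to the ball and undefined
  outside, whence the side condition of \<open>e_apply\<close>.\<close>

definition e where "e = (\<lambda>x\<in>HS. x :: real^'n)"

lemma e_in: "e : Gm" using subgroup.one_closed[OF sub] by (simp add: isom_group_one e_def)

lemma e_apply: "x : HS ==> e x = x" by (simp add: e_def)

definition gmul where "gmul ga dl = ga \<otimes>\<^bsub>G\<^esub> dl"

definition ginv where "ginv ga = inv\<^bsub>G\<^esub> ga"

lemma gmul: "ga : Gm ==> dl : Gm ==> gmul ga dl : Gm"
 "ga : Gm ==> dl : Gm ==> x : HS ==> gmul ga dl x = ga (dl x)"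
 unfolding gmul_def using subgroup.m_closed[OF sub] isom_group_mult[OF isom isom] by auto

lemma ginv: "ga : Gm ==> ginv ga : Gm" "ga : Gm ==> x : HS ==> ginv ga (ga x) = x"
 "ga : Gm ==> x : HS ==> ga (ginv ga x) = x"
 unfolding ginv_def using subgroup.m_inv_closed[OF sub] isom_group_inv_apply[OF isom] by auto

lemma ext: "ga : Gm ==> dl : Gm ==> (!!x. x : HS ==> ga x = dl x) ==> ga = dl"
 by (rule hyp_isom_ext[OF isom isom])

lemmas dist_inv = hyp_isom_dist[OF isom]

text \<open>A compact-open neighbourhood of the identity contains every isometry that is uniformly
  close to the identity on a suitable compact set.\<close>

lemma discrete:
 "EX K ep. compact K & K \<subseteq> HS & ep > 0 & (ALL ga:Gm. (ALL x:K. norm (ga x - x) < ep) --> ga = e)"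
proof -
 let ?S = "{{f : hyp_isom. f ` K \<subseteq> U} | K U. compact K & K \<subseteq> HS & open U} :: ((real^'n) => real^'n) set set"
 have "openin (subtopology (isom_topology HS hm) Gm) {e}"
  using cocompact e_in by (simp add: cocompact_lattice_def)
 then obtain U where U: "openin (isom_topology HS hm) U" "{e} = U \<inter> Gm"
  unfolding openin_subtopology by blast
 have gen: "generate_topology_on ?S U"
  using U(1) unfolding isom_topology_def openin_topology_generated_by_iff by simp
 have eU: "e : U" using U(2) by auto
 obtain F where F: "finite F" "F \<subseteq> ?S" "e : \<Inter>F" "\<Inter>F \<subseteq> U"
  using generate_topology_on_finite_inter[OF gen eU] by (elim exE conjE) (rule that)
 have "EX K ep. compact K & K \<subseteq> HS & ep > 0 & (ALL ga:Gm. (ALL x:K. norm (ga x - x) < ep) --> ga : A)" if AF: "A : F" for A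
 proof -
  obtain K V where KV: "A = {f : hyp_isom. f ` K \<subseteq> V}" "compact K" "K \<subseteq> HS" "open V"
   using subsetD[OF F(2) AF] by (elim CollectE exE conjE) (rule that)
  have "e ` K \<subseteq> V" using F(3) AF KV(1) by blast
  then have "K \<subseteq> V" using KV(3) e_apply by force
  then obtain ep where ep: "ep > 0" "(\<Union>x\<in>K. ball x ep) \<subseteq> V"
   using compact_subset_open_imp_ball_epsilon_subset[OF KV(2,4)] by blast
  have "ga : A" if "ga : Gm" "ALL x:K. norm (ga x - x) < ep" for ga
  proof -
   have "ga x : V" if "x : K" for x
   proof -
    have "ga x : ball x ep" using \<open>ALL x:K. norm (ga x - x) < ep\<close> that by (simp add: dist_norm norm_minus_commute)
    then show ?thesis using ep(2) that by blast
   qed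
   then show ?thesis using isom[OF that(1)] KV(1) by blast
  qed
  then show ?thesis using KV ep by blast
 qed
 then obtain K ep where K: "!!A. A : F ==> compact (K A) & K A \<subseteq> HS & ep A > (0::real) &
   (ALL ga:Gm. (ALL x:K A. norm (ga x - x) < ep A) --> ga : A)" by metis
 show ?thesis
 proof (intro exI conjI ballI impI)
  show "compact (\<Union>A\<in>F. K A)" using F(1) K by (intro compact_UN) auto
  show "(\<Union>A\<in>F. K A) \<subseteq> HS" using K by blast
  show "Min (insert 1 (ep ` F)) > 0" using F(1) K by simp
  fix ga assume ga: "ga : Gm" "ALL x:\<Union>A\<in>F. K A. norm (ga x - x) < Min (insert 1 (ep ` F))"
  have "ga : A" if "A : F" for A
  proof -
   have "Min (insert 1 (ep ` F)) <= ep A" using F(1) that by simp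
   then show ?thesis using K[OF that] ga that by (metis UN_I order_less_le_trans)
  qed
  then show "ga = e" using F(4) U(2) ga(1) by blast
 qed
qed

text \<open>Proper discontinuity by the pigeonhole principle. Elements moving \<open>0\<close> by at
  most \<open>C\<close> are uniformly Lipschitz on \<open>K\<close> and map it into one compact
  ball. Recording the images of a finite net up to \<open>et\<close> leaves finitely many codes, and
  two elements with the same code differ by one that is close to the identity on
  \<open>K\<close>.\<close>

lemma finite_bounded: "finite {ga : Gm. hdist (ga 0) 0 <= C}"
proof (rule ccontr)
 let ?S = "{ga : Gm. hdist (ga 0) 0 <= C}"
 assume inf: "infinite ?S"
 obtain K ep where K: "compact K" "K \<subseteq> HS" "ep > 0" and dis: "!!ga. ga : Gm ==> (!!x. x : K ==> norm (ga x - x) < ep) ==> ga = e"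
  using discrete by metis
 obtain r where r: "0 <= r" "r < 1" "K \<subseteq> cball 0 r"
 proof (cases "K = {}")
  case False
  have "continuous_on K norm" by (intro continuous_intros)
  then obtain x where "x : K" "ALL y:K. norm y <= norm x"
   using continuous_attains_sup[OF K(1) False] by blast
  then show ?thesis using that[of "norm x"] K(2) by force
 qed (use that[of 0] in auto)
 \<comment> \<open>\<open>L\<close> turns Euclidean into hyperbolic distances on \<open>K\<close>,
   and \<open>L'\<close> does so on a ball that contains all images of \<open>K\<close>.\<close>
 define L where "L = 2 / (1 - r^2)"
 define r' where "r' = sqrt (1 - exp (- (L * r + C)))"
 have "r' < 1"
  unfolding r'_def using real_sqrt_less_iff[of "1 - exp (- (L * r + C))" 1] by simp
 define L' where "L' = 2 / (1 - (max 0 r')^2)"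
 have Lpos: "L > 0" "L' > 0"
  using r \<open>r' < 1\<close> by (auto simp: L_def L'_def power_less_one_iff abs_square_less_1 max_def)
 have bd: "norm (ga x) <= r'" if "ga : ?S" "x : K" for ga x
  unfolding r'_def
 proof (rule hdist_bound_norm)
  have x: "x : HS" "norm x <= r" using that K(2) r by auto
  have g: "ga : Gm" using that by simp
  show "ga x : HS" by (rule in_ball[OF g x(1)])
  have "hdist (ga x) 0 <= hdist (ga x) (ga 0) + hdist (ga 0) 0"
   using in_ball[OF g x(1)] in_ball[OF g, of 0] by (intro hdist_triangle) auto
  also have "hdist (ga x) (ga 0) = hdist x 0" by (rule dist_inv[OF g x(1)]) simp
  also have "hdist x 0 <= L * r"
  proof -
   have "hdist x 0 <= L * norm (0 - x)" unfolding L_def by (rule hdist_le_cball) (use x r in auto)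
   also have "... <= L * r" using x Lpos by (intro mult_left_mono) auto
   finally show ?thesis .
  qed
  finally show "hdist (ga x) 0 <= L * r + C" using that by simp
 qed
 \<comment> \<open>Chosen so that the final estimate \<open>L' * ((2 + L) * et)\<close> equals
   \<open>ep / 2\<close>.\<close>
 define et where "et = ep / (2 * L' * (2 + L))"
 have et: "et > 0" using Lpos K by (simp add: et_def)
 have "K \<subseteq> (\<Union>x\<in>K. ball x et)" using et by auto
 from compactE_image[OF K(1) open_ball this]
 obtain N where N: "finite N" "N \<subseteq> K" "K \<subseteq> (\<Union>x\<in>N. ball x et)" by metis
 obtain Q where Q: "finite Q" "cball (0::real^'n) 1 \<subseteq> (\<Union>q\<in>Q. ball q et)"
 proof -
  have "cball (0::real^'n) 1 \<subseteq> (\<Union>q\<in>cball 0 1. ball q et)" using et by auto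
  then show ?thesis using compactE_image[OF compact_cball, of "cball 0 1" "%x. ball x et" "0::real^'n" 1] that
   by (metis open_ball)
 qed
 define cell where "cell p = (SOME q. q : Q & p : ball q et)" for p
 have cell: "cell p : Q" "dist (cell p) p < et" if "norm p < 1" for p
 proof -
  have "EX q. q : Q & p : ball q et" using Q(2) that by force
  then have "cell p : Q & p : ball (cell p) et" unfolding cell_def by (rule someI_ex)
  then show "cell p : Q" "dist (cell p) p < et" by auto
 qed
 define code where "code ga = restrict (%x. cell (ga x)) N" for ga :: "real^'n => real^'n"
 have "code ` ?S \<subseteq> (N \<rightarrow>\<^sub>E Q)"
 proof
  fix c assume "c : code ` ?S"
  then obtain ga where g: "ga : Gm" "c = code ga" by blast
  have "cell (ga x) : Q" if "x : N" for x
   using cell(1)[of "ga x"] in_ball[OF g(1), of x] N(2) K(2) that by auto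
  then show "c : N \<rightarrow>\<^sub>E Q" using g(2) by (auto simp: code_def)
 qed
 then have "finite (code ` ?S)" using finite_PiE[OF N(1), of "%_. Q"] Q(1) by (meson finite_subset)
 then have "~ inj_on code ?S" using inf finite_imageD by blast
 then obtain ga dl where gd: "ga : ?S" "dl : ?S" "ga ~= dl" "code ga = code dl" unfolding inj_on_def by blast
 have "gmul (ginv dl) ga = e"
 proof (rule dis)
  show "gmul (ginv dl) ga : Gm" using gd gmul ginv by auto
  fix x assume x: "x : K"
  then have xb: "x : HS" "norm x <= r" using K(2) r by auto
  obtain y where y: "y : N" "dist y x < et" using N(3) x by auto
  then have yb: "y : HS" "norm y <= r" using N(2) K(2) r by auto
  have gd': "ga : Gm" "dl : Gm" "ginv dl : Gm" using gd ginv(1) by auto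
  have in': "ga x : HS" "dl x : HS" "ga y : HS" "dl y : HS" "ginv dl (ga x) : HS"
   using in_ball[OF gd'(1) xb(1)] in_ball[OF gd'(2) xb(1)] in_ball[OF gd'(1) yb(1)] in_ball[OF gd'(2) yb(1)]
    in_ball[OF gd'(3) in_ball[OF gd'(1) xb(1)]] by auto
  have "cell (ga y) = cell (dl y)" using gd(4) y(1) by (simp add: code_def fun_eq_iff) metis
  then have "dist (ga y) (dl y) < 2 * et"
   using cell(2)[of "ga y"] cell(2)[of "dl y"] in' dist_triangle3[of "ga y" "dl y" "cell (ga y)"] by simp
  moreover have lip: "dist (f x) (f y) <= L / 2 * et" if "f : Gm" for f
  proof -
   have "2 * norm (f x - f y) <= hdist (f y) (f x)" by (rule hdist_ge_norm[OF in_ball[OF that yb(1)] in_ball[OF that xb(1)]])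
   also have "... = hdist y x" by (rule dist_inv[OF that yb(1) xb(1)])
   also have "... <= L * norm (x - y)" unfolding L_def by (rule hdist_le_cball) (use xb yb r in auto)
   also have "... <= L * et" using y Lpos by (intro mult_left_mono) (auto simp: dist_norm norm_minus_commute)
   finally show ?thesis by (simp add: dist_norm)
  qed
  ultimately have "dist (ga x) (dl x) < 2 * et + L * et"
   using lip[OF gd'(1)] lip[OF gd'(2)] dist_triangle[of "ga x" "dl x" "ga y"] dist_triangle[of "ga y" "dl x" "dl y"]
   by (simp add: dist_commute)
  then have *: "norm (ga x - dl x) < (2 + L) * et" by (simp add: dist_norm algebra_simps)
  have "2 * norm (ginv dl (ga x) - x) <= hdist x (ginv dl (ga x))"
   by (rule hdist_ge_norm[OF xb(1) in'(5)])
  also have "... = hdist (dl x) (dl (ginv dl (ga x)))"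
   by (rule dist_inv[symmetric, OF gd'(2) xb(1) in'(5)])
  also have "... = hdist (dl x) (ga x)" using ginv(3)[OF gd'(2) in'(1)] by simp
  also have "... <= L' * norm (ga x - dl x)" unfolding L'_def
   by (rule hdist_le_cball) (use bd[OF _ x] gd \<open>r' < 1\<close> in "auto simp: le_max_iff_disj")
  also have "... < L' * ((2 + L) * et)" using * Lpos by (intro mult_strict_left_mono) auto
  also have "... = ep / 2"
  proof -
   have "L' * (2 + L) * 2 ~= 0" using Lpos by simp
   then show ?thesis by (simp add: et_def field_simps)
  qed
  finally show "norm (gmul (ginv dl) ga x - x) < ep"
   using gmul(2)[of "ginv dl" ga x] gd ginv(1) xb K(3) by simp
 qed
 then have "ga x = dl x" if "x : HS" for x
  using gmul(2)[of "ginv dl" ga x] gd ginv(1)[of dl] that e_apply[OF that] ginv(3)[of dl "ga x"] in_ball[of ga x] by simp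
 then show False using ext[of ga dl] gd by auto
qed

text \<open>Compactness is given for the coset space of the isometry group. The sets of cosets
  having a member that moves \<open>0\<close> into a ball of radius below 1 cover it and increase
  with \<open>k\<close>, so one \<open>k\<close> suffices. The coset of the inversion exchanging
  \<open>y\<close> and \<open>0\<close> then supplies the lattice element.\<close>

lemma cocompact_bound: "EX C>=0. ALL y:HS. EX ga:Gm. hdist (ga y) 0 <= C"
proof -
 let ?T = "isom_topology HS (hm :: (real^'n) tensor2)"
 let ?q = "%f. f <#\<^bsub>G\<^esub> Gm"
 have top: "topspace ?T = hyp_isom"
 proof
  show "topspace ?T \<subseteq> hyp_isom" by (auto simp: isom_topology_def)
  have "openin ?T {f : hyp_isom. f ` {} \<subseteq> ball 0 1}"
   unfolding isom_topology_def
   by (intro topology_generated_by_Basis CollectI exI[of _ "{}"] exI[of _ "ball 0 1"]) auto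
  then show "hyp_isom \<subseteq> topspace ?T" using openin_subset by fastforce
 qed
 define U where "U k = {c : ?q ` hyp_isom. EX u:c. u 0 : ball 0 (1 - 1 / (real k + 1))}" for k :: nat
 have coset: "?q f = {f \<otimes>\<^bsub>G\<^esub> h | h. h : Gm}" for f by (auto simp: l_coset_def)
 have open_U: "openin (quotient_topology ?T ?q) (U k)" for k
  unfolding openin_quotient_topology
 proof
  show "U k \<subseteq> ?q ` topspace ?T" unfolding top by (auto simp: U_def)
  \<comment> \<open>The preimage of \<open>U k\<close> is a union over \<open>h : Gm\<close> of
    subbasic sets belonging to the one-point compact sets \<open>{h 0}\<close>.\<close>
  have "{x : topspace ?T. ?q x : U k} = (\<Union>h\<in>Gm. {f : hyp_isom. f ` {h 0} \<subseteq> ball 0 (1 - 1 / (real k + 1))})"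
   unfolding top U_def coset using isom_group_mult[OF _ isom, of _ _ 0] by fastforce
  moreover have "openin ?T {f : hyp_isom. f ` {h 0} \<subseteq> ball 0 (1 - 1 / (real k + 1))}" if "h : Gm" for h
   unfolding isom_topology_def using in_ball[OF that, of 0]
   by (intro topology_generated_by_Basis CollectI exI[of _ "{h 0}"] exI[of _ "ball 0 (1 - 1 / (real k + 1))"]) auto
  ultimately show "openin ?T {x : topspace ?T. ?q x : U k}" by auto
 qed
 have topQ: "topspace (quotient_topology ?T ?q) = ?q ` hyp_isom"
 proof
  show "topspace (quotient_topology ?T ?q) \<subseteq> ?q ` hyp_isom"
   using openin_topspace[of "quotient_topology ?T ?q"] unfolding openin_quotient_topology top by blast
  have "{x : topspace ?T. ?q x : ?q ` hyp_isom} = topspace ?T" using top by auto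
  then have "openin (quotient_topology ?T ?q) (?q ` hyp_isom)"
   unfolding openin_quotient_topology using openin_topspace[of ?T] by (simp add: top)
  then show "?q ` hyp_isom \<subseteq> topspace (quotient_topology ?T ?q)" by (rule openin_subset)
 qed
 have mono: "U j \<subseteq> U k" if "j <= k" for j k
 proof -
  have "1 / (real k + 1) <= 1 / (real j + 1)" using that by (intro divide_left_mono) auto
  then have "ball (0::real^'n) (1 - 1 / (real j + 1)) \<subseteq> ball 0 (1 - 1 / (real k + 1))" by (intro subset_ball) simp
  then show ?thesis unfolding U_def by blast
 qed
 have "?q ` hyp_isom \<subseteq> \<Union>(range U)"
 proof
  fix c assume c: "c : ?q ` hyp_isom"
  then obtain f where f: "f : hyp_isom" "c = ?q f" by blast
  have "f \<otimes>\<^bsub>G\<^esub> e : c" using f e_in coset by auto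
  moreover have "(f \<otimes>\<^bsub>G\<^esub> e) 0 = f 0" using isom_group_mult[OF f(1) isom[OF e_in], of 0] e_apply[of 0] by simp
  moreover have "norm (f 0) < 1" using hyp_isomD(4)[OF f(1), of 0] by simp
  then obtain k :: nat where "1 / (real k + 1) < 1 - norm (f 0)"
   using reals_Archimedean[of "1 - norm (f 0)"] by (auto simp: inverse_eq_divide add.commute)
  ultimately have "f \<otimes>\<^bsub>G\<^esub> e : c" "(f \<otimes>\<^bsub>G\<^esub> e) 0 : ball 0 (1 - 1 / (real k + 1))" by simp_all
  then have "c : U k" using c unfolding U_def by blast
  then show "c : \<Union>(range U)" by blast
 qed
 moreover have "compactin (quotient_topology ?T ?q) (?q ` hyp_isom)"
  using cocompact topQ by (simp add: cocompact_lattice_def compact_space_def)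
 ultimately obtain F where F: "finite F" "F \<subseteq> range U" "?q ` hyp_isom \<subseteq> \<Union>F"
  using open_U unfolding compactin_def by (metis (no_types, lifting) rangeE)
 then obtain I where I: "finite I" "F = U ` I" by (meson finite_subset_image)
 define k where "k = Max (insert 0 I)"
 have Uk: "?q ` hyp_isom \<subseteq> U k"
 proof -
  have "U j \<subseteq> U k" if "j : I" for j using mono I(1) that by (simp add: k_def)
  then show ?thesis using F(3) I(2) by blast
 qed
 define rh where "rh = 1 - 1 / (real k + 1)"
 have rh: "0 <= rh" "rh < 1" by (auto simp: rh_def)
 define C where "C = 2 / (1 - rh^2)"
 have C: "C >= 0" using rh by (simp add: C_def power_le_one)
 have "EX ga:Gm. hdist (ga y) 0 <= C" if y: "y : HS" for y
 proof -
  define f where "f = (\<lambda>x\<in>HS. inversion y x)"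
  have f: "f : hyp_isom" unfolding f_def by (rule inversion_isom) (use y in simp)
  have fy: "f y = 0" using y by (simp add: f_def inversion_a)
  have "?q f : U k" using Uk f by blast
  then obtain h where h: "h : Gm" "norm (f (h 0)) < rh"
   unfolding U_def coset rh_def using isom_group_mult[OF f isom, of _ 0] by fastforce
  have h0: "h 0 : HS" using in_ball[OF h(1), of 0] by simp
  have "hdist (ginv h y) 0 = hdist (h (ginv h y)) (h 0)"
   by (rule dist_inv[symmetric, OF h(1) in_ball[OF ginv(1)[OF h(1)] y]]) simp
  also have "... = hdist y (h 0)" using ginv(3)[OF h(1) y] by simp
  also have "... = hdist (f y) (f (h 0))" by (rule hyp_isom_dist[symmetric, OF f y h0])
  also have "... <= 2 / (1 - rh^2) * norm (f (h 0) - f y)"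
   by (rule hdist_le_cball) (use fy h rh in auto)
  also have "... <= C * 1"
   unfolding C_def[symmetric] using fy h rh C by (intro mult_left_mono) auto
  finally show ?thesis using ginv(1) h by auto
 qed
 then show ?thesis using C by blast
qed

lemma npow:
 assumes "ga : Gm" shows "ga [^]\<^bsub>G\<^esub> (k::nat) : Gm"
 by (induction k) (use subgroup.m_closed[OF sub _ assms] subgroup.one_closed[OF sub] in auto)

lemma npow_fix:
 assumes "ga : Gm" "z : HS" "ga z = z" shows "(ga [^]\<^bsub>G\<^esub> (k::nat)) z = z"
proof (induction k)
 case 0
 then show ?case using assms by (simp add: isom_group_one)
next
 case (Suc k)
 then show ?case using isom_group_mult[OF isom[OF npow[OF assms(1)]] isom[OF assms(1)] assms(2)] assms by simp
qed

text \<open>All powers of an element with a fixed point move \<open>0\<close> by a bounded amount,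
  so two of them coincide by \<open>finite_bounded\<close>, and torsion-freeness applies.\<close>

lemma free:
 assumes g: "ga : Gm" and z: "z : HS" "ga z = z"
 shows "ga = e"
proof -
 interpret gr: group G by (rule group_isom)
 have "range (%k::nat. ga [^]\<^bsub>G\<^esub> k) \<subseteq> {ga : Gm. hdist (ga 0) 0 <= 2 * hdist z 0}"
 proof safe
  fix k :: nat
  let ?p = "ga [^]\<^bsub>G\<^esub> k"
  show p: "?p : Gm" by (rule npow[OF g])
  have "hdist (?p 0) 0 <= hdist (?p 0) z + hdist z 0"
   using in_ball[OF p, of 0] z by (intro hdist_triangle) auto
  also have "hdist (?p 0) z = hdist (?p 0) (?p z)" using npow_fix[OF g z] by simp
  also have "... = hdist 0 z" by (rule dist_inv[OF p]) (use z in auto)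
  finally show "hdist (?p 0) 0 <= 2 * hdist z 0" by (simp add: hdist_sym[of 0 z])
 qed
 then have "finite (range (%k::nat. ga [^]\<^bsub>G\<^esub> k))" using finite_bounded finite_subset by blast
 then have "~ inj (%k::nat. ga [^]\<^bsub>G\<^esub> k)" using finite_imageD by blast
 then obtain k l :: nat where kl: "k < l" "ga [^]\<^bsub>G\<^esub> k = ga [^]\<^bsub>G\<^esub> l"
  unfolding inj_on_def by (metis linorder_neqE_nat)
 have gc: "ga : carrier G" using isom[OF g] by simp
 have "ga [^]\<^bsub>G\<^esub> k \<otimes>\<^bsub>G\<^esub> ga [^]\<^bsub>G\<^esub> (l - k) = ga [^]\<^bsub>G\<^esub> k \<otimes>\<^bsub>G\<^esub> \<one>\<^bsub>G\<^esub>"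
  using gr.nat_pow_mult[OF gc, of k "l - k"] kl gc by simp
 then have "ga [^]\<^bsub>G\<^esub> (l - k) = \<one>\<^bsub>G\<^esub>"
  using gr.Units_l_cancel[of "ga [^]\<^bsub>G\<^esub> k" "ga [^]\<^bsub>G\<^esub> (l - k)" "\<one>\<^bsub>G\<^esub>"] gc by (simp add: gr.Units_eq)
 then have "ga = \<one>\<^bsub>G\<^esub>" using torsion g kl(1) unfolding torsion_free_def by (metis zero_less_diff)
 then show ?thesis by (simp add: isom_group_one e_def)
qed

text \<open>Conjugation carries a short displacement into the compact ball of
  \<open>cocompact_bound\<close>. There only finitely many elements compete by
  \<open>finite_bounded\<close>, and by \<open>free\<close> each has a positive minimal
  displacement.\<close>

lemma injectivity_radius: "EX c>0. ALL ga:Gm. ga ~= e --> (ALL z:HS. c <= hdist z (ga z))"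
proof -
 obtain C where C: "0 <= C" "!!y. y : HS ==> EX ga:Gm. hdist (ga y) 0 <= C"
  using cocompact_bound by blast
 \<comment> \<open>\<open>2 * C + 1\<close> bounds the displacement of \<open>0\<close> under an
   element that moves a point at distance at most \<open>C\<close> by less than 1; the cap 1 in the
   choice of \<open>c\<close> ensures the latter.\<close>
 define F where "F = {ga : Gm. hdist (ga 0) 0 <= 2 * C + 1} - {e}"
 have F: "finite F" "F \<subseteq> Gm" unfolding F_def using finite_bounded[of "2 * C + 1"] by auto
 define r where "r = sqrt (1 - exp (- C))"
 have r: "0 <= r" "r < 1" using C real_sqrt_less_iff[of "1 - exp (- C)" 1] by (auto simp: r_def)
 have sub_r: "cball 0 r \<subseteq> (HS :: (real^'n) set)" using r by auto
 have "EX m>0. ALL w:cball 0 r. m <= norm (ga w - w)" if "ga : F" for ga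
 proof -
  have g: "ga : Gm" "ga ~= e" using that by (auto simp: F_def)
  have "continuous_on (cball 0 r) (%w. norm (ga w - w))"
   using continuous_on_subset[OF smooth_on_continuous[OF hyp_isomD(2)[OF isom[OF g(1)]]] sub_r]
   by (intro continuous_intros)
  then obtain w where w: "w : cball 0 r" "!!v. v : cball 0 r ==> norm (ga w - w) <= norm (ga v - v)"
   using continuous_attains_inf[of "cball (0::real^'n) r" "%w. norm (ga w - w)"] r by auto
  have "ga w ~= w" using free[OF g(1)] g(2) w(1) sub_r by blast
  then show ?thesis using w by (intro exI[of _ "norm (ga w - w)"]) auto
 qed
 then obtain m where m: "!!ga. ga : F ==> m ga > 0 & (ALL w:cball 0 r. m ga <= norm (ga w - w))" by metis
 define c where "c = Min (insert 1 (m ` F))"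
 have c: "c > 0" "c <= 1" using F(1) m by (auto simp: c_def)
 have "c <= hdist z (ga z)" if g: "ga : Gm" "ga ~= e" and z: "z : HS" for ga z
 proof (rule ccontr)
  assume "~ c <= hdist z (ga z)"
  then have lt: "hdist z (ga z) < c" by simp
  obtain h where h: "h : Gm" "hdist (h z) 0 <= C" using C(2)[OF z] by blast
  define w where "w = h z"
  have w: "w : HS" "norm w <= r"
   unfolding w_def r_def using in_ball[OF h(1) z] hdist_bound_norm[OF in_ball[OF h(1) z] h(2)] by auto
  define dl where "dl = gmul (gmul h ga) (ginv h)"
  have hg: "gmul h ga : Gm" "ginv h : Gm" using gmul(1)[OF h(1) g(1)] ginv(1)[OF h(1)] by auto
  have d: "dl : Gm" unfolding dl_def by (rule gmul(1)[OF hg])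
  have gz: "ga z : HS" by (rule in_ball[OF g(1) z])
  have dw: "dl w = h (ga z)"
   unfolding dl_def using gmul(2)[OF hg w(1)] gmul(2)[OF h(1) g(1) z] ginv(2)[OF h(1) z] by (simp add: w_def)
  have dd: "hdist w (dl w) = hdist z (ga z)" using dist_inv[OF h(1) z gz] dw by (simp add: w_def)
  have "hdist (dl 0) 0 <= hdist (dl 0) (dl w) + (hdist (dl w) w + hdist w 0)"
   using hdist_triangle[of "dl 0" "dl w" 0] hdist_triangle[of "dl w" w 0] in_ball[OF d, of 0] in_ball[OF d w(1)] w by auto
  also have "hdist (dl 0) (dl w) = hdist 0 w" by (rule dist_inv[OF d _ w(1)]) simp
  finally have "hdist (dl 0) 0 <= 2 * C + 1"
   using h(2) lt c(2) dd by (simp add: hdist_sym[of 0 w] hdist_sym[of "dl w" w] w_def[symmetric])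
  moreover have "dl ~= e"
  proof
   assume "dl = e"
   then have "h (ga z) = h z" using dw e_apply[OF w(1)] by (simp add: w_def)
   then have "ga z = z" using ginv(2)[OF h(1) z] ginv(2)[OF h(1) gz] by simp
   then show False using free[OF g(1) z] g(2) by simp
  qed
  ultimately have dF: "dl : F" using d by (simp add: F_def)
  have "c <= m dl" using F(1) dF by (simp add: c_def)
  also have "m dl <= norm (dl w - w)" using m[OF dF] w by simp
  also have "... <= hdist w (dl w)" using hdist_ge_norm[OF w(1) in_ball[OF d w(1)]] norm_ge_zero[of "dl w - w"] by linarith
  finally show False using dd lt by simp
 qed
 then show ?thesis using c(1) by blast
qed

end

subsection \<open>The Gram determinant of a rank-one perturbation\<close>

text \<open>An orthogonal change of coordinates turns \<open>v\<close> into a multiple of a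
  coordinate vector, and then the matrix is diagonal.\<close>

lemma det_rank_one:
 fixes v :: "real^'m::finite"
 shows "det (mat 1 - k *\<^sub>R (\<chi> i j. v $ i * v $ j)) = 1 - k * (v \<bullet> v)"
proof -
 define i0 :: 'm where "i0 = undefined"
 define a where "a = norm v *\<^sub>R axis i0 (1::real)"
 have "norm a = norm v" by (simp add: a_def)
 then obtain f where f: "orthogonal_transformation f" "f a = v"
  by (rule orthogonal_transformation_exists)
 define Q where "Q = matrix f"
 have Q: "orthogonal_matrix Q" "det Q * det Q = 1" "transpose Q ** Q = mat 1"
  using f(1) orthogonal_transformation_matrix[of f] det_orthogonal_matrix[of Q]
  by (auto simp: Q_def orthogonal_matrix_def)
 have "Q *v a = v" using matrix_vector_mul(2)[OF orthogonal_transformation_linear[OF f(1)]] f(2) unfolding Q_def by metis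
 then have QT: "transpose Q *v v = a" using Q(3) by (metis matrix_vector_mul_assoc matrix_vector_mul_lid)
 have outer: "transpose Q ** (\<chi> i j. v $ i * v $ j) ** Q = (\<chi> i j. a $ i * a $ j)"
  unfolding QT[symmetric]
 proof (unfold vec_eq_iff, intro allI)
  fix i l
  have "(transpose Q ** (\<chi> i j. v $ i * v $ j) ** Q) $ i $ l = (\<Sum>m\<in>UNIV. (\<Sum>p\<in>UNIV. Q $ p $ i * (v $ p * v $ m)) * Q $ m $ l)"
   by (simp add: matrix_matrix_mult_def transpose_def)
  also have "... = (\<Sum>m\<in>UNIV. (\<Sum>p\<in>UNIV. Q $ p $ i * v $ p) * (Q $ m $ l * v $ m))"
   by (intro sum.cong refl) (simp add: sum_distrib_right sum_distrib_left mult_ac)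
  also have "... = (\<Sum>p\<in>UNIV. Q $ p $ i * v $ p) * (\<Sum>m\<in>UNIV. Q $ m $ l * v $ m)"
   by (simp add: sum_distrib_left)
  finally show "(transpose Q ** (\<chi> i j. v $ i * v $ j) ** Q) $ i $ l =
   (\<chi> i j. (transpose Q *v v) $ i * (transpose Q *v v) $ j) $ i $ l"
   by (simp add: matrix_vector_mult_def transpose_def)
 qed
 have "transpose Q ** (mat 1 - k *\<^sub>R (\<chi> i j. v $ i * v $ j)) ** Q
   = transpose Q ** mat 1 ** Q - k *\<^sub>R (transpose Q ** (\<chi> i j. v $ i * v $ j) ** Q)"
  by (simp add: vec_eq_iff matrix_matrix_mult_def sum_subtractf right_diff_distrib left_diff_distrib sum_distrib_left
    sum_distrib_right mult.assoc mult.left_commute)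
 also have "... = mat 1 - k *\<^sub>R (\<chi> i j. a $ i * a $ j)" using outer Q(3) by simp
 finally have "det (transpose Q ** (mat 1 - k *\<^sub>R (\<chi> i j. v $ i * v $ j)) ** Q) = det (mat 1 - k *\<^sub>R (\<chi> i j. a $ i * a $ j))"
  by simp
 moreover have "det (transpose Q ** A ** Q) = det A" for A
  using Q(2) by (simp add: det_mul det_transpose mult.commute mult.left_commute)
 moreover have "det (mat 1 - k *\<^sub>R (\<chi> i j. a $ i * a $ j)) = (\<Prod>i\<in>UNIV. if i = i0 then 1 - k * (v \<bullet> v) else 1)"
 proof -
  have "(mat 1 - k *\<^sub>R (\<chi> i j. a $ i * a $ j)) $ i $ i = (if i = i0 then 1 - k * (v \<bullet> v) else 1)" for i
   by (simp add: mat_def a_def axis_def power2_norm_eq_inner[symmetric] power2_eq_square)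
  then show ?thesis by (subst det_diagonal) (auto simp: mat_def a_def axis_def)
 qed
 ultimately show ?thesis by simp
qed

text \<open>Indexes \<open>Basis\<close> by a finite type, so that the Leibniz sum in
  \<open>gram_det\<close> becomes the determinant of a matrix.\<close>

definition bas :: "'n::finite + 'n => 'n pt" where
 "bas k = (case k of Inl i => (axis i 1, 0) | Inr i => (0, axis i 1))"

lemma bij_bas: "bij_betw bas UNIV (Basis :: 'n::finite pt set)"
proof -
 have "inj (bas :: 'n + 'n => _)"
  by (auto simp: inj_def bas_def axis_eq_axis split: sum.splits)
 moreover have "range (bas :: 'n + 'n => _) = Basis"
  by (simp add: UNIV_sum image_Un image_image bas_def Basis_prod_def Basis_vec_def) auto
 ultimately show ?thesis by (simp add: bij_betw_def)
qed

lemma gram_det_eq_det: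
 fixes g :: "'n::finite pt tensor2"
 shows "gram_det g z = det (\<chi> i j. g z (bas i) (bas j))"
proof -
 let ?m = "map_permutation UNIV (bas :: 'n + 'n => _)"
 have inj: "inj (bas :: 'n + 'n => _)" and img: "range (bas :: 'n + 'n => _) = Basis"
  using bij_bas by (auto simp: bij_betw_def)
 have bij: "bij_betw ?m {p. p permutes UNIV} {p. p permutes Basis}"
 proof -
  have "?m = (%\<pi> x. if x : Basis then bas (\<pi> (inv_into UNIV bas x)) else x)"
   by (intro ext) (simp add: map_permutation_def restrict_id_def img)
  then show ?thesis using bij_betw_permutations[OF bij_bas[where 'n='n]] by simp
 qed
 have "gram_det g z = (\<Sum>p | p permutes UNIV. of_int (sign (?m p)) * (\<Prod>b\<in>Basis. g z b (?m p b)))"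
  unfolding gram_det_def by (rule sum.reindex_bij_betw[OF bij, symmetric])
 also have "... = (\<Sum>p | p permutes UNIV. of_int (sign p) * (\<Prod>i\<in>UNIV. g z (bas i) (bas (p i))))"
 proof (rule sum.cong[OF refl])
  fix p :: "'n + 'n => 'n + 'n" assume "p : {p. p permutes UNIV}"
  then have "sign (?m p) = sign p" by (intro sign_map_permutation inj) auto
  moreover have "(\<Prod>b\<in>Basis. g z b (?m p b)) = (\<Prod>i\<in>UNIV. g z (bas i) (?m p (bas i)))"
   by (rule prod.reindex_bij_betw[OF bij_bas, symmetric])
  ultimately show "of_int (sign (?m p)) * (\<Prod>b\<in>Basis. g z b (?m p b)) = of_int (sign p) * (\<Prod>i\<in>UNIV. g z (bas i) (bas (p i)))"
   by (simp add: map_permutation_apply[OF inj])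
 qed
 finally show ?thesis by (simp add: det_def)
qed

text \<open>The matrix is a diagonal one times a rank-one perturbation of the identity, so
  \<open>det_rank_one\<close> applies.\<close>

lemma gram_det_block:
 fixes g :: "'n::finite pt tensor2"
 assumes g: "!!u v. g z u v = c1 * (fst u \<bullet> fst v) + c2 * (snd u \<bullet> snd v) - k * (w \<bullet> snd u) * (w \<bullet> snd v)"
  and c2: "c2 ~= 0"
 shows "gram_det g z = c1 ^ CARD('n) * c2 ^ CARD('n) * (1 - k * (w \<bullet> w) / c2)"
proof -
 define d :: "'n + 'n => real" where "d i = (case i of Inl _ => c1 | Inr _ => c2)" for i
 define v :: "real^('n + 'n)" where "v = (\<chi> i. case i of Inl _ => 0 | Inr i => w $ i)"
 define D :: "real^('n + 'n)^('n + 'n)" where "D = (\<chi> i j. if i = j then d i else 0)"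
 have sum_plus: "sum f UNIV = (\<Sum>i\<in>UNIV. f (Inl i)) + (\<Sum>i\<in>UNIV. f (Inr i))" for f :: "'n + 'n => real"
  by (simp add: UNIV_Plus_UNIV[symmetric] sum.Plus del: UNIV_Plus_UNIV)
 have prod_plus: "prod f UNIV = (\<Prod>i\<in>UNIV. f (Inl i)) * (\<Prod>i\<in>UNIV. f (Inr i))" for f :: "'n + 'n => real"
  by (simp add: UNIV_Plus_UNIV[symmetric] prod.Plus del: UNIV_Plus_UNIV)
 have "v \<bullet> v = w \<bullet> w" unfolding inner_vec_def by (simp add: sum_plus v_def)
 have "(\<chi> i j. g z (bas i) (bas j)) = D ** (mat 1 - (k / c2) *\<^sub>R (\<chi> i j. v $ i * v $ j))"
 proof -
  have "g z (bas i) (bas j) = d i * ((if i = j then 1 else 0) - (k / c2) * (v $ i * v $ j))" for i j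
   using c2 by (cases i; cases j)
    (auto simp: g bas_def d_def v_def inner_axis_axis inner_axis algebra_simps, auto simp: axis_def)
  moreover have "(D ** A) $ i $ j = d i * A $ i $ j" for A :: "real^('n + 'n)^('n + 'n)" and i j
   by (simp add: matrix_matrix_mult_def D_def if_distrib[of "%x. x * _"] cong: if_cong)
  ultimately show ?thesis by (simp add: vec_eq_iff mat_def)
 qed
 then have "gram_det g z = det D * (1 - k / c2 * (v \<bullet> v))"
  by (simp only: gram_det_eq_det det_mul det_rank_one)
 also have "det D = c1 ^ CARD('n) * c2 ^ CARD('n)"
  by (subst det_diagonal) (auto simp: D_def prod_plus d_def)
 finally show ?thesis using \<open>v \<bullet> v = w \<bullet> w\<close> by simp
qed

subsection \<open>Distance to the orbit of the origin\<close>

definition conf :: "real^'n::finite => real" where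
 "conf x = 4 / (1 - (norm x)^2)^2"

lemma hyp_metric_conf: "hm x u v = conf x * (u \<bullet> v)"
 by (simp add: hyp_metric_def conf_def)

lemma conf_pos: "norm x < 1 ==> conf x > 0"
 using norm_sq_less_1[of x] by (simp add: conf_def)

text \<open>The translates under \<open>Gm\<close> of the Euclidean ball of radius \<open>R\<close>
  about \<open>0\<close> are disjoint.\<close>

locale tube = lattice Gm for Gm :: "((real^'n::finite) => real^'n) set" +
 fixes R :: real
 assumes R: "0 < R" "R <= 1 / 4"
  and sep: "!!ga y. ga : Gm ==> norm y < R ==> norm (ga y) < R ==> ga = e"
begin

definition near :: "real^'n => bool" where "near y \<longleftrightarrow> (EX ga:Gm. norm (ga y) < R)"

text \<open>The Euclidean norm after the translation that brings \<open>y\<close> close to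
  \<open>0\<close>, cut off at \<open>R\<close>. The description is justified by
  \<open>near_unique\<close>; taking the value \<open>R\<close> elsewhere makes the function
  Lipschitz.\<close>

definition wd :: "real^'n => real" where
 "wd y = (if near y then norm ((THE ga. ga : Gm & norm (ga y) < R) y) else R)"

lemma near_unique:
 assumes y: "y : HS" and g: "ga : Gm" "norm (ga y) < R" and d: "dl : Gm" "norm (dl y) < R"
 shows "ga = dl"
proof -
 let ?h = "gmul dl (ginv ga)"
 have h: "?h : Gm" by (rule gmul(1)[OF d(1) ginv(1)[OF g(1)]])
 have hx: "?h x = dl (ginv ga x)" if "x : HS" for x by (rule gmul(2)[OF d(1) ginv(1)[OF g(1)] that])
 have "?h (ga y) = dl y" using hx[OF in_ball[OF g(1) y]] ginv(2)[OF g(1) y] by simp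
 then have "?h = e" using sep[OF h g(2)] d(2) by simp
 then have "dl x = ga x" if "x : HS" for x
  using hx[OF in_ball[OF g(1) that]] ginv(2)[OF g(1) that] e_apply[OF in_ball[OF g(1) that]] by simp
 then show ?thesis using ext[OF g(1) d(1)] by simp
qed

lemma wd_near:
 assumes "y : HS" "ga : Gm" "norm (ga y) < R" shows "near y" "wd y = norm (ga y)"
proof -
 show n: "near y" using assms by (auto simp: near_def)
 have "(THE ga. ga : Gm & norm (ga y) < R) = ga"
  by (rule the_equality) (use assms near_unique in auto)
 then show "wd y = norm (ga y)" using n by (simp add: wd_def)
qed

lemma wd_le:
 assumes "y : HS" "ga : Gm" shows "wd y <= norm (ga y)"
proof (cases "norm (ga y) < R")
 case False
 have "wd y <= R"
 proof (cases "near y")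
  case True
  then obtain dl where "dl : Gm" "norm (dl y) < R" by (auto simp: near_def)
  then show ?thesis using wd_near(2)[OF assms(1)] by force
 qed (simp add: wd_def)
 then show ?thesis using False by simp
qed (use wd_near[OF assms] in simp)

lemma near_wd_less: "y : HS ==> near y ==> wd y < R"
 using wd_near(2)[of y] by (metis near_def)

lemma wd_far: "~ near y ==> wd y = R"
 by (simp add: wd_def)

lemma wd_le_R: "y : HS ==> wd y <= R"
 using near_wd_less wd_far by force

lemma near_iff: "y : HS ==> near y \<longleftrightarrow> wd y < R"
 using near_wd_less wd_far by force

lemma wd_nonneg: "0 <= wd y"
 using R by (simp add: wd_def)

lemma wd_invariant:
 assumes y: "y : HS" and g: "ga : Gm" shows "wd (ga y) = wd y"
proof -
 have le: "wd (ga y) <= wd y" if y: "y : HS" and g: "ga : Gm" for y ga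
 proof (cases "near y")
  case True
  then obtain dl where d: "dl : Gm" "norm (dl y) < R" by (auto simp: near_def)
  have "gmul dl (ginv ga) (ga y) = dl y"
   using gmul(2)[OF d(1) ginv(1)[OF g] in_ball[OF g y]] ginv(2)[OF g y] by simp
  then show ?thesis
   using wd_le[OF in_ball[OF g y] gmul(1)[OF d(1) ginv(1)[OF g]]] wd_near(2)[OF y d] by simp
 qed (simp add: wd_le_R[OF in_ball[OF g y]] wd_def[of y])
 show ?thesis
  using le[OF y g] le[OF in_ball[OF g y] ginv(1)[OF g]] ginv(2)[OF g y] by simp
qed

lemma wd_base: "norm y < R ==> wd y = norm y"
 using wd_near(2)[of y e] e_in e_apply[of y] R by simp

text \<open>The factor 1/2 is that of \<open>hdist_ge_norm\<close>: hyperbolic length is at least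
  twice the Euclidean one.\<close>

lemma wd_lipschitz:
 assumes "y : HS" "z : HS" shows "wd y <= wd z + hdist y z / 2"
proof (cases "near z")
 case True
 then obtain ga where g: "ga : Gm" "norm (ga z) < R" by (auto simp: near_def)
 have "wd y <= norm (ga y)" by (rule wd_le[OF assms(1) g(1)])
 also have "... <= norm (ga z) + norm (ga z - ga y)" by (metis norm_minus_commute norm_triangle_sub)
 finally have 1: "wd y <= norm (ga z) + norm (ga z - ga y)" .
 have "2 * norm (ga z - ga y) <= hdist (ga y) (ga z)"
  by (rule hdist_ge_norm[OF in_ball[OF g(1) assms(1)] in_ball[OF g(1) assms(2)]])
 also have "... = hdist y z" by (rule dist_inv[OF g(1) assms])
 finally show ?thesis using 1 wd_near(2)[OF assms(2) g] by simp
next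
 case False
 then show ?thesis
  using wd_far[OF False] wd_le_R[OF assms(1)] rdist_nonneg[of HS hm y z] by linarith
qed

lemma wd_continuous: "continuous_on HS wd"
proof (rule continuous_at_imp_continuous_on, rule ballI)
 fix y :: "real^'n" assume y: "y : HS"
 define r where "r = (1 + norm y) / 2"
 have r: "norm y < r" "r < 1" "0 < r" using y norm_ge_zero[of y] by (auto simp: r_def field_simps intro: add_pos_nonneg)
 define L where "L = 2 / (1 - r^2)"
 have bd: "\<bar>wd z - wd y\<bar> <= L * norm (z - y) / 2" if "z : ball 0 r" for z
 proof -
  have z: "norm z < r" using that by simp
  have "hdist y z <= L * norm (z - y)" "hdist z y <= L * norm (z - y)"
   unfolding L_def using hdist_le_cball[of y r z] hdist_le_cball[of z r y] r z by (auto simp: norm_minus_commute)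
  moreover have "z : HS" using z r by simp
  ultimately have "wd z - wd y <= L * norm (z - y) / 2" "wd y - wd z <= L * norm (z - y) / 2"
   using wd_lipschitz[of y z] wd_lipschitz[of z y] y by linarith+
  then show ?thesis by linarith
 qed
 have "((%z. wd z - wd y) \<longlongrightarrow> 0) (at y)"
 proof (rule Lim_null_comparison)
  show "((%z. L * norm (z - y) / 2) \<longlongrightarrow> 0) (at y)" by (auto intro!: tendsto_eq_intros)
  have "eventually (%z. z : ball 0 r) (at y)"
   using r by (intro eventually_at_in_open') auto
  then show "eventually (%z. norm (wd z - wd y) <= L * norm (z - y) / 2) (at y)"
   by eventually_elim (use bd in simp)
 qed
 then have "(wd \<longlongrightarrow> wd y) (at y)" by (rule LIM_zero_cancel)
 then show "isCont wd y" by (simp add: isCont_def)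
qed

end

lemma map_prod_derivative:
 fixes f ga :: "real^'n::finite => real^'n"
 assumes "f : hyp_isom" "ga : hyp_isom" "z : HP"
 shows "(map_prod f ga has_derivative map_prod (FD f (fst z)) (FD ga (snd z))) (at z)"
proof -
 have zz: "fst z : HS" "snd z : HS" using assms by (auto simp: hyp_prod_def)
 have "((%z. f (fst z)) has_derivative (%v. FD f (fst z) (fst v))) (at z)"
  "((%z. ga (snd z)) has_derivative (%v. FD ga (snd z) (snd v))) (at z)"
  using has_derivative_compose[OF has_derivative_fst[OF has_derivative_ident] hyp_isomD(5)[OF assms(1) zz(1)]]
   has_derivative_compose[OF has_derivative_snd[OF has_derivative_ident] hyp_isomD(5)[OF assms(2) zz(2)]] by auto
 from has_derivative_Pair[OF this] show ?thesis
  by (simp add: map_prod_def case_prod_beta')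
qed

section \<open>The metric with shells\<close>

locale shell = tube Gm R for Gm :: "((real^'n::finite) => real^'n) set" and R :: real +
 fixes rh :: real
 assumes rh: "0 < rh" "2 * rh <= R" and dim: "3 <= CARD('n)"
begin

text \<open>Squared because close to the orbit it is then \<open>ga z \<bullet> ga z\<close>, smooth
  with a simple differential.\<close>

definition W :: "real^'n => real" where "W y = (wd y)^2"

definition dW :: "real^'n => real^'n => real" where "dW y = FD W y"

definition sg :: "real => real^'n => real" where
 "sg dl y = bump dl (W y - rh^2) / real CARD('n)"

text \<open>\<open>dl\<close> is the width of the shell and \<open>sg\<close> the strength of the modification. \<open>kap\<close> solves
 \<open>(1 - kap si) / ((1 + si)\<^sup>n (1 - si)\<^sup>n) = 1\<close>, which keeps the Gram determinant.\<close>

definition kap :: "real => real" where "kap si = 1 - (1 - si^2) ^ CARD('n)"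

text \<open>The square of the hyperbolic component normal to the spheres: by
  \<open>gradient_W\<close> the squared hyperbolic length of the covector \<open>dW y\<close> is
  \<open>W y * (1 - W y)^2\<close>.\<close>

definition nrm :: "(real^'n) tensor2" where
 "nrm y b b' = dW y b * dW y b' / (W y * (1 - W y)^2)"

definition fib :: "real => (real^'n) tensor2" where
 "fib dl y b b' = (hm y b b' - kap (sg dl y) * nrm y b b') / (1 - sg dl y)"

definition gd :: "real => 'n pt tensor2" where
 "gd dl z u v = hm (fst z) (fst u) (fst v) / (1 + sg dl (snd z)) + fib dl (snd z) (snd u) (snd v)"

text \<open>Keeps the support of the bump away from the centre, where the denominator of
  \<open>nrm\<close> vanishes, and from the rim \<open>W = R^2\<close>, where \<open>W\<close> has a
  kink.\<close>

definition ok :: "real => bool" where "ok dl \<longleftrightarrow> 0 < dl & 4 * dl <= rh^2"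

lemma kap_0 [simp]: "kap 0 = 0" by (simp add: kap_def)

lemma W_nonneg: "0 <= W y" by (simp add: W_def)

lemma W_le: "y : HS ==> W y <= R^2"
 unfolding W_def using wd_le_R wd_nonneg by (simp add: power_mono)

lemma R2: "R^2 <= 1 / 16" "R^2 > 0" "4 * rh^2 <= R^2"
proof -
 have "R^2 <= (1 / 4)^2" using R by (intro power_mono) auto
 then show "R^2 <= 1 / 16" by (simp add: power2_eq_square)
 show "R^2 > 0" using R by simp
 have "(2 * rh)^2 <= R^2" using rh by (intro power_mono) auto
 then show "4 * rh^2 <= R^2" by (simp add: power_mult_distrib)
qed

lemma W_less_1: "y : HS ==> W y < 1"
 using W_le[of y] R2(1) by linarith

lemma W_near: "y : HS ==> near y \<longleftrightarrow> W y < R^2"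
 using near_iff[of y] power_strict_mono[of "wd y" R 2] power2_less_imp_less[of "wd y" R] wd_nonneg[of y] R
 unfolding W_def by auto

lemma W_invariant: "y : HS ==> ga : Gm ==> W (ga y) = W y"
 by (simp add: W_def wd_invariant)

lemma W_continuous: "continuous_on HS W"
 unfolding W_def by (intro continuous_intros wd_continuous)

lemma W_base: "norm y < R ==> W y = (norm y)^2"
 by (simp add: W_def wd_base)

context
 fixes dl :: real
 assumes ok: "ok dl"
begin

lemma sg_bounds: "0 <= sg dl y" "sg dl y <= 1 / real CARD('n)" "sg dl y <= 1 / 3"
proof -
 have d: "0 < dl" using ok by (simp add: ok_def)
 show "0 <= sg dl y" "sg dl y <= 1 / real CARD('n)"
  unfolding sg_def using bump_facts(1,2)[OF d] by (auto intro: divide_right_mono)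
 moreover have "1 / real CARD('n) <= 1 / 3" using dim by (intro divide_left_mono) auto
 ultimately show "sg dl y <= 1 / 3" by linarith
qed

lemma sg_zero: "dl <= \<bar>W y - rh^2\<bar> ==> sg dl y = 0"
 using bump_facts(4)[of dl "W y - rh^2"] ok by (simp add: sg_def ok_def)

lemma sg_far: "~ near y ==> sg dl y = 0"
 using sg_zero[of y] wd_far[of y] R2 ok R by (auto simp: W_def ok_def)

lemma sg_top: "W y = rh^2 ==> sg dl y = 1 / real CARD('n)"
 using bump_facts(3)[of dl] ok by (simp add: sg_def ok_def)

text \<open>Bernoulli gives \<open>kap s <= n s^2\<close>, and this is at most \<open>s\<close>
  because \<open>s <= 1 / n\<close>. So normal vectors lose no more by the factor
  \<open>1 - kap\<close> than they gain from the division by \<open>1 - s\<close>.\<close>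

lemma kap_bounds: "0 <= kap (sg dl y)" "1 - sg dl y <= 1 - kap (sg dl y)" "kap (sg dl y) <= 1 / 3"
proof -
 let ?s = "sg dl y" and ?n = "CARD('n)"
 have s: "0 <= ?s" "?s <= 1 / real ?n" "?s <= 1 / 3" using sg_bounds by auto
 have s2: "?s^2 <= 1" using s by (simp add: power_le_one)
 show "0 <= kap ?s" using s2 by (simp add: kap_def power_le_one)
 have "1 + real ?n * (- (?s^2)) <= (1 + (- (?s^2))) ^ ?n"
  by (rule Bernoulli_inequality) (use s2 in simp)
 moreover have "real ?n * ?s^2 <= ?s"
 proof -
  have "real ?n * ?s <= 1" using s(2) dim by (simp add: field_simps)
  then have "real ?n * ?s * ?s <= 1 * ?s" using s by (intro mult_right_mono) auto
  then show ?thesis by (simp add: power2_eq_square mult.assoc)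
 qed
 ultimately show *: "1 - ?s <= 1 - kap ?s" by (simp add: kap_def)
 then show "kap ?s <= 1 / 3" using s by linarith
qed

end

lemma near_nbhd:
 assumes y: "y : HS" and g: "ga : Gm" "norm (ga y) < R"
 shows "open {z : HS. norm (ga z) < R}" "y : {z : HS. norm (ga z) < R}"
  "!!z. z : {z : HS. norm (ga z) < R} ==> W z = (ga z) \<bullet> (ga z)"
proof -
 have "continuous_on HS (%z. norm (ga z))"
  using smooth_on_continuous[OF hyp_isomD(2)[OF isom[OF g(1)]]] by (intro continuous_intros)
 then have "open (HS \<inter> (%z. norm (ga z)) -` {..<R})"
  by (rule continuous_open_preimage) auto
 moreover have "{z : HS. norm (ga z) < R} = HS \<inter> (%z. norm (ga z)) -` {..<R}" by auto
 ultimately show "open {z : HS. norm (ga z) < R}" by simp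
 show "y : {z : HS. norm (ga z) < R}" using y g by simp
 show "W z = (ga z) \<bullet> (ga z)" if "z : {z : HS. norm (ga z) < R}" for z
  using that wd_near(2)[of z ga] g by (simp add: W_def power2_norm_eq_inner)
qed

lemma W_has_derivative:
 assumes y: "y : HS" and g: "ga : Gm" "norm (ga y) < R"
 shows "(W has_derivative (%b. 2 * (ga y \<bullet> FD ga y b))) (at y)"
  and "dW y b = 2 * (ga y \<bullet> FD ga y b)"
proof -
 note d = hyp_isomD(5)[OF isom[OF g(1)] y]
 have "((%z. ga z \<bullet> ga z) has_derivative (%b. ga y \<bullet> FD ga y b + FD ga y b \<bullet> ga y)) (at y)"
  by (rule has_derivative_inner[OF d d])
 then have "(W has_derivative (%b. ga y \<bullet> FD ga y b + FD ga y b \<bullet> ga y)) (at y)"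
  by (rule has_derivative_transform_within_open[OF _ near_nbhd(1)[OF assms] near_nbhd(2)[OF assms]])
   (use near_nbhd(3)[OF assms] in simp)
 then show *: "(W has_derivative (%b. 2 * (ga y \<bullet> FD ga y b))) (at y)"
  by (simp add: inner_commute)
 show "dW y b = 2 * (ga y \<bullet> FD ga y b)"
  unfolding dW_def using frechet_derivative_at[OF *] by metis
qed

lemma dW_has_derivative:
 assumes y: "y : HS" "near y" shows "(W has_derivative dW y) (at y)"
proof -
 obtain ga where g: "ga : Gm" "norm (ga y) < R" using y by (auto simp: near_def)
 show ?thesis
  using W_has_derivative(1)[OF y(1) g] unfolding dW_def by (metis frechet_derivative_at)
qed

lemma dW_invariant:
 assumes y: "y : HS" "near y" and g: "ga : Gm"
 shows "dW (ga y) (FD ga y b) = dW y b"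
proof -
 have gy: "ga y : HS" by (rule in_ball[OF g y(1)])
 have "near (ga y)" using y near_iff[OF gy] near_iff[OF y(1)] wd_invariant[OF y(1) g] by simp
 then have "(W has_derivative dW (ga y)) (at (ga y))" using dW_has_derivative gy by blast
 then have "((%z. W (ga z)) has_derivative (%b. dW (ga y) (FD ga y b))) (at y)"
  by (rule has_derivative_compose[OF hyp_isomD(5)[OF isom[OF g] y(1)]])
 then have "(W has_derivative (%b. dW (ga y) (FD ga y b))) (at y)"
  by (rule has_derivative_transform_within_open[OF _ open_ball y(1)]) (rule W_invariant[OF _ g])
 then show ?thesis using has_derivative_unique[OF dW_has_derivative[OF y]] by metis
qed

text \<open>The isometry \<open>ga\<close> reduces the claim to the ball at the origin, where the
  gradient is radial; \<open>w\<close> is the pullback of the covector \<open>2 ga y\<close>, and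
  conformality of the differential gives its length.\<close>

lemma gradient_W:
 assumes y: "y : HS" "near y"
 shows "EX w. (ALL b. dW y b = w \<bullet> b) & w \<bullet> w = conf y * (W y * (1 - W y)^2)"
proof -
 obtain ga where g: "ga : Gm" "norm (ga y) < R" using y by (auto simp: near_def)
 let ?F = "FD ga y"
 have gy: "ga y : HS" by (rule in_ball[OF g(1) y(1)])
 have inner: "conf (ga y) * (?F u \<bullet> ?F v) = conf y * (u \<bullet> v)" for u v
  using hyp_isomD(6)[OF isom[OF g(1)] y(1)] by (simp add: hyp_metric_conf)
 have c: "conf (ga y) > 0" "conf y > 0" using conf_pos gy y by auto
 have lin: "linear ?F" using hyp_isomD(5)[OF isom[OF g(1)] y(1)] has_derivative_linear by blast
 have "inj ?F"
 proof (rule linear_injective_0[OF lin, THEN iffD2], intro allI impI)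
  fix v assume "?F v = 0"
  then show "v = 0" using inner[of v v] c by simp
 qed
 then have "surj ?F" using linear_injective_imp_surjective[OF lin] by blast
 then obtain b where b: "?F b = ga y" by (metis surjD)
 define k where "k = conf y / conf (ga y)"
 have Fk: "?F u \<bullet> ?F v = k * (u \<bullet> v)" for u v using inner[of u v] c by (simp add: k_def field_simps)
 define w where "w = (2 * k) *\<^sub>R b"
 have "dW y v = w \<bullet> v" for v
  using W_has_derivative(2)[OF y(1) g, of v] Fk[of b v] b by (simp add: w_def)
 moreover have Wy: "W y = ga y \<bullet> ga y" using near_nbhd(3)[OF y(1) g near_nbhd(2)[OF y(1) g]] .
 have "w \<bullet> w = 4 * k * W y" using Fk[of b b] b Wy by (simp add: w_def)
 moreover have "4 * k = conf y * (1 - W y)^2"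
 proof -
  have cg: "conf (ga y) = 4 / (1 - W y)^2" by (simp add: conf_def Wy power2_norm_eq_inner)
  have "(1 - W y)^2 ~= 0" using W_less_1[OF y(1)] by simp
  then show ?thesis unfolding k_def cg by (simp add: field_simps)
 qed
 ultimately show ?thesis by (intro exI[of _ w]) (simp add: mult_ac)
qed

text \<open>Cauchy-Schwarz for the gradient of \<open>W\<close>; at the centre the quotient is 0 by
  the convention on division.\<close>

lemma nrm_bounds:
 assumes y: "y : HS" "near y"
 shows "0 <= nrm y b b" "nrm y b b <= hm y b b"
proof -
 have W: "0 <= W y * (1 - W y)^2" using W_nonneg by simp
 show "0 <= nrm y b b" using W by (simp add: nrm_def)
 obtain w where w: "!!b. dW y b = w \<bullet> b" "w \<bullet> w = conf y * (W y * (1 - W y)^2)"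
  using gradient_W[OF y] by metis
 show "nrm y b b <= hm y b b"
 proof (cases "W y * (1 - W y)^2 = 0")
  case True
  then show ?thesis unfolding nrm_def using conf_pos[of y] y by (auto simp: hyp_metric_conf)
 next
  case False
  have "(w \<bullet> b)^2 <= (w \<bullet> w) * (b \<bullet> b)" by (rule Cauchy_Schwarz_ineq)
  then have "dW y b * dW y b <= hm y b b * (W y * (1 - W y)^2)"
   by (simp add: w hyp_metric_conf power2_eq_square mult_ac)
  moreover have "W y * (1 - W y)^2 > 0" using False W by linarith
  ultimately show ?thesis unfolding nrm_def using pos_divide_le_eq by blast
 qed
qed

context
 fixes dl :: real
 assumes ok: "ok dl"
begin

lemma fib_off: "sg dl y = 0 ==> fib dl y b b' = hm y b b'"
 by (simp add: fib_def)

lemma gd_off: "sg dl (snd z) = 0 ==> gd dl z u v = g0 z u v"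
 by (simp add: gd_def fib_off hyp_prod_metric_def)

lemma reduced_bounds:
 assumes y: "y : HS"
 shows "(1 - kap (sg dl y)) * hm y b b <= hm y b b - kap (sg dl y) * nrm y b b"
  "hm y b b - kap (sg dl y) * nrm y b b <= hm y b b"
proof -
 have "0 <= kap (sg dl y) * nrm y b b & kap (sg dl y) * nrm y b b <= kap (sg dl y) * hm y b b"
 proof (cases "near y")
  case True
  then show ?thesis using nrm_bounds[OF y True] kap_bounds[OF ok, of y]
   by (simp add: mult_left_mono)
 qed (simp add: sg_far[OF ok])
 then show "(1 - kap (sg dl y)) * hm y b b <= hm y b b - kap (sg dl y) * nrm y b b"
  "hm y b b - kap (sg dl y) * nrm y b b <= hm y b b"
  by (auto simp: algebra_simps)
qed

lemma hyp_nonneg: "0 <= hm y b b"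
 by (simp add: hyp_metric_def)

lemma fib_bounds:
 assumes y: "y : HS"
 shows "hm y b b <= fib dl y b b" "fib dl y b b <= 2 * hm y b b"
proof -
 have s: "1 - sg dl y >= 2 / 3" using sg_bounds(3)[OF ok, of y] by simp
 have "hm y b b * (1 - sg dl y) <= hm y b b * (1 - kap (sg dl y))"
  using kap_bounds(2)[OF ok] hyp_nonneg by (intro mult_left_mono) auto
 also have "... <= hm y b b - kap (sg dl y) * nrm y b b"
  using reduced_bounds(1)[OF y] by (simp add: mult.commute)
 finally show "hm y b b <= fib dl y b b" using s by (simp add: fib_def pos_le_divide_eq)
 have "fib dl y b b <= hm y b b / (1 - sg dl y)"
  unfolding fib_def using reduced_bounds(2)[OF y] s by (intro divide_right_mono) auto
 also have "... <= hm y b b / (1 / 2)"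
  using s hyp_nonneg by (intro divide_left_mono) auto
 finally show "fib dl y b b <= 2 * hm y b b" by simp
qed

lemma gd_bounds:
 assumes z: "z : HP"
 shows "g0 z u u <= 2 * gd dl z u u" "gd dl z u u <= 2 * g0 z u u"
  "hm (fst z) (fst u) (fst u) / (1 + 1 / real CARD('n)) <= gd dl z u u"
  "hm (snd z) (snd u) (snd u) <= gd dl z u u"
proof -
 have z2: "snd z : HS" using z by (auto simp: hyp_prod_def)
 let ?s = "sg dl (snd z)" and ?h = "hm (fst z) (fst u) (fst u)"
 have s: "0 <= ?s" "?s <= 1 / real CARD('n)" "?s <= 1 / 3" using sg_bounds[OF ok] by auto
 define A B where "A = ?h / (1 + ?s)" and "B = ?h / (1 + 1 / real CARD('n))"
 have h: "?h / 2 <= A" "A <= ?h / 1" "B <= A" "0 <= A"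
  unfolding A_def B_def
  using s hyp_nonneg[of "fst z" "fst u"]
  by (intro divide_left_mono add_pos_nonneg mult_pos_pos divide_nonneg_nonneg; simp)+
 note f = fib_bounds[OF z2, of "snd u"] hyp_nonneg[of "snd z" "snd u"] hyp_nonneg[of "fst z" "fst u"]
 define C where "C = fib dl (snd z) (snd u) (snd u)"
 define D where "D = hm (snd z) (snd u) (snd u)"
 define E where "E = ?h"
 have F: "D <= C" "C <= 2 * D" "0 <= D" "0 <= E" "E / 2 <= A" "A <= E"
  using f h(1,2) by (auto simp: C_def D_def E_def)
 have "E + D <= 2 * (A + C)" "A + C <= 2 * (E + D)" "B <= A + C" "D <= A + C"
  using F h(3,4) by auto
 then show "g0 z u u <= 2 * gd dl z u u" "gd dl z u u <= 2 * g0 z u u"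
  "?h / (1 + 1 / real CARD('n)) <= gd dl z u u"
  "hm (snd z) (snd u) (snd u) <= gd dl z u u"
  by (simp_all add: hyp_prod_metric_def gd_def A_def B_def C_def D_def E_def)
qed

lemma gram_det_gd:
 assumes z: "z : HP" shows "gram_det (gd dl) z = gram_det g0 z"
proof -
 let ?x = "fst z" and ?y = "snd z" and ?s = "sg dl (snd z)" and ?n = "CARD('n)"
 have xy: "?x : HS" "?y : HS" using z by (auto simp: hyp_prod_def)
 have g0: "gram_det g0 z = conf ?x ^ ?n * conf ?y ^ ?n * (1 - 0 * ((0::real^'n) \<bullet> 0) / conf ?y)"
  by (rule gram_det_block) (use conf_pos[of ?y] xy in "auto simp: hyp_prod_metric_def hyp_metric_conf")
 show ?thesis
 proof (cases "?s = 0")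
  case True
  then show ?thesis by (simp add: gram_det_def gd_off)
 next
  case False
  then have n: "near ?y" using sg_far[OF ok] by blast
  have s: "0 <= ?s" "?s <= 1 / 3" using sg_bounds[OF ok] by auto
  have "\<bar>W ?y - rh^2\<bar> < dl" using sg_zero[OF ok, of ?y] False by linarith
  then have "W ?y > 0" using ok zero_less_power[OF rh(1), of 2] unfolding ok_def by linarith
  then have V: "W ?y * (1 - W ?y)^2 > 0" using W_less_1[OF xy(2)] by simp
  obtain w where w: "!!b. dW ?y b = w \<bullet> b" "w \<bullet> w = conf ?y * (W ?y * (1 - W ?y)^2)"
   using gradient_W[OF xy(2) n] by metis
  let ?V = "W ?y * (1 - W ?y)^2"
  have c: "conf ?y > 0" using conf_pos[of ?y] xy by simp
  have "gram_det (gd dl) z = (conf ?x / (1 + ?s)) ^ ?n * (conf ?y / (1 - ?s)) ^ ?n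
    * (1 - kap ?s / (?V * (1 - ?s)) * (w \<bullet> w) / (conf ?y / (1 - ?s)))"
  proof (rule gram_det_block)
   show "gd dl z u v = conf ?x / (1 + ?s) * (fst u \<bullet> fst v) + conf ?y / (1 - ?s) * (snd u \<bullet> snd v)
     - kap ?s / (?V * (1 - ?s)) * (w \<bullet> snd u) * (w \<bullet> snd v)" for u v
    by (simp add: gd_def fib_def nrm_def w(1) hyp_metric_conf diff_divide_distrib mult.assoc)
   show "conf ?y / (1 - ?s) ~= 0" using c s by simp
  qed
  also have "kap ?s / (?V * (1 - ?s)) * (w \<bullet> w) / (conf ?y / (1 - ?s)) = kap ?s"
  proof -
   have "k / (v * t) * (c * v) / (c / t) = k" if "v > 0" "c > 0" "t > 0" for k v t c :: real
    using that by simp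
   from this[OF V c, of "1 - ?s" "kap ?s"] show ?thesis using s w(2) by simp
  qed
  also have "(conf ?x / (1 + ?s)) ^ ?n * (conf ?y / (1 - ?s)) ^ ?n * (1 - kap ?s) =
    conf ?x ^ ?n * conf ?y ^ ?n * ((1 - kap ?s) / ((1 + ?s) * (1 - ?s)) ^ ?n)"
   by (simp add: power_divide power_mult_distrib)
  also have "(1 + ?s) * (1 - ?s) = 1 - ?s^2" by (simp add: algebra_simps power2_eq_square)
  also have "(1 - kap ?s) / (1 - ?s^2) ^ ?n = 1"
  proof -
   have "?s^2 < 1" using s by (simp add: power_less_one_iff abs_square_less_1)
   then show ?thesis by (simp add: kap_def)
  qed
  finally show ?thesis using g0 by simp
 qed
qed

lemma riem_vol_gd: "riem_vol HP (gd dl) = riem_vol HP g0"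
proof -
 have X: "open (HP :: 'n pt set)"
  unfolding hyp_prod_def by (intro open_Times open_ball)
 have "density (restrict_space lborel HP) (%x. ennreal (sqrt (gram_det (gd dl) x)))
   = density (restrict_space lborel HP) (%x. ennreal (sqrt (gram_det g0 x)))"
  \<comment> \<open>The Gram determinants agree on the domain only, so the comparison is made on the
    restricted measure space.\<close>
  unfolding density_def
 proof (rule measure_of_eq)
  show "sets (restrict_space lborel HP) \<subseteq> Pow (space (restrict_space lborel (HP :: 'n pt set)))"
   by (rule sets.space_closed)
  fix A :: "'n pt set"
  show "(\<integral>\<^sup>+ x. ennreal (sqrt (gram_det (gd dl) x)) * indicator A x \<partial>restrict_space lborel HP) =
    (\<integral>\<^sup>+ x. ennreal (sqrt (gram_det g0 x)) * indicator A x \<partial>restrict_space lborel HP)"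
   by (intro nn_integral_cong) (use gram_det_gd in "auto simp: space_restrict_space")
 qed
 then show ?thesis by (simp add: riem_vol_def)
qed

lemma gd_form:
 assumes z: "z : HP"
 shows "EX c1 c2 k w. ALL u v. gd dl z u v = c1 * (fst u \<bullet> fst v) + c2 * (snd u \<bullet> snd v) - k * (w \<bullet> snd u) * (w \<bullet> snd v)"
proof (cases "near (snd z)")
 case True
 then obtain w where w: "!!b. dW (snd z) b = w \<bullet> b" using gradient_W[of "snd z"] z by (auto simp: hyp_prod_def)
 show ?thesis
  by (intro exI[of _ "conf (fst z) / (1 + sg dl (snd z))"] exI[of _ "conf (snd z) / (1 - sg dl (snd z))"]
    exI[of _ "kap (sg dl (snd z)) / (W (snd z) * (1 - W (snd z))^2 * (1 - sg dl (snd z)))"] exI[of _ w])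
   (simp add: gd_def fib_def nrm_def w hyp_metric_conf diff_divide_distrib mult.assoc)
next
 case False
 then show ?thesis
  by (intro exI[of _ "conf (fst z)"] exI[of _ "conf (snd z)"] exI[of _ 0])
   (simp add: gd_def fib_def sg_far[OF ok] hyp_metric_conf)
qed

lemma open_W_pos: "open {y : HS. P (W y)}" if "open {t. P t}" for P :: "real => bool"
proof -
 have "open (HS \<inter> W -` {t. P t})" by (rule continuous_open_preimage[OF W_continuous open_ball that])
 moreover have "HS \<inter> W -` {t. P t} = {y : HS. P (W y)}" by auto
 ultimately show ?thesis by simp
qed

lemma W_smooth_near:
 assumes y: "y : HS" "\<bar>W y - rh^2\<bar> <= dl"
 shows "EX U. open U & y : U & U \<subseteq> HS & smooth_on U W & (ALL z:U. 0 < W z)"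
proof -
 have rh2: "rh^2 > 0" using rh by simp
 have d: "0 < dl" "4 * dl <= rh^2" using ok by (auto simp: ok_def)
 have "W y < R^2" using y R2 d rh2 by linarith
 then obtain ga where g: "ga : Gm" "norm (ga y) < R" using W_near[OF y(1)] by (auto simp: near_def)
 let ?U = "{z : HS. norm (ga z) < R} \<inter> {z : HS. 0 < W z}"
 have U: "open ?U"
  by (intro open_Int near_nbhd(1)[OF y(1) g] open_W_pos[of "%t. 0 < t"]) (simp add: open_Collect_less)
 have "smooth_on ?U ga" by (rule smooth_on_subset[OF hyp_isomD(2)[OF isom[OF g(1)]]]) auto
 then have "smooth_on ?U (%z. ga z \<bullet> ga z)" by (intro smooth_on_inner U)
 then have "smooth_on ?U W" by (rule smooth_on_cong[OF U]) (use near_nbhd(3)[OF y(1) g] in auto)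
 moreover have "y : ?U" using near_nbhd(2)[OF y(1) g] y d rh2 by auto
 ultimately show ?thesis using U by (intro exI[of _ ?U]) auto
qed

lemma smooth_sg_local:
 assumes "open U" "smooth_on U W" shows "smooth_on U (sg dl)"
proof -
 have "smooth_on U (%y. bump dl (W y - rh^2))"
  by (rule smooth_on_compose[OF assms(1) smooth_on_bump]) (use assms in "auto intro!: smooth_on_diff")
 then have "smooth_on U (%y. bump dl (W y - rh^2) / real CARD('n))"
  by (intro smooth_on_divide assms smooth_on_const) auto
 then show ?thesis unfolding sg_def by simp
qed

text \<open>Around each point of the closed slab \<open>|W - rh^2| <= dl\<close> the function
  \<open>W\<close> is smooth and positive; on the open complement the modification vanishes
  identically, which disposes of the centre and the rim.\<close>

lemma smooth_sg: "smooth_on HS (sg dl)"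
 and smooth_fib: "smooth_on HS (%y. fib dl y b b')"
proof -
 have hyp: "smooth_on HS (%y. hm y b b')"
  using riemannian_hyp unfolding riemannian_metric_def by blast
 have "EX U. open U & y : U & smooth_on U (sg dl) & smooth_on U (%y. fib dl y b b')" if y: "y : HS" for y
 proof (cases "\<bar>W y - rh^2\<bar> <= dl")
  case True
  then obtain U where U: "open U" "y : U" "U \<subseteq> HS" "smooth_on U W" "!!z. z : U ==> 0 < W z"
   using W_smooth_near[OF y] by blast
  have sgU: "smooth_on U (sg dl)" by (rule smooth_sg_local[OF U(1,4)])
  have dWU: "smooth_on U (%y. dW y v)" for v
   unfolding dW_def by (rule smooth_on_frechet[OF U(4)])
  have nz: "W z * (1 - W z)^2 ~= 0" "1 - sg dl z ~= 0" if "z : U" for z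
   using U(5)[OF that] W_less_1[OF subsetD[OF U(3) that]] sg_bounds(3)[OF ok, of z] by auto
  have "smooth_on U (%y. fib dl y b b')"
   unfolding fib_def nrm_def kap_def
   by (intro smooth_on_divide smooth_on_diff smooth_on_mult smooth_on_const smooth_on_power U(1,4) sgU dWU
     smooth_on_subset[OF hyp U(3)] nz)
  then show ?thesis using U sgU by blast
 next
  case False
  let ?U = "{y : HS. dl < \<bar>W y - rh^2\<bar>}"
  have U: "open ?U" by (rule open_W_pos[of "%t. dl < \<bar>t - rh^2\<bar>"]) (intro open_Collect_less continuous_intros)
  have z: "sg dl y = 0" if "y : ?U" for y using sg_zero[OF ok, of y] that by auto
  have "smooth_on ?U (sg dl)" by (rule smooth_on_cong[OF U smooth_on_const[of _ 0]]) (use z in auto)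
  moreover have "smooth_on ?U (%y. fib dl y b b')"
   by (rule smooth_on_cong[OF U smooth_on_subset[OF hyp]]) (use z fib_off in auto)
  ultimately show ?thesis using U y False by (intro exI[of _ ?U]) auto
 qed
 then show "smooth_on HS (sg dl)" "smooth_on HS (%y. fib dl y b b')"
  by (meson smooth_on_local)+
qed

lemma riemannian_gd: "riemannian_metric HP (gd dl)"
 unfolding riemannian_metric_def
proof (intro conjI ballI allI impI)
 fix z :: "'n pt" assume z: "z : HP"
 obtain c1 c2 k w where f: "!!u v. gd dl z u v = c1 * (fst u \<bullet> fst v) + c2 * (snd u \<bullet> snd v) - k * (w \<bullet> snd u) * (w \<bullet> snd v)"
  using gd_form[OF z] by blast
 show "bilinear (gd dl z)"
  unfolding bilinear_def f by (auto intro!: linearI simp: inner_add_left inner_add_right algebra_simps)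
 show "gd dl z u v = gd dl z v u" for u v by (simp add: f inner_commute)
 show "0 < gd dl z u u" if u: "u ~= 0" for u
 proof -
  have zz: "fst z : HS" "snd z : HS" using z by (auto simp: hyp_prod_def)
  have "4 * (norm u)^2 <= g0 z u u"
   using hyp_metric_ge[OF zz(1), of "fst u"] hyp_metric_ge[OF zz(2), of "snd u"]
   by (simp add: hyp_prod_metric_def norm_prod_def)
  moreover have "0 < (norm u)^2" using u by simp
  ultimately show ?thesis using gd_bounds(1)[OF z, of u] by linarith
 qed
next
 fix u v :: "'n pt"
 have X: "open (HP :: 'n pt set)"
  unfolding hyp_prod_def by (intro open_Times open_ball)
 have c: "smooth_on HP (%z. F (fst z))" "smooth_on HP (%z. F (snd z))" if "smooth_on HS F"
  for F :: "real^'n => real"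
  by (rule smooth_on_compose[OF X that smooth_on_bounded_linear[OF X bounded_linear_fst]], force simp: hyp_prod_def)
   (rule smooth_on_compose[OF X that smooth_on_bounded_linear[OF X bounded_linear_snd]], force simp: hyp_prod_def)
 have "smooth_on HS (%x. hm x (fst u) (fst v))"
  using riemannian_hyp unfolding riemannian_metric_def by blast
 note s = c(1)[OF this] c(2)[OF smooth_sg] c(2)[OF smooth_fib, of "snd u" "snd v"]
 show "smooth_on HP (%z. gd dl z u v)"
  unfolding gd_def
 proof (intro smooth_on_add smooth_on_divide smooth_on_const X s)
  show "1 + sg dl (snd z) ~= 0" for z using sg_bounds(1)[OF ok, of "snd z"] by linarith
 qed
qed

lemma gd_invariant:
 assumes f: "f : hyp_isom" and g: "ga : Gm" and z: "z : HP"
 shows "gd dl (map_prod f ga z) (map_prod (FD f (fst z)) (FD ga (snd z)) u)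
   (map_prod (FD f (fst z)) (FD ga (snd z)) v) = gd dl z u v"
proof -
 have zz: "fst z : HS" "snd z : HS" using z by (auto simp: hyp_prod_def)
 have W: "W (ga (snd z)) = W (snd z)" by (rule W_invariant[OF zz(2) g])
 then have s: "sg dl (ga (snd z)) = sg dl (snd z)" by (simp add: sg_def)
 have fb: "fib dl (ga (snd z)) (FD ga (snd z) b) (FD ga (snd z) b') = fib dl (snd z) b b'" for b b'
 proof (cases "near (snd z)")
  case True
  then show ?thesis
   by (simp add: fib_def s nrm_def W dW_invariant[OF zz(2) True g] hyp_isomD(6)[OF isom[OF g] zz(2)])
 next
  case False
  then show ?thesis using s sg_far[OF ok False] by (simp add: fib_off hyp_isomD(6)[OF isom[OF g] zz(2)])
 qed
 show ?thesis
  by (simp add: gd_def s fb hyp_isomD(6)[OF f zz(1)])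
qed

lemma preserves_gd:
 assumes f: "f : hyp_isom" and g: "ga : Gm"
 shows "preserves_metric HP (gd dl) (map_prod f ga)"
 unfolding preserves_metric_def
proof (intro ballI allI)
 fix z u v :: "'n pt" assume z: "z : HP"
 have "FD (map_prod f ga) z = map_prod (FD f (fst z)) (FD ga (snd z))"
  using frechet_derivative_at[OF map_prod_derivative[OF f isom[OF g] z]] by simp
 then show "gd dl (map_prod f ga z) (FD (map_prod f ga) z u) (FD (map_prod f ga) z v) = gd dl z u v"
  using gd_invariant[OF f g z] by simp
qed

text \<open>Cauchy--Schwarz with the weights \<open>1 + s\<close> and \<open>1 - s\<close>, whose sum is 2 for every \<open>s\<close>.\<close>

lemma gd_l1:
 assumes z: "z : HP"
 shows "(sqrt (hm (fst z) a a) + sqrt (hm (snd z) b b - kap (sg dl (snd z)) * nrm (snd z) b b))^2 <= 2 * gd dl z (a, b) (a, b)"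
proof -
 have zz: "snd z : HS" using z by (auto simp: hyp_prod_def)
 let ?s = "sg dl (snd z)"
 define p where "p = hm (fst z) a a"
 define q where "q = hm (snd z) b b - kap ?s * nrm (snd z) b b"
 have s: "0 <= ?s" "?s <= 1 / 3" using sg_bounds[OF ok] by auto
 have p: "0 <= p" by (simp add: p_def hyp_nonneg)
 have "0 <= (1 - kap ?s) * hm (snd z) b b" using kap_bounds(3)[OF ok, of "snd z"] hyp_nonneg by (intro mult_nonneg_nonneg) auto
 then have q: "0 <= q" using reduced_bounds(1)[OF zz, of b] unfolding q_def by linarith
 \<comment> \<open>Weighted Cauchy-Schwarz, cleared of denominators.\<close>
 have key: "(sqrt p + sqrt q)^2 * (al * be) <= 2 * (p * be + q * al)" if "al + be = 2" "0 < al" "0 < be" for al be :: real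
 proof -
  have "0 <= (be * sqrt p - al * sqrt q)^2" by simp
  also have "... = be^2 * p + al^2 * q - 2 * al * be * (sqrt p * sqrt q)"
   using p q by (simp add: power2_diff power_mult_distrib)
  finally have 1: "2 * al * be * (sqrt p * sqrt q) <= be^2 * p + al^2 * q" by simp
  have "(sqrt p + sqrt q)^2 * (al * be) = (p + q) * (al * be) + 2 * al * be * (sqrt p * sqrt q)"
   using p q by (simp add: power2_sum algebra_simps)
  also have "... <= (p + q) * (al * be) + (be^2 * p + al^2 * q)" using 1 by simp
  also have "... = (al + be) * (p * be + q * al)" by (simp add: algebra_simps power2_eq_square)
  finally show ?thesis using that by simp
 qed
 have pos: "0 < (1 + ?s) * (1 - ?s)" using s by (intro mult_pos_pos) auto
 have "(sqrt p + sqrt q)^2 <= 2 * (p * (1 - ?s) + q * (1 + ?s)) / ((1 + ?s) * (1 - ?s))"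
  using key[of "1 + ?s" "1 - ?s"] s pos by (simp add: pos_le_divide_eq)
 also have "... = 2 * (p / (1 + ?s) + q / (1 - ?s))"
  using s by (simp add: field_simps)
 finally show ?thesis by (simp add: gd_def fib_def p_def q_def)
qed

end

end

subsection \<open>Two distances on the product\<close>

text \<open>The sum of two speeds is bounded pointwise, which after integration controls an l1
  distance; separate bounds on the two lengths would lose a factor.\<close>

lemma path_length_add_le:
 assumes g: "semi_metric X g" and c: "valid_path c" "c ` {0..1} \<subseteq> X"
  and F: "C1_map U F F'" "c ` {0..1} \<subseteq> U" "semi_metric Y g'" "F ` (c ` {0..1}) \<subseteq> Y"
  and H: "C1_map U H H'" "semi_metric Z g''" "H ` (c ` {0..1}) \<subseteq> Z" and K: "0 <= K"
  and le: "!!t v. t : {0..1} ==> sqrt (g' (F (c t)) (F' (c t) v) (F' (c t) v)) + sqrt (g'' (H (c t)) (H' (c t) v) (H' (c t) v))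
   <= K * sqrt (g (c t) v v)"
 shows "path_length g' (F \<circ> c) + path_length g'' (H \<circ> c) <= ennreal K * path_length g c"
proof -
 have [measurable]: "(%t. indicator {0..1} t * speed g c t) : borel_measurable borel"
  by (rule speed_measurable[OF g c])
 have [measurable]: "(%t. indicator {0..1} t * speed g' (F \<circ> c) t) : borel_measurable borel"
  by (rule speed_measurable[OF F(3) C1_map_path(1)[OF F(1) c(1) F(2)]]) (use F(4) in auto)
 have [measurable]: "(%t. indicator {0..1} t * speed g'' (H \<circ> c) t) : borel_measurable borel"
  by (rule speed_measurable[OF H(2) C1_map_path(1)[OF H(1) c(1) F(2)]]) (use H(3) in auto)
 obtain S where S: "finite S" "!!t. t : {0..1} - S ==> vector_derivative (F \<circ> c) (at t) = F' (c t) (vector_derivative c (at t))"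
  using C1_map_path(2)[OF F(1) c(1) F(2)] by blast
 obtain T where T: "finite T" "!!t. t : {0..1} - T ==> vector_derivative (H \<circ> c) (at t) = H' (c t) (vector_derivative c (at t))"
  using C1_map_path(2)[OF H(1) c(1) F(2)] by blast
 have "path_length g' (F \<circ> c) + path_length g'' (H \<circ> c) =
   (\<integral>\<^sup>+t. ennreal (indicator {0..1} t * speed g' (F \<circ> c) t) + ennreal (indicator {0..1} t * speed g'' (H \<circ> c) t) \<partial>lborel)"
  unfolding path_length_plen plen_def nn_integral_mult_indicator_ennreal
  by (rule nn_integral_add[symmetric]) auto
 also have "... <= (\<integral>\<^sup>+t. ennreal K * ennreal (indicator {0..1} t * speed g c t) \<partial>lborel)"
 proof (rule nn_integral_cong_finite[of "S \<union> T"])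
  fix t assume t: "t ~: S \<union> T"
  show "ennreal (indicator {0..1} t * speed g' (F \<circ> c) t) + ennreal (indicator {0..1} t * speed g'' (H \<circ> c) t)
   <= ennreal K * ennreal (indicator {0..1} t * speed g c t)"
  proof (cases "t : {0..1}")
   case True
   have nn: "0 <= speed g' (F \<circ> c) t" "0 <= speed g'' (H \<circ> c) t"
    using F(3,4) H(2,3) True by (auto simp: speed_def semi_metric_def image_subset_iff)
   have "speed g' (F \<circ> c) t + speed g'' (H \<circ> c) t <= K * speed g c t"
    unfolding speed_def using S(2)[of t] T(2)[of t] t True le[OF True] by (simp add: o_def)
   then have "ennreal (speed g' (F \<circ> c) t + speed g'' (H \<circ> c) t) <= ennreal (K * speed g c t)"
    by (rule ennreal_leI)
   then show ?thesis using True nn K by (simp add: ennreal_mult')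
  qed auto
 qed (use S T in auto)
 also have "... = ennreal K * path_length g c"
  by (subst nn_integral_cmult) (auto simp: path_length_plen plen_def nn_integral_mult_indicator_ennreal)
 finally show ?thesis .
qed

lemma open_HP: "open (HP :: 'n::finite pt set)"
 unfolding hyp_prod_def by (intro open_Times open_ball)

lemma convex_HP: "convex (HP :: 'n::finite pt set)"
 unfolding hyp_prod_def by (intro convex_Times convex_ball)

lemma HP_D: "z : HP ==> fst z : HS" "z : HP ==> snd z : HS"
 by (auto simp: hyp_prod_def)

lemma riemannian_hyp_prod: "riemannian_metric HP (g0 :: 'n::finite pt tensor2)"
 unfolding riemannian_metric_def
proof (intro conjI ballI allI impI)
 fix z :: "'n pt" assume z: "z : HP"
 show "bilinear (g0 z)"
  unfolding bilinear_def hyp_prod_metric_def hyp_metric_conf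
  by (auto intro!: linearI simp: inner_add_left inner_add_right algebra_simps)
 show "g0 z u v = g0 z v u" for u v by (simp add: hyp_prod_metric_def hyp_metric_conf inner_commute)
 show "0 < g0 z u u" if u: "u ~= 0" for u
 proof -
  have "4 * (norm u)^2 <= g0 z u u"
   using hyp_metric_ge[OF HP_D(1)[OF z], of "fst u"] hyp_metric_ge[OF HP_D(2)[OF z], of "snd u"]
   by (simp add: hyp_prod_metric_def norm_prod_def)
  moreover have "0 < (norm u)^2" using u by simp
  ultimately show ?thesis by linarith
 qed
next
 fix u v :: "'n pt"
 have h: "smooth_on HS (%x::real^'n. hm x a b)" for a b
  using riemannian_hyp unfolding riemannian_metric_def by blast
 show "smooth_on HP (%z. g0 z u v)"
  unfolding hyp_prod_metric_def
  by (intro smooth_on_add open_HP smooth_on_compose[OF open_HP h smooth_on_bounded_linear[OF open_HP bounded_linear_fst]]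
    smooth_on_compose[OF open_HP h smooth_on_bounded_linear[OF open_HP bounded_linear_snd]])
   (auto simp: hyp_prod_def)
qed

abbreviation "HD == rdist HP g0"

lemmas semi_HP = riemannian_semi_metric[OF riemannian_hyp_prod]

lemma C1_map_fst: "C1_map U fst (%_. fst)" and C1_map_snd: "C1_map U snd (%_. snd)"
 by (auto simp: C1_map_def intro!: derivative_eq_intros)

text \<open>Carries a comparison known at the scale \<open>c\<close> to all scales:
  \<open>split\<close> peels off one piece shorter than \<open>c\<close> at a time. Both distances
  are abstract, because the lemma serves for the product, the shell, the l1 and the maximum
  distance.\<close>

lemma rdist_chain:
 assumes split: "!!p q a b. p : X ==> q : X ==> d p q < a + b ==> 0 < a ==> 0 < b ==> EX w:X. d p w < a & d w q < b"
  and tri: "!!p q r. p : X ==> q : X ==> r : X ==> d' p r <= d' p q + d' q r"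
  and short: "!!p q. p : X ==> q : X ==> d p q < c ==> d' p q <= L" and c: "(0::real) < c"
 shows "p : X ==> q : X ==> d p q < real (Suc m) * c ==> d' p q <= real (Suc m) * L"
proof (induction m arbitrary: p)
 case 0
 then show ?case using short[of p q] by simp
next
 case (Suc m)
 have "d p q < c + real (Suc m) * c" using Suc.prems(3) by (simp add: algebra_simps)
 then obtain w where w: "w : X" "d p w < c" "d w q < real (Suc m) * c"
  using split[OF Suc.prems(1,2), of c "real (Suc m) * c"] c by auto
 have "d' p q <= L + real (Suc m) * L"
  using tri[OF Suc.prems(1) w(1) Suc.prems(2)] short[OF Suc.prems(1) w(1,2)] Suc.IH[OF w(1) Suc.prems(2) w(3)] by linarith
 then show ?case by (simp add: algebra_simps)
qed

subsection \<open>Radial maps\<close>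

text \<open>A radial map multiplies tangential vectors by \<open>pf\<close> and radial ones by
  \<open>pf + 2 |y|^2 pf'\<close>; since it moves points towards \<open>0\<close>, the conformal
  factor does not increase.\<close>

lemma radial_bound:
 fixes y b :: "real^'n::finite"
 assumes y: "norm y < 1" and pf: "0 <= pf" "pf <= 1" and ka: "(pf + 2 * (norm y)^2 * pf')^2 <= 1 - ka" and k: "0 <= ka" "ka <= 1"
 shows "hm (pf *\<^sub>R y) (pf *\<^sub>R b + (2 * pf' * (y \<bullet> b)) *\<^sub>R y) (pf *\<^sub>R b + (2 * pf' * (y \<bullet> b)) *\<^sub>R y)
  <= hm y b b - ka * (conf y * (y \<bullet> b)^2 / (norm y)^2)"
proof -
 let ?N = "(norm y)^2" and ?d = "pf *\<^sub>R b + (2 * pf' * (y \<bullet> b)) *\<^sub>R y"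
 define t where "t = (y \<bullet> b)^2 / ?N"
 have t: "0 <= t" "t <= b \<bullet> b" "t * ?N = (y \<bullet> b)^2"
 proof -
  show "0 <= t" by (simp add: t_def)
  have "(y \<bullet> b)^2 <= ?N * (b \<bullet> b)" using Cauchy_Schwarz_ineq[of y b] by (simp add: power2_norm_eq_inner)
  then show "t <= b \<bullet> b" by (cases "y = 0") (auto simp: t_def pos_divide_le_eq mult.commute)
  show "t * ?N = (y \<bullet> b)^2" by (cases "y = 0") (auto simp: t_def)
 qed
 have "?d \<bullet> ?d = pf^2 * (b \<bullet> b) + (4 * pf * pf' + 4 * pf'^2 * ?N) * (y \<bullet> b)^2"
  unfolding power2_norm_eq_inner
  by (simp add: inner_add_left inner_add_right inner_commute power2_eq_square algebra_simps)
 also have "... = pf^2 * (b \<bullet> b - t) + (pf + 2 * ?N * pf')^2 * t"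
  unfolding t(3)[symmetric] by (simp add: power2_eq_square algebra_simps)
 also have "... <= 1 * (b \<bullet> b - t) + (1 - ka) * t"
  using t pf ka by (intro add_mono mult_right_mono) (auto simp: power_le_one)
 finally have d: "?d \<bullet> ?d <= b \<bullet> b - ka * t" by (simp add: algebra_simps)
 have c: "conf (pf *\<^sub>R y) <= conf y"
 proof -
  have "norm (pf *\<^sub>R y) <= norm y" using pf by (simp add: mult_left_le_one_le)
  then have "(norm (pf *\<^sub>R y))^2 <= ?N" by (intro power_mono) auto
  moreover have "?N < 1" using norm_sq_less_1[OF y] .
  ultimately have "(1 - ?N)^2 <= (1 - (norm (pf *\<^sub>R y))^2)^2" "0 < (1 - ?N)^2" by (auto intro!: power_mono)
  then show ?thesis unfolding conf_def by (intro frac_le) auto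
 qed
 have "conf (pf *\<^sub>R y) * (?d \<bullet> ?d) <= conf y * (b \<bullet> b - ka * t)"
  by (rule mult_mono[OF c d]) (use conf_pos[OF y] in auto)
 then show ?thesis by (simp add: hyp_metric_conf t_def algebra_simps)
qed

lemma radial_C1:
 fixes pf pf' :: "real => real"
 assumes "!!N. 0 <= N ==> (pf has_real_derivative pf' N) (at N)" and "continuous_on {0..} pf'"
 shows "C1_map U (%y::real^'n::finite. pf ((norm y)^2) *\<^sub>R y) (%y b. pf ((norm y)^2) *\<^sub>R b + (2 * pf' ((norm y)^2) * (y \<bullet> b)) *\<^sub>R y)"
 unfolding C1_map_def
proof (intro conjI ballI allI)
 fix y :: "real^'n"
 have "((%y. y \<bullet> y) has_derivative (%b. y \<bullet> b + b \<bullet> y)) (at y)" by (auto intro!: derivative_eq_intros)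
 moreover have "(pf has_derivative (%u. pf' (y \<bullet> y) * u)) (at (y \<bullet> y))"
  using assms(1)[of "y \<bullet> y"] by (simp add: has_field_derivative_def)
 ultimately have "((%y. pf (y \<bullet> y)) has_derivative (%b. pf' (y \<bullet> y) * (y \<bullet> b + b \<bullet> y))) (at y)"
  by (rule has_derivative_compose)
 from has_derivative_scaleR[OF this has_derivative_ident]
 show "((%y. pf ((norm y)^2) *\<^sub>R y) has_derivative (%b. pf ((norm y)^2) *\<^sub>R b + (2 * pf' ((norm y)^2) * (y \<bullet> b)) *\<^sub>R y)) (at y)"
  by (simp add: power2_norm_eq_inner inner_commute mult.assoc mult.left_commute)
next
 fix b :: "real^'n"
 have "continuous_on {0..} pf"
  using assms(1) by (intro continuous_at_imp_continuous_on ballI DERIV_isCont) auto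
 then have "continuous_on U (%y::real^'n. pf ((norm y)^2))" "continuous_on U (%y::real^'n. pf' ((norm y)^2))"
  using assms(2) by (auto intro!: continuous_on_compose2[of "{0..}" _ U "%y. (norm y)^2"] continuous_intros)
 then show "continuous_on U (%y::real^'n. pf ((norm y)^2) *\<^sub>R b + (2 * pf' ((norm y)^2) * (y \<bullet> b)) *\<^sub>R y)"
  by (intro continuous_intros)
qed

lemma map_prod_C1:
 fixes f ga :: "real^'n::finite => real^'n"
 assumes f: "f : hyp_isom" and g: "ga : hyp_isom"
 shows "C1_map HP (map_prod f ga) (%z. map_prod (FD f (fst z)) (FD ga (snd z)))"
 unfolding C1_map_def
proof (intro conjI ballI allI)
 show "(map_prod f ga has_derivative map_prod (FD f (fst z)) (FD ga (snd z))) (at z)"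
  if "z : HP" for z by (rule map_prod_derivative[OF f g that])
 fix v :: "'n pt"
 have 1: "continuous_on HS (%x. FD h x w)" if "h : hyp_isom" for h :: "real^'n => real^'n" and w
  using smooth_on_continuous[OF smooth_on_frechet[OF hyp_isomD(2)[OF that]]] .
 have "continuous_on HP (%z. FD f (fst z) (fst v))"
  by (rule continuous_on_compose2[OF 1[OF f]]) (auto simp: hyp_prod_def intro: continuous_intros)
 moreover have "continuous_on HP (%z. FD ga (snd z) (snd v))"
  by (rule continuous_on_compose2[OF 1[OF g]]) (auto simp: hyp_prod_def intro: continuous_intros)
 ultimately show "continuous_on HP (%z. map_prod (FD f (fst z)) (FD ga (snd z)) v)"
  unfolding map_prod_def case_prod_beta' by (rule continuous_on_Pair)
qed

lemma map_prod_image: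
 fixes f ga :: "real^'n::finite => real^'n"
 assumes f: "f : hyp_isom" and g: "ga : hyp_isom"
 shows "map_prod f ga ` HP \<subseteq> HP"
 using hyp_isomD(4)[OF f] hyp_isomD(4)[OF g] by (force simp: hyp_prod_def)

lemma hyp_isom_inverse:
 fixes f :: "real^'n::finite => real^'n"
 assumes "f : hyp_isom"
 obtains f' where "f' : hyp_isom" "!!x. x : HS ==> f' (f x) = x"
 using group.inv_closed[OF group_isom] assms isom_group_inv_apply(1)[OF assms] by blast

lemma hyp_prod_isometry:
 fixes f ga :: "real^'n::finite => real^'n"
 assumes f: "f : hyp_isom" and g: "ga : hyp_isom" and pq: "p : HP" "q : HP"
 shows "HD (map_prod f ga p) (map_prod f ga q) = HD p q"
proof -
 obtain f' where f': "f' : hyp_isom" "!!x. x : HS ==> f' (f x) = x" using hyp_isom_inverse[OF f] by blast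
 obtain ga' where g': "ga' : hyp_isom" "!!x. x : HS ==> ga' (ga x) = x" using hyp_isom_inverse[OF g] by blast
 show ?thesis
 proof (rule rdist_isometry[OF semi_HP map_prod_C1[OF f g] map_prod_image[OF f g] map_prod_C1[OF f'(1) g'(1)] map_prod_image[OF f'(1) g'(1)]])
  show "map_prod f' ga' (map_prod f ga x) = x" if "x : HP" for x
   using that f'(2)[OF HP_D(1)[OF that]] g'(2)[OF HP_D(2)[OF that]] by (cases x) auto
 qed (use pq in \<open>auto simp: hyp_prod_metric_def hyp_isomD(6)[OF f HP_D(1)] hyp_isomD(6)[OF g HP_D(2)]
   hyp_isomD(6)[OF f'(1) HP_D(1)] hyp_isomD(6)[OF g'(1) HP_D(2)]\<close>)
qed

section \<open>Local comparison of the shell distance with the two product distances\<close>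

context shell
begin

abbreviation Xp where "Xp == (HP :: 'n pt set)"

abbreviation D0 where "D0 == rdist Xp g0"

abbreviation Dd where "Dd dl == rdist Xp (gd dl)"

lemmas D0_sym = rdist_sym[OF semi_HP convex_HP]

lemma dW_base:
 assumes "norm y < R" shows "dW y b = 2 * (y \<bullet> b)"
proof -
 have y: "y : HS" "norm (e y) < R" using assms R e_apply[of y] by auto
 have "(e has_derivative (%b. b)) (at y)"
  by (rule has_derivative_transform_within_open[OF has_derivative_ident open_ball y(1)]) (simp add: e_apply)
 then have "FD e y = (%b. b)" using frechet_derivative_at by metis
 then show ?thesis using W_has_derivative(2)[OF y(1) e_in y(2)] e_apply[OF y(1)] by simp
qed

lemma nrm_base: "norm y < R ==> nrm y b b = conf y * (y \<bullet> b)^2 / (norm y)^2"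
 by (simp add: nrm_def dW_base W_base conf_def power2_eq_square)

context
 fixes dl :: real
 assumes ok: "ok dl"
begin

lemma semi_gd: "semi_metric Xp (gd dl)"
 by (rule riemannian_semi_metric[OF riemannian_gd[OF ok]])

lemmas Dd_triangle = rdist_triangle[OF semi_gd convex_HP]

lemmas Dd_sym = rdist_sym[OF semi_gd convex_HP]

lemma D0_le_Dd: "p : Xp ==> q : Xp ==> D0 p q <= sqrt 2 * Dd dl p q"
 using rdist_map_le[OF semi_gd convex_HP semi_HP convex_HP C1_map_id, of "sqrt 2" p q] gd_bounds(1)[OF ok] by simp

lemma Dd_le_D0: "p : Xp ==> q : Xp ==> Dd dl p q <= sqrt 2 * D0 p q"
 using rdist_map_le[OF semi_HP convex_HP semi_gd convex_HP C1_map_id, of "sqrt 2" p q] gd_bounds(2)[OF ok] by simp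

lemma hdist_snd_le_Dd:
 assumes "p : Xp" "q : Xp" shows "hdist (snd p) (snd q) <= Dd dl p q"
proof -
 have "hdist (snd p) (snd q) <= 1 * Dd dl p q"
  by (rule rdist_map_le[OF semi_gd convex_HP semi_hyp convex_ball C1_map_snd])
   (use gd_bounds(4)[OF ok] assms in "auto simp: hyp_prod_def")
 then show ?thesis by simp
qed

lemma Dd_invariant:
 assumes f: "f : hyp_isom" and g: "ga : Gm" and pq: "p : Xp" "q : Xp"
 shows "Dd dl (map_prod f ga p) (map_prod f ga q) = Dd dl p q"
proof -
 obtain f' where f': "f' : hyp_isom" "!!x. x : HS ==> f' (f x) = x" using hyp_isom_inverse[OF f] by blast
 define ga' where "ga' = ginv ga"
 have g': "ga' : Gm" "!!x. x : HS ==> ga' (ga x) = x" using ginv(1,2)[OF g] by (auto simp: ga'_def)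
 show ?thesis
 proof (rule rdist_isometry[OF semi_gd map_prod_C1[OF f isom[OF g]] map_prod_image[OF f isom[OF g]] map_prod_C1[OF f'(1) isom[OF g'(1)]] map_prod_image[OF f'(1) isom[OF g'(1)]]])
  show "map_prod f' ga' (map_prod f ga x) = x" if "x : Xp" for x
   using that f'(2)[OF HP_D(1)[OF that]] g'(2)[OF HP_D(2)[OF that]] by (cases x) auto
 qed (use gd_invariant[OF ok f g] gd_invariant[OF ok f'(1) g'(1)] pq in auto)
qed

lemma path_points:
 assumes g: "semi_metric Xp g" and c: "valid_path c" "c ` {0..1} \<subseteq> Xp" "path_length g c < ennreal L" and t: "t : {0..1}"
 shows "rdist Xp g (c 0) (c t) < L"
proof -
 have "riem_dist Xp g (c 0) (c t) <= path_length g c"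
  using path_length_split[OF g c(1,2), of t] t by (auto intro: order.trans[rotated])
 then have "riem_dist Xp g (c 0) (c t) < ennreal L" using c(3) by simp
 moreover have "c 0 : Xp" "c t : Xp" using c(2) t by auto
 ultimately show ?thesis using rdist_less_iff[OF g convex_HP] by blast
qed

lemma short_path:
 assumes g: "semi_metric Xp g" and pq: "p : Xp" "q : Xp" "rdist Xp g p q < L"
 obtains c where "valid_path c" "c ` {0..1} \<subseteq> Xp" "c 0 = p" "c 1 = q" "path_length g c < ennreal L"
 using riem_dist_lessE[of Xp g p q "ennreal L"] rdist_less_iff[OF g convex_HP pq(1,2)] pq(3) by metis

text \<open>\<open>H\<close> replaces the projection to the second factor. It has to absorb the
  shrunk normal direction: away from the shells \<open>snd\<close> itself will do, near them a
  radial contraction of it.\<close>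

lemma l1_of_path:
 assumes c: "valid_path c" "c ` {0..1} \<subseteq> Xp" "path_length (gd dl) c < ennreal L" and L: "0 <= L"
  and H: "C1_map U H H'" "c ` {0..1} \<subseteq> U" "H ` c ` {0..1} \<subseteq> HS"
  and le: "!!t (v :: 'n pt). t : {0..1} ==> hm (H (c t)) (H' (c t) v) (H' (c t) v)
    <= hm (snd (c t)) (snd v) (snd v) - kap (sg dl (snd (c t))) * nrm (snd (c t)) (snd v) (snd v)"
 shows "hdist (fst (c 0)) (fst (c 1)) + hdist (H (c 0)) (H (c 1)) <= sqrt 2 * L"
proof -
 have fc: "fst ` c ` {0..1} \<subseteq> HS" using c(2) by (force simp: hyp_prod_def)
 have sum: "path_length hm (fst \<circ> c) + path_length hm (H \<circ> c) <= ennreal (sqrt 2) * path_length (gd dl) c"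
 proof (rule path_length_add_le[OF semi_gd c(1,2) C1_map_fst H(2) semi_hyp fc H(1) semi_hyp H(3)])
  fix t :: real and v :: "'n pt" assume t: "t : {0..1}"
  then have ct: "c t : Xp" using c(2) by auto
  let ?A = "sqrt (hm (fst (c t)) (fst v) (fst v))"
  let ?B = "sqrt (hm (snd (c t)) (snd v) (snd v) - kap (sg dl (snd (c t))) * nrm (snd (c t)) (snd v) (snd v))"
  have "?A + sqrt (hm (H (c t)) (H' (c t) v) (H' (c t) v)) <= ?A + ?B"
   using le[OF t, of v] by simp
  also have "?A + ?B <= sqrt (2 * gd dl (c t) v v)"
   using gd_l1[OF ok ct, of "fst v" "snd v"] by (intro real_le_rsqrt) simp
  finally show "?A + sqrt (hm (H (c t)) (H' (c t) v) (H' (c t) v)) <= sqrt 2 * sqrt (gd dl (c t) v v)"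
   by (simp add: real_sqrt_mult)
 qed simp
 have in01: "c 0 : Xp" "c 1 : Xp" "H (c 0) : HS" "H (c 1) : HS"
  using c(2) subsetD[OF H(3), of "H (c 0)"] subsetD[OF H(3), of "H (c 1)"] by auto
 have "riem_dist HS hm ((fst \<circ> c) 0) ((fst \<circ> c) 1) <= path_length hm (fst \<circ> c)"
  by (rule riem_dist_le_path_length[OF C1_map_path(1)[OF C1_map_fst c(1) H(2)]]) (use fc in auto)
 moreover have "riem_dist HS hm ((H \<circ> c) 0) ((H \<circ> c) 1) <= path_length hm (H \<circ> c)"
  by (rule riem_dist_le_path_length[OF C1_map_path(1)[OF H(1) c(1) H(2)]]) (use H(3) in auto)
 ultimately have "ennreal (hdist (fst (c 0)) (fst (c 1))) + ennreal (hdist (H (c 0)) (H (c 1))) <= ennreal (sqrt 2) * path_length (gd dl) c"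
  using sum HP_D[OF in01(1)] HP_D[OF in01(2)] in01(3,4) by (simp add: hdist_eq order.trans[OF add_mono])
 also have "... <= ennreal (sqrt 2) * ennreal L" using c(3) by (intro mult_left_mono) auto
 also have "... = ennreal (sqrt 2 * L)" by (simp add: ennreal_mult' L)
 finally show ?thesis using L by (simp add: ennreal_plus[symmetric] del: ennreal_plus)
qed

lemma snd_close:
 assumes "p : Xp" "q : Xp" "Dd dl p q < L"
 shows "norm (snd q - snd p) < L / 2" "\<bar>wd (snd q) - wd (snd p)\<bar> < L / 2"
proof -
 note m = HP_D(2)[OF assms(1)] HP_D(2)[OF assms(2)]
 have h: "hdist (snd p) (snd q) < L" using hdist_snd_le_Dd[OF assms(1,2)] assms(3) by simp
 show "norm (snd q - snd p) < L / 2" using hdist_ge_norm[OF m] h by simp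
 have "wd (snd q) <= wd (snd p) + hdist (snd p) (snd q) / 2" "wd (snd p) <= wd (snd q) + hdist (snd p) (snd q) / 2"
  using wd_lipschitz[OF m] wd_lipschitz[OF m(2,1)] by (auto simp: hdist_sym)
 then show "\<bar>wd (snd q) - wd (snd p)\<bar> < L / 2" using h by linarith
qed

lemma C1_map_compose:
 fixes F :: "'a::euclidean_space => 'b::euclidean_space" and H :: "'b => 'c::real_normed_vector"
 assumes F: "C1_map U F F'" and H: "C1_map V H H'" and FU: "F ` U \<subseteq> V"
 shows "C1_map U (%x. H (F x)) (%x v. H' (F x) (F' x v))"
 unfolding C1_map_def
proof (intro conjI ballI allI)
 fix x assume x: "x : U"
 then have "F x : V" using FU by blast
 then show "((%x. H (F x)) has_derivative (%v. H' (F x) (F' x v))) (at x)"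
  using F H x unfolding C1_map_def by (blast intro: has_derivative_compose)
next
 fix v
 show "continuous_on U (%x. H' (F x) (F' x v))"
 proof (rule continuous_on_lin_family[where A="%x. H' (F x)"])
  show "linear (H' (F x))" if "x : U" for x using C1_map_lin[OF H] FU that by blast
  show "continuous_on U (%x. H' (F x) w)" for w
   using continuous_on_compose2[OF _ C1_map_continuous[OF F] FU, of "%y. H' y w"] H by (simp add: C1_map_def)
  show "continuous_on U (%x. F' x v)" using F by (simp add: C1_map_def)
 qed
qed

text \<open>The radial map with profile \<open>N \<mapsto> 1 - a dl (pi/2 + arctan ((N - rh\<^sup>2) / dl))\<close>, \<open>N = |y|\<^sup>2\<close>, moves points by
 \<open>O(dl)\<close> only, but contracts the normal direction of the shell by a definite factor.\<close>

lemma short_lower_base: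
 assumes pq: "p : Xp" "q : Xp" "Dd dl p q < L" and L: "0 <= L" "L <= R / 5" and y0: "norm (snd p) < 4 * R / 5"
 shows "hdist (fst p) (fst q) + hdist (snd p) (snd q) <= sqrt 2 * L + 3 * dl / rh^2"
proof -
 have d: "0 < dl" "4 * dl <= rh^2" and r2: "0 < rh^2" using ok rh by (auto simp: ok_def)
 obtain c where c: "valid_path c" "c ` {0..1} \<subseteq> Xp" "c 0 = p" "c 1 = q" "path_length (gd dl) c < ennreal L"
  using short_path[OF semi_gd pq] by metis
 \<comment> \<open>A path shorter than \<open>L\<close> moves the second component by less than
   \<open>L / 2 <= R / 10\<close>, so it stays in the ball where \<open>wd\<close> is the
   norm.\<close>
 have nb: "norm (snd (c t)) < R" if t: "t : {0..1}" for t
 proof -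
  have ct: "c t : Xp" using c(2) t by auto
  have "norm (snd (c t) - snd p) < L / 2"
   using snd_close(1)[OF pq(1) ct] path_points[OF semi_gd c(1,2,5) t] c(3) by simp
  then show ?thesis using norm_triangle_sub[of "snd (c t)" "snd p"] y0 L R by linarith
 qed
 \<comment> \<open>\<open>2 rh^2 a = 1\<close> brings the radial factor \<open>pf + 2 N pf'\<close>
   close to 0 at \<open>N = rh^2\<close>, while the total drop \<open>a dl pi\<close> of
   \<open>pf\<close> vanishes with \<open>dl\<close>.\<close>
 define a where "a = 1 / (2 * rh^2)"
 define pf where "pf N = 1 - a * dl * (pi / 2 + arctan ((N - rh^2) / dl))" for N
 define pf' where "pf' N = - (a / (1 + ((N - rh^2) / dl)^2))" for N
 have a: "0 < a" "a * dl <= 1 / 8" "a * rh^2 = 1 / 2" using d r2 by (auto simp: a_def field_simps)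
 have der: "(pf has_real_derivative pf' N) (at N)" for N
 proof -
  have "((%N. (N - rh^2) / dl) has_real_derivative 1 / dl) (at N)"
   using d by (auto intro!: derivative_eq_intros)
  from DERIV_chain2[OF DERIV_arctan this]
  have "((%N. arctan ((N - rh^2) / dl)) has_real_derivative inverse (1 + ((N - rh^2) / dl)^2) * (1 / dl)) (at N)" .
  then have "((%N. 1 - a * dl * (pi / 2 + arctan ((N - rh^2) / dl))) has_real_derivative
    0 - a * dl * (0 + inverse (1 + ((N - rh^2) / dl)^2) * (1 / dl))) (at N)"
   by (intro DERIV_diff DERIV_const DERIV_cmult DERIV_add)
  moreover have "0 - a * dl * (0 + inverse (1 + ((N - rh^2) / dl)^2) * (1 / dl)) = pf' N"
   using d by (simp add: pf'_def inverse_eq_divide)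
  ultimately show ?thesis unfolding pf_def by simp
 qed
 have cont: "continuous_on {0..} pf'"
  unfolding pf'_def by (intro continuous_intros) (use d in "auto simp: add_nonneg_eq_0_iff")
 have arc: "0 <= pi / 2 + arctan u" "pi / 2 + arctan u <= pi" for u
  using arctan_lbound[of u] arctan_ubound[of u] by auto
 have G: "0 <= 1 - pf N" "1 - pf N <= a * dl * pi" for N
  unfolding pf_def using arc[of "(N - rh^2) / dl"] a d by (auto intro!: mult_left_mono)
 have pi: "pi < 3.2" using pi_approx by simp
 have "a * dl * pi <= 1 / 8 * 3.2" using a d pi by (intro mult_mono) auto
 then have psi: "6 / 10 <= pf N" "pf N <= 1" for N using G[of N] by auto
 have slope: "0 <= - (2 * N * pf' N)" "- (2 * N * pf' N) <= 5 / 4" if N: "0 <= N" for N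
 proof -
  define u where "u = (N - rh^2) / dl"
  have u: "0 < 1 + u^2" by (simp add: add_pos_nonneg)
  have eq: "- (2 * N * pf' N) = 2 * N * a / (1 + u^2)" by (simp add: pf'_def u_def)
  show "0 <= - (2 * N * pf' N)" unfolding eq using N a u by simp
  have "N = rh^2 + dl * u" using d by (simp add: u_def)
  then have "2 * N * a = 1 + 2 * (a * dl) * u" using a by (simp add: algebra_simps)
  also have "... <= 1 + \<bar>u\<bar> / 4"
  proof -
   have "2 * (a * dl) * u <= 2 * (a * dl) * \<bar>u\<bar>" using a d by (intro mult_left_mono) auto
   also have "... <= 1 / 4 * \<bar>u\<bar>" using a by (intro mult_right_mono) auto
   finally show ?thesis by simp
  qed
  also have "... <= 5 / 4 * (1 + u^2)"
  proof -
   have "0 <= (\<bar>u\<bar> - 1 / 2)^2" by simp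
   then have "\<bar>u\<bar> <= u^2 + 1 / 4" by (simp add: power2_diff power2_eq_square field_simps)
   then have "\<bar>u\<bar> <= 1 + 5 * u^2" using zero_le_power2[of u] by linarith
   then show ?thesis by (simp add: algebra_simps)
  qed
  finally show "- (2 * N * pf' N) <= 5 / 4" unfolding eq using u by (simp add: pos_divide_le_eq)
 qed
 \<comment> \<open>Here \<open>N >= 3/4 rh^2\<close>, because \<open>dl <= rh^2 / 4\<close>, and the
   arctangent still has at least half of its maximal slope.\<close>
 have slab: "3 / 8 <= - (2 * N * pf' N)" if N: "\<bar>N - rh^2\<bar> < dl" for N
 proof -
  define u where "u = (N - rh^2) / dl"
  have "\<bar>u\<bar> < 1" using N d by (simp add: u_def)
  then have u: "1 + u^2 <= 2" "0 < 1 + u^2" by (auto simp: abs_square_less_1 less_imp_le add_pos_nonneg)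
  have "3 / 4 * rh^2 <= N" using N d by linarith
  then have "2 * (3 / 4 * rh^2) * a <= 2 * N * a" using a by (intro mult_right_mono) auto
  moreover have "2 * (3 / 4 * rh^2) * a = 3 / 2 * (a * rh^2)" by simp
  moreover have "3 / 2 * (a * rh^2) = 3 / 4" using a(3) by linarith
  ultimately have "3 / 4 <= 2 * N * a" by linarith
  then have "3 / 4 / 2 <= 2 * N * a / (1 + u^2)" using u by (intro frac_le) auto
  then show ?thesis by (simp add: pf'_def u_def)
 qed
 let ?Ph = "%y::real^'n. pf ((norm y)^2) *\<^sub>R y"
 let ?Ph' = "%y b::real^'n. pf ((norm y)^2) *\<^sub>R b + (2 * pf' ((norm y)^2) * (y \<bullet> b)) *\<^sub>R y"
 have C1: "C1_map UNIV (%z. ?Ph (snd z)) (%z v. ?Ph' (snd z) (snd v))"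
  by (rule C1_map_compose[OF C1_map_snd radial_C1[OF der cont, where U = UNIV]]) (rule subset_UNIV)
 have Phn: "norm (?Ph y) <= norm y" for y using psi[of "(norm y)^2"] by (simp add: mult_left_le_one_le)
 have main: "hdist (fst (c 0)) (fst (c 1)) + hdist (?Ph (snd (c 0))) (?Ph (snd (c 1))) <= sqrt 2 * L"
 proof (rule l1_of_path[OF c(1,2,5) L(1) C1])
  show "(%z. ?Ph (snd z)) ` c ` {0..1} \<subseteq> HS"
   unfolding image_image
  proof (rule image_subsetI)
   fix t :: real assume t: "t : {0..1}"
   show "?Ph (snd (c t)) : HS" using Phn[of "snd (c t)"] nb[OF t] R by simp
  qed
  fix t :: real and v :: "'n pt" assume t: "t : {0..1}"
  let ?y = "snd (c t)" and ?b = "snd v"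
  let ?k = "kap (sg dl ?y)"
  have k: "0 <= ?k" "?k <= 1 / 3" using kap_bounds[OF ok] by auto
  have sq: "(pf ((norm ?y)^2) + 2 * (norm ?y)^2 * pf' ((norm ?y)^2))^2 <= 1 - ?k"
  proof (cases "\<bar>(norm ?y)^2 - rh^2\<bar> < dl")
   case True
   \<comment> \<open>From above by \<open>1 - 3/8\<close>, from below by \<open>6/10 - 5/4\<close>;
     the square of 65/100 is below \<open>1 - kap\<close>, since \<open>kap <= 1/3\<close>.\<close>
   have "\<bar>pf ((norm ?y)^2) + 2 * (norm ?y)^2 * pf' ((norm ?y)^2)\<bar> <= 65 / 100"
    using slab[OF True] slope[OF zero_le_power2[of "norm ?y"]] psi[of "(norm ?y)^2"] by (intro abs_leI) linarith+
   then have "(pf ((norm ?y)^2) + 2 * (norm ?y)^2 * pf' ((norm ?y)^2))^2 <= (65 / 100)^2"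
    by (metis abs_le_square_iff abs_of_nonneg zero_le_divide_iff zero_le_numeral)
   also have "... <= 1 - ?k" using k by (simp add: power2_eq_square)
   finally show ?thesis .
  next
   case False
   then have "sg dl ?y = 0" using sg_zero[OF ok, of ?y] W_base[OF nb[OF t]] by simp
   moreover have "\<bar>pf ((norm ?y)^2) + 2 * (norm ?y)^2 * pf' ((norm ?y)^2)\<bar> <= 1"
    using slope[of "(norm ?y)^2"] psi[of "(norm ?y)^2"] by (simp add: abs_le_iff)
   ultimately show ?thesis by (simp add: abs_square_le_1)
  qed
  have "hm (?Ph ?y) (?Ph' ?y ?b) (?Ph' ?y ?b) <= hm ?y ?b ?b - ?k * (conf ?y * (?y \<bullet> ?b)^2 / (norm ?y)^2)"
   by (rule radial_bound[OF _ _ _ sq]) (use nb[OF t] R psi[of "(norm ?y)^2"] k in auto)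
  then show "hm (?Ph ?y) (?Ph' ?y ?b) (?Ph' ?y ?b) <= hm ?y ?b ?b - ?k * nrm ?y ?b ?b"
   by (simp add: nrm_base[OF nb[OF t]])
 qed simp
 have disp: "hdist y (?Ph y) <= 3 / 2 * dl / rh^2" if y: "norm y < R" for y
 proof -
  have "hdist y (?Ph y) <= 2 / (1 - R^2) * norm (?Ph y - y)"
   by (rule hdist_le_cball) (use Phn[of y] y R in auto)
  also have "?Ph y - y = - (1 - pf ((norm y)^2)) *\<^sub>R y" by (simp add: algebra_simps)
  also have "norm (- (1 - pf ((norm y)^2)) *\<^sub>R y) = (1 - pf ((norm y)^2)) * norm y" using psi[of "(norm y)^2"] by simp
  also have "2 / (1 - R^2) * ((1 - pf ((norm y)^2)) * norm y) <= 3 * ((a * dl * pi) * (1 / 4))"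
  proof (intro mult_mono)
   show "2 / (1 - R^2) <= 3" using R2(1) by (simp add: field_simps)
   show "1 - pf ((norm y)^2) <= a * dl * pi" using G[of "(norm y)^2"] by simp
   show "0 <= (1 - pf ((norm y)^2)) * norm y" using psi[of "(norm y)^2"] by simp
   show "0 <= a * dl * pi" using a d by simp
  qed (use y R in auto)
  also have "... <= 3 * ((a * dl * 4) * (1 / 4))" using pi a d by (intro mult_left_mono mult_right_mono) auto
  also have "... = 3 / 2 * dl / rh^2" using r2 by (simp add: a_def)
  finally show ?thesis .
 qed
 have n0: "norm (snd p) < R" "norm (snd q) < R" using nb[of 0] nb[of 1] c by auto
 have m: "snd p : HS" "snd q : HS" "?Ph (snd p) : HS" "?Ph (snd q) : HS"
  using n0 R Phn[of "snd p"] Phn[of "snd q"] by auto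
 have "hdist (snd p) (snd q) <= hdist (snd p) (?Ph (snd p)) + hdist (?Ph (snd p)) (?Ph (snd q)) + hdist (snd q) (?Ph (snd q))"
  using hdist_triangle[OF m(1,3,2)] hdist_triangle[OF m(3,4,2)] hdist_sym[of "snd q" "?Ph (snd q)"] by linarith
 also have "... <= 3 / 2 * dl / rh^2 + hdist (?Ph (snd p)) (?Ph (snd q)) + 3 / 2 * dl / rh^2"
  using disp[OF n0(1)] disp[OF n0(2)] by linarith
 finally show ?thesis using main c(3,4) by simp
qed

text \<open>Either the path starts within \<open>4 R / 5\<close> of the orbit and a lattice element
  carries it to the base ball, or it never comes below \<open>7 R / 10\<close> and so runs in the
  product metric throughout.\<close>

lemma short_lower:
 assumes pq: "p : Xp" "q : Xp" "Dd dl p q < L" and L: "0 <= L" "L <= R / 5"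
 shows "hdist (fst p) (fst q) + hdist (snd p) (snd q) <= sqrt 2 * L + 3 * dl / rh^2"
proof (cases "wd (snd p) < 4 * R / 5")
 case True
 note m = HP_D(2)[OF pq(1)] HP_D(2)[OF pq(2)] HP_D(1)[OF pq(1)] HP_D(1)[OF pq(2)]
 have "near (snd p)" using True near_iff[OF m(1)] R by simp
 then obtain ga where g: "ga : Gm" "norm (ga (snd p)) < R" by (auto simp: near_def)
 have n: "norm (ga (snd p)) < 4 * R / 5" using True wd_near(2)[OF m(1) g] by simp
 let ?f = "map_prod e ga"
 have fx: "?f p : Xp" "?f q : Xp"
  using in_ball[OF g(1) m(1)] in_ball[OF g(1) m(2)] in_ball[OF e_in m(3)] in_ball[OF e_in m(4)] by (cases p; cases q; simp add: hyp_prod_def)+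
 have "Dd dl (?f p) (?f q) < L" using Dd_invariant[OF isom[OF e_in] g(1) pq(1,2)] pq(3) by simp
 from short_lower_base[OF fx this L] n
 have "hdist (e (fst p)) (e (fst q)) + hdist (ga (snd p)) (ga (snd q)) <= sqrt 2 * L + 3 * dl / rh^2"
  by (cases p; cases q) simp
 then show ?thesis using dist_inv[OF g(1) m(1,2)] e_apply[OF m(3)] e_apply[OF m(4)] by simp
next
 case False
 obtain c where c: "valid_path c" "c ` {0..1} \<subseteq> Xp" "c 0 = p" "c 1 = q" "path_length (gd dl) c < ennreal L"
  using short_path[OF semi_gd pq] by metis
 have off: "sg dl (snd (c t)) = 0" if t: "t : {0..1}" for t
 proof -
  have ct: "c t : Xp" using c(2) t by auto
  have "\<bar>wd (snd (c t)) - wd (snd p)\<bar> < L / 2"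
   using snd_close(2)[OF pq(1) ct] path_points[OF semi_gd c(1,2,5) t] c(3) by simp
  then have "7 / 10 * R <= wd (snd (c t))" using False L by linarith
  then have "(7 / 10 * R)^2 <= W (snd (c t))" unfolding W_def using R by (intro power_mono) auto
  then have "dl <= W (snd (c t)) - rh^2" using R2 ok by (simp add: power_mult_distrib ok_def power2_eq_square)
  then show ?thesis using sg_zero[OF ok, of "snd (c t)"] by simp
 qed
 have "hdist (fst (c 0)) (fst (c 1)) + hdist (snd (c 0)) (snd (c 1)) <= sqrt 2 * L"
 proof (rule l1_of_path[OF c(1,2,5) L(1) C1_map_snd])
  show "snd ` c ` {0..1} \<subseteq> HS" using c(2) by (force simp: hyp_prod_def)
  show "c ` {0..1} \<subseteq> UNIV" by simp
  show "hm (snd (c t)) (snd v) (snd v) <= hm (snd (c t)) (snd v) (snd v) - kap (sg dl (snd (c t))) * nrm (snd (c t)) (snd v) (snd v)"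
   if "t : {0..1}" for t v using off[OF that] by simp
 qed
 moreover have "0 <= 3 * dl / rh^2" using ok by (simp add: ok_def)
 ultimately show ?thesis unfolding c(3,4) by linarith
qed

text \<open>One parameter \<open>m\<close> is exempt, because at the instant of entry or exit the
  path may already lie in the shell; a single point has measure zero.\<close>

lemma plen_off:
 assumes "!!ta. ta : {a..b} ==> ta ~= m ==> sg dl (snd (c ta)) = 0"
 shows "plen (gd dl) c a b = plen g0 c a b"
 unfolding plen_def speed_def
 by (rule nn_integral_cong_point[of m]) (use assms gd_off[OF ok] in "auto simp: indicator_def")

lemma Dd_vertical:
 assumes x: "x : HS" and y: "norm y < R" "norm y' < R"
 shows "Dd dl (x, y) (x, y') <= 5 * norm (y' - y)"
proof -
 have sub: "closed_segment (x, y) (x, y') \<subseteq> {x} \<times> ball 0 R"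
  using y by (intro closed_segment_subset convex_Times) (auto intro: convex_singleton)
 have "D0 (x, y) (x, y') <= 3 * norm (y' - y)"
 proof (rule rdist_le_segment)
  show "closed_segment (x, y) (x, y') \<subseteq> Xp" using sub x R by (force simp: hyp_prod_def)
  fix z assume "z : closed_segment (x, y) (x, y')"
  then have z: "norm (snd z) < R" using sub by auto
  then have "sqrt (g0 z ((x, y') - (x, y)) ((x, y') - (x, y))) = 2 * norm (y' - y) / (1 - (norm (snd z))^2)"
   using sqrt_hyp_metric[of "snd z" "y' - y"] R by (simp add: hyp_prod_metric_def hyp_metric_def)
  also have "... <= 2 * norm (y' - y) / (2 / 3)"
  proof (intro divide_left_mono)
   have "(norm (snd z))^2 <= R^2" using z by (intro power_mono) auto
   then show "2 / 3 <= 1 - (norm (snd z))^2" using R2(1) by linarith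
   then show "0 < (1 - (norm (snd z))^2) * (2 / 3)" by simp
  qed simp
  finally show "sqrt (g0 z ((x, y') - (x, y)) ((x, y') - (x, y))) <= 3 * norm (y' - y)" by simp
 qed simp
 moreover have "(x, y) : Xp" "(x, y') : Xp" using x y R by (auto simp: hyp_prod_def)
 ultimately have "Dd dl (x, y) (x, y') <= sqrt 2 * (3 * norm (y' - y))"
  using Dd_le_D0[of "(x, y)" "(x, y')"] by (smt (verit) mult_left_mono real_sqrt_ge_zero)
 also have "... <= (5 / 3) * (3 * norm (y' - y))"
  by (intro mult_right_mono real_le_lsqrt) (auto simp: power2_eq_square)
 finally show ?thesis by simp
qed

text \<open>Between its first entry into the ball of radius \<open>sqrt (rh\<^sup>2 + dl)\<close> and its last exit a path is pushed inside
 the shell by a radial contraction that is nearly the identity well inside the ball of squared radius \<open>A = rh\<^sup>2 - dl\<close>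
 and has values below that radius.\<close>

lemma saturation:
 fixes A th :: real
 assumes A: "0 < A" and th: "0 < th" "th < 1"
 shows "\<exists>pf pf'. (ALL N>=0. (pf has_real_derivative pf' N) (at N)) & continuous_on {0..} pf' &
  (ALL N>=0. 0 <= pf N & pf N <= 1 & (pf N + 2 * N * pf' N)^2 <= 1 & N * (pf N)^2 <= A) &
  (ALL r>=0. r - r * pf (r^2) <= max (r * th) (r - sqrt A * (1 - th)))"
proof -
 \<comment> \<open>The exponent \<open>m\<close> is taken so large that at \<open>N = A\<close>,
   where the profile below has the value \<open>2 powr (- al)\<close>, it has not dropped below
   \<open>1 - th\<close>.\<close>
 have "(%m. (1 - th) ^ m) \<longlonglongrightarrow> 0" using th by (intro LIMSEQ_power_zero) auto
 then have "eventually (%m. (1 - th) ^ m < 1 / 2) sequentially" by (rule order_tendstoD) simp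
 then obtain m0 where m0: "!!m. m >= m0 ==> (1 - th) ^ m < 1 / 2" unfolding eventually_sequentially by blast
 define m where "m = Suc m0"
 have m: "(1 - th) ^ (2 * m) < 1 / 2" "m > 0" using m0[of "2 * m"] by (auto simp: m_def)
 define al where "al = 1 / (2 * real m)"
 have al: "al > 0" "2 * al * real m = 1" using m by (auto simp: al_def)
 \<comment> \<open>A smooth version of \<open>min 1 (sqrt (A / N))\<close>: the image radius
   \<open>|y| / (1 + (|y|^2 / A)^m)^(1 / (2 m))\<close> stays below both \<open>|y|\<close> and
   \<open>sqrt A\<close>.\<close>
 define pf where "pf N = (1 + (N / A) ^ m) powr (- al)" for N
 define pf' where "pf' N = - al * (1 + (N / A) ^ m) powr (- al - 1) * (real m * (N / A) ^ (m - 1) / A)" for N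
 have pos: "0 < 1 + (N / A) ^ m" "1 <= 1 + (N / A) ^ m" if "0 <= N" for N
  using that A by (auto intro: add_pos_nonneg)
 have der: "(pf has_real_derivative pf' N) (at N)" if N: "0 <= N" for N
 proof -
  have "((%N. 1 + (N / A) ^ m) has_real_derivative (real m * (N / A) ^ (m - 1) / A)) (at N)"
   using A by (auto intro!: derivative_eq_intros)
  from DERIV_chain2[OF has_real_derivative_powr[OF pos(1)[OF N], of "- al"] this]
  show ?thesis unfolding pf_def pf'_def by simp
 qed
 have cont: "continuous_on {0..} pf'"
  unfolding pf'_def using A pos by (intro continuous_intros) (auto simp: less_imp_neq[THEN not_sym])
 have one: "0 <= pf N" "pf N <= 1" if "0 <= N" for N
  using pos[OF that] al powr_mono2'[of "- al" 1 "1 + (N / A) ^ m"] by (auto simp: pf_def)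
 have slope: "(pf N + 2 * N * pf' N)^2 <= 1" if N: "0 <= N" for N
 proof -
  let ?q = "(N / A) ^ m"
  have "2 * N * pf' N = - ((1 + ?q) powr (- al - 1)) * ((2 * al * real m) * (N / A * (N / A) ^ (m - 1)))"
   by (simp add: pf'_def)
  also have "N / A * (N / A) ^ (m - 1) = ?q" using m by (simp add: power_eq_if)
  finally have e: "2 * N * pf' N = - ((1 + ?q) powr (- al - 1) * ?q)" using al by simp
  have "pf N = (1 + ?q) powr (- al - 1) * (1 + ?q)"
   using pos[OF N] powr_add[of "1 + ?q" "- al - 1" 1] by (simp add: pf_def)
  then have "pf N + 2 * N * pf' N = (1 + ?q) powr (- al - 1)" using e by (simp add: algebra_simps)
  moreover have "(1 + ?q) powr (- al - 1) <= 1 powr (- al - 1)"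
   by (rule powr_mono2') (use pos[OF N] al in auto)
  ultimately show ?thesis by (simp add: power_le_one)
 qed
 have sqpsi: "(pf N)^2 = (1 + (N / A) ^ m) powr (- (2 * al))" for N
  by (simp add: pf_def power2_eq_square powr_add[symmetric])
 have le: "N * (pf N)^2 <= A" if N: "0 <= N" for N
 proof (cases "N = 0")
  case False
  then have NA: "N / A > 0" using N A by simp
  have "(pf N)^2 <= ((N / A) ^ m) powr (- (2 * al))"
   unfolding sqpsi by (rule powr_mono2') (use NA al in auto)
  also have "... = (N / A) powr (real m * (- (2 * al)))"
   using NA by (simp add: powr_realpow[symmetric] powr_powr)
  also have "real m * (- (2 * al)) = -1" using al(2) by (simp add: mult_ac)
  also have "(N / A) powr -1 = A / N" using NA N A False by (simp add: powr_minus_divide)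
  finally have "N * (pf N)^2 <= N * (A / N)" using N by (intro mult_left_mono) auto
  then show ?thesis using False by simp
 qed (use A in simp)
 have half: "1 - th <= 2 powr (- al)"
 proof -
  have "((1 - th) ^ (2 * m)) powr al <= (1 / 2) powr al" by (rule powr_mono2) (use m al th in auto)
  moreover have "((1 - th) ^ (2 * m)) powr al = 1 - th"
   using th al(2) by (simp add: powr_realpow[symmetric] powr_powr mult_ac)
  ultimately show ?thesis by (simp add: powr_minus_divide powr_divide)
 qed
 have disp: "r - r * pf (r^2) <= max (r * th) (r - sqrt A * (1 - th))" if r: "0 <= r" for r
 proof (cases "r^2 <= A")
  case True
  then have "(r^2 / A) ^ m <= 1" using A by (intro power_le_one) auto
  then have "2 powr (- al) <= pf (r^2)" unfolding pf_def by (intro powr_mono2') (use al pos[of "r^2"] in auto)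
  then have "r * (1 - th) <= r * pf (r^2)" using half r by (intro mult_left_mono) auto
  then show ?thesis by (simp add: algebra_simps)
 next
  case False
  then have q: "1 <= (r^2 / A) ^ m" using A by (intro one_le_power) (simp add: pos_le_divide_eq)
  have rp: "r > 0" using False A r by (cases "r = 0") auto
  have "(2 * (r^2 / A) ^ m) powr (- al) <= pf (r^2)"
   unfolding pf_def by (rule powr_mono2') (use al q pos[of "r^2"] in auto)
  also have "(2 * (r^2 / A) ^ m) powr (- al) = 2 powr (- al) * ((r^2 / A) ^ m) powr (- al)"
   by (rule powr_mult)
  also have "((r^2 / A) ^ m) powr (- al) = (r^2 / A) powr (- (1 / 2))"
  proof -
   have "r^2 / A > 0" using rp A by simp
   moreover have "real m * al = 1 / 2" using al(2) by (simp add: mult.commute mult.left_commute)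
   ultimately have "((r^2 / A) powr real m) powr (- al) = (r^2 / A) powr (- (1 / 2))" by (simp only: powr_powr mult_minus_right)
   then show ?thesis using \<open>r^2 / A > 0\<close> by (simp add: powr_realpow)
  qed
  also have "(r^2 / A) powr (- (1 / 2)) = sqrt A / r"
   using rp A by (simp add: powr_minus_divide powr_half_sqrt real_sqrt_divide)
  finally have "r * (2 powr (- al) * (sqrt A / r)) <= r * pf (r^2)" using r by (intro mult_left_mono)
  moreover have "sqrt A * (1 - th) <= sqrt A * 2 powr (- al)" using half A by (intro mult_left_mono) auto
  ultimately show ?thesis using rp by (simp add: mult.commute)
 qed
 show ?thesis
  by (intro exI[of _ pf] exI[of _ pf'] conjI allI impI der cont one slope le disp)
qed

lemma short_upper_base:
 assumes c: "valid_path c" "c ` {0..1} \<subseteq> Xp" "path_length g0 c < ennreal L" and L: "0 <= L"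
  and nb: "!!t. t : {0..1} ==> norm (snd (c t)) < R" and hit: "t0 : {0..1}" "(norm (snd (c t0)))^2 <= rh^2 + dl"
 shows "Dd dl (c 0) (c 1) <= L + 30 * dl / rh"
proof -
 have d: "0 < dl" "4 * dl <= rh^2" and r2: "0 < rh^2" using ok rh by (auto simp: ok_def)
 have rh8: "rh <= 1 / 8" using rh R by simp
 have rh64: "rh^2 <= 1 / 64" using power_mono[OF rh8, of 2] rh by (simp add: power2_eq_square)
 define T where "T = {t : {0..1}. (norm (snd (c t)))^2 <= rh^2 + dl}"
 have cc: "continuous_on {0..1} c" using c(1) by (simp add: valid_path_def piecewise_C1_differentiable_on_def)
 have "continuous_on {0..1} (%t. (norm (snd (c t)))^2)" by (intro continuous_intros cc)
 then have "closed ({0..1} \<inter> (%t. (norm (snd (c t)))^2) -` {..rh^2 + dl})"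
  by (rule continuous_closed_preimage) auto
 moreover have "{0..1} \<inter> (%t. (norm (snd (c t)))^2) -` {..rh^2 + dl} = T" by (auto simp: T_def)
 ultimately have "closed T" by simp
 moreover have "bounded T" by (rule bounded_subset[OF bounded_closed_interval[of 0 1]]) (auto simp: T_def)
 ultimately have cT: "compact T" using compact_eq_bounded_closed by blast
 have "t0 : T" using hit by (simp add: T_def)
 then obtain s t where st: "s : T" "t : T" "!!ta. ta : T ==> s <= ta & ta <= t"
  using compact_attains_inf[OF cT] compact_attains_sup[OF cT] by blast
 have s01: "0 <= s" "s <= t" "t <= 1" using st by (auto simp: T_def)
 have off: "sg dl (snd (c ta)) = 0" if "ta : {0..1}" "ta ~: T" for ta
  using sg_zero[OF ok, of "snd (c ta)"] W_base[OF nb[OF that(1)]] that by (auto simp: T_def)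
 have p1: "plen (gd dl) c 0 s = plen g0 c 0 s"
  by (rule plen_off[of _ _ s]) (use off st(3) s01 in force)
 have p3: "plen (gd dl) c t 1 = plen g0 c t 1"
 proof (rule plen_off[of _ _ t])
  fix ta assume "ta : {t..1}" "ta ~= t"
  then have "ta : {0..1}" "ta ~: T" using s01 st(3)[of ta] by auto
  then show "sg dl (snd (c ta)) = 0" by (rule off)
 qed
 \<comment> \<open>The inner edge of the shell: at squared norm at most \<open>A\<close> the bump
   vanishes.\<close>
 define A where "A = rh^2 - dl"
 have A: "0 < A" "A < R^2" using d r2 R2 by (auto simp: A_def)
 have d1: "dl < 1" using d rh64 by linarith
 obtain pf pf' where sat: "!!N. 0 <= N ==> (pf has_real_derivative pf' N) (at N)" "continuous_on {0..} pf'"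
   "!!N. 0 <= N ==> 0 <= pf N & pf N <= 1 & (pf N + 2 * N * pf' N)^2 <= 1 & N * (pf N)^2 <= A"
   "!!r. 0 <= r ==> r - r * pf (r^2) <= max (r * dl) (r - sqrt A * (1 - dl))"
  using saturation[OF A(1) d(1) d1] by blast
 let ?Ph = "%y::real^'n. pf ((norm y)^2) *\<^sub>R y"
 let ?Ph' = "%y b::real^'n. pf ((norm y)^2) *\<^sub>R b + (2 * pf' ((norm y)^2) * (y \<bullet> b)) *\<^sub>R y"
 let ?Ps = "%z::'n pt. (fst z, ?Ph (snd z))"
 let ?Ps' = "%(z::'n pt) (v::'n pt). (fst v, ?Ph' (snd z) (snd v))"
 have C1s: "C1_map UNIV (%z. ?Ph (snd z)) (%z v. ?Ph' (snd z) (snd v))"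
  by (rule C1_map_compose[OF C1_map_snd radial_C1[OF sat(1,2), where U = UNIV]]) simp_all
 have C1: "C1_map UNIV ?Ps ?Ps'"
  using C1s C1_map_fst[of UNIV] unfolding C1_map_def by (auto intro!: has_derivative_Pair continuous_on_Pair)
 have psi01: "0 <= pf ((norm y)^2)" "pf ((norm y)^2) <= 1" for y :: "real^'n" using sat(3)[of "(norm y)^2"] by auto
 have Phn: "norm (?Ph y) <= norm y" "(norm (?Ph y))^2 <= A" for y :: "real^'n"
  using sat(3)[of "(norm y)^2"] by (auto simp: mult_left_le_one_le power_mult_distrib mult.commute intro!: mult_left_le)
 have mem: "?Ps z : Xp" "sg dl (snd (?Ps z)) = 0" if z: "z : Xp" "norm (snd z) < R" for z
 proof -
  have n: "norm (?Ph (snd z)) < R" using Phn(1)[of "snd z"] z by simp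
  show "?Ps z : Xp" using z n R by (auto simp: hyp_prod_def)
  show "sg dl (snd (?Ps z)) = 0" using sg_zero[OF ok, of "?Ph (snd z)"] W_base[OF n] Phn(2)[of "snd z"] by (simp add: A_def)
 qed
 define c2 where "c2 = subpath s t c"
 have c2: "valid_path c2" "c2 ` {0..1} \<subseteq> Xp" "c2 0 = c s" "c2 1 = c t"
   "path_length g0 c2 = plen g0 c s t"
  using valid_path_subpath[OF c(1), of s t] path_length_subpath[OF semi_HP c(1,2), of s t] s01
   path_image_subpath_subset[of s t c] c(2) by (auto simp: c2_def path_image_def subpath_def)
 have c2n: "norm (snd (c2 ta)) < R" if "ta : {0..1}" for ta
 proof -
  have "c2 ta : c ` {0..1}" using path_image_subpath_subset[of s t c] s01 that by (auto simp: c2_def path_image_def)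
  then show ?thesis using nb by auto
 qed
 have mid: "path_length (gd dl) (?Ps \<circ> c2) <= ennreal 1 * path_length g0 c2"
 proof (rule path_length_map_le[OF semi_HP c2(1,2) C1])
  fix ta :: real and v :: "'n pt" assume ta: "ta : {0..1}"
  let ?z = "c2 ta"
  have z: "?z : Xp" using c2(2) ta by auto
  have "hm (?Ph (snd ?z)) (?Ph' (snd ?z) (snd v)) (?Ph' (snd ?z) (snd v)) <= hm (snd ?z) (snd v) (snd v) - 0 * (conf (snd ?z) * (snd ?z \<bullet> snd v)^2 / (norm (snd ?z))^2)"
   by (rule radial_bound) (use sat(3)[of "(norm (snd ?z))^2"] c2n[OF ta] R in auto)
  then show "gd dl (?Ps ?z) (?Ps' ?z v) (?Ps' ?z v) <= 1^2 * g0 ?z v v"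
   using gd_off[OF ok mem(2)[OF z c2n[OF ta]]] by (simp add: hyp_prod_metric_def)
 qed auto
 have "riem_dist Xp (gd dl) ((?Ps \<circ> c2) 0) ((?Ps \<circ> c2) 1) <= path_length (gd dl) (?Ps \<circ> c2)"
  by (rule riem_dist_le_path_length[OF C1_map_path(1)[OF C1 c2(1)]]) (use c2(2) c2n mem(1) in auto)
 then have mid: "riem_dist Xp (gd dl) (?Ps (c s)) (?Ps (c t)) <= plen g0 c s t"
  using mid c2(3,4,5) by simp
 have pts: "c ta : Xp" if "ta : {0..1}" for ta using c(2) that by auto
 have in01: "0 : {0..(1::real)}" "1 : {0..(1::real)}" "s : {0..1}" "t : {0..1}" using s01 by auto
 note re = riem_dist_eq_rdist[OF semi_gd convex_HP]
 have fin: "plen g0 c 0 s + (plen g0 c s t + plen g0 c t 1) = path_length g0 c"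
  using plen_add[OF semi_HP c(1,2), of s t 1] plen_add[OF semi_HP c(1,2), of 0 s 1] s01 by (simp add: path_length_plen)
 have "riem_dist Xp (gd dl) (c 0) (c s) <= plen g0 c 0 s"
  using riem_dist_le_plen[OF semi_gd c(1,2), of 0 s] p1 s01 by simp
 moreover have "riem_dist Xp (gd dl) (c t) (c 1) <= plen g0 c t 1"
  using riem_dist_le_plen[OF semi_gd c(1,2), of t 1] p3 s01 by simp
 ultimately have "riem_dist Xp (gd dl) (c 0) (c s) + (riem_dist Xp (gd dl) (?Ps (c s)) (?Ps (c t)) + riem_dist Xp (gd dl) (c t) (c 1))
   <= path_length g0 c"
  unfolding fin[symmetric] by (intro add_mono mid)
 also have "... <= ennreal L" using c(3) by simp
 finally have "riem_dist Xp (gd dl) (c 0) (c s) + (riem_dist Xp (gd dl) (?Ps (c s)) (?Ps (c t)) + riem_dist Xp (gd dl) (c t) (c 1)) <= ennreal L" .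
 then have sum: "Dd dl (c 0) (c s) + Dd dl (?Ps (c s)) (?Ps (c t)) + Dd dl (c t) (c 1) <= L"
  using re pts in01 mem(1) nb L by (simp add: ennreal_plus[symmetric] del: ennreal_plus)
 \<comment> \<open>The points of first entry and last exit are linked to their images by vertical
   segments. With \<open>th = dl\<close> in \<open>saturation\<close> their length is of order
   \<open>dl\<close>.\<close>
 have disp: "Dd dl (c ta) (?Ps (c ta)) <= 15 * dl / rh" if ta: "ta : T" for ta
 proof -
  have t01: "ta : {0..1}" using ta by (simp add: T_def)
  let ?y = "snd (c ta)" and ?r = "norm (snd (c ta))"
  have r: "?r^2 <= rh^2 + dl" using ta by (simp add: T_def)
  have "norm (?Ph ?y) < R" using Phn(1)[of ?y] nb[OF t01] by simp
  then have "Dd dl (fst (c ta), ?y) (fst (c ta), ?Ph ?y) <= 5 * norm (?Ph ?y - ?y)"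
   by (intro Dd_vertical HP_D(1)[OF pts[OF t01]] nb[OF t01])
  also have "?Ph ?y - ?y = - (1 - pf (?r^2)) *\<^sub>R ?y" by (simp add: algebra_simps)
  also have "norm (- (1 - pf (?r^2)) *\<^sub>R ?y) = ?r - ?r * pf (?r^2)" using psi01[of ?y] by (simp only: norm_scaleR) (simp add: algebra_simps)
  also have "... <= max (?r * dl) (?r - sqrt A * (1 - dl))" by (rule sat(4)) simp
  also have "... <= 3 * dl / rh"
  proof (rule max.boundedI)
   have "?r * dl <= 1 * dl" using nb[OF t01] R d by (intro mult_right_mono) auto
   also have "... <= 3 * dl / rh" using d rh rh8 by (simp add: field_simps)
   finally show "?r * dl <= 3 * dl / rh" .
   have "?r <= sqrt (rh^2 + dl)" using r by (intro real_le_rsqrt)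
   also have "... <= rh + dl / rh"
    using rh d by (intro real_le_lsqrt) (auto simp: power2_sum power_divide)
   finally have 1: "?r <= rh + dl / rh" .
   have "rh - dl / rh <= sqrt A"
   proof (rule real_le_rsqrt)
    have "(dl / rh)^2 <= dl" using d r2 by (simp add: power_divide pos_divide_le_eq power2_eq_square)
    then show "(rh - dl / rh)^2 <= A" using rh by (simp add: A_def power2_diff)
   qed
   moreover have "sqrt A <= 1" using A R2 by (simp add: real_sqrt_le_1_iff)
   then have "sqrt A * dl <= 1 * dl" using d by (intro mult_right_mono) auto
   moreover have "dl <= dl / rh" using d rh rh8 by (simp add: field_simps)
   moreover have "sqrt A * (1 - dl) = sqrt A - sqrt A * dl" "3 * dl / rh = 3 * (dl / rh)" by (simp_all add: algebra_simps)
   ultimately show "?r - sqrt A * (1 - dl) <= 3 * dl / rh" using 1 by linarith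
  qed
  finally show ?thesis by simp
 qed
 have q: "?Ps (c s) : Xp" "?Ps (c t) : Xp" using mem(1) pts in01 nb by auto
 have "Dd dl (c 0) (c 1) <= Dd dl (c 0) (c s) + (Dd dl (c s) (?Ps (c s)) + (Dd dl (?Ps (c s)) (?Ps (c t)) + (Dd dl (?Ps (c t)) (c t) + Dd dl (c t) (c 1))))"
  using Dd_triangle[OF pts[OF in01(1)] pts[OF in01(3)] pts[OF in01(2)]] Dd_triangle[OF pts[OF in01(3)] q(1) pts[OF in01(2)]]
   Dd_triangle[OF q pts[OF in01(2)]] Dd_triangle[OF q(2) pts[OF in01(4)] pts[OF in01(2)]] by linarith
 then show ?thesis using sum disp[OF st(1)] disp[OF st(2)] by (simp add: Dd_sym[of "?Ps (c t)"])
qed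

text \<open>If the path meets a shell, a lattice element moves the meeting point into the base ball,
  and a path of length below \<open>R / 5\<close> cannot leave that ball.\<close>

lemma short_upper:
 assumes pq: "p : Xp" "q : Xp" "D0 p q < L" and L: "0 <= L" "L <= R / 5"
 shows "Dd dl p q <= L + 30 * dl / rh"
proof -
 have err: "0 <= 30 * dl / rh" using ok rh by (simp add: ok_def)
 obtain c where c: "valid_path c" "c ` {0..1} \<subseteq> Xp" "c 0 = p" "c 1 = q" "path_length g0 c < ennreal L"
  using short_path[OF semi_HP pq] by metis
 have pts: "c t : Xp" if "t : {0..1}" for t using c(2) that by auto
 show ?thesis
 proof (cases "EX t0:{0..1}. sg dl (snd (c t0)) ~= 0")
  case False
  then have "plen (gd dl) c 0 1 = plen g0 c 0 1" by (intro plen_off[of _ _ 0]) auto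
  then have "riem_dist Xp (gd dl) (c 0) (c 1) <= ennreal L"
   using riem_dist_le_plen[OF semi_gd c(1,2), of 0 1] c(5) by (simp add: path_length_plen)
  then show ?thesis using rdist_le_iff[OF semi_gd convex_HP pq(1,2) L(1)] c(3,4) err by simp
 next
  case True
  then obtain t0 where t0: "t0 : {0..1}" "sg dl (snd (c t0)) ~= 0" by blast
  have m0: "snd (c t0) : HS" using HP_D(2)[OF pts[OF t0(1)]] .
  have Wt0: "\<bar>W (snd (c t0)) - rh^2\<bar> < dl" using sg_zero[OF ok] t0(2) by force
  have "near (snd (c t0))" using sg_far[OF ok] t0(2) by blast
  then obtain ga where g: "ga : Gm" "norm (ga (snd (c t0))) < R" by (auto simp: near_def)
  have wt0: "(norm (ga (snd (c t0))))^2 <= rh^2 + dl" using wd_near(2)[OF m0 g] Wt0 by (simp add: W_def)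
  \<comment> \<open>\<open>rh^2 + dl <= 5/4 rh^2 <= 5/16 R^2\<close>, by
    \<open>4 * dl <= rh^2\<close> and \<open>4 * rh^2 <= R^2\<close>.\<close>
  also have "... <= (R * 6 / 10)^2" using R2(3) ok by (simp add: ok_def power_mult_distrib power_divide)
  finally have n0: "norm (ga (snd (c t0))) <= R * 6 / 10" using R by (simp add: power2_le_iff_abs_le)
  let ?f = "map_prod e ga" and ?c = "map_prod e ga \<circ> c"
  have C1: "C1_map Xp ?f (%z. map_prod (FD e (fst z)) (FD ga (snd z)))"
   by (rule map_prod_C1[OF isom[OF e_in] isom[OF g(1)]])
  have img: "?f ` Xp \<subseteq> Xp" by (rule map_prod_image[OF isom[OF e_in] isom[OF g(1)]])
  have vc: "valid_path ?c" by (rule C1_map_path(1)[OF C1 c(1,2)])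
  have ic: "?c ` {0..1} \<subseteq> Xp" using img c(2) by (auto simp: image_comp[symmetric])
  have "path_length g0 ?c <= ennreal 1 * path_length g0 c"
  proof (rule path_length_map_le[OF semi_HP c(1,2) C1 c(2)])
   fix t :: real and v assume t: "t : {0..1}"
   show "g0 (?f (c t)) (map_prod (FD e (fst (c t))) (FD ga (snd (c t))) v)
     (map_prod (FD e (fst (c t))) (FD ga (snd (c t))) v) <= 1^2 * g0 (c t) v v"
    using hyp_isomD(6)[OF isom[OF e_in] HP_D(1)[OF pts[OF t]]] hyp_isomD(6)[OF isom[OF g(1)] HP_D(2)[OF pts[OF t]]]
    by (cases "c t"; cases v) (simp add: hyp_prod_metric_def)
  qed simp
  then have pl: "path_length g0 ?c < ennreal L" using c(5) by simp
  have nb: "norm (snd (?c t)) < R" if t: "t : {0..1}" for t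
  proof -
   have tt: "hdist (ga (snd (c t0))) (ga (snd (c t))) < 2 * L"
   proof -
    have a: "hdist (snd (c 0)) (snd (c u)) < L" if u: "u : {0..1}" for u
    proof -
     have "hdist (snd (c 0)) (snd (c u)) <= 1 * D0 (c 0) (c u)"
      by (rule rdist_map_le[OF semi_HP convex_HP semi_hyp convex_ball C1_map_snd])
       (use pts u in "auto simp: hyp_prod_def hyp_prod_metric_def hyp_nonneg[OF ok]")
     then show ?thesis using path_points[OF semi_HP c(1,2,5) u] by simp
    qed
    have m: "snd (c 0) : HS" "snd (c t) : HS" using HP_D(2)[OF pts] t by auto
    have "hdist (snd (c t0)) (snd (c t)) < 2 * L"
     using hdist_triangle[OF m0 m(1,2)] a[OF t0(1)] a[OF t] hdist_sym[of "snd (c t0)"] by simp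
    then show ?thesis using dist_inv[OF g(1) m0 m(2)] by simp
   qed
   have "2 * norm (ga (snd (c t)) - ga (snd (c t0))) <= hdist (ga (snd (c t0))) (ga (snd (c t)))"
    by (rule hdist_ge_norm[OF in_ball[OF g(1) m0] in_ball[OF g(1) HP_D(2)[OF pts[OF t]]]])
   then have "norm (ga (snd (c t)) - ga (snd (c t0))) < R / 5" using tt L by linarith
   then show ?thesis using norm_triangle_sub[of "ga (snd (c t))" "ga (snd (c t0))"] n0 R by (cases "c t") auto
  qed
  have "Dd dl (?c 0) (?c 1) <= L + 30 * dl / rh"
   by (rule short_upper_base[OF vc ic pl L(1) nb t0(1)]) (use wt0 in "auto simp: split_beta")
  then show ?thesis using Dd_invariant[OF isom[OF e_in] g(1) pq(1,2)] c(3,4) by simp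
 qed
qed

end

end

subsection \<open>Volume growth rates\<close>

text \<open>Fekete's subadditive lemma for real arguments, with the infimum of
  \<open>F R / R\<close> as limit; monotonicity controls \<open>F\<close> between the multiples of
  \<open>m\<close>.\<close>

lemma fekete_mono:
 fixes F :: "real => real"
 assumes mono: "!!R S. 0 < R ==> R <= S ==> F R <= F S" and nn: "!!R. 0 < R ==> 0 <= F R"
  and sub: "!!R S. 0 < R ==> 0 < S ==> F (R + S) <= F R + F S"
 shows "EX h. ((%R. F R / R) \<longlongrightarrow> h) at_top"
proof -
 define A where "A = (%R. F R / R) ` {0<..}"
 define h where "h = Inf A"
 have A: "A ~= {}" "bdd_below A" using nn by (auto simp: A_def intro!: bdd_belowI[of _ 0])
 have mult: "F (real (Suc k) * m) <= real (Suc k) * F m" if m: "0 < m" for k m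
 proof (induction k)
  case (Suc k)
  have "F (m + real (Suc k) * m) <= F m + F (real (Suc k) * m)" using m by (intro sub) auto
  then show ?case using Suc by (simp add: algebra_simps)
 qed simp
 have lim: "EX h. ((%R. F R / R) \<longlongrightarrow> h) at_top"
 proof (rule exI, rule tendstoI)
  fix ep :: real assume ep: "0 < ep"
  have "Inf A < h + ep / 2" using ep by (simp add: h_def)
  then obtain m where m: "0 < m" "F m / m < h + ep / 2" using cInf_less_iff[OF A] by (auto simp: A_def)
  have "((%R. F m / R) \<longlongrightarrow> 0) at_top" by real_asymp
  then have "\<forall>\<^sub>F R in at_top. F m / R < ep / 2" by (rule order_tendstoD) (use ep in simp)
  then show "\<forall>\<^sub>F R in at_top. dist (F R / R) h < ep"
   using eventually_gt_at_top[of 0]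
  proof eventually_elim
   case (elim R)
   have low: "h <= F R / R" unfolding h_def by (rule cInf_lower[OF _ A(2)]) (use elim in "auto simp: A_def")
   define k where "k = nat \<lfloor>R / m\<rfloor>"
   have k: "real k <= R / m" "R / m <= real (Suc k)"
    using elim m by (auto simp: k_def of_nat_nat) linarith+
   have "F R <= F (real (Suc k) * m)" using k m elim by (intro mono) (auto simp: field_simps)
   also have "... <= real (Suc k) * F m" by (rule mult[OF m(1)])
   also have "... <= (R / m + 1) * F m" using k nn[OF m(1)] by (intro mult_right_mono) auto
   finally have "F R / R <= (R / m + 1) * F m / R" using elim by (intro divide_right_mono) auto
   also have "... = F m / m + F m / R" using elim m by (simp add: field_simps)
   finally have "F R / R < h + ep" using m elim by linarith
   then show ?case using low by (simp add: dist_real_def)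
  qed
 qed
 then show ?thesis .
qed

text \<open>A setting in which the exponential growth rate of balls exists: distances can be split,
  small balls have uniformly bounded volume, and \<open>move\<close> makes the space coarsely
  homogeneous. \<open>move\<close> speaks of distances only; volumes are transported by counting
  separated points.\<close>

locale growth =
 fixes X :: "'a set" and d :: "'a => 'a => real" and M :: "'a measure" and o' :: 'a and K a b :: real
 assumes refl: "p : X ==> d p p = 0" and sym: "d p q = d q p"
  and tri: "p : X ==> q : X ==> r : X ==> d p r <= d p q + d q r"
  and split: "p : X ==> q : X ==> d p q < s + t ==> 0 < s ==> 0 < t ==> EX w:X. d p w < s & d w q < t"
  and move: "w : X ==> EX f. f ` X \<subseteq> X & (ALL p:X. ALL q:X. d (f p) (f q) = d p q) & d o' (f w) <= K"
  and o: "o' : X" and a: "0 < a" and K: "0 <= K"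
  and sets: "p : X ==> {q : X. d p q < s} : sets M"
  and fin: "p : X ==> emeasure M {q : X. d p q < s} ~= \<infinity>"
  and lo: "p : X ==> a <= measure M {q : X. d p q < 1 / 2}"
  and hi: "p : X ==> measure M {q : X. d p q < 1} <= b"
begin

definition B where "B p r = {q : X. d p q < r}"

definition V where "V p r = measure M (B p r)"

definition sep where "sep p r E \<longleftrightarrow> finite E & E \<subseteq> B p r & (ALL x:E. ALL y:E. x ~= y --> 1 <= d x y)"

lemma B_fmeasurable: "p : X ==> B p r : fmeasurable M"
 using sets[of p r] fin[of p r] by (intro fmeasurableI) (auto simp: B_def top.not_eq_extremum)

lemma V_mono: "p : X ==> q : X ==> d p q + r <= s ==> V q r <= V p s"
 unfolding V_def
proof (rule measure_mono_fmeasurable)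
 assume "p : X" "q : X" "d p q + r <= s"
 then show "B q r \<subseteq> B p s" using tri[of p q] by (fastforce simp: B_def)
qed (auto intro: B_fmeasurable fmeasurableD)

lemma V_low: "p : X ==> 1 / 2 <= r ==> a <= V p r"
 using lo[of p] V_mono[of p p "1/2" r] refl[of p] by (simp add: V_def B_def)

lemma card_sep:
 assumes p: "p : X" and E: "sep p r E"
 shows "real (card E) * a <= V p (r + 1 / 2)"
proof -
 have EX: "x : X" if "x : E" for x using E that by (auto simp: sep_def B_def)
 have "disjoint_family_on (%x. B x (1 / 2)) E"
  unfolding disjoint_family_on_def
 proof (intro ballI impI)
  fix x y assume xy: "x : E" "y : E" "x ~= y"
  then have "1 <= d x y" using E by (simp add: sep_def)
  then show "B x (1 / 2) \<inter> B y (1 / 2) = {}" using tri[OF EX[OF xy(1)] _ EX[OF xy(2)]] sym[of y] by (fastforce simp: B_def)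
 qed
 then have "(\<Sum>x\<in>E. V x (1 / 2)) = measure M (\<Union>x\<in>E. B x (1 / 2))"
  unfolding V_def using E EX B_fmeasurable
  by (intro measure_finite_Union[symmetric]) (auto simp: sep_def fmeasurable_def top.not_eq_extremum)
 also have "... <= V p (r + 1 / 2)"
  unfolding V_def
 proof (rule measure_mono_fmeasurable)
  show "(\<Union>x\<in>E. B x (1 / 2)) \<subseteq> B p (r + 1 / 2)"
  proof safe
   fix x y assume x: "x : E" "y : B x (1 / 2)"
   then have "d p x < r" "x : X" "y : X" "d x y < 1 / 2" using E by (auto simp: sep_def B_def)
   then show "y : B p (r + 1 / 2)" using tri[OF p, of x y] by (auto simp: B_def)
  qed
  show "(\<Union>x\<in>E. B x (1 / 2)) : sets M"
   using E EX B_fmeasurable by (intro sets.finite_UN) (auto simp: sep_def)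
 qed (rule B_fmeasurable[OF p])
 finally have "(\<Sum>x\<in>E. V x (1 / 2)) <= V p (r + 1 / 2)" .
 moreover have "real (card E) * a <= (\<Sum>x\<in>E. V x (1 / 2))"
  using sum_mono[of E "%_. a" "%x. V x (1 / 2)"] V_low EX by simp
 ultimately show ?thesis by linarith
qed

text \<open>\<open>card_sep\<close> limits the size of separated sets, so there is a largest one,
  and maximality makes it a net.\<close>

lemma net:
 assumes p: "p : X"
 obtains E where "sep p r E" "!!q. q : B p r ==> EX x:E. d x q < 1"
proof -
 have "EX E. sep p r E & (ALL F. sep p r F --> card F <= card E)"
 proof (rule ex_has_greatest_nat)
  show "sep p r {}" by (simp add: sep_def)
  show "ALL F. sep p r F --> card F < Suc (nat \<lfloor>V p (r + 1 / 2) / a\<rfloor>)"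
   using card_sep[OF p] a by (auto simp: le_nat_floor pos_le_divide_eq less_Suc_eq_le)
 qed
 then obtain E where E: "sep p r E" "!!F. sep p r F ==> card F <= card E" by blast
 have "EX x:E. d x q < 1" if q: "q : B p r" for q
 proof (rule ccontr)
  assume n: "~ (EX x:E. d x q < 1)"
  then have "q ~: E" using refl q by (auto simp: B_def)
  moreover have "sep p r (insert q E)"
   using E(1) n q sym by (auto simp: sep_def not_less)
  ultimately show False using E(2)[of "insert q E"] E(1) by (simp add: sep_def)
 qed
 then show thesis using E(1) that by blast
qed

lemma V_le_net:
 assumes "sep p r E" "!!q. q : A ==> EX x:E. d x q < s" "A \<subseteq> X" "A : sets M"
  and "!!x. x : E ==> V x s <= c"
 shows "measure M A <= real (card E) * c"
proof -
 have EX: "x : X" if "x : E" for x using assms(1) that by (auto simp: sep_def B_def)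
 have "measure M A <= measure M (\<Union>x\<in>E. B x s)"
  by (rule measure_mono_fmeasurable) (use assms EX B_fmeasurable in "fastforce simp: sep_def B_def intro!: fmeasurable.finite_UN")+
 also have "... <= (\<Sum>x\<in>E. V x s)"
  unfolding V_def using assms(1) EX B_fmeasurable by (intro measure_UNION_le) (auto simp: sep_def)
 also have "... <= real (card E) * c" using sum_mono[of E "%x. V x s" "%_. c"] assms(5) by simp
 finally show ?thesis .
qed

lemma B_sets: "p : X ==> B p r : sets M" using B_fmeasurable by blast

lemma b_pos: "0 < b" using V_low[OF o, of 1] hi[OF o] a by (simp add: V_def B_def)

text \<open>A net of the ball at \<open>w\<close> is carried to the neighbourhood of
  \<open>o'\<close> by a distance preserving map and counted there; each point stands for a volume
  between \<open>a\<close> and \<open>b\<close>.\<close>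

lemma V_other:
 assumes w: "w : X" shows "V w r <= b / a * V o' (r + 1 / 2 + K)"
proof -
 obtain f where f: "f ` X \<subseteq> X" "!!p q. p : X ==> q : X ==> d (f p) (f q) = d p q" "d o' (f w) <= K" using move[OF w] by metis
 obtain E where E: "sep w r E" "!!q. q : B w r ==> EX x:E. d x q < 1" using net[OF w] by metis
 have EX: "E \<subseteq> X" using E by (auto simp: sep_def B_def)
 have inj: "inj_on f E"
 proof (rule inj_onI)
  fix x y assume xy: "x : E" "y : E" "f x = f y"
  then have X: "x : X" "y : X" "f y : X" using EX f(1) by auto
  then have "d x y = 0" using f(2)[OF X(1,2)] refl[OF X(3)] xy by simp
  then show "x = y" using E(1) xy by (force simp: sep_def)
 qed
 have "sep o' (r + K) (f ` E)"
  unfolding sep_def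
 proof (intro conjI)
  show "finite (f ` E)" using E by (simp add: sep_def)
  show "f ` E \<subseteq> B o' (r + K)"
  proof safe
   fix x assume x: "x : E"
   then have "d (f w) (f x) < r" "x : X" using E(1) f(2)[OF w, of x] by (auto simp: sep_def B_def)
   moreover from this have "f w : X" "f x : X" using f(1) w by auto
   ultimately show "f x : B o' (r + K)" using tri[OF o, of "f w" "f x"] f(3) by (auto simp: B_def)
  qed
  show "ALL x:f ` E. ALL y:f ` E. x ~= y --> 1 <= d x y" using E(1) f(2) EX by (auto simp: sep_def subset_iff)
 qed
 from card_sep[OF o this] have c: "real (card E) <= V o' (r + 1 / 2 + K) / a"
  using a inj by (simp add: card_image pos_le_divide_eq add_ac)
 have "V w r <= real (card E) * b"
  unfolding V_def by (rule V_le_net[OF E(1), of _ 1]) (use E w B_sets EX hi in "auto simp: B_def V_def")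
 also have "... <= V o' (r + 1 / 2 + K) / a * b" using c b_pos by (intro mult_right_mono) auto
 finally show ?thesis by (simp add: mult.commute)
qed

text \<open>Submultiplicativity up to constants: a point of the large ball lies within
  \<open>S\<close> of a point of the ball of radius \<open>R\<close>, hence within
  \<open>S + 1\<close> of a net of that ball.\<close>

lemma V_sub:
 assumes "0 < R" "0 < S"
 shows "V o' (R + S) <= b / a / a * V o' (R + (K + 2)) * V o' (S + (K + 2))"
proof -
 obtain E where E: "sep o' R E" "!!q. q : B o' R ==> EX x:E. d x q < 1" using net[OF o] by metis
 have EX: "E \<subseteq> X" using E by (auto simp: sep_def B_def)
 have "V o' (R + S) <= real (card E) * (b / a * V o' (S + (K + 2)))"
  unfolding V_def[of o' "R + S"]
 proof (rule V_le_net[OF E(1), of _ "S + 1"])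
  fix q assume q: "q : B o' (R + S)"
  then obtain w where w: "w : X" "d o' w < R" "d w q < S" using split[OF o, of q R S] assms by (auto simp: B_def)
  then obtain x where x: "x : E" "d x w < 1" using E(2)[of w] by (auto simp: B_def)
  have "d x q <= d x w + d w q" using x w q EX by (intro tri) (auto simp: B_def)
  then show "EX x:E. d x q < S + 1" using x w by (intro bexI[of _ x]) auto
 next
  fix x assume x: "x : E"
  have "V x (S + 1) <= b / a * V o' (S + 1 + 1 / 2 + K)" by (rule V_other) (use x EX in auto)
  also have "... <= b / a * V o' (S + (K + 2))"
   using a b_pos refl[OF o] by (intro mult_left_mono V_mono[OF o o]) auto
  finally show "V x (S + 1) <= b / a * V o' (S + (K + 2))" .
 qed (use B_sets o in "auto simp: B_def")
 also have "... <= V o' (R + (K + 2)) / a * (b / a * V o' (S + (K + 2)))"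
 proof (rule mult_right_mono)
  have "real (card E) * a <= V o' (R + (K + 2))"
   using card_sep[OF o E(1)] V_mono[OF o o, of "R + 1 / 2" "R + (K + 2)"] refl[OF o] K by simp
  then show "real (card E) <= V o' (R + (K + 2)) / a" using a by (simp add: pos_le_divide_eq)
 qed (use a b_pos in "simp add: V_def")
 finally show ?thesis by (simp add: mult_ac)
qed

theorem growth_rate: "EX h. ALL p:X. ((%R. ln (V p R) / R) \<longlongrightarrow> h) at_top"
proof -
 \<comment> \<open>The shift by \<open>2 * K'\<close> and the factor \<open>C\<close> absorb the
   constants of \<open>V_sub\<close>, making \<open>F\<close> subadditive and nonnegative without
   error terms.\<close>
 define K' where "K' = K + 2"
 define C where "C = max (b / a / a) (1 / a)"
 have C: "0 < C" "b / a / a <= C" "1 / a <= C" using a by (auto simp: C_def less_max_iff_disj)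
 have K': "2 <= K'" using K by (simp add: K'_def)
 define F where "F R = ln (C * V o' (R + 2 * K'))" for R
 have Vp: "a <= V o' R" "1 <= C * V o' R" if "1 <= R" for R
 proof -
  show v: "a <= V o' R" using V_low[OF o, of R] that by simp
  have "1 / a * a <= C * V o' R" using v C a by (intro mult_mono) auto
  then show "1 <= C * V o' R" using a by simp
 qed
 have Vm: "V o' R <= V o' S" if "R <= S" for R S using V_mono[OF o o, of R S] refl[OF o] that by simp
 have "EX h. ((%R. F R / R) \<longlongrightarrow> h) at_top"
 proof (rule fekete_mono)
  fix R S :: real assume R: "0 < R"
  have 1: "1 <= C * V o' (R + 2 * K')" using R K' by (intro Vp) auto
  then show "0 <= F R" by (simp add: F_def)
  show "F R <= F S" if "R <= S"
   unfolding F_def using 1 C Vm[of "R + 2 * K'" "S + 2 * K'"] that by (intro ln_mono mult_left_mono) auto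
  show "F (R + S) <= F R + F S" if S: "0 < S"
  proof -
   have 2: "1 <= C * V o' (S + 2 * K')" using S K' by (intro Vp) auto
   have 3: "1 <= C * V o' (R + S + 2 * K')" using S R K' by (intro Vp) auto
   have "V o' ((R + K') + (S + K')) <= b / a / a * V o' ((R + K') + (K + 2)) * V o' ((S + K') + (K + 2))"
    using R S K' by (intro V_sub) auto
   also have "... <= C * V o' ((R + K') + (K + 2)) * V o' ((S + K') + (K + 2))"
    using C by (intro mult_right_mono) (auto simp: V_def)
   finally have "V o' (R + S + 2 * K') <= C * V o' (R + 2 * K') * V o' (S + 2 * K')"
    by (simp add: K'_def algebra_simps)
   then have "C * V o' (R + S + 2 * K') <= C * (C * V o' (R + 2 * K') * V o' (S + 2 * K'))"
    using C by (intro mult_left_mono) auto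
   then have "F (R + S) <= ln ((C * V o' (R + 2 * K')) * (C * V o' (S + 2 * K')))"
    unfolding F_def using 3 by (intro ln_mono) (auto simp: mult_ac)
   also have "... = F R + F S" unfolding F_def using 1 2 by (intro ln_mult_pos) auto
   finally show ?thesis .
  qed
 qed
 then obtain h where h: "((%R. F R / R) \<longlongrightarrow> h) at_top" by blast
 have shift: "((%R. (F (R + c) - ln C) / R) \<longlongrightarrow> h) at_top" for c
 proof -
  have "((%R. F (R + c) / (R + c) * ((R + c) / R) - ln C / R) \<longlongrightarrow> h * 1 - 0) at_top"
  proof (intro tendsto_diff tendsto_mult)
   show "((%R. F (R + c) / (R + c)) \<longlongrightarrow> h) at_top"
    by (rule filterlim_compose[OF h]) real_asymp
   show "((%R. (R + c) / R) \<longlongrightarrow> 1) at_top" by real_asymp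
   show "((%R. ln C / R) \<longlongrightarrow> 0) at_top" by real_asymp
  qed
  moreover have "\<forall>\<^sub>F R in at_top. F (R + c) / (R + c) * ((R + c) / R) - ln C / R = (F (R + c) - ln C) / R"
   using eventually_gt_at_top[of "max 0 (- c)"] by eventually_elim (simp add: diff_divide_distrib)
  ultimately have "((%R. (F (R + c) - ln C) / R) \<longlongrightarrow> h * 1 - 0) at_top" by (rule Lim_transform_eventually)
  then show ?thesis by simp
 qed
 have "((%R. ln (V p R) / R) \<longlongrightarrow> h) at_top" if p: "p : X" for p
 proof (rule tendsto_sandwich[OF _ _ shift[of "- (2 * K') - d o' p"] shift[of "d o' p"]])
  have dn: "0 <= d o' p" using tri[OF o p o] refl[OF o] sym[of p] by simp
  have eq: "F R - ln C = ln (V o' (R + 2 * K'))" if "1 <= R + 2 * K'" for R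
   using C Vp(1)[OF that] a by (simp add: F_def ln_mult_pos)
  show "\<forall>\<^sub>F R in at_top. (F (R + (- (2 * K') - d o' p)) - ln C) / R <= ln (V p R) / R"
   using eventually_gt_at_top[of "1 + d o' p"]
  proof eventually_elim
   case (elim R)
   have "0 < V o' (R - d o' p)" using Vp(1)[of "R - d o' p"] elim a by simp
   moreover have "V o' (R - d o' p) <= V p R" using V_mono[OF p o, of "R - d o' p" R] sym[of p] by simp
   ultimately show ?case using eq[of "R + (- (2 * K') - d o' p)"] elim dn by (intro divide_right_mono) (auto intro: ln_mono)
  qed
  show "\<forall>\<^sub>F R in at_top. ln (V p R) / R <= (F (R + d o' p) - ln C) / R"
   using eventually_gt_at_top[of "1 + d o' p"]
  proof eventually_elim
   case (elim R)
   have "0 < V p R" using V_low[OF p, of R] elim dn a by simp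
   moreover have "V p R <= V o' (R + d o' p + 2 * K')" using V_mono[OF o p, of R "R + d o' p + 2 * K'"] K' by simp
   ultimately show ?case using eq[of "R + d o' p"] elim dn K' by (intro divide_right_mono) (auto intro: ln_mono)
  qed
 qed
 then show ?thesis by blast
qed

end

lemma growth_compare:
 fixes V V' :: "real => real"
 assumes h: "((%R. ln (V R) / R) \<longlongrightarrow> h) at_top" and h': "((%R. ln (V' R) / R) \<longlongrightarrow> h') at_top"
  and le: "\<forall>\<^sub>F R in at_top. 0 < V R & V R <= V' (al * R + be)" and al: "0 < al"
 shows "h <= al * h'"
proof (rule tendsto_le[OF _ _ h])
 show "((%R. ln (V' (al * R + be)) / (al * R + be) * ((al * R + be) / R)) \<longlongrightarrow> al * h') at_top"
  unfolding mult.commute[of al h']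
 proof (rule tendsto_mult)
  show "((%R. ln (V' (al * R + be)) / (al * R + be)) \<longlongrightarrow> h') at_top"
   by (rule filterlim_compose[OF h']) (use al in real_asymp)
  show "((%R. (al * R + be) / R) \<longlongrightarrow> al) at_top" using al by real_asymp
 qed
 have "filterlim (%R. al * R + be) at_top at_top" using al by real_asymp
 then have "\<forall>\<^sub>F R in at_top. 0 < al * R + be" by (simp add: filterlim_at_top_dense)
 then show "\<forall>\<^sub>F R in at_top. ln (V R) / R <= ln (V' (al * R + be)) / (al * R + be) * ((al * R + be) / R)"
  using le eventually_gt_at_top[of 0]
 proof eventually_elim
  case (elim R)
  then have "ln (V R) <= ln (V' (al * R + be))" by (intro ln_mono) auto
  then show ?case using elim by (simp add: divide_right_mono)
 qed
qed simp

lemma growth_bound: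
 fixes V :: "real => real"
 assumes h: "((%R. ln (V R) / R) \<longlongrightarrow> h) at_top" and mono: "!!R S. R <= S ==> V R <= V S" and ep: "h < h'" "0 <= h'"
 shows "EX c>=0. ALL R>=0. V R <= exp (h' * R + c)"
proof -
 obtain R1 where R1: "!!R. R >= R1 ==> ln (V R) / R < h'"
  using order_tendstoD(2)[OF h ep(1)] unfolding eventually_at_top_linorder by blast
 define R0 where "R0 = max R1 1"
 have R0: "R0 > 0" "!!R. R >= R0 ==> ln (V R) / R < h'" using R1 by (auto simp: R0_def)
 define c where "c = max 0 (ln (V R0))"
 have "V R <= exp (h' * R + c)" if R: "R >= 0" for R
 proof (cases "0 < V R")
  case True
  show ?thesis
  proof (cases "R0 <= R")
   case T: True
   then have "ln (V R) <= h' * R" using R0(2)[OF T] R0(1) by (simp add: pos_divide_less_eq)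
   moreover have "0 <= c" by (simp add: c_def)
   ultimately have "exp (ln (V R)) <= exp (h' * R + c)" unfolding exp_le_cancel_iff by linarith
   then show ?thesis using True by simp
  next
   case False
   then have "V R <= V R0" by (intro mono) auto
   also have v: "V R0 = exp (ln (V R0))" using True \<open>V R <= V R0\<close> by (intro exp_ln[symmetric]) linarith
   also have "exp (ln (V R0)) <= exp (h' * R + c)"
    using mult_nonneg_nonneg[OF ep(2) R] max.cobounded2[of "ln (V R0)" 0] unfolding c_def exp_le_cancel_iff by linarith
   finally show ?thesis .
  qed
 next
  case False
  then show ?thesis using exp_gt_zero[of "h' * R + c"] by linarith
 qed
 then show ?thesis by (intro exI[of _ c]) (auto simp: c_def)
qed

subsection \<open>Volumes of hyperbolic balls\<close>

definition hball :: "real^'n::finite => real => (real^'n) set" where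
 "hball x r = {y : HS. hdist x y < r}"

definition dens :: "real^'n::finite => real" where
 "dens x = (2 / (1 - (norm x)^2)) ^ CARD('n)"

text \<open>A density on the whole space; it is applied to subsets of the ball.\<close>

definition hvol :: "(real^'n::finite) measure" where
 "hvol = density lborel (%x. ennreal (dens x))"

lemma dens_measurable [measurable]: "dens : borel_measurable borel"
 unfolding dens_def by measurable

lemma dens_nonneg: "x : HS ==> 0 <= dens x"
 using norm_sq_less_1[of x] by (simp add: dens_def)

lemma open_hball:
 fixes x :: "real^'n::finite"
 assumes x: "x : HS" shows "open (hball x r)"
 unfolding open_contains_ball
proof
 fix y assume y: "y : hball x r"
 then have yb: "norm y < 1" and s: "0 < r - hdist x y" by (auto simp: hball_def)
 define t where "t = (1 + norm y) / 2"
 have t: "norm y < t" "t < 1" "0 <= t" using yb by (auto simp: t_def)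
 define k where "k = 2 / (1 - t^2)"
 have k: "0 < k" using t norm_sq_less_1[of t] by (simp add: k_def)
 show "EX e>0. ball y e \<subseteq> hball x r"
 proof (intro exI conjI subsetI)
  show "0 < min (t - norm y) ((r - hdist x y) / k)" using t s k by simp
  fix z assume "z : ball y (min (t - norm y) ((r - hdist x y) / k))"
  then have z: "norm (z - y) < t - norm y" "k * norm (z - y) < r - hdist x y"
   using k by (auto simp: dist_norm norm_minus_commute pos_less_divide_eq mult.commute)
  then have zt: "norm z <= t" using norm_triangle_sub[of z y] by simp
  have "hdist y z <= k * norm (z - y)" unfolding k_def by (rule hdist_le_cball) (use zt t in auto)
  moreover have "hdist x z <= hdist x y + hdist y z" by (rule hdist_triangle) (use x yb zt t in auto)
  ultimately show "z : hball x r" using z zt t by (auto simp: hball_def)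
 qed
qed

lemma hball_borel [measurable]: "x : HS ==> hball x r : sets borel"
 by (simp add: borel_open open_hball)

lemma emeasure_hvol: "A : sets borel ==> emeasure hvol A = (\<integral>\<^sup>+x. ennreal (dens x) * indicator A x \<partial>lborel)"
 unfolding hvol_def by (subst emeasure_density) auto

lemma sets_hvol [simp]: "sets hvol = sets borel" by (simp add: hvol_def)

lemma hball_height:
 assumes "x : HS" "y : hball x r"
 shows "1 - (norm y)^2 <= exp r * (1 - (norm x)^2)" "1 - (norm x)^2 <= exp r * (1 - (norm y)^2)"
proof -
 have y: "y : HS" "hdist x y < r" using assms by (auto simp: hball_def)
 have p: "0 < 1 - (norm x)^2" "0 < 1 - (norm y)^2" using norm_sq_less_1 assms(1) y(1) by auto
 have "\<bar>ln (1 - (norm x)^2) - ln (1 - (norm y)^2)\<bar> <= r"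
  using height_lipschitz[OF assms(1) y(1)] y(2) unfolding height_def by linarith
 then have "ln (1 - (norm y)^2) <= ln (exp r * (1 - (norm x)^2))" "ln (1 - (norm x)^2) <= ln (exp r * (1 - (norm y)^2))"
  using p by (auto simp: ln_mult_pos)
 then show "1 - (norm y)^2 <= exp r * (1 - (norm x)^2)" "1 - (norm x)^2 <= exp r * (1 - (norm y)^2)" using p by auto
qed

text \<open>Along a path that stays in the hyperbolic ball \<open>1 - |c t|^2\<close> is at most
  \<open>w = exp r * (1 - |x|^2)\<close>, so hyperbolic length below \<open>r\<close> forces
  Euclidean length below \<open>w * r\<close>.\<close>

lemma hball_subset_ball:
 fixes x :: "real^'n::finite"
 assumes x: "x : HS" and r: "0 < r"
 shows "hball x r \<subseteq> ball x (exp r * (1 - (norm x)^2) * r)"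
proof
 fix y assume y: "y : hball x r"
 define w where "w = exp r * (1 - (norm x)^2)"
 have w: "0 < w" using x norm_sq_less_1[of x] by (simp add: w_def)
 have yb: "y : HS" using y by (simp add: hball_def)
 have "riem_dist HS hm x y < ennreal r"
  using y rdist_less_iff[OF semi_hyp convex_ball x yb] by (simp add: hball_def)
 then obtain c where c: "valid_path c" "c ` {0..1} \<subseteq> HS" "c 0 = x" "c 1 = y" "path_length hm c < ennreal r"
  by (rule riem_dist_lessE)
 have cb: "c t : hball x r" if t: "t : {0..1}" for t
 proof -
  have ct: "c t : HS" using c(2) t by blast
  have "riem_dist HS hm (c 0) (c t) <= path_length hm c"
   using path_length_split[OF semi_hyp c(1,2), of t] t by (auto intro: order.trans[rotated])
  then have "riem_dist HS hm x (c t) < ennreal r" using c by simp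
  then show ?thesis using rdist_less_iff[OF semi_hyp convex_ball x ct] ct by (simp add: hball_def)
 qed
 have "ennreal (norm (c 1 - c 0)) <= path_length (%_ u v. u \<bullet> v) ((%x. x) \<circ> c)"
  using FTC_norm_bound[OF c(1)] by (simp add: o_def)
 also have "... <= ennreal w * path_length hm c"
 proof (rule path_length_map_le[OF semi_hyp c(1,2) C1_map_id c(2)])
  fix t :: real and v :: "real^'n" assume t: "t : {0..1}"
  let ?q = "1 - (norm (c t))^2"
  have q: "0 < ?q" "?q <= w" using hball_height(1)[OF x cb[OF t]] cb[OF t] norm_sq_less_1[of "c t"] by (auto simp: w_def hball_def)
  then have "1 <= (w / ?q)^2" by (intro one_le_power) simp
  then have "1 <= 4 * (w / ?q)^2" by linarith
  then have "1 * (v \<bullet> v) <= 4 * (w / ?q)^2 * (v \<bullet> v)" by (intro mult_right_mono) auto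
  then show "v \<bullet> v <= w^2 * hm (c t) v v" by (simp add: hyp_metric_def power_divide mult_ac)
 qed (use w in simp)
 also have "... < ennreal w * ennreal r" by (rule ennreal_mult_strict_left_mono) (use c(5) w in auto)
 finally have "norm (y - x) < w * r" using w r c by (simp add: ennreal_mult'[symmetric] ennreal_less_iff)
 then show "y : ball x (exp r * (1 - (norm x)^2) * r)" by (simp add: dist_norm norm_minus_commute w_def)
qed

lemma ball_subset_hball:
 fixes x :: "real^'n::finite"
 assumes x: "x : HS"
 shows "ball x ((1 - (norm x)^2) / 32) \<subseteq> hball x (1 / 8)"
  and "y : ball x ((1 - (norm x)^2) / 32) ==> 1 - (norm y)^2 <= 2 * (1 - (norm x)^2)"
proof -
 define w where "w = 1 - (norm x)^2"
 have w: "0 < w" "w <= 1" using x norm_sq_less_1[of x] by (auto simp: w_def)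
 have close: "\<bar>(norm y)^2 - (norm x)^2\<bar> <= w / 8 & norm y < 1" if y: "y : ball x (w / 32)" for y
 proof -
  have yx: "norm (y - x) < w / 32" using y by (simp add: dist_norm norm_minus_commute)
  have d: "\<bar>norm y - norm x\<bar> <= w / 32" using norm_triangle_ineq3[of y x] yx by linarith
  have "\<bar>(norm y)^2 - (norm x)^2\<bar> = \<bar>norm y - norm x\<bar> * (norm y + norm x)"
   by (simp add: power2_eq_square square_diff_square_factored abs_mult mult.commute)
  also have "... <= w / 32 * 4"
  proof (rule mult_mono[OF d])
   have "norm y <= norm x + 1" using d w by linarith
   then show "norm y + norm x <= 4" using x by simp
  qed (use w in auto)
  finally have s: "\<bar>(norm y)^2 - (norm x)^2\<bar> <= w / 8" by simp
  have "(norm y)^2 <= (norm x)^2 + w / 8" using abs_le_D1[OF s] by linarith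
  then have "(norm y)^2 < 1" using w unfolding w_def by (simp add: field_simps)
  then show ?thesis using s by (simp add: power_less_one_iff abs_square_less_1)
 qed
 show "1 - (norm y)^2 <= 2 * (1 - (norm x)^2)" if "y : ball x ((1 - (norm x)^2) / 32)"
  using abs_le_D2[OF conjunct1[OF close[of y]]] that w unfolding w_def[symmetric] by (simp add: w_def field_simps)
 show "ball x ((1 - (norm x)^2) / 32) \<subseteq> hball x (1 / 8)"
 proof
  fix y assume "y : ball x ((1 - (norm x)^2) / 32)"
  then have y: "y : ball x (w / 32)" by (simp add: w_def)
  have seg: "closed_segment x y \<subseteq> ball x (w / 32)" using y w by (intro closed_segment_subset) auto
  have "hdist x y <= 4 * norm (y - x) / w"
  proof (rule rdist_le_segment)
   show "closed_segment x y \<subseteq> HS" using seg close by auto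
   fix z assume "z : closed_segment x y"
   then have z: "z : HS" "\<bar>(norm z)^2 - (norm x)^2\<bar> <= w / 8" using seg close[of z] by auto
   have "sqrt (hm z (y - x) (y - x)) = 2 * norm (y - x) / (1 - (norm z)^2)" by (rule sqrt_hyp_metric[OF z(1)])
   also have "... <= 2 * norm (y - x) / (w / 2)"
   proof -
    have "w / 2 <= 1 - (norm z)^2" using abs_le_D1[OF z(2)] w by (simp add: w_def field_simps)
    then show ?thesis using w by (intro divide_left_mono mult_pos_pos) auto
   qed
   finally show "sqrt (hm z (y - x) (y - x)) <= 4 * norm (y - x) / w" by simp
  qed (use w in simp)
  moreover have "norm (y - x) < w / 32" using y by (simp add: dist_norm norm_minus_commute)
  then have "4 * norm (y - x) / w < 1 / 8" using w by (simp add: pos_divide_less_eq)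
  ultimately have "hdist x y < 1 / 8" by simp
  then show "y : hball x (1 / 8)" using close[OF y] by (simp add: hball_def)
 qed
qed

text \<open>Uniform in \<open>x\<close> by scaling: with \<open>w = 1 - |x|^2\<close>, a Euclidean
  ball of radius comparable to \<open>w\<close> lies inside, and the density is at least of order
  \<open>w ^ -n\<close>, so \<open>w\<close> cancels. The upper bound below works in the same
  way.\<close>

lemma hvol_hball_lower:
 fixes x :: "real^'n::finite"
 assumes x: "x : HS"
 shows "ennreal (unit_ball_vol (real CARD('n)) * (1 / 32) ^ CARD('n)) <= emeasure hvol (hball x (1 / 8))"
proof -
 define w where "w = 1 - (norm x)^2"
 have w: "0 < w" using x norm_sq_less_1[of x] by (auto simp: w_def)
 let ?A = "ball x (w / 32)"
 have "ennreal (unit_ball_vol (real CARD('n)) * (1 / 32) ^ CARD('n)) = ennreal ((1 / w) ^ CARD('n)) * emeasure lborel ?A"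
  using w by (simp add: emeasure_ball ennreal_mult'[symmetric] power_divide field_simps)
 also have "... = (\<integral>\<^sup>+y. ennreal ((1 / w) ^ CARD('n)) * indicator ?A y \<partial>lborel)"
  by (rule nn_integral_cmult_indicator[symmetric]) simp
 also have "... <= (\<integral>\<^sup>+y. ennreal (dens y) * indicator (hball x (1 / 8)) y \<partial>lborel)"
 proof (intro nn_integral_mono)
  fix y
  show "ennreal ((1 / w) ^ CARD('n)) * indicator ?A y <= ennreal (dens y) * indicator (hball x (1 / 8)) y"
  proof (cases "y : ?A")
   case True
   have yb: "y : hball x (1 / 8)" using ball_subset_hball(1)[OF x] True by (auto simp: w_def)
   then have "0 < 1 - (norm y)^2" using norm_sq_less_1[of y] by (auto simp: hball_def)
   moreover have "1 - (norm y)^2 <= 2 * w" using ball_subset_hball(2)[OF x] True by (auto simp: w_def)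
   ultimately have "1 / w <= 2 / (1 - (norm y)^2)" using w by (simp add: field_simps)
   then show ?thesis using yb True w by (simp add: dens_def ennreal_leI power_mono)
  qed simp
 qed
 also have "... = emeasure hvol (hball x (1 / 8))" by (rule emeasure_hvol[symmetric]) (rule hball_borel[OF x])
 finally show ?thesis .
qed

lemma hvol_hball_upper:
 fixes x :: "real^'n::finite"
 assumes x: "x : HS" and r: "0 < r"
 shows "emeasure hvol (hball x r) <= ennreal (unit_ball_vol (real CARD('n)) * (2 * exp r * exp r * r) ^ CARD('n))"
proof -
 define w where "w = 1 - (norm x)^2"
 have w: "0 < w" using x norm_sq_less_1[of x] by (auto simp: w_def)
 let ?A = "ball x (exp r * w * r)"
 have "emeasure hvol (hball x r) = (\<integral>\<^sup>+y. ennreal (dens y) * indicator (hball x r) y \<partial>lborel)"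
  by (rule emeasure_hvol) (rule hball_borel[OF x])
 also have "... <= (\<integral>\<^sup>+y. ennreal ((2 * exp r / w) ^ CARD('n)) * indicator ?A y \<partial>lborel)"
 proof (intro nn_integral_mono)
  fix y
  show "ennreal (dens y) * indicator (hball x r) y <= ennreal ((2 * exp r / w) ^ CARD('n)) * indicator ?A y"
  proof (cases "y : hball x r")
   case True
   have "y : ?A" using hball_subset_ball[OF x r] True by (auto simp: w_def)
   moreover have p: "0 < 1 - (norm y)^2" using True norm_sq_less_1[of y] by (auto simp: hball_def)
   have "2 / (1 - (norm y)^2) <= 2 * exp r / w"
    using hball_height(2)[OF x True] p w by (simp add: w_def[symmetric] field_simps)
   then have "dens y <= (2 * exp r / w) ^ CARD('n)" unfolding dens_def using p by (intro power_mono) auto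
   ultimately show ?thesis using True by (simp add: ennreal_leI)
  qed simp
 qed
 also have "... = ennreal ((2 * exp r / w) ^ CARD('n)) * emeasure lborel ?A"
  by (rule nn_integral_cmult_indicator) simp
 also have "... = ennreal (unit_ball_vol (real CARD('n)) * (2 * exp r * exp r * r) ^ CARD('n))"
  using w r by (simp add: emeasure_ball ennreal_mult'[symmetric] power_divide power_mult_distrib field_simps)
 finally show ?thesis .
qed

lemma gram_det_hyp_prod:
 fixes z :: "'n::finite pt"
 assumes z: "z : HP"
 shows "sqrt (gram_det g0 z) = dens (fst z) * dens (snd z)"
proof -
 have p: "0 <= dens (fst z)" "0 <= dens (snd z)" using dens_nonneg HP_D[OF z] by auto
 have c: "conf x ^ CARD('n) = (dens x)^2" for x :: "real^'n"
 proof -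
  have "conf x = (2 / (1 - (norm x)^2))^2" by (simp add: conf_def power_divide)
  then show ?thesis unfolding dens_def by (metis power_mult mult.commute)
 qed
 have "gram_det g0 z = conf (fst z) ^ CARD('n) * conf (snd z) ^ CARD('n) * (1 - 0 * ((0::real^'n) \<bullet> 0) / conf (snd z))"
  by (rule gram_det_block) (use conf_pos[of "snd z"] HP_D(2)[OF z] in \<open>auto simp: hyp_prod_metric_def hyp_metric_conf\<close>)
 then have "gram_det g0 z = (dens (fst z) * dens (snd z))^2" by (simp add: c power_mult_distrib)
 then show ?thesis using p by simp
qed

abbreviation pvol :: "'n::finite pt measure" where
 "pvol == riem_vol HP g0"

lemma sets_pvol: "A : sets pvol \<longleftrightarrow> A : sets borel & A \<subseteq> HP"
 unfolding riem_vol_def by (auto simp: sets_restrict_space_iff borel_open open_HP)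

lemma emeasure_pvol:
 fixes A :: "'n::finite pt set"
 assumes A: "A : sets borel" "A \<subseteq> HP"
 shows "emeasure pvol A = (\<integral>\<^sup>+z. ennreal (dens (fst z) * dens (snd z)) * indicator A z \<partial>lborel)"
proof -
 have X: "HP : sets (borel :: 'n pt measure)" by (simp add: borel_open open_HP)
 have [measurable]: "(%z::'n pt. ennreal (dens (fst z) * dens (snd z))) : borel_measurable borel"
 proof -
  have "(%z::'n pt. dens (fst z)) : borel_measurable borel" "(%z::'n pt. dens (snd z)) : borel_measurable borel"
   by (rule measurable_compose[OF _ dens_measurable]; simp add: borel_prod[symmetric])+
  then show ?thesis by measurable
 qed
 have m: "(%z::'n pt. ennreal (sqrt (gram_det g0 z))) : borel_measurable (restrict_space lborel HP)"
  by (subst measurable_cong[where g = "%z. ennreal (dens (fst z) * dens (snd z))"])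
   (auto simp: space_restrict_space gram_det_hyp_prod intro: measurable_restrict_space1)
 have "emeasure pvol A = (\<integral>\<^sup>+z. ennreal (sqrt (gram_det g0 z)) * indicator A z \<partial>restrict_space lborel HP)"
  unfolding riem_vol_def by (rule emeasure_density[OF m]) (use A X in "simp add: sets_restrict_space_iff")
 also have "... = (\<integral>\<^sup>+z. ennreal (sqrt (gram_det g0 z)) * indicator A z * indicator HP z \<partial>lborel)"
  by (rule nn_integral_restrict_space) (use X in simp)
 also have "... = (\<integral>\<^sup>+z. ennreal (dens (fst z) * dens (snd z)) * indicator A z \<partial>lborel)"
  by (rule nn_integral_cong) (use A in "auto simp: gram_det_hyp_prod indicator_def")
 finally show ?thesis .
qed

lemma pvol_times:
 fixes A B :: "(real^'n::finite) set"
 assumes A: "A : sets borel" "A \<subseteq> HS" and B: "B : sets borel" "B \<subseteq> HS"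
 shows "emeasure pvol (A \<times> B) = emeasure hvol A * emeasure hvol B"
proof -
 have [measurable]: "(%x. ennreal (dens x) * indicator A x) : borel_measurable borel" "(%x. ennreal (dens x) * indicator B x) : borel_measurable borel"
  using A B by measurable
 have AB: "A \<times> B : sets borel" "A \<times> B \<subseteq> HP" using A B by (auto simp: hyp_prod_def intro: borel_Times)
 have "emeasure pvol (A \<times> B) = (\<integral>\<^sup>+z. (ennreal (dens (fst z)) * indicator A (fst z)) * (ennreal (dens (snd z)) * indicator B (snd z)) \<partial>(lborel \<Otimes>\<^sub>M lborel))"
  unfolding emeasure_pvol[OF AB] lborel_prod
 proof (rule nn_integral_cong)
  fix z :: "'n pt"
  show "ennreal (dens (fst z) * dens (snd z)) * indicator (A \<times> B) z =
    (ennreal (dens (fst z)) * indicator A (fst z)) * (ennreal (dens (snd z)) * indicator B (snd z))"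
  proof (cases "z : A \<times> B")
   case True
   then have "fst z : HS" "snd z : HS" using A B by auto
   then show ?thesis using True dens_nonneg[of "fst z"] dens_nonneg[of "snd z"] by (auto simp: ennreal_mult)
  qed (cases z; auto simp: indicator_def)
 qed
 also have "... = (\<integral>\<^sup>+x. \<integral>\<^sup>+y. (ennreal (dens x) * indicator A x) * (ennreal (dens y) * indicator B y) \<partial>lborel \<partial>lborel)"
  by (subst lborel.nn_integral_fst[symmetric]) auto
 also have "... = (\<integral>\<^sup>+x. (ennreal (dens x) * indicator A x) * emeasure hvol B \<partial>lborel)"
  by (simp add: nn_integral_cmult emeasure_hvol B)
 also have "... = emeasure hvol A * emeasure hvol B" by (simp add: nn_integral_multc emeasure_hvol A)
 finally show ?thesis .
qed

subsection \<open>The entropy of the metrics\<close>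

lemma hyp_transitive:
 fixes w :: "real^'n::finite"
 assumes "w : HS"
 obtains f where "f : hyp_isom" "f w = 0" "f 0 = w"
proof (rule that)
 show "(\<lambda>x\<in>HS. inversion w x) : hyp_isom" using assms by (intro inversion_isom) simp
qed (use assms in "auto simp: inversion_a inversion_0")

lemma hvol_hball_finite:
 fixes x :: "real^'n::finite"
 assumes x: "x : HS" shows "emeasure hvol (hball x r) < \<infinity>"
proof -
 have "emeasure hvol (hball x r) <= emeasure hvol (hball x (max r 1))"
  by (intro emeasure_mono) (use hball_borel[OF x] in "auto simp: hball_def")
 also have "... < \<infinity>" using hvol_hball_upper[OF x, of "max r 1"] by (auto simp: less_max_iff_disj intro: le_less_trans)
 finally show ?thesis .
qed

lemma hyp_growth:
 "EX h>=0. ((%R. ln (measure (hvol :: (real^'n::finite) measure) (hball 0 R)) / R) \<longlongrightarrow> h) at_top"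
proof -
 let ?a = "unit_ball_vol (real CARD('n)) * (1 / 32) ^ CARD('n)" and ?b = "unit_ball_vol (real CARD('n)) * (2 * exp 1 * exp 1 * 1) ^ CARD('n)"
 have low: "?a <= measure hvol (hball p r)" if "1 / 8 <= r" "p : HS" for r and p :: "real^'n"
 proof -
  have "ennreal ?a <= emeasure hvol (hball p (1 / 8))" by (rule hvol_hball_lower[OF that(2)])
  also have "... <= emeasure hvol (hball p r)" by (intro emeasure_mono) (use hball_borel[OF that(2)] that(1) in "auto simp: hball_def")
  also have "... = ennreal (measure hvol (hball p r))" using hvol_hball_finite[OF that(2), of r] by (intro emeasure_eq_ennreal_measure) auto
  finally show ?thesis by simp
 qed
 interpret growth "HS :: (real^'n) set" hdist hvol 0 0 ?a ?b
 proof
  fix p q r :: "real^'n" and s t :: real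
  show "p : HS ==> hdist p p = 0" by (rule hdist_refl)
  show "hdist p q = hdist q p" by (rule hdist_sym)
  show "p : HS ==> q : HS ==> r : HS ==> hdist p r <= hdist p q + hdist q r" by (rule hdist_triangle)
  show "p : HS ==> q : HS ==> hdist p q < s + t ==> 0 < s ==> 0 < t ==> EX w:HS. hdist p w < s & hdist w q < t"
   by (rule rdist_split[OF semi_hyp convex_ball])
  show "\<exists>f :: real^'n => real^'n. f ` HS \<subseteq> HS & (ALL p:HS. ALL q:HS. hdist (f p) (f q) = hdist p q) & hdist 0 (f p) <= 0"
   if "p : HS"
  proof -
   from that obtain f where f: "f : hyp_isom" "f p = 0" by (rule hyp_transitive)
   show ?thesis using hyp_isom_dist[OF f(1)] hyp_isomD(4)[OF f(1)] f(2) hdist_refl[of "0 :: real^'n"]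
    by (intro exI[of _ f]) auto
  qed
  show "p : HS ==> {q : HS. hdist p q < s} : sets hvol" using hball_borel[of p s] by (simp add: hball_def)
  show "p : HS ==> emeasure hvol {q : HS. hdist p q < s} ~= \<infinity>" using hvol_hball_finite[of p s] by (simp add: hball_def)
  show "p : HS ==> ?a <= measure hvol {q : HS. hdist p q < 1 / 2}" using low[of "1/2" p] by (simp add: hball_def)
  assume p: "p : HS"
  show "measure hvol {q : HS. hdist p q < 1} <= ?b"
   using hvol_hball_upper[OF p, of 1] unfolding measure_def hball_def by (intro enn2real_leI) auto
 qed auto
 obtain h where h: "((%R. ln (measure (hvol :: (real^'n) measure) (hball 0 R)) / R) \<longlongrightarrow> h) at_top"
  using growth_rate unfolding V_def B_def hball_def by force
 moreover have "0 <= h"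
 proof (rule tendsto_le[OF _ h])
  show "((%R. ln ?a / R) \<longlongrightarrow> 0) at_top" by real_asymp
  show "\<forall>\<^sub>F R in at_top. ln ?a / R <= ln (measure (hvol :: (real^'n) measure) (hball 0 R)) / R"
   using eventually_ge_at_top[of 1]
  proof eventually_elim
   case (elim R)
   have "0 < ?a" by simp
   then show ?case using low[of R 0] elim by (intro divide_right_mono ln_mono) auto
  qed
 qed simp
 ultimately show ?thesis by blast
qed

lemma D0_le_l1:
 fixes p q :: "'n::finite pt"
 assumes p: "p : HP" and q: "q : HP"
 shows "HD p q <= hdist (fst p) (fst q) + hdist (snd p) (snd q)"
proof -
 note P = HP_D[OF p] and Q = HP_D[OF q]
 have 1: "HD (fst p, snd p) (fst q, snd p) <= 1 * hdist (fst p) (fst q)"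
 proof (rule rdist_map_le[OF semi_hyp convex_ball semi_HP convex_HP, of "%x. (x, snd p)" "%_ v. (v, 0)"])
  show "C1_map HS (%x. (x, snd p)) (%_ v. (v, 0))" by (auto simp: C1_map_def intro!: derivative_eq_intros)
 qed (use P Q in "auto simp: hyp_prod_def hyp_prod_metric_def hyp_metric_def")
 have 2: "HD (fst q, snd p) (fst q, snd q) <= 1 * hdist (snd p) (snd q)"
 proof (rule rdist_map_le[OF semi_hyp convex_ball semi_HP convex_HP, of "%y. (fst q, y)" "%_ v. (0, v)"])
  show "C1_map HS (%y. (fst q, y)) (%_ v. (0, v))" by (auto simp: C1_map_def intro!: derivative_eq_intros)
 qed (use P Q in "auto simp: hyp_prod_def hyp_prod_metric_def hyp_metric_def")
 have m: "(fst q, snd p) : HP" using P Q by (simp add: hyp_prod_def)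
 show ?thesis using rdist_triangle[OF semi_HP convex_HP p m q] 1 2 by simp
qed

lemma hyp_metric_nonneg: "0 <= hm x u u" by (simp add: hyp_metric_def)

lemma D0_ge_hdist:
 fixes p q :: "'n::finite pt"
 assumes p: "p : HP" and q: "q : HP"
 shows "hdist (fst p) (fst q) <= HD p q" "hdist (snd p) (snd q) <= HD p q"
proof -
 have "hdist (fst p) (fst q) <= 1 * HD p q"
  by (rule rdist_map_le[OF semi_HP convex_HP semi_hyp convex_ball C1_map_fst])
   (use p q in "auto simp: hyp_prod_def hyp_prod_metric_def hyp_metric_nonneg")
 then show "hdist (fst p) (fst q) <= HD p q" by simp
 have "hdist (snd p) (snd q) <= 1 * HD p q"
  by (rule rdist_map_le[OF semi_HP convex_HP semi_hyp convex_ball C1_map_snd])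
   (use p q in "auto simp: hyp_prod_def hyp_prod_metric_def hyp_metric_nonneg")
 then show "hdist (snd p) (snd q) <= HD p q" by simp
qed

lemma open_rdist_ball:
 fixes g :: "'n::finite pt tensor2"
 assumes g: "semi_metric HP g"
  and le: "!!p q. p : HP ==> q : HP ==> rdist HP g p q <= 2 * HD p q"
  and p: "p : HP"
 shows "open {q : HP. rdist HP g p q < r}"
 unfolding open_contains_ball
proof
 fix q assume q: "q : {q : HP. rdist HP g p q < r}"
 define s where "s = (r - rdist HP g p q) / 4"
 have s: "0 < s" using q by (simp add: s_def)
 have qq: "fst q : HS" "snd q : HS" "q : HP" using q by (auto simp: hyp_prod_def)
 have "open (hball (fst q) s \<times> hball (snd q) s)" using qq by (intro open_Times open_hball)
 moreover have "q : hball (fst q) s \<times> hball (snd q) s" using qq s by (cases q) (auto simp: hball_def hdist_refl)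
 ultimately obtain e where e: "e > 0" "ball q e \<subseteq> hball (fst q) s \<times> hball (snd q) s" unfolding open_contains_ball by blast
 have "hball (fst q) s \<times> hball (snd q) s \<subseteq> {q : HP. rdist HP g p q < r}"
 proof
  fix z assume z: "z : hball (fst q) s \<times> hball (snd q) s"
  then have zX: "z : HP" by (auto simp: hyp_prod_def hball_def)
  have "rdist HP g q z <= 2 * (hdist (fst q) (fst z) + hdist (snd q) (snd z))"
   using le[OF qq(3) zX] mult_left_mono[OF D0_le_l1[OF qq(3) zX], of 2] by simp
  then have "rdist HP g q z < 4 * s" using z by (auto simp: hball_def)
  then show "z : {q : HP. rdist HP g p q < r}"
   using rdist_triangle[OF g convex_HP p qq(3) zX] zX by (simp add: s_def)
 qed
 then show "EX e>0. ball q e \<subseteq> {q : HP. rdist HP g p q < r}" using e by blast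
qed

text \<open>A metric with the volume of the product metric and a distance within a factor 2 of it
  falls under \<open>growth\<close>, the volumes of small balls being compared with products of
  hyperbolic balls. In particular the \<open>THE\<close> in \<open>volume_entropy\<close>
  denotes.\<close>

lemma prod_entropy:
 fixes g :: "'n::finite pt tensor2"
 assumes g: "semi_metric HP g" and vol: "riem_vol HP g = pvol"
  and le: "!!p q. p : HP ==> q : HP ==> rdist HP g p q <= 2 * HD p q"
  and ge: "!!p q. p : HP ==> q : HP ==> HD p q <= 2 * rdist HP g p q"
  and move: "!!w. w : HP ==> EX f. f ` HP \<subseteq> HP & (ALL p:HP. ALL q:HP. rdist HP g (f p) (f q) = rdist HP g p q) &
   rdist HP g 0 (f w) <= K" and K: "0 <= K"
 shows "((%R. ln (measure pvol {q : HP. rdist HP g 0 q < R}) / R) \<longlongrightarrow> volume_entropy HP g) at_top"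
  and "0 < R ==> 0 < measure pvol {q : HP. rdist HP g 0 q < R + 1}"
  and "{q : HP. rdist HP g 0 q < R} : fmeasurable pvol"
proof -
 let ?D = "rdist HP g"
 let ?u = "unit_ball_vol (real CARD('n))"
 define a where "a = (?u * (1 / 32) ^ CARD('n)) * (?u * (1 / 32) ^ CARD('n))"
 define c where "c r = ?u * (2 * exp r * exp r * r) ^ CARD('n)" for r :: real
 have c: "emeasure hvol (hball x r) <= ennreal (c r)" "0 <= c r" if "x : HS" "0 < r" for x :: "real^'n" and r
  using hvol_hball_upper[OF that] that by (auto simp: c_def)
 define b where "b r = c r * c r" for r :: real
 have a: "0 < a" by (simp add: a_def)
 have z: "(0 :: 'n pt) : HP" by (simp add: hyp_prod_def zero_prod_def)
 have meas: "{q : HP. ?D p q < r} : sets pvol" if p: "p : HP" for p r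
  using open_rdist_ball[OF g le p] by (auto simp: sets_pvol borel_open)
 have box: "hball (fst p) r \<times> hball (snd p) r : sets pvol"
  "emeasure pvol (hball (fst p) r \<times> hball (snd p) r) = emeasure hvol (hball (fst p) r) * emeasure hvol (hball (snd p) r)"
  if p: "p : HP" for p :: "'n pt" and r
 proof -
  have 1: "hball (fst p) r : sets borel" "hball (snd p) r : sets borel" using HP_D[OF p] by (auto intro: hball_borel)
  have 2: "hball (fst p) r \<subseteq> HS" "hball (snd p) r \<subseteq> HS" by (auto simp: hball_def)
  have "hball (fst p) r \<times> hball (snd p) r \<subseteq> HP" using 2 unfolding hyp_prod_def by (rule Sigma_mono)
  then show "hball (fst p) r \<times> hball (snd p) r : sets pvol" unfolding sets_pvol using borel_Times[OF 1] by simp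
  show "emeasure pvol (hball (fst p) r \<times> hball (snd p) r) = emeasure hvol (hball (fst p) r) * emeasure hvol (hball (snd p) r)"
   by (rule pvol_times[OF 1(1) 2(1) 1(2) 2(2)])
 qed
 have up: "emeasure pvol {q : HP. ?D p q < r} <= ennreal (b (2 * r))" if p: "p : HP" and r: "0 < r" for p r
 proof -
  have "emeasure pvol {q : HP. ?D p q < r} <= emeasure pvol (hball (fst p) (2 * r) \<times> hball (snd p) (2 * r))"
  proof (intro emeasure_mono box(1)[OF p] subsetI)
   fix q assume "q : {q : HP. ?D p q < r}"
   then have q: "q : HP" "?D p q < r" by auto
   show "q : hball (fst p) (2 * r) \<times> hball (snd p) (2 * r)"
    using D0_ge_hdist[OF p q(1)] ge[OF p q(1)] q HP_D[OF q(1)] by (cases q) (auto simp: hball_def)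
  qed
  also have "... <= ennreal (b (2 * r))"
   unfolding box(2)[OF p] b_def using HP_D[OF p] r
   by (subst ennreal_mult) (auto intro!: mult_mono c(1) c(2)[of "fst p"])
  finally show ?thesis .
 qed
 have fin: "emeasure pvol {q : HP. ?D p q < r} < \<infinity>" if p: "p : HP" for p r
 proof -
  have "emeasure pvol {q : HP. ?D p q < r} <= emeasure pvol {q : HP. ?D p q < max r 1}"
   by (intro emeasure_mono meas[OF p]) auto
  also have "... < \<infinity>" using up[OF p, of "max r 1"] by (auto simp: less_max_iff_disj intro: le_less_trans)
  finally show ?thesis .
 qed
 have lowe: "ennreal a <= emeasure pvol {q : HP. ?D p q < r}" if p: "p : HP" and r: "1 / 2 <= r" for p r
 proof -
  have "ennreal a <= emeasure pvol (hball (fst p) (1 / 8) \<times> hball (snd p) (1 / 8))"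
   unfolding box(2)[OF p] a_def using HP_D[OF p] by (subst ennreal_mult) (auto intro!: mult_mono hvol_hball_lower)
  also have "... <= emeasure pvol {q : HP. ?D p q < r}"
  proof (intro emeasure_mono meas[OF p] subsetI)
   fix q assume q: "q : hball (fst p) (1 / 8) \<times> hball (snd p) (1 / 8)"
   then have qX: "q : HP" by (auto simp: hyp_prod_def hball_def)
   have "hdist (fst p) (fst q) < 1 / 8" "hdist (snd p) (snd q) < 1 / 8" using q by (auto simp: hball_def)
   then show "q : {q : HP. ?D p q < r}" using le[OF p qX] D0_le_l1[OF p qX] qX r by simp
  qed
  finally show ?thesis .
 qed
 have low: "a <= measure pvol {q : HP. ?D p q < r}" if p: "p : HP" and r: "1 / 2 <= r" for p r
 proof -
  have "ennreal a <= ennreal (measure pvol {q : HP. ?D p q < r})"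
   using lowe[OF p r] fin[OF p, of r] by (subst emeasure_eq_ennreal_measure[symmetric]) auto
  then show ?thesis by simp
 qed
 interpret growth "HP :: 'n pt set" ?D pvol 0 K a "b (2 * 1)"
 proof
  fix p q r :: "'n pt" and s t :: real
  show "p : HP ==> ?D p p = 0" by (rule rdist_refl[OF g convex_HP])
  show "?D p q = ?D q p" by (rule rdist_sym[OF g convex_HP])
  show "p : HP ==> q : HP ==> r : HP ==> ?D p r <= ?D p q + ?D q r" by (rule rdist_triangle[OF g convex_HP])
  show "p : HP ==> q : HP ==> ?D p q < s + t ==> 0 < s ==> 0 < t ==> EX w:HP. ?D p w < s & ?D w q < t"
   by (rule rdist_split[OF g convex_HP])
  show "p : HP ==> measure pvol {q : HP. ?D p q < 1} <= b (2 * 1)"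
   using up[of p 1] unfolding measure_def by (intro enn2real_leI) (simp_all add: b_def)
  show "p : HP ==> emeasure pvol {q : HP. ?D p q < s} ~= \<infinity>" using fin[of p s] by simp
  show "p : HP ==> a <= measure pvol {q : HP. ?D p q < 1 / 2}" by (rule low) simp_all
 qed (use move K z a meas in auto)
 obtain h where h: "!!p. p : HP ==> ((%R. ln (measure pvol {q : HP. ?D p q < R}) / R) \<longlongrightarrow> h) at_top"
  using growth_rate unfolding V_def B_def by blast
 have eq: "{y : HP. riem_dist HP g p y < ennreal R} = {q : HP. ?D p q < R}" if "p : HP" for p R
  using rdist_less_iff[OF g convex_HP that] by auto
 have "volume_entropy HP g = h"
  unfolding volume_entropy_def vol
 proof (rule the_equality)
  show "ALL p:HP. ((%R. ln (measure pvol {y : HP. riem_dist HP g p y < ennreal R}) / R) \<longlongrightarrow> h) at_top"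
   using h eq by simp
  fix h' assume h': "ALL p:HP. ((%R. ln (measure pvol {y : HP. riem_dist HP g p y < ennreal R}) / R) \<longlongrightarrow> h') at_top"
  show "h' = h" by (rule tendsto_unique[OF _ bspec[OF h' z]]) (use h[OF z] eq[OF z] in auto)
 qed
 then show "((%R. ln (measure pvol {q : HP. ?D 0 q < R}) / R) \<longlongrightarrow> volume_entropy HP g) at_top"
  using h[OF z] by simp
 show "0 < R ==> 0 < measure pvol {q : HP. ?D 0 q < R + 1}" using low[OF z, of "R + 1"] a by simp
 show "{q : HP. ?D 0 q < R} : fmeasurable pvol" using meas[OF z] fin[OF z] by (intro fmeasurableI) (auto simp: less_top[symmetric])
qed

text \<open>Isometries move \<open>p\<close> to the origin, where both factors are Euclidean up to
  the factor \<open>1 - s^2\<close>, and there the segment has Pythagorean length. Chained with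
  \<open>s\<close> tending to 0, it compares the product distance with \<open>sqrt 2\<close> times
  the maximum without the use of geodesics.\<close>

lemma D0_short:
 fixes p q :: "'n::finite pt"
 assumes p: "p : HP" and q: "q : HP" and s: "0 < s" "s <= 1 / 2"
  and d: "hdist (fst p) (fst q) < s" "hdist (snd p) (snd q) < s"
 shows "HD p q <= sqrt 2 * s / (1 - s^2)"
proof -
 note P = HP_D[OF p] and Q = HP_D[OF q]
 obtain f where f: "f : hyp_isom" "f (fst p) = 0" using hyp_transitive[OF P(1)] by metis
 obtain h where h: "h : hyp_isom" "h (snd p) = 0" using hyp_transitive[OF P(2)] by metis
 define u where "u = f (fst q)"
 define v where "v = h (snd q)"
 have z: "(0 :: real^'n) : HS" by simp
 have uv: "u : HS" "v : HS" using hyp_isomD(4)[OF f(1) Q(1)] hyp_isomD(4)[OF h(1) Q(2)] by (auto simp: u_def v_def)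
 have n: "norm u <= s / 2" "norm v <= s / 2"
  using hdist_ge_norm[OF z uv(1)] hdist_ge_norm[OF z uv(2)] hyp_isom_dist[OF f(1) P(1) Q(1)] hyp_isom_dist[OF h(1) P(2) Q(2)] f(2) h(2) d
  by (auto simp: u_def v_def)
 have s1: "s^2 < 1" using s by (simp add: abs_square_less_1)
 have "HD (0, 0) (u, v) <= sqrt 2 * s / (1 - s^2)"
 proof (rule rdist_le_segment)
  have m: "(0, 0) : cball 0 (s / 2) \<times> cball (0 :: real^'n) (s / 2)" "(u, v) : cball 0 (s / 2) \<times> cball 0 (s / 2)" using n s by auto
  have sub: "closed_segment (0, 0) (u, v) \<subseteq> cball 0 (s / 2) \<times> cball 0 (s / 2)"
   by (rule closed_segment_subset[OF m convex_Times[OF convex_cball convex_cball]])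
  then show "closed_segment (0, 0) (u, v) \<subseteq> HP" using s by (fastforce simp: hyp_prod_def)
  fix z assume "z : closed_segment (0, 0) (u, v)"
  then have z: "norm (fst z) <= s / 2" "norm (snd z) <= s / 2" using sub by auto
  have le: "hm y w w <= s^2 / (1 - s^2)^2" if "norm y <= s / 2" "norm w <= s / 2" for y w :: "real^'n"
  proof -
   have "(norm y)^2 <= s^2" using that s by (intro power_mono) auto
   then have "(1 - s^2)^2 <= (1 - (norm y)^2)^2" using s1 by (intro power_mono) auto
   moreover have "(norm w)^2 <= (s / 2)^2" using that s by (intro power_mono) auto
   then have "4 * (w \<bullet> w) <= s^2" by (simp add: power2_norm_eq_inner power_divide)
   ultimately show ?thesis unfolding hyp_metric_def using s1 by (intro frac_le) auto
  qed
  have "g0 z ((u, v) - (0, 0)) ((u, v) - (0, 0)) <= s^2 / (1 - s^2)^2 + s^2 / (1 - s^2)^2"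
   using le[OF z(1) n(1)] le[OF z(2) n(2)] by (simp add: hyp_prod_metric_def)
  also have "... = (sqrt 2 * s / (1 - s^2))^2" by (simp add: power_divide power_mult_distrib)
  finally show "sqrt (g0 z ((u, v) - (0, 0)) ((u, v) - (0, 0))) <= sqrt 2 * s / (1 - s^2)"
   using s s1 by (intro real_le_lsqrt) auto
 qed (use s s1 in auto)
 then show ?thesis using hyp_prod_isometry[OF f(1) h(1) p q] f h by (cases p; cases q) (simp add: u_def v_def)
qed

lemma measure_pvol_box:
 "measure (pvol :: 'n::finite pt measure) (hball 0 r \<times> hball 0 s) = measure hvol (hball (0 :: real^'n) r) * measure hvol (hball (0 :: real^'n) s)"
 "hball 0 r \<times> hball 0 s : fmeasurable (pvol :: 'n::finite pt measure)"
proof -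
 have b: "hball (0 :: real^'n) r : sets borel" "hball (0 :: real^'n) r \<subseteq> HS" for r by (rule hball_borel) (auto simp: hball_def)
 have e: "emeasure pvol (hball (0 :: real^'n) r \<times> hball (0 :: real^'n) s) = emeasure hvol (hball (0 :: real^'n) r) * emeasure hvol (hball (0 :: real^'n) s)"
  by (rule pvol_times) (use b in simp_all)
 then show "measure (pvol :: 'n pt measure) (hball 0 r \<times> hball 0 s) = measure hvol (hball (0 :: real^'n) r) * measure hvol (hball (0 :: real^'n) s)"
  by (simp add: measure_def enn2real_mult)
 have "hball 0 r \<times> hball (0 :: real^'n) s : sets pvol"
  unfolding sets_pvol using borel_Times[OF b(1) b(1)] b(2) by (auto simp: hyp_prod_def)
 then show "hball 0 r \<times> hball 0 s : fmeasurable (pvol :: 'n pt measure)"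
  using e hvol_hball_finite[of "0 :: real^'n"] by (intro fmeasurableI) (auto simp: ennreal_mult_less_top)
qed

text \<open>Sorting by the integer part of the first distance covers the l1 ball by at most
  \<open>T + 1\<close> boxes whose volumes share the bound \<open>exp (h' (T + 1))\<close> up to a
  constant, because the two radii of a box add up to \<open>T + 1\<close>.\<close>

lemma l1_volume:
 assumes h: "((%R. ln (measure (hvol :: (real^'n::finite) measure) (hball 0 R)) / R) \<longlongrightarrow> h) at_top" and h': "h < h'" "0 <= h'"
 shows "EX c. ALL T>=0. ALL A:fmeasurable pvol. A \<subseteq> {q : HP. hdist 0 (fst q) + hdist (0 :: real^'n) (snd q) < T} -->
  measure pvol A <= (T + 1) * exp (h' * (T + 1) + c)"
proof -
 let ?V = "%R. measure (hvol :: (real^'n) measure) (hball 0 R)"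
 have mono: "?V R <= ?V S" if "R <= S" for R S
  using that hvol_hball_finite[of "0 :: real^'n"] hball_borel[of "0 :: real^'n"]
  by (intro measure_mono_fmeasurable fmeasurableI) (auto simp: hball_def)
 obtain c where c: "!!R. 0 <= R ==> ?V R <= exp (h' * R + c)" using growth_bound[OF h mono h'] by auto
 have "measure pvol A <= (T + 1) * exp (h' * (T + 1) + 2 * c)"
  if T: "0 <= T" and A: "A : fmeasurable pvol" "A \<subseteq> {q : HP. hdist 0 (fst q) + hdist (0 :: real^'n) (snd q) < T}" for T A
 proof -
  let ?N = "nat \<lfloor>T\<rfloor>" and ?B = "%k::nat. hball 0 (real k + 1) \<times> hball (0 :: real^'n) (T - real k)"
  have "A \<subseteq> (\<Union>k\<in>{..?N}. ?B k)"
  proof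
   fix q assume "q : A"
   then have q: "q : HP" "hdist 0 (fst q) + hdist 0 (snd q) < T" using A by auto
   define k where "k = nat \<lfloor>hdist 0 (fst q)\<rfloor>"
   have k: "real k <= hdist 0 (fst q)" "hdist 0 (fst q) < real k + 1" by (auto simp: k_def of_nat_nat)
   have "hdist 0 (fst q) <= T" using q(2) rdist_nonneg[of HS hm 0 "snd q"] by linarith
   then have "k <= ?N" unfolding k_def by (intro nat_mono floor_mono)
   moreover have "q : ?B k" using HP_D[OF q(1)] q(2) k by (cases q) (auto simp: hball_def)
   ultimately show "q : (\<Union>k\<in>{..?N}. ?B k)" by blast
  qed
  then have "measure pvol A <= measure pvol (\<Union>k\<in>{..?N}. ?B k)"
   by (intro measure_mono_fmeasurable fmeasurable.finite_UN measure_pvol_box(2)) (use A in auto)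
  also have "... <= (\<Sum>k\<in>{..?N}. measure pvol (?B k))"
   by (intro measure_UNION_le) (auto intro: fmeasurableD measure_pvol_box(2))
  also have "... <= (\<Sum>k\<in>{..?N}. exp (h' * (T + 1) + 2 * c))"
  proof (rule sum_mono)
   fix k assume "k : {..?N}"
   then have k: "real k <= T" using T by (auto simp: le_nat_floor) linarith
   have "measure pvol (?B k) <= exp (h' * (real k + 1) + c) * exp (h' * (T - real k) + c)"
    unfolding measure_pvol_box(1) using k by (intro mult_mono c) auto
   also have "... = exp (h' * (T + 1) + 2 * c)" unfolding exp_add[symmetric] by (simp add: algebra_simps)
   finally show "measure pvol (?B k) <= exp (h' * (T + 1) + 2 * c)" .
  qed
  also have "... <= (T + 1) * exp (h' * (T + 1) + 2 * c)"
   using T by (simp add: of_nat_nat)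
  finally show ?thesis .
 qed
 then show ?thesis by blast
qed

text \<open>\<open>l1_volume\<close> is available for every rate above \<open>h\<close>; its
  polynomial factor and the constant \<open>be\<close> disappear in the limit, after which the rate
  is lowered to \<open>h\<close>.\<close>

lemma entropy_le_l1:
 fixes g :: "'n::finite pt tensor2"
 assumes h: "((%R. ln (measure (hvol :: (real^'n::finite) measure) (hball 0 R)) / R) \<longlongrightarrow> h) at_top" "0 <= h"
  and E: "((%R. ln (measure pvol {q : HP. rdist HP g 0 q < R}) / R) \<longlongrightarrow> E) at_top"
   "!!R. 0 < R ==> 0 < measure pvol {q : HP. rdist HP g 0 q < R + 1}"
   "!!R. {q : HP. rdist HP g 0 q < R} : fmeasurable pvol"
  and le: "!!q R. q : HP ==> rdist HP g 0 q < R ==> hdist 0 (fst q) + hdist 0 (snd q) < al * R + be"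
  and al: "0 < al" "0 <= be"
 shows "E <= al * h"
proof -
 have "E / al <= h'" if h': "h < h'" for h'
 proof -
  have h0: "0 <= h'" using h(2) h' by simp
  obtain c where c: "!!T A. 0 <= T ==> A : fmeasurable pvol ==> A \<subseteq> {q : HP. hdist 0 (fst q) + hdist (0 :: real^'n) (snd q) < T} ==>
   measure pvol A <= (T + 1) * exp (h' * (T + 1) + c)" using l1_volume[OF h(1) h' h0] by blast
  have "E <= al * h'"
  proof (rule growth_compare[OF E(1)])
   have "((%T. ln (T + 1) / T + (h' * (T + 1) + c) / T) \<longlongrightarrow> 0 + h') at_top"
    by (intro tendsto_add) real_asymp+
   moreover have "\<forall>\<^sub>F T in at_top. ln (T + 1) / T + (h' * (T + 1) + c) / T = ln ((T + 1) * exp (h' * (T + 1) + c)) / T"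
    using eventually_gt_at_top[of 0] by eventually_elim (simp add: ln_mult_pos add_divide_distrib)
   ultimately have "((%T. ln ((T + 1) * exp (h' * (T + 1) + c)) / T) \<longlongrightarrow> 0 + h') at_top" by (rule Lim_transform_eventually)
   then show "((%T. ln ((T + 1) * exp (h' * (T + 1) + c)) / T) \<longlongrightarrow> h') at_top" by simp
   show "\<forall>\<^sub>F R in at_top. 0 < measure pvol {q : HP. rdist HP g 0 q < R} &
     measure pvol {q : HP. rdist HP g 0 q < R} <= (al * R + be + 1) * exp (h' * (al * R + be + 1) + c)"
    using eventually_gt_at_top[of 1]
   proof eventually_elim
    case (elim R)
    have "0 <= al * R + be" using elim al by simp
    then show ?case using E(2)[of "R - 1"] elim by (auto intro!: c E(3) le)
   qed
  qed (rule al(1))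
  then show ?thesis using al by (simp add: pos_divide_le_eq mult.commute)
 qed
 then have "E / al <= h" by (rule dense_ge)
 then show ?thesis using al by (simp add: pos_divide_le_eq mult.commute)
qed

lemma move_0:
 assumes "w : (HP :: 'n::finite pt set)"
 shows "EX f. f ` HP \<subseteq> HP & (ALL p:HP. ALL q:HP. HD (f p) (f q) = HD p q) &
   HD 0 (f w :: 'n pt) <= 0"
proof -
 note W = HP_D[OF assms]
 obtain f where f: "f : hyp_isom" "f (fst w) = 0" using hyp_transitive[OF W(1)] by metis
 obtain h where h: "h : hyp_isom" "h (snd w) = 0" using hyp_transitive[OF W(2)] by metis
 have "map_prod f h w = 0" using f h by (cases w) (simp add: zero_prod_def)
 moreover have "HD 0 (0 :: 'n pt) = 0"
  by (rule rdist_refl[OF semi_HP convex_HP]) (simp add: hyp_prod_def zero_prod_def)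
 ultimately show ?thesis using hyp_prod_isometry[OF f(1) h(1)] map_prod_image[OF f(1) h(1)] by (intro exI[of _ "map_prod f h"]) auto
qed

lemma rdist_le_double: "rdist HP g p q <= 2 * rdist HP g p q"
 using rdist_nonneg[of HP g p q] by linarith

lemmas entropy_HP = prod_entropy[OF semi_HP refl rdist_le_double rdist_le_double move_0 order.refl]

text \<open>The box of two hyperbolic balls of radius \<open>R\<close> has volume
  \<open>(?V R)^2\<close>, of rate \<open>2 h\<close>, and lies in a product ball of radius about
  \<open>sqrt 2 R\<close>.\<close>

lemma entropy_HP_ge:
 assumes h: "((%R. ln (measure (hvol :: (real^'n::finite) measure) (hball 0 R)) / R) \<longlongrightarrow> h) at_top"
 shows "sqrt 2 * h <= volume_entropy HP (g0 :: 'n pt tensor2)"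
proof -
 let ?E = "volume_entropy HP (g0 :: 'n pt tensor2)"
 let ?V = "%R. measure (hvol :: (real^'n) measure) (hball 0 R)"
 let ?D = "rdist HP (g0 :: 'n pt tensor2)"
 have z: "(0 :: 'n pt) : HP" by (simp add: hyp_prod_def zero_prod_def)
 have ineq: "2 * h <= sqrt 2 / (1 - s^2) * ?E" if s: "0 < s" "s < 1 / 2" for s :: real
 proof (rule growth_compare[of "%R. (?V R)^2"])
  let ?a = "sqrt 2 / (1 - s^2)"
  have a: "0 < ?a" using s by (simp add: abs_square_less_1)
  then show "0 < ?a" .
  have "((%R. 2 * (ln (?V R) / R)) \<longlongrightarrow> 2 * h) at_top" by (intro tendsto_mult_left h)
  then show "((%R. ln ((?V R)^2) / R) \<longlongrightarrow> 2 * h) at_top" by (simp add: ln_realpow)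
  show "((%R. ln (measure pvol {q : HP. ?D 0 q < R}) / R) \<longlongrightarrow> ?E) at_top" by (rule entropy_HP(1))
  show "\<forall>\<^sub>F R in at_top. 0 < (?V R)^2 & (?V R)^2 <= measure pvol {q : HP. ?D 0 q < ?a * R + (?a * s + 1)}"
   using eventually_ge_at_top[of 1]
  proof (eventually_elim, intro conjI)
   case (elim R)
   have "ennreal (unit_ball_vol (real CARD('n)) * (1 / 32) ^ CARD('n)) <= emeasure hvol (hball (0 :: real^'n) R)"
    using elim hball_borel[of "0 :: real^'n" R]
    by (intro order.trans[OF hvol_hball_lower[of "0 :: real^'n"]] emeasure_mono) (auto simp: hball_def)
   also have "... = ennreal (?V R)" using hvol_hball_finite[of "0 :: real^'n" R] by (intro emeasure_eq_ennreal_measure) auto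
   finally have "unit_ball_vol (real CARD('n)) * (1 / 32) ^ CARD('n) <= ?V R" by simp
   moreover have "0 < unit_ball_vol (real CARD('n)) * (1 / 32) ^ CARD('n)" by simp
   ultimately have "0 < ?V R" by linarith
   then show "0 < (?V R)^2" by simp
   have "(?V R)^2 = measure pvol (hball (0 :: real^'n) R \<times> hball (0 :: real^'n) R)" by (simp add: measure_pvol_box power2_eq_square)
   also have "... <= measure pvol {q : HP. ?D 0 q < ?a * R + (?a * s + 1)}"
   proof (rule measure_mono_fmeasurable)
    show "hball (0 :: real^'n) R \<times> hball (0 :: real^'n) R \<subseteq> {q : HP. ?D 0 q < ?a * R + (?a * s + 1)}"
    proof
     fix q assume q: "q : hball (0 :: real^'n) R \<times> hball (0 :: real^'n) R"
     then have qX: "q : HP" by (auto simp: hyp_prod_def hball_def)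
     define m where "m = nat \<lfloor>R / s\<rfloor>"
     have m: "real m <= R / s" "R / s < real (Suc m)" using s elim by (auto simp: m_def of_nat_nat) linarith
     have "?D 0 q <= real (Suc m) * (sqrt 2 * s / (1 - s^2))"
     proof (rule rdist_chain[of HP "%p q. max (hdist (fst p) (fst q)) (hdist (snd p) (snd q))" ?D s])
      fix p q :: "'n pt" and t u :: real
      assume pq: "p : HP" "q : HP" "max (hdist (fst p) (fst q)) (hdist (snd p) (snd q)) < t + u" "0 < t" "0 < u"
      obtain x where x: "x : HS" "hdist (fst p) x < t" "hdist x (fst q) < u"
       using rdist_split[OF semi_hyp convex_ball HP_D(1)[OF pq(1)] HP_D(1)[OF pq(2)], of t u] pq by auto
      obtain y where y: "y : HS" "hdist (snd p) y < t" "hdist y (snd q) < u"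
       using rdist_split[OF semi_hyp convex_ball HP_D(2)[OF pq(1)] HP_D(2)[OF pq(2)], of t u] pq by auto
      show "EX w:HP. max (hdist (fst p) (fst w)) (hdist (snd p) (snd w)) < t & max (hdist (fst w) (fst q)) (hdist (snd w) (snd q)) < u"
       by (rule bexI[of _ "(x, y)"]) (use x y in "auto simp: hyp_prod_def")
     next
      show "max (hdist (fst (0 :: 'n pt)) (fst q)) (hdist (snd (0 :: 'n pt)) (snd q)) < real (Suc m) * s"
       using q m(2) s elim by (auto simp: hball_def pos_divide_less_eq)
     next
      fix p q :: "'n pt"
      assume "p : HP" "q : HP" "max (hdist (fst p) (fst q)) (hdist (snd p) (snd q)) < s"
      then show "?D p q <= sqrt 2 * s / (1 - s^2)" using s by (intro D0_short) auto
     qed (use rdist_triangle[OF semi_HP convex_HP] s z qX in auto)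
     also have "... = real (Suc m) * (?a * s)" by simp
     also have "... <= (R / s + 1) * (?a * s)" by (rule mult_right_mono[OF _ mult_nonneg_nonneg]) (use m(1) a s in "simp_all del: times_divide_eq_left")
     also have "(R / s + 1) * (x * s) = x * R + x * s" for x using s by (simp add: field_simps)
     finally show "q : {q : HP. ?D 0 q < ?a * R + (?a * s + 1)}" using qX by simp
    qed
    show "hball (0 :: real^'n) R \<times> hball (0 :: real^'n) R : sets pvol" by (rule fmeasurableD[OF measure_pvol_box(2)])
   qed (rule entropy_HP(3))
   finally show "(?V R)^2 <= measure pvol {q : HP. ?D 0 q < ?a * R + (?a * s + 1)}" .
  qed
 qed
 have "2 * h <= sqrt 2 / (1 - 0^2) * ?E"
 proof (rule tendsto_lowerbound)
  show "((%s. sqrt 2 / (1 - s^2) * ?E) \<longlongrightarrow> sqrt 2 / (1 - 0^2) * ?E) (at_right 0)" by (intro tendsto_intros) auto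
  show "\<forall>\<^sub>F s in at_right 0. 2 * h <= sqrt 2 / (1 - s^2) * ?E"
   by (rule eventually_mono[OF eventually_at_right_real[of 0 "1 / 2 :: real"]]) (use ineq in auto)
 qed simp
 moreover have "sqrt 2 * (sqrt 2 * h) = 2 * h" by (simp flip: mult.assoc)
 ultimately have "sqrt 2 * (sqrt 2 * h) <= sqrt 2 * ?E" by (simp only:) simp
 then show ?thesis by (rule mult_left_le_imp_le) simp
qed

section \<open>Convergence of the entropies\<close>

context shell
begin

lemma entropy_converges:
 assumes d: "!!i. ok (dl i)" "dl \<longlonglongrightarrow> 0"
 shows "(%i. volume_entropy Xp (gd (dl i))) \<longlonglongrightarrow> volume_entropy Xp g0"
proof -
 obtain h where h: "((%R. ln (measure (hvol :: (real^'n) measure) (hball 0 R)) / R) \<longlongrightarrow> h) at_top" "0 <= h" using hyp_growth by blast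
 let ?E = "%dl. volume_entropy Xp (gd dl)" and ?Z = "volume_entropy Xp g0"
 \<comment> \<open>The fixed scale of both local comparisons. As \<open>dl\<close> tends to 0, their
   errors vanish relative to \<open>c\<close>, so \<open>up\<close> tends to \<open>sqrt 2\<close>
   and \<open>lo\<close> to 1.\<close>
 define c where "c = R / 5"
 have c: "0 < c" "0 <= c" "c <= R / 5" using R by (auto simp: c_def)
 have z: "0 : Xp" by (simp add: hyp_prod_def zero_prod_def)
 have sq: "sqrt 2 * x <= 2 * x" if "0 <= x" for x :: real using that sqrt2_less_2 by (intro mult_right_mono) auto
 note E0 = entropy_HP[where ?'n='n]
 define up where "up dl = (sqrt 2 * c + 3 * dl / rh^2) / c" for dl
 define lo where "lo dl = (c + 30 * dl / rh) / c" for dl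
 have chain: "d' 0 q < L / c * T + (L + 1)"
  if split: "!!p q a b. p : Xp ==> q : Xp ==> d p q < a + b ==> 0 < a ==> 0 < b ==> EX w:Xp. d p w < a & d w q < b"
  and tri: "!!p q r. p : Xp ==> q : Xp ==> r : Xp ==> d' p r <= d' p q + d' q r"
  and short: "!!p q. p : Xp ==> q : Xp ==> d p q < c ==> d' p q <= L"
  and q: "q : Xp" "d 0 q < T" "0 <= d 0 q" "0 <= L"
  for d d' :: "'n pt => 'n pt => real" and q L T
 proof -
  define m where "m = nat \<lfloor>T / c\<rfloor>"
  have T: "0 < T / c" using q(2,3) c by simp
  have m: "real m <= T / c" "T / c < real (Suc m)" using T by (auto simp: m_def of_nat_nat) linarith
  have "d' 0 q <= real (Suc m) * L"
   by (rule rdist_chain[of Xp d d' c, OF split tri short c(1) z q(1)]) (use q(2) m(2) c in "simp_all add: pos_divide_less_eq")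
  also have "... <= (T / c + 1) * L" using m(1) q(4) by (intro mult_right_mono) auto
  finally show ?thesis by (simp add: algebra_simps)
 qed
 have bounds: "?Z <= lo dl * ?E dl" "?E dl <= up dl * h" "0 < lo dl" if ok: "ok dl" for dl
 proof -
  have d: "0 <= 3 * dl / rh^2" "0 <= 30 * dl / rh" using ok rh by (auto simp: ok_def)
  obtain K where K: "0 <= K" "!!y. y : HS ==> EX ga:Gm. hdist (ga y) 0 <= K" using cocompact_bound by blast
  have move: "EX f. f ` Xp \<subseteq> Xp & (ALL p:Xp. ALL q:Xp. Dd dl (f p) (f q) = Dd dl p q) & Dd dl 0 (f w) <= 2 * K" if w: "w : Xp" for w
  proof -
   note W = HP_D[OF w]
   obtain f where f: "f : hyp_isom" "f (fst w) = 0" using hyp_transitive[OF W(1)] by metis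
   obtain ga where g: "ga : Gm" "hdist (ga (snd w)) 0 <= K" using K(2)[OF W(2)] by blast
   have m: "map_prod f ga w : Xp" using map_prod_image[OF f(1) isom[OF g(1)]] w by blast
   have fw: "fst (map_prod f ga w) = 0" "snd (map_prod f ga w) = ga (snd w)" using f by (cases w; simp)+
   have "Dd dl 0 (map_prod f ga w) <= sqrt 2 * D0 0 (map_prod f ga w)" by (rule Dd_le_D0[OF ok z m])
   also have "... <= 2 * D0 0 (map_prod f ga w)" by (rule sq) simp
   also have "... <= 2 * K"
    using D0_le_l1[OF z m] fw g(2) hdist_sym[of "ga (snd w)" 0] hdist_refl[of "0 :: real^'n"] by simp
   finally show ?thesis
    using Dd_invariant[OF ok f(1) g(1)] map_prod_image[OF f(1) isom[OF g(1)]] by (intro exI[of _ "map_prod f ga"]) auto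
  qed
  have cmp: "Dd dl p q <= 2 * D0 p q" "D0 p q <= 2 * Dd dl p q" if "p : Xp" "q : Xp" for p q
   using Dd_le_D0[OF ok that] D0_le_Dd[OF ok that] sq[of "D0 p q"] sq[of "Dd dl p q"] by auto
  have KK: "0 <= 2 * K" using K by simp
  note E = prod_entropy[OF semi_gd[OF ok] riem_vol_gd[OF ok] cmp move KK]
  show lo: "0 < lo dl" using c d by (simp add: lo_def add_pos_nonneg)
  show "?E dl <= up dl * h"
  proof (rule entropy_le_l1[OF h E])
   fix q T assume q: "q : Xp" "Dd dl 0 q < T"
   have "(%p q. hdist (fst p) (fst q) + hdist (snd p) (snd q)) 0 q < (sqrt 2 * c + 3 * dl / rh^2) / c * T + ((sqrt 2 * c + 3 * dl / rh^2) + 1)"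
   proof (rule chain[of "Dd dl", OF rdist_split[OF semi_gd[OF ok] convex_HP]])
    fix p q r assume "p : Xp" "q : Xp" "r : Xp"
    then show "hdist (fst p) (fst r) + hdist (snd p) (snd r) <= hdist (fst p) (fst q) + hdist (snd p) (snd q) + (hdist (fst q) (fst r) + hdist (snd q) (snd r))"
     using hdist_triangle[of "fst p" "fst q" "fst r"] hdist_triangle[of "snd p" "snd q" "snd r"] by (auto simp: hyp_prod_def)
   next
    fix p q assume "p : Xp" "q : Xp" "Dd dl p q < c"
    then show "hdist (fst p) (fst q) + hdist (snd p) (snd q) <= sqrt 2 * c + 3 * dl / rh^2"
     by (rule short_lower[OF ok _ _ _ c(2,3)])
   qed (use c q d in auto)
   then show "hdist 0 (fst q) + hdist 0 (snd q) < up dl * T + (sqrt 2 * c + 3 * dl / rh^2 + 1)" by (simp add: up_def)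
  qed (use c d in "auto simp: up_def add_pos_nonneg")
  show "?Z <= lo dl * ?E dl"
  proof (rule growth_compare[OF E0(1) E(1) _ lo])
   show "\<forall>\<^sub>F T in at_top. 0 < measure pvol {q : Xp. D0 0 q < T} &
     measure pvol {q : Xp. D0 0 q < T} <= measure pvol {q : Xp. Dd dl 0 q < lo dl * T + (c + 30 * dl / rh + 1)}"
    using eventually_gt_at_top[of 1]
   proof (eventually_elim, intro conjI)
    case (elim T)
    show "0 < measure pvol {q : Xp. D0 0 q < T}" using E0(2)[of "T - 1"] elim by simp
    show "measure pvol {q : Xp. D0 0 q < T} <= measure pvol {q : Xp. Dd dl 0 q < lo dl * T + (c + 30 * dl / rh + 1)}"
    proof (intro measure_mono_fmeasurable E(3) fmeasurableD[OF E0(3)] subsetI)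
     fix q assume "q : {q : Xp. D0 0 q < T}"
     then have q: "q : Xp" "D0 0 q < T" by auto
     have "Dd dl 0 q < (c + 30 * dl / rh) / c * T + (c + 30 * dl / rh + 1)"
      by (rule chain[of D0, OF rdist_split[OF semi_HP convex_HP] Dd_triangle[OF ok]])
       (use short_upper[OF ok _ _ _ c(2,3)] c q d in auto)
     then show "q : {q : Xp. Dd dl 0 q < lo dl * T + (c + 30 * dl / rh + 1)}" using q by (simp add: lo_def)
    qed
   qed
  qed
 qed
 have up: "(%i. up (dl i) * h) \<longlonglongrightarrow> sqrt 2 * h"
  unfolding up_def using d(2) c rh by (auto intro!: tendsto_eq_intros)
 have lo: "(%i. lo (dl i)) \<longlonglongrightarrow> 1"
  unfolding lo_def using d(2) c rh by (auto intro!: tendsto_eq_intros)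
 \<comment> \<open>Passing to the limit in the same estimates also identifies the entropy of the
   product metric as \<open>sqrt 2 * h\<close>.\<close>
 have "?Z <= 1 * (sqrt 2 * h)"
 proof (rule LIMSEQ_le_const[OF tendsto_mult[OF lo up]], intro exI allI impI)
  fix i :: nat
  have "?Z <= lo (dl i) * ?E (dl i)" by (rule bounds(1)[OF d(1)])
  also have "... <= lo (dl i) * (up (dl i) * h)" using bounds(2,3)[OF d(1)[of i]] by (intro mult_left_mono) auto
  finally show "?Z <= lo (dl i) * (up (dl i) * h)" .
 qed
 then have E0eq: "?Z = sqrt 2 * h" using entropy_HP_ge[OF h(1)] by simp
 show ?thesis
 proof (rule tendsto_sandwich)
  show "\<forall>\<^sub>F i in sequentially. ?Z / lo (dl i) <= ?E (dl i)"
   using bounds(1,3)[OF d(1)] by (simp add: pos_divide_le_eq mult.commute)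
  show "\<forall>\<^sub>F i in sequentially. ?E (dl i) <= up (dl i) * h" using bounds(2)[OF d(1)] by simp
  show "(%i. ?Z / lo (dl i)) \<longlonglongrightarrow> ?Z" using tendsto_divide[OF tendsto_const lo, of ?Z] by simp
  show "(%i. up (dl i) * h) \<longlonglongrightarrow> ?Z" using up E0eq by simp
 qed
qed

end

subsection \<open>Quotients\<close>

lemma topspace_quot_top: "topspace (quot_top X D) = quot X D"
proof -
 have "openin (quot_top X D) (quot X D)"
 proof -
  have "{x : X. orb D x : orb D ` X} = X" by auto
  then show ?thesis unfolding quot_top_def openin_quotient_topology by (simp add: quot_def)
 qed
 moreover have "U \<subseteq> quot X D" if "openin (quot_top X D) U" for U
  using that unfolding quot_top_def openin_quotient_topology by (auto simp: quot_def)
 ultimately show ?thesis by (meson openin_subset openin_topspace subset_antisym)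
qed

lemma continuous_map_orb: "continuous_map (top_of_set X) (quot_top X D) (orb D)"
 unfolding continuous_map topspace_quot_top
 by (auto simp: quot_def quot_top_def openin_quotient_topology)

lemma orb_vimage_borel:
 assumes X: "open X" and B: "B : sigma_sets (quot X D) {U. openin (quot_top X D) U}"
 shows "{x : X. orb D x : B} : sets borel"
 using B
proof induction
 case (Basic U)
 then have "openin (top_of_set X) {x : topspace (top_of_set X). orb D x : U}"
  using continuous_map_orb[of X D] by (simp add: continuous_map)
 then show ?case using openin_open_eq[OF X] by (auto intro: borel_open)
next
 case (Compl B)
 have "{x : X. orb D x : quot X D - B} = X - {x : X. orb D x : B}" by (auto simp: quot_def)
 then show ?case using Compl.IH X by (auto intro: borel_open)
next
 case (Union B)
 have "{x : X. orb D x : (\<Union>i. B i)} = (\<Union>i. {x : X. orb D x : B i})" by auto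
 then show ?case using Union.IH by simp
qed simp

lemma sets_riem_vol: "open X ==> A : sets (riem_vol X g) \<longleftrightarrow> A : sets borel & A \<subseteq> X"
 unfolding riem_vol_def by (auto simp: sets_restrict_space_iff borel_open)

text \<open>The supremum is countably additive: partial sections over disjoint sets unite to a
  section, and a section over a union splits along the preimages of the parts.\<close>

lemma emeasure_quot_vol:
 fixes g :: "'a::euclidean_space tensor2"
 assumes X: "open X" and B: "B : sigma_sets (quot X D) {U. openin (quot_top X D) U}"
 shows "emeasure (quot_vol X D g) B =
  (SUP E \<in> {E : sets (riem_vol X g). inj_on (orb D) E & orb D ` E \<subseteq> B}. emeasure (riem_vol X g) E)"
proof -
 let ?M = "riem_vol X g"
 define S where "S B = {E : sets ?M. inj_on (orb D) E & orb D ` E \<subseteq> B}" for B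
 define F where "F B = (SUP E \<in> S B. emeasure ?M E)" for B
 let ?A = "{U. openin (quot_top X D) U}"
 have ne: "{} : S B" for B by (simp add: S_def)
 have sup: "F B + F C <= F (B \<union> C)" if "B \<inter> C = {}" for B C
 proof -
  have "F B + F C = (SUP E\<in>S B. emeasure ?M E + F C)"
   unfolding F_def[of B] using ne by (intro ennreal_SUP_add_left[symmetric]) auto
  also have "... <= F (B \<union> C)"
  proof (rule SUP_least)
   fix E assume E: "E : S B"
   have "emeasure ?M E + F C = (SUP E'\<in>S C. emeasure ?M E + emeasure ?M E')"
    unfolding F_def add.commute[of "emeasure ?M E"] using ne[of C] by (intro ennreal_SUP_add_left[symmetric]) auto
   also have "... <= F (B \<union> C)"
   proof (rule SUP_least)
    fix E' assume E': "E' : S C"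
    have dis: "orb D ` E \<inter> orb D ` E' = {}" using E E' that by (auto simp: S_def)
    then have "E \<union> E' : S (B \<union> C)" using E E' by (auto simp: S_def inj_on_Un)
    moreover have "emeasure ?M E + emeasure ?M E' = emeasure ?M (E \<union> E')"
     using E E' dis by (intro plus_emeasure) (auto simp: S_def)
    ultimately show "emeasure ?M E + emeasure ?M E' <= F (B \<union> C)" unfolding F_def by (metis SUP_upper)
   qed
   finally show "emeasure ?M E + F C <= F (B \<union> C)" .
  qed
  finally show ?thesis .
 qed
 have mono: "F B <= F C" if "B \<subseteq> C" for B C unfolding F_def by (rule SUP_subset_mono) (use that in "auto simp: S_def")
 have "emeasure (quot_vol X D g) B = F B"
 proof (rule emeasure_measure_of)
  show "quot_vol X D g = measure_of (quot X D) ?A F" unfolding quot_vol_def F_def S_def ..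
  show A: "?A \<subseteq> Pow (quot X D)" using openin_subset[of "quot_top X D"] by (auto simp: topspace_quot_top)
  have sets: "sets (quot_vol X D g) = sigma_sets (quot X D) ?A" unfolding quot_vol_def by (rule sets_measure_of[OF A])
  show "positive (sets (quot_vol X D g)) F"
   by (auto simp: positive_def F_def S_def intro!: antisym SUP_least)
  show "countably_additive (sets (quot_vol X D g)) F"
   unfolding countably_additive_def sets
  proof (intro allI impI antisym)
   fix C :: "nat => 'a set set"
   assume C: "range C \<subseteq> sigma_sets (quot X D) ?A" "disjoint_family C"
   have fin: "(\<Sum>i<n. F (C i)) <= F (\<Union>i<n. C i)" for n
   proof (induction n)
    case (Suc n)
    have "C i \<inter> C n = {}" if "i < n" for i using C(2) that unfolding disjoint_family_on_def by simp
    then have "(\<Union>i<n. C i) \<inter> C n = {}" by blast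
    then have "F (\<Union>i<n. C i) + F (C n) <= F ((\<Union>i<n. C i) \<union> C n)" by (rule sup)
    moreover have "(\<Union>i<n. C i) \<union> C n = (\<Union>i<Suc n. C i)" by (auto simp: less_Suc_eq)
    ultimately have "F (\<Union>i<n. C i) + F (C n) <= F (\<Union>i<Suc n. C i)" by simp
    moreover have "(\<Sum>i<Suc n. F (C i)) <= F (\<Union>i<n. C i) + F (C n)" using add_right_mono[OF Suc] by simp
    ultimately show ?case by (rule order.trans[rotated])
   qed simp
   show "(\<Sum>i. F (C i)) <= F (\<Union>i. C i)"
    by (rule suminf_le_const[OF summableI]) (auto intro: order.trans[OF fin mono])
   show "F (\<Union>i. C i) <= (\<Sum>i. F (C i))"
    unfolding F_def[of "\<Union>i. C i"]
   proof (rule SUP_least)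
    fix E assume E: "E : S (\<Union>i. C i)"
    define E' where "E' i = E \<inter> {x : X. orb D x : C i}" for i
    have EX: "E \<subseteq> X" "E : sets borel" using E sets_riem_vol[OF X] by (auto simp: S_def)
    have E's: "E' i : S (C i)" for i
     using E EX orb_vimage_borel[OF X, of "C i" D] C(1)
     by (auto simp: S_def E'_def sets_riem_vol[OF X] intro: inj_on_subset)
    have "E = (\<Union>i. E' i)" using E EX by (auto simp: E'_def S_def)
    moreover have "disjoint_family E'" using C(2) by (auto simp: disjoint_family_on_def E'_def)
    ultimately have "emeasure ?M E = (\<Sum>i. emeasure ?M (E' i))"
    proof -
     have "range E' \<subseteq> sets ?M" using E's by (auto simp: S_def)
     from suminf_emeasure[OF this \<open>disjoint_family E'\<close>] show ?thesis using \<open>E = (\<Union>i. E' i)\<close> by simp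
    qed
    also have "... <= (\<Sum>i. F (C i))"
     by (intro suminf_le summableI) (auto simp: F_def intro: SUP_upper E's)
    finally show "emeasure ?M E <= (\<Sum>i. F (C i))" .
   qed
  qed
  show "B : sets (quot_vol X D g)" using B sets by simp
 qed
 then show ?thesis by (simp add: F_def S_def)
qed

lemma emeasure_le_quot_vol:
 fixes g :: "'a::euclidean_space tensor2"
 assumes X: "open X" and Z: "closedin (quot_top X D) Z"
  and E: "E : sets (riem_vol X g)" "inj_on (orb D) E"
 shows "emeasure (riem_vol X g) {x : E. orb D x : Z} <= emeasure (quot_vol X D g) Z"
proof -
 have "quot X D - (quot X D - Z) : sigma_sets (quot X D) {U. openin (quot_top X D) U}"
  using Z by (intro sigma_sets.Compl sigma_sets.Basic) (simp add: closedin_def topspace_quot_top)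
 moreover have "quot X D - (quot X D - Z) = Z" using closedin_subset[OF Z] by (auto simp: topspace_quot_top)
 ultimately have ZB: "Z : sigma_sets (quot X D) {U. openin (quot_top X D) U}" by simp
 have "{x : E. orb D x : Z} = E \<inter> {x : X. orb D x : Z}" using E sets_riem_vol[OF X] by auto
 then have "{x : E. orb D x : Z} : sets (riem_vol X g)"
  using E orb_vimage_borel[OF X ZB] sets_riem_vol[OF X] by auto
 then show ?thesis unfolding emeasure_quot_vol[OF X ZB] using E(2)
  by (intro SUP_upper) (auto intro: inj_on_subset)
qed

lemma le_intrinsic_dist: "d p q <= intrinsic_dist T d A p q"
 unfolding intrinsic_dist_def
proof (rule INF_greatest)
 fix c assume c: "c : {c. pathin (subtopology T A) c & c 0 = p & c 1 = q}"
 \<comment> \<open>Partitions are infinite increasing sequences of which \<open>k + 1\<close> terms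
   are used; here \<open>k = 1\<close>.\<close>
 let ?t = "%i::nat. if i = 0 then 0 else 1 :: real"
 have "(\<Sum>i<1. d (c (?t i)) (c (?t (Suc i)))) <= curve_length d c"
  unfolding curve_length_def by (intro SUP_upper2[of "(?t, 1)"]) (auto simp: incseq_def)
 then show "d p q <= curve_length d c" using c by simp
qed

lemma intrinsic_dist_le:
 fixes c :: "real => 'a::euclidean_space"
 assumes D: "!!x. x : X ==> x : orb D x" and g: "semi_metric X g" and c: "valid_path c" "c ` {0..1} \<subseteq> X"
  and Z: "!!t. t : {0..1} ==> orb D (c t) ~: Z"
 shows "intrinsic_dist (quot_top X D) (quot_dist X D g) (quot X D - Z) (orb D (c 0)) (orb D (c 1)) <= path_length g c"
proof -
 have "continuous_map (top_of_set {0..1}) (top_of_set X) c"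
  using c valid_path_imp_path by (auto simp: path_def)
 then have "continuous_map (top_of_set {0..1}) (quot_top X D) (orb D \<circ> c)"
  by (rule continuous_map_compose) (rule continuous_map_orb)
 then have "pathin (subtopology (quot_top X D) (quot X D - Z)) (orb D \<circ> c)"
  using c Z by (auto simp: pathin_def continuous_map_in_subtopology quot_def)
 then have "intrinsic_dist (quot_top X D) (quot_dist X D g) (quot X D - Z) (orb D (c 0)) (orb D (c 1)) <= curve_length (quot_dist X D g) (orb D \<circ> c)"
  unfolding intrinsic_dist_def by (intro INF_lower) auto
 also have "... <= path_length g c"
  unfolding curve_length_def
 proof (rule SUP_least, safe)
  fix t :: "nat => real" and k :: nat
  assume t: "incseq t" "range t \<subseteq> {0..1}"
  have t01: "0 <= t i" "t i <= 1" for i using t(2) by (auto simp: image_subset_iff)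
  have ti: "t i <= t j" if "i <= j" for i j using t(1) that by (simp add: incseq_def)
  have "(\<Sum>i<k. quot_dist X D g ((orb D \<circ> c) (t i)) ((orb D \<circ> c) (t (Suc i)))) <= (\<Sum>i<k. plen g c (t i) (t (Suc i)))"
  proof (rule sum_mono)
   fix i
   have m: "c (t i) : X" "c (t (Suc i)) : X" using c(2) t01 by auto
   have "quot_dist X D g (orb D (c (t i))) (orb D (c (t (Suc i)))) <= riem_dist X g (c (t i)) (c (t (Suc i)))"
    unfolding quot_dist_def using D m by (intro INF_lower2[of "(c (t i), c (t (Suc i)))"]) auto
   also have "... <= plen g c (t i) (t (Suc i))" by (rule riem_dist_le_plen[OF g c t01(1) ti t01(2)]) simp
   finally show "quot_dist X D g ((orb D \<circ> c) (t i)) ((orb D \<circ> c) (t (Suc i))) <= plen g c (t i) (t (Suc i))" by simp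
  qed
  also have "... = plen g c (t 0) (t k)"
  proof (induction k)
   case (Suc k)
   then show ?case using plen_add[OF g c t01(1) ti ti t01(2), of 0 k "Suc k"] by simp
  qed (simp add: plen_point)
  also have "... <= path_length g c" unfolding path_length_plen
   by (rule plen_mono_bounds[OF g c]) (use t01 ti in auto)
  finally show "(\<Sum>i<k. quot_dist X D g ((orb D \<circ> c) (t i)) ((orb D \<circ> c) (t (Suc i)))) <= path_length g c" .
 qed
 finally show ?thesis .
qed

subsection \<open>Paths avoiding a frontier\<close>

text \<open>A relation with an upper bound for the length, so that paths are concatenated without
  being named.\<close>

definition joined :: "'a::euclidean_space set => 'a tensor2 => 'a set => 'a => 'a => real => bool" where
 "joined X g B p q L \<longleftrightarrow> (EX c. valid_path c & c ` {0..1} \<subseteq> X - B & c 0 = p & c 1 = q & path_length g c <= ennreal L)"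

lemma joined_sym: "semi_metric X g ==> joined X g B p q L ==> joined X g B q p L"
 unfolding joined_def
proof (elim exE conjE)
 fix c assume g: "semi_metric X g" and c: "valid_path c" "c ` {0..1} \<subseteq> X - B" "c 0 = p" "c 1 = q" "path_length g c <= ennreal L"
 have "reversepath c ` {0..1} = c ` {0..1}" using path_image_reversepath[of c] by (simp add: path_image_def)
 then show "EX c. valid_path c & c ` {0..1} \<subseteq> X - B & c 0 = q & c 1 = p & path_length g c <= ennreal L"
  using c valid_path_imp_reverse[OF c(1)] path_length_reversepath[OF g c(1)] by (intro exI[of _ "reversepath c"]) (auto simp: reversepath_def subset_iff)
qed

lemma joined_trans:
 assumes g: "semi_metric X g" and "joined X g B p q L" "joined X g B q r L'" "0 <= L" "0 <= L'"
 shows "joined X g B p r (L + L')"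
proof -
 obtain c where c: "valid_path c" "c ` {0..1} \<subseteq> X - B" "c 0 = p" "c 1 = q" "path_length g c <= ennreal L"
  using assms(2) unfolding joined_def by auto
 obtain d where d: "valid_path d" "d ` {0..1} \<subseteq> X - B" "d 0 = q" "d 1 = r" "path_length g d <= ennreal L'"
  using assms(3) unfolding joined_def by auto
 have e: "c 1 = d 0" using c d by simp
 have "valid_path (c +++ d)" using c d e by (intro valid_path_join) (auto simp: pathfinish_def pathstart_def)
 moreover have "(c +++ d) ` {0..1} \<subseteq> X - B" using path_image_join_subset[of c d] c d by (auto simp: path_image_def)
 moreover have "path_length g (c +++ d) = path_length g c + path_length g d"
  by (rule path_length_join[OF g c(1) _ d(1) _ e]) (use c d in auto)
 moreover have "path_length g c + path_length g d <= ennreal (L + L')" using c(5) d(5) assms(4,5) by (simp add: add_mono)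
 ultimately show ?thesis unfolding joined_def using c d by (intro exI[of _ "c +++ d"]) (auto simp: joinpaths_def)
qed

lemma joined_mono: "joined X g B p q L ==> L <= L' ==> joined X g B p q L'"
 unfolding joined_def using order.trans[OF _ ennreal_leI] by blast

lemma path_length_linepath:
 assumes "!!z. z : closed_segment p q ==> sqrt (g z (q - p) (q - p)) <= K"
 shows "path_length g (linepath p q) <= ennreal K"
proof -
 have "path_length g (linepath p q) <= (\<integral>\<^sup>+t. ennreal K * indicator {0..1::real} t \<partial>lborel)"
  unfolding path_length_def
 proof (intro nn_integral_mono)
  fix t :: real
  show "ennreal (sqrt (g (linepath p q t) (vector_derivative (linepath p q) (at t)) (vector_derivative (linepath p q) (at t)))) * indicator {0..1} t
    <= ennreal K * indicator {0..1} t"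
  proof (cases "t : {0..1}")
   case True
   then have "linepath p q t : closed_segment p q" using path_image_linepath[of p q] by (auto simp: path_image_def)
   then show ?thesis using assms True by (simp add: ennreal_leI)
  qed simp
 qed
 then show ?thesis by (simp add: nn_integral_cmult_indicator)
qed

lemma joined_segment:
 assumes "closed_segment p q \<subseteq> X - B" "!!z. z : closed_segment p q ==> sqrt (g z (q - p) (q - p)) <= K"
 shows "joined X g B p q K"
 unfolding joined_def
 by (rule exI[of _ "linepath p q"]) (use assms path_length_linepath[of p q g K] path_image_linepath[of p q] linepath_0'[of p q] linepath_1'[of p q] in "auto simp: path_image_def")

text \<open>Avoiding the frontier is enough: a connected set that meets both \<open>Z\<close> and
  its complement meets the frontier, so the path stays on the side where it starts.\<close>

lemma joined_intrinsic:
 fixes p :: "'a::euclidean_space"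
 assumes D: "!!x. x : X ==> x : orb D x" and g: "semi_metric X g"
  and j: "joined X g {x. orb D x : quot_top X D frontier_of Z} p q L" and p: "orb D p ~: Z"
 shows "orb D q ~: Z" and "intrinsic_dist (quot_top X D) (quot_dist X D g) (quot X D - Z) (orb D p) (orb D q) <= ennreal L"
proof -
 obtain c where c: "valid_path c" "c ` {0..1} \<subseteq> X" "!!t. t : {0..1} ==> orb D (c t) ~: quot_top X D frontier_of Z"
   "c 0 = p" "c 1 = q" "path_length g c <= ennreal L"
  using j unfolding joined_def by (auto simp: image_subset_iff)
 have "continuous_map (top_of_set {0..1}) (top_of_set X) c"
  using c valid_path_imp_path by (auto simp: path_def)
 then have "continuous_map (top_of_set {0..1}) (quot_top X D) (orb D \<circ> c)"
  by (rule continuous_map_compose) (rule continuous_map_orb)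
 then have con: "connectedin (quot_top X D) ((orb D \<circ> c) ` {0..1})"
  by (rule connectedin_continuous_map_image) (simp add: connectedin_subtopology)
 have out: "orb D (c t) ~: Z" if t: "t : {0..1}" for t
 proof
  assume "orb D (c t) : Z"
  then have 1: "(orb D \<circ> c) ` {0..1} \<inter> Z ~= {}" using t by (intro ex_in_conv[THEN iffD1] exI[of _ "orb D (c t)"]) auto
  have 2: "(orb D \<circ> c) ` {0..1} - Z ~= {}" using p c(4) by (force simp: image_iff)
  have "(orb D \<circ> c) ` {0..1} \<inter> quot_top X D frontier_of Z ~= {}" by (rule connectedin_Int_frontier_of[OF con 1 2])
  then show False using c(3) by auto
 qed
 show "orb D q ~: Z" using out[of 1] c(5) by simp
 show "intrinsic_dist (quot_top X D) (quot_dist X D g) (quot X D - Z) (orb D p) (orb D q) <= ennreal L"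
  using intrinsic_dist_le[OF D g c(1,2) out] c(4-6) by auto
qed

subsection \<open>The action of the product lattice\<close>

text \<open>\<open>c0\<close> is a common injectivity bound for both lattices;
  \<open>8 * R <= c0\<close> leaves room for the product of balls \<open>Q\<close> to embed in the
  quotient.\<close>

locale duo = G1: lattice Gm\<^sub>1 + shell Gm R rh
 for Gm\<^sub>1 Gm :: "((real^'n::finite) => real^'n) set" and R rh :: real +
 fixes c0 :: real
 assumes inj1: "ga : Gm\<^sub>1 ==> ga ~= G1.e ==> z : HS ==> c0 <= hdist z (ga z)"
  and inj2: "ga : Gm ==> ga ~= e ==> z : HS ==> c0 <= hdist z (ga z)"
  and R_c0: "8 * R <= c0"
begin

abbreviation Dk where "Dk == prod_action Gm\<^sub>1 Gm"

abbreviation qd where "qd dl == quot_dist Xp Dk (gd dl)"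

lemma orb_iff: "w : orb Dk z \<longleftrightarrow> (\<exists>ga\<^sub>1\<in>Gm\<^sub>1. \<exists>ga\<^sub>2\<in>Gm. w = map_prod ga\<^sub>1 ga\<^sub>2 z)"
 by (auto simp: orb_def prod_action_def)

lemma act_in: "ga\<^sub>1 : Gm\<^sub>1 ==> ga\<^sub>2 : Gm ==> z : Xp ==> map_prod ga\<^sub>1 ga\<^sub>2 z : Xp"
 using map_prod_image[OF G1.isom isom] by blast

lemma act_id: "z : Xp ==> map_prod G1.e e z = z"
 by (cases z) (auto simp: hyp_prod_def G1.e_apply e_apply)

lemma orb_self: "z : Xp ==> z : orb Dk z"
 unfolding orb_iff using act_id G1.e_in e_in by metis

text \<open>For comparing two lifts: undoing \<open>ga\<close> on both returns the first to its base
  point and leaves an element \<open>ep\<close> acting on the second.\<close>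

lemma act_move:
 assumes z: "z : Xp" and g: "ga\<^sub>1 : Gm\<^sub>1" "ga\<^sub>2 : Gm" and d: "dl\<^sub>1 : Gm\<^sub>1" "dl\<^sub>2 : Gm"
 obtains ep\<^sub>1 ep\<^sub>2 where "ep\<^sub>1 : Gm\<^sub>1" "ep\<^sub>2 : Gm" "map_prod dl\<^sub>1 dl\<^sub>2 z = map_prod ga\<^sub>1 ga\<^sub>2 (map_prod ep\<^sub>1 ep\<^sub>2 z)"
proof -
 define ep\<^sub>1 where "ep\<^sub>1 = G1.gmul (G1.ginv ga\<^sub>1) dl\<^sub>1"
 define ep\<^sub>2 where "ep\<^sub>2 = gmul (ginv ga\<^sub>2) dl\<^sub>2"
 note Z = HP_D[OF z]
 show thesis
 proof (rule that)
  show "ep\<^sub>1 : Gm\<^sub>1" "ep\<^sub>2 : Gm"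
   using G1.gmul(1)[OF G1.ginv(1)[OF g(1)] d(1)] gmul(1)[OF ginv(1)[OF g(2)] d(2)] by (auto simp: ep\<^sub>1_def ep\<^sub>2_def)
  show "map_prod dl\<^sub>1 dl\<^sub>2 z = map_prod ga\<^sub>1 ga\<^sub>2 (map_prod ep\<^sub>1 ep\<^sub>2 z)"
   using G1.gmul(2)[OF G1.ginv(1)[OF g(1)] d(1) Z(1)] gmul(2)[OF ginv(1)[OF g(2)] d(2) Z(2)]
    G1.ginv(3)[OF g(1) G1.in_ball[OF d(1) Z(1)]] ginv(3)[OF g(2) in_ball[OF d(2) Z(2)]]
   by (cases z) (auto simp: ep\<^sub>1_def ep\<^sub>2_def)
 qed
qed

lemma orb_eq:
 assumes z: "z : Xp" and w: "w : orb Dk z"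
 shows "orb Dk w = orb Dk z"
proof -
 have sub: "orb Dk w \<subseteq> orb Dk z" if zX: "z : Xp" and w: "w : orb Dk z" for z w
 proof
  fix v assume "v : orb Dk w"
  then obtain a b where ab: "a : Gm\<^sub>1" "b : Gm" "v = map_prod a b w" by (auto simp: orb_iff)
  obtain c d where cd: "c : Gm\<^sub>1" "d : Gm" "w = map_prod c d z" using w by (auto simp: orb_iff)
  have "v = map_prod (G1.gmul a c) (gmul b d) z"
   using ab(3) cd(3) G1.gmul(2)[OF ab(1) cd(1) HP_D(1)[OF zX]] gmul(2)[OF ab(2) cd(2) HP_D(2)[OF zX]]
   by (cases z) auto
  then show "v : orb Dk z" using G1.gmul(1)[OF ab(1) cd(1)] gmul(1)[OF ab(2) cd(2)] by (auto simp: orb_iff)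
 qed
 obtain a b where ab: "a : Gm\<^sub>1" "b : Gm" "w = map_prod a b z" using w by (auto simp: orb_iff)
 obtain c d where cd: "c : Gm\<^sub>1" "d : Gm" "map_prod G1.e e w = map_prod a b (map_prod c d w)"
  using act_move[OF act_in[OF ab(1,2) z] ab(1,2) G1.e_in e_in] ab(3) by metis
 have wX: "w : Xp" using act_in[OF ab(1,2) z] ab(3) by simp
 have "z = map_prod (G1.ginv a) (ginv b) w"
  using ab(3) G1.ginv(2)[OF ab(1) HP_D(1)[OF z]] ginv(2)[OF ab(2) HP_D(2)[OF z]] by (cases z) auto
 then have "z : orb Dk w" using G1.ginv(1)[OF ab(1)] ginv(1)[OF ab(2)] by (auto simp: orb_iff)
 then show ?thesis using sub[OF z w] sub[OF wX] by blast
qed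

definition Q where "Q = cball (0 :: real^'n) (R / 2) \<times> cball (0 :: real^'n) (R / 2)"

lemma Q_sub: "Q \<subseteq> Xp" using R by (fastforce simp: Q_def hyp_prod_def)

text \<open>Corresponding components of points of \<open>Q\<close> are at most \<open>3 R\<close>
  apart, so an element that brings \<open>w\<close> within \<open>R\<close> of \<open>z\<close>
  displaces both components of \<open>w\<close> by less than \<open>4 R < c0\<close> and is
  trivial.\<close>

lemma Q_separated:
 assumes z: "z : Q" and w: "w : Q" and g: "ga\<^sub>1 : Gm\<^sub>1" "ga\<^sub>2 : Gm" and d: "D0 z (map_prod ga\<^sub>1 ga\<^sub>2 w) < R"
 shows "map_prod ga\<^sub>1 ga\<^sub>2 w = w"
proof -
 have zX: "z : Xp" and wX: "w : Xp" using z w Q_sub by auto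
 have fw: "map_prod ga\<^sub>1 ga\<^sub>2 w : Xp" by (rule act_in[OF g wX])
 note Z = HP_D[OF zX] and W = HP_D[OF wX]
 have close: "hdist x y <= 3 * R" if "norm x <= R / 2" "norm y <= R / 2" for x y :: "real^'n"
 proof -
  have r: "(R / 2)^2 <= 1 / 64" using R2(1) by (simp add: power_divide)
  have "hdist x y <= 2 / (1 - (R / 2)^2) * norm (y - x)" by (rule hdist_le_cball) (use that R in auto)
  also have "... <= 3 * R"
  proof (rule mult_mono)
   show "2 / (1 - (R / 2)^2) <= 3" using r by (simp add: pos_divide_le_eq)
   show "norm (y - x) <= R" using norm_triangle_ineq4[of y x] that by simp
  qed auto
  finally show ?thesis .
 qed
 have zw: "norm (fst z) <= R / 2" "norm (snd z) <= R / 2" "norm (fst w) <= R / 2" "norm (snd w) <= R / 2"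
  using z w by (auto simp: Q_def)
 have "hdist (fst w) (ga\<^sub>1 (fst w)) <= hdist (fst w) (fst z) + hdist (fst z) (ga\<^sub>1 (fst w))"
  by (rule hdist_triangle[OF W(1) Z(1) G1.in_ball[OF g(1) W(1)]])
 moreover have "hdist (snd w) (ga\<^sub>2 (snd w)) <= hdist (snd w) (snd z) + hdist (snd z) (ga\<^sub>2 (snd w))"
  by (rule hdist_triangle[OF W(2) Z(2) in_ball[OF g(2) W(2)]])
 moreover have "hdist (fst z) (ga\<^sub>1 (fst w)) < R" "hdist (snd z) (ga\<^sub>2 (snd w)) < R"
  using D0_ge_hdist[OF zX fw] d by (cases w; simp)+
 ultimately have "hdist (fst w) (ga\<^sub>1 (fst w)) < c0" "hdist (snd w) (ga\<^sub>2 (snd w)) < c0"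
  using close[OF zw(3,1)] close[OF zw(4,2)] R_c0 R by linarith+
 then have "ga\<^sub>1 = G1.e" "ga\<^sub>2 = e" using inj1[OF g(1) _ W(1)] inj2[OF g(2) _ W(2)] by fastforce+
 then show ?thesis using act_id[OF wX] by simp
qed

lemma inj_on_orb_Q: "inj_on (orb Dk) Q"
proof (rule inj_onI)
 fix z w assume z: "z : Q" and w: "w : Q" and eq: "orb Dk z = orb Dk w"
 have zX: "z : Xp" using z Q_sub by auto
 then have "z : orb Dk w" using orb_self[OF zX] eq by simp
 then obtain a b where ab: "a : Gm\<^sub>1" "b : Gm" "z = map_prod a b w" by (auto simp: orb_iff)
 have "D0 z (map_prod a b w) < R" using ab(3) rdist_refl[OF semi_HP convex_HP zX] R by simp
 then show "z = w" using Q_separated[OF z w ab(1,2)] ab(3) by simp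
qed

context
 fixes dl :: real
 assumes ok: "ok dl"
begin

text \<open>By \<open>Q_separated\<close> the lift of the second orbit that comes close to
  \<open>z\<close> is \<open>w\<close> itself.\<close>

lemma quot_less:
 assumes z: "z : Q" and w: "w : Q" and L: "qd dl (orb Dk z) (orb Dk w) < ennreal L" "L <= R / 2"
 shows "Dd dl z w < L"
proof -
 have zX: "z : Xp" and wX: "w : Xp" using z w Q_sub by auto
 obtain u v where uv: "u : orb Dk z" "v : orb Dk w" "riem_dist Xp (gd dl) u v < ennreal L"
  using L(1) unfolding quot_dist_def by (auto simp: INF_less_iff)
 obtain a b where ab: "a : Gm\<^sub>1" "b : Gm" "u = map_prod a b z" using uv(1) by (auto simp: orb_iff)
 obtain c d where cd: "c : Gm\<^sub>1" "d : Gm" "v = map_prod c d w" using uv(2) by (auto simp: orb_iff)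
 obtain p q where pq: "p : Gm\<^sub>1" "q : Gm" "map_prod c d w = map_prod a b (map_prod p q w)"
  using act_move[OF wX ab(1,2) cd(1,2)] by metis
 have m: "map_prod p q w : Xp" "u : Xp" "v : Xp" using act_in pq ab cd zX wX by auto
 have "Dd dl u v < L" using rdist_less_iff[OF semi_gd[OF ok] convex_HP m(2,3)] uv(3) by simp
 then have less: "Dd dl z (map_prod p q w) < L"
  using Dd_invariant[OF ok G1.isom[OF ab(1)] ab(2) zX m(1)] ab(3) cd(3) pq(3) by simp
 have "D0 z (map_prod p q w) <= sqrt 2 * Dd dl z (map_prod p q w)" by (rule D0_le_Dd[OF ok zX m(1)])
 also have "... <= 2 * Dd dl z (map_prod p q w)" using sqrt2_less_2 by (intro mult_right_mono) auto
 also have "... < R" using less L(2) by simp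
 finally have "map_prod p q w = w" by (rule Q_separated[OF z w pq(1,2)])
 then show ?thesis using less by simp
qed

lemma quot_riemannian_gd: "quot_riemannian_metric Xp Dk (gd dl)"
 unfolding quot_riemannian_metric_def
 using riemannian_gd[OF ok] preserves_gd[OF ok G1.isom] by (auto simp: prod_action_def)

end

lemma quot_dist_le:
 assumes g: "semi_metric Xp g" and z: "z : Xp" and w: "w : Xp"
 shows "quot_dist Xp Dk g (orb Dk z) (orb Dk w) <= ennreal (rdist Xp g z w)"
 unfolding quot_dist_def riem_dist_eq_rdist[OF g convex_HP z w, symmetric]
 by (rule INF_lower2[of "(z, w)"]) (use orb_self z w in auto)

lemma lift_close:
 assumes a: "a : Xp" and p: "p : quot Xp Dk" and L: "quot_dist Xp Dk g0 (orb Dk a) p < ennreal L"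
 obtains b where "b : Xp" "orb Dk b = p" "D0 a b < L"
proof -
 obtain w where w: "w : Xp" "p = orb Dk w" using p by (auto simp: quot_def)
 obtain u v where uv: "u : orb Dk a" "v : orb Dk w" "riem_dist Xp g0 u v < ennreal L"
  using L unfolding quot_dist_def w by (auto simp: INF_less_iff)
 obtain f h where fh: "f : Gm\<^sub>1" "h : Gm" "u = map_prod f h a" using uv(1) by (auto simp: orb_iff)
 obtain c d where cd: "c : Gm\<^sub>1" "d : Gm" "v = map_prod c d w" using uv(2) by (auto simp: orb_iff)
 obtain p' q' where pq: "p' : Gm\<^sub>1" "q' : Gm" "map_prod c d w = map_prod f h (map_prod p' q' w)"
  using act_move[OF w(1) fh(1,2) cd(1,2)] by metis
 let ?b = "map_prod p' q' w"
 have m: "?b : Xp" "u : Xp" "v : Xp" using act_in pq fh cd a w by auto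
 have "D0 u v < L" using rdist_less_iff[OF semi_HP convex_HP m(2,3)] uv(3) by simp
 then have "D0 a ?b < L" using hyp_prod_isometry[OF G1.isom[OF fh(1)] isom[OF fh(2)] a m(1)] fh(3) cd(3) pq(3) by simp
 moreover have "orb Dk ?b = p" unfolding w(2) by (rule orb_eq[OF w(1)]) (use pq in "auto simp: orb_iff")
 ultimately show thesis using that m(1) by blast
qed

end

subsection \<open>Detours around small squares\<close>

text \<open>A square is encoded by its centre and half side. Open squares are the obstacles; the
  closed ones will be disjoint, so that the boundary of each is free of all obstacles.\<close>

definition osq :: "(real \<times> real) \<times> real => (real \<times> real) set" where
 "osq s = {q. \<bar>fst q - fst (fst s)\<bar> < snd s & \<bar>snd q - snd (fst s)\<bar> < snd s}"

definition csq :: "(real \<times> real) \<times> real => (real \<times> real) set" where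
 "csq s = {q. \<bar>fst q - fst (fst s)\<bar> <= snd s & \<bar>snd q - snd (fst s)\<bar> <= snd s}"

abbreviation "osqs S == \<Union>s\<in>S. osq s"
abbreviation "meets S a b ta == {s : S. EX t:{a..b}. (t, ta) : osq s}"

lemma osq_csq: "osq s \<subseteq> csq s" by (auto simp: osq_def csq_def)

text \<open>In each coordinate the new centre divides the old ones in the ratio
  \<open>r' : r\<close>, so the square of half side \<open>r + r'\<close> just reaches over
  both.\<close>

lemma merge_two:
 assumes "0 < snd s" "0 < snd s'" "csq s \<inter> csq s' ~= {}"
 obtains m where "snd m = snd s + snd s'" "osq s \<subseteq> osq m" "osq s' \<subseteq> osq m"
proof -
 have coord: "EX c::real. (ALL q. \<bar>q - a\<bar> < r --> \<bar>q - c\<bar> < r + r') & (ALL q. \<bar>q - b\<bar> < r' --> \<bar>q - c\<bar> < r + r')"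
  if r: "0 < r" "0 < r'" and ab: "\<bar>a - b\<bar> <= r + r'" for a b r r' :: real
 proof (intro exI conjI allI impI)
  let ?c = "a + (b - a) * (r' / (r + r'))"
  have "\<bar>(b - a) * (r' / (r + r'))\<bar> <= (r + r') * (r' / (r + r'))"
   unfolding abs_mult using ab r by (intro mult_mono) auto
  then have 1: "\<bar>?c - a\<bar> <= r'" using r by simp
  have "?c - b = - ((b - a) * (r / (r + r')))" using r by (simp add: field_simps)
  moreover have "\<bar>(b - a) * (r / (r + r'))\<bar> <= (r + r') * (r / (r + r'))"
   unfolding abs_mult using ab r by (intro mult_mono) auto
  ultimately have 2: "\<bar>?c - b\<bar> <= r" using r by simp
  show "\<bar>q - ?c\<bar> < r + r'" if "\<bar>q - a\<bar> < r" for q using 1 that by linarith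
  show "\<bar>q - ?c\<bar> < r + r'" if "\<bar>q - b\<bar> < r'" for q using 2 that by linarith
 qed
 obtain q where q: "q : csq s" "q : csq s'" using assms(3) by blast
 have "\<bar>fst (fst s) - fst (fst s')\<bar> <= snd s + snd s'" "\<bar>snd (fst s) - snd (fst s')\<bar> <= snd s + snd s'"
  using q unfolding csq_def by auto
 from coord[OF assms(1,2) this(1)] coord[OF assms(1,2) this(2)]
 obtain c d where "ALL q. \<bar>q - fst (fst s)\<bar> < snd s --> \<bar>q - c\<bar> < snd s + snd s'" "ALL q. \<bar>q - fst (fst s')\<bar> < snd s' --> \<bar>q - c\<bar> < snd s + snd s'"
  "ALL q. \<bar>q - snd (fst s)\<bar> < snd s --> \<bar>q - d\<bar> < snd s + snd s'" "ALL q. \<bar>q - snd (fst s')\<bar> < snd s' --> \<bar>q - d\<bar> < snd s + snd s'"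
  by blast
 then show thesis by (intro that[of "((c, d), snd s + snd s')"]) (auto simp: osq_def)
qed

text \<open>Merging two squares that touch does not increase the total half side and lowers their
  number, so it ends with disjoint ones.\<close>

lemma merge_squares:
 assumes "finite J" "!!s. s : J ==> 0 < snd s"
 shows "EX J'. finite J' & (ALL s:J'. 0 < snd s) & osqs J \<subseteq> osqs J' & sum snd J' <= sum snd J &
  (ALL s:J'. ALL s':J'. s ~= s' --> csq s \<inter> csq s' = {})"
 using assms
proof (induction "card J" arbitrary: J rule: less_induct)
 case less
 show ?case
 proof (cases "ALL s:J. ALL s':J. s ~= s' --> csq s \<inter> csq s' = {}")
  case True
  then show ?thesis using less.prems by (intro exI[of _ J]) auto
 next
  case False
  then obtain s s' where s: "s : J" "s' : J" "s ~= s'" "csq s \<inter> csq s' ~= {}" by blast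
  obtain m where m: "snd m = snd s + snd s'" "osq s \<subseteq> osq m" "osq s' \<subseteq> osq m"
   using merge_two[OF less.prems(2)[OF s(1)] less.prems(2)[OF s(2)] s(4)] by blast
  define K where "K = J - {s} - {s'}"
  have sK: "s' ~: K" "s ~: insert s' K" using s(3) by (auto simp: K_def)
  have J: "J = insert s (insert s' K)" using s by (auto simp: K_def)
  have fK: "finite K" using less.prems(1) by (simp add: K_def)
  have "card (insert s (insert s' K)) = Suc (Suc (card K))" using fK sK by simp
  then have cJ: "card J = Suc (Suc (card K))" using J by simp
  have "sum snd (insert s (insert s' K)) = snd s + (snd s' + sum snd K)" using fK sK by simp
  then have sJ: "sum snd J = snd s + (snd s' + sum snd K)" using J by simp
  have pm: "0 < snd m" using m(1) less.prems(2)[OF s(1)] less.prems(2)[OF s(2)] by simp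
  have "card (insert m K) < card J" using cJ card_insert_le_m1[of "Suc (card K)" K m] by simp
  moreover have pK: "!!s. s : insert m K ==> 0 < snd s" using less.prems(2) pm J by auto
  moreover have "finite (insert m K)" using fK by simp
  ultimately obtain J' where J': "finite J'" "ALL s:J'. 0 < snd s" "(\<Union>s\<in>insert m K. osq s) \<subseteq> osqs J'"
    "sum snd J' <= sum snd (insert m K)" "ALL s:J'. ALL s':J'. s ~= s' --> csq s \<inter> csq s' = {}"
   using less.hyps[of "insert m K"] by blast
  have "sum snd (insert m K) <= snd m + sum snd K" using fK pm by (cases "m : K") (auto simp: insert_absorb)
  then have "sum snd J' <= sum snd J" using J'(4) m(1) sJ by simp
  moreover have "osqs J \<subseteq> osqs J'" using J'(3) m(2,3) by (subst J) blast
  ultimately show ?thesis using J' by blast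
 qed
qed

text \<open>\<open>E p q c\<close> stands for joining \<open>p\<close> to \<open>q\<close> at cost
  \<open>c\<close>. Each square in the way is passed along its left, top and right sides; for half
  side \<open>r\<close> these cost at most \<open>2 r\<close> each at the rate \<open>v'\<close>,
  which explains the 6. Induction on the number of squares met, splitting the segment at one of
  them.\<close>

lemma detour:
 fixes E :: "real \<times> real => real \<times> real => real => bool"
 assumes J: "finite J" "!!s. s : J ==> 0 < snd s" "!!s s'. s : J ==> s' : J ==> s ~= s' ==> csq s \<inter> csq s' = {}"
  and H: "!!s. s : J ==> 2 * snd s <= H"
  and trans: "!!p q r c d. E p q c ==> E q r d ==> 0 <= c ==> 0 <= d ==> E p r (c + d)"
  and mono: "!!p q c d. E p q c ==> c <= d ==> E p q d"
  and line: "!!a b. al <= a ==> a <= b ==> b <= be ==> (!!t. t : {a..b} ==> (t, rh) ~: osqs J) ==> E (a, rh) (b, rh) (v * (b - a))"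
  and across: "!!a b ta. al <= a ==> a <= b ==> b <= be ==> rh <= ta ==> ta <= rh + H ==>
   (!!t. t : {a..b} ==> (t, ta) ~: osqs J) ==> E (a, ta) (b, ta) (v' * (b - a))"
  and up: "!!t ta. al <= t ==> t <= be ==> rh <= ta ==> ta <= rh + H ==>
   (!!ta'. ta' : {rh..ta} ==> (t, ta') ~: osqs J) ==> E (t, rh) (t, ta) (v' * (ta - rh)) & E (t, ta) (t, rh) (v' * (ta - rh))"
  and v: "0 <= v" "0 <= v'"
 shows "al <= a ==> a <= b ==> b <= be ==> (a, rh) ~: osqs J ==> (b, rh) ~: osqs J ==>
  E (a, rh) (b, rh) (v * (b - a) + 6 * v' * sum snd (meets J a b rh))"
proof (induction "card (meets J a b rh)" arbitrary: a b rule: less_induct)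
 case less
 define S where "S a b = (meets J a b rh)" for a b
 have fin: "finite (S a b)" for a b using J(1) by (simp add: S_def)
 have nn: "0 <= sum snd (S a b)" for a b by (rule sum_nonneg) (use J(2) in "auto simp: S_def less_imp_le")
 show ?case
 proof (cases "S a b = {}")
  case True
  then have "E (a, rh) (b, rh) (v * (b - a))" using less.prems by (intro line) (auto simp: S_def)
  then show ?thesis using True unfolding S_def[symmetric] by simp
 next
  case False
  then obtain s t0 where s: "s : J" and t0: "t0 : {a..b}" "(t0, rh) : osq s" by (auto simp: S_def)
  obtain x y r where sxy: "s = ((x, y), r)" by (metis surj_pair)
  have r: "0 < r" using J(2)[OF s] sxy by simp
  have y: "\<bar>rh - y\<bar> < r" "\<bar>t0 - x\<bar> < r" using t0 sxy by (auto simp: osq_def)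
  have "(a, rh) ~: osq s" "(b, rh) ~: osq s" using less.prems(4,5) s by auto
  then have ab: "a <= x - r" "x + r <= b" using y t0(1) by (auto simp: osq_def sxy)
  have notin: "q ~: osqs J" if q: "q : csq s" "q ~: osq s" for q
  proof
   assume "q : osqs J"
   then obtain s' where s': "s' : J" "q : osq s'" by blast
   then have "s' ~= s" using q by blast
   then have "csq s' \<inter> csq s = {}" using J(3) s s' by blast
   then show False using q osq_csq s' by blast
  qed
  have l: "(x - r, rh) ~: osqs J" and u: "(x + r, rh) ~: osqs J"
  proof -
   have "(x - r, rh) : csq s" "(x - r, rh) ~: osq s" "(x + r, rh) : csq s" "(x + r, rh) ~: osq s"
    using y r by (auto simp: csq_def osq_def sxy)
   then show "(x - r, rh) ~: osqs J" "(x + r, rh) ~: osqs J" by (simp_all only: notin not_False_eq_True)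
  qed
  have sub: "S a (x - r) \<subseteq> S a b" "S (x + r) b \<subseteq> S a b" using ab r by (auto simp: S_def)
  have sS: "s : S a b" using s t0 by (auto simp: S_def)
  have ns: "s ~: S a (x - r)" "s ~: S (x + r) b" by (auto simp: S_def osq_def sxy)
  \<comment> \<open>A square meeting the segment on both sides of \<open>s\<close> would by
    convexity contain the point \<open>(x - r, rh)\<close> of the boundary of \<open>s\<close>,
    which is free.\<close>
  have disj: "S a (x - r) \<inter> S (x + r) b = {}"
  proof (rule ccontr)
   assume "S a (x - r) \<inter> S (x + r) b ~= {}"
   then obtain s' t1 t2 where s': "s' : J" "t1 <= x - r" "x + r <= t2" "(t1, rh) : osq s'" "(t2, rh) : osq s'" by (auto simp: S_def)
   then have "(x - r, rh) : osq s'" using r by (auto simp: osq_def)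
   then show False using l s'(1) by blast
  qed
  have IH1: "E (a, rh) (x - r, rh) (v * (x - r - a) + 6 * v' * sum snd (S a (x - r)))"
   unfolding S_def
  proof (rule less.hyps)
   show "card (meets J a (x - r) rh) < card (meets J a b rh)"
    unfolding S_def[symmetric] by (rule psubset_card_mono[OF fin]) (use sub sS ns in blast)
  qed (use less.prems ab r l in auto)
  have IH2: "E (x + r, rh) (b, rh) (v * (b - (x + r)) + 6 * v' * sum snd (S (x + r) b))"
   unfolding S_def
  proof (rule less.hyps)
   show "card (meets J (x + r) b rh) < card (meets J a b rh)"
    unfolding S_def[symmetric] by (rule psubset_card_mono[OF fin]) (use sub sS ns in blast)
  qed (use less.prems ab r u in auto)
  define T where "T = y + r"
  have T: "rh <= T" "T <= rh + H" "T - rh <= 2 * r" using y H[OF s] by (auto simp: T_def sxy)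
  have "E (x - r, rh) (x - r, T) (v' * (T - rh))"
   using y r ab less.prems T by (intro conjunct1[OF up] notin) (auto simp: T_def csq_def osq_def sxy)
  moreover have "E (x - r, T) (x + r, T) (v' * (x + r - (x - r)))"
   using y r ab less.prems T by (intro across notin) (auto simp: T_def csq_def osq_def sxy)
  moreover have "E (x + r, T) (x + r, rh) (v' * (T - rh))"
   using y r ab less.prems T by (intro conjunct2[OF up] notin) (auto simp: T_def csq_def osq_def sxy)
  ultimately have "E (x - r, rh) (x + r, rh) (v' * (T - rh) + v' * (x + r - (x - r)) + v' * (T - rh))"
   using T v r by (intro trans[OF trans]) auto
  moreover have "v' * (T - rh) <= v' * (2 * r)" using T(3) v by (intro mult_left_mono)
  ultimately have D: "E (x - r, rh) (x + r, rh) (6 * v' * r)" by (elim mono) (simp add: algebra_simps)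
  have "E (a, rh) (b, rh) (v * (x - r - a) + 6 * v' * sum snd (S a (x - r)) + 6 * v' * r + (v * (b - (x + r)) + 6 * v' * sum snd (S (x + r) b)))"
   using ab v r nn by (intro trans[OF trans[OF IH1 D] IH2]) auto
  moreover have "v * (x - r - a) + 6 * v' * sum snd (S a (x - r)) + 6 * v' * r + (v * (b - (x + r)) + 6 * v' * sum snd (S (x + r) b))
   <= v * (b - a) + 6 * v' * sum snd (S a b)"
  proof -
   have "sum snd (insert s (S a (x - r) \<union> S (x + r) b)) <= sum snd (S a b)"
    by (rule sum_mono2[OF fin]) (use sub sS J(2) in "auto simp: S_def less_imp_le")
   then have "r + (sum snd (S a (x - r)) + sum snd (S (x + r) b)) <= sum snd (S a b)"
    using ns fin disj sxy by (simp add: sum.union_disjoint)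
   then have "6 * v' * (r + (sum snd (S a (x - r)) + sum snd (S (x + r) b))) <= 6 * v' * sum snd (S a b)"
    using v by (intro mult_left_mono) auto
   moreover have "0 <= v * (2 * r)" using v r by simp
   ultimately show ?thesis by (simp add: algebra_simps)
  qed
  ultimately show ?thesis unfolding S_def[symmetric] by (rule mono)
 qed
qed

text \<open>The intervals have total length \<open>2 * sum r J\<close>, too little to cover one of
  length \<open>L\<close>.\<close>

lemma exists_outside:
 fixes c r :: "'i => real"
 assumes J: "finite J" "!!j. j : J ==> 0 < r j" and L: "2 * sum r J < L"
 shows "EX t:{a..a + L}. ALL j:J. r j <= \<bar>t - c j\<bar>"
proof (rule ccontr)
 assume "~ ?thesis"
 then have n: "EX j:J. \<bar>t - c j\<bar> < r j" if "t : {a..a + L}" for t using that by (simp add: not_le)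
 have "{a..a + L} \<subseteq> (\<Union>j\<in>J. {c j - r j<..<c j + r j})"
 proof
  fix t assume "t : {a..a + L}"
  then obtain j where "j : J" "\<bar>t - c j\<bar> < r j" using n by blast
  then show "t : (\<Union>j\<in>J. {c j - r j<..<c j + r j})" by (intro UN_I[of j]) (auto simp: abs_less_iff)
 qed
 then have "emeasure lborel {a..a + L} <= emeasure lborel (\<Union>j\<in>J. {c j - r j<..<c j + r j})" by (rule emeasure_mono) (simp add: borel_open open_UN)
 also have "... <= (\<Sum>j\<in>J. emeasure lborel {c j - r j<..<c j + r j})" by (rule emeasure_subadditive_finite) (use J in auto)
 also have "... = (\<Sum>j\<in>J. ennreal (2 * r j))" using J(2) by (intro sum.cong) (auto simp: less_imp_le)
 also have "... = ennreal (2 * sum r J)" using J(2) by (subst sum_ennreal) (auto simp: sum_distrib_left less_imp_le)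
 finally have le: "emeasure lborel {a..a + L} <= ennreal (2 * sum r J)" .
 have "0 <= sum r J" using J(2) by (intro sum_nonneg) (auto simp: less_imp_le)
 moreover from this have "0 <= L" using L by simp
 ultimately show False using le L by (simp add: ennreal_le_iff2)
qed

subsection \<open>Slices meeting few small balls\<close>

text \<open>Despite the name a tube: for unit \<open>d\<close>, the \<open>r\<close>-neighbourhood
  of the segment of half length \<open>L\<close> centred at \<open>a\<close>.\<close>

definition cone :: "'a::euclidean_space => 'a => real => real => 'a set" where
 "cone a d L r = (\<Union>t\<in>{-L..L}. ball (a + t *\<^sub>R d) r)"

lemma cone_borel: "cone a d L r : sets borel"
 unfolding cone_def by (intro borel_open open_UN ballI open_ball)

text \<open>Balls of radius \<open>2 r\<close> with centres spaced by \<open>r\<close> cover the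
  tube, and their number is of order \<open>L / r\<close>.\<close>

lemma cone_measure:
 fixes a d :: "'a::euclidean_space"
 assumes d: "norm d = 1" and r: "0 < r" "r <= L"
 shows "emeasure lborel (cone a d L r) <= ennreal (5 * L * unit_ball_vol (real DIM('a)) * 2 ^ DIM('a) * r ^ (DIM('a) - 1))"
proof -
 define N where "N = \<lceil>L / r\<rceil>"
 have "0 < L / r" using r by simp
 then have N: "0 <= N" "real_of_int N <= L / r + 1" using ceiling_correct[of "L / r"] by (auto simp: N_def)
 have "cone a d L r \<subseteq> (\<Union>k\<in>{-N..N}. ball (a + (of_int k * r) *\<^sub>R d) (2 * r))"
 proof
  fix x assume "x : cone a d L r"
  then obtain t where t: "\<bar>t\<bar> <= L" "dist (a + t *\<^sub>R d) x < r" unfolding cone_def UN_iff mem_ball by (metis abs_le_iff atLeastAtMost_iff minus_le_iff)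
  define k where "k = \<lfloor>t / r\<rfloor>"
  have "- L <= t" "t <= L" using t(1) by auto
  then have "- L / r <= t / r" "t / r <= L / r" using r divide_right_mono[of "- L" t r] divide_right_mono[of t L r] by simp_all
  then have k: "k : {-N..N}" unfolding k_def N_def by (auto simp: le_floor_iff floor_le_iff) linarith+
  have "\<bar>t / r - of_int k\<bar> <= 1" unfolding k_def by linarith
  then have "\<bar>t / r - of_int k\<bar> * r <= 1 * r" using r by (intro mult_right_mono) auto
  moreover have "of_int k * r - t = - ((t / r - of_int k) * r)" using r by (simp add: left_diff_distrib)
  then have "\<bar>of_int k * r - t\<bar> = \<bar>t / r - of_int k\<bar> * r" using r by (simp only: abs_minus_cancel abs_mult abs_of_pos)
  ultimately have "\<bar>of_int k * r - t\<bar> <= r" by linarith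
  moreover have "dist (a + (of_int k * r) *\<^sub>R d) (a + t *\<^sub>R d) = \<bar>of_int k * r - t\<bar>"
   using d by (simp add: dist_norm scaleR_left_diff_distrib[symmetric])
  ultimately have "dist (a + (of_int k * r) *\<^sub>R d) x < 2 * r" using t(2) dist_triangle[of "a + (of_int k * r) *\<^sub>R d" x "a + t *\<^sub>R d"] by linarith
  then show "x : (\<Union>k\<in>{-N..N}. ball (a + (of_int k * r) *\<^sub>R d) (2 * r))" using k by auto
 qed
 then have "emeasure lborel (cone a d L r) <= emeasure lborel (\<Union>k\<in>{-N..N}. ball (a + (of_int k * r) *\<^sub>R d) (2 * r))"
  by (rule emeasure_mono) auto
 also have "... <= (\<Sum>k\<in>{-N..N}. emeasure lborel (ball (a + (of_int k * r) *\<^sub>R d) (2 * r)))"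
  by (rule emeasure_subadditive_finite) auto
 also have "... = (\<Sum>k\<in>{-N..N}. ennreal (unit_ball_vol (real DIM('a)) * (2 * r) ^ DIM('a)))"
  using r by (simp add: emeasure_ball)
 also have "... = ennreal (real_of_int (2 * N + 1) * (unit_ball_vol (real DIM('a)) * (2 * r) ^ DIM('a)))"
  using N(1) r by (subst sum_ennreal) (auto simp: of_nat_nat)
 also have "... <= ennreal (5 * L * unit_ball_vol (real DIM('a)) * 2 ^ DIM('a) * r ^ (DIM('a) - 1))"
 proof (rule ennreal_leI)
  have "1 <= L / r" using r by simp
  then have "real_of_int (2 * N + 1) <= 5 * (L / r)" using N(2) by simp
  then have "real_of_int (2 * N + 1) * (unit_ball_vol (real DIM('a)) * (2 * r) ^ DIM('a)) <= 5 * (L / r) * (unit_ball_vol (real DIM('a)) * (2 * r) ^ DIM('a))"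
   using r by (intro mult_right_mono) auto
  also have "... = 5 * L * unit_ball_vol (real DIM('a)) * 2 ^ DIM('a) * r ^ (DIM('a) - 1)"
  proof -
   obtain m where "DIM('a) = Suc m" using DIM_positive[where 'a='a] gr0_conv_Suc by blast
   then show ?thesis using r by (simp add: power_mult_distrib)
  qed
  finally show "real_of_int (2 * N + 1) * (unit_ball_vol (real DIM('a)) * (2 * r) ^ DIM('a)) <= 5 * L * unit_ball_vol (real DIM('a)) * 2 ^ DIM('a) * r ^ (DIM('a) - 1)" .
 qed
 finally show ?thesis .
qed

lemma emeasure_lborel_Times:
 fixes A :: "'a::euclidean_space set" and B :: "'b::euclidean_space set"
 assumes "A : sets borel" "B : sets borel"
 shows "emeasure lborel (A \<times> B) = emeasure lborel A * emeasure lborel B"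
 unfolding lborel_prod[symmetric] by (rule lborel.emeasure_pair_measure_Times) (use assms in auto)

abbreviation "hit x y r p q j == norm (p - x j) < r j & norm (q - y j) < r j"
abbreviation "hits J e R x y r x0 w == {j\<in>J. EX t:{-R/4..R/4}. EX ta:{R/4..R/2}. hit x y r (x0 + t *\<^sub>R e) ((ta / norm w) *\<^sub>R w) j}"

text \<open>Averaging over the slices spanned by the line \<open>x0 + t e\<close> and the ray of
  \<open>w\<close>. The pairs whose slice meets the product of balls \<open>j\<close> have measure
  \<open>O(r ^ (2 n - 2))\<close>, which the weight \<open>r / et\<close> of Markov's inequality
  turns into \<open>O(r ^ (2 n - 1))\<close>; those whose ray at \<open>t = 0\<close> meets it have
  measure \<open>O(r ^ (2 n - 1))\<close> at once. The sum of these powers is what small boundary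
  area controls. The ray at \<open>t = 0\<close> has to be entirely free, since it leads from
  \<open>(x0, w)\<close>, known to lie outside \<open>B\<close>, into the slice.\<close>

lemma slice_exists:
 fixes y0 e :: "real^'n::finite"
 assumes R: "0 < R" and y0: "norm y0 = 3 * R / 8" and e: "norm e = 1"
 defines "Box == cball (0 :: real^'n) (R / 16) \<times> cball y0 (R / 16)"
 obtains C where "0 < C"
  "!!(J :: nat set) x y r B et. finite J ==> (!!j. j : J ==> 0 < r j & r j <= R / 4) ==> B : sets borel ==> 0 < et ==>
   emeasure lborel (B \<inter> Box) + ennreal (C * (1 + 1 / et) * (\<Sum>j\<in>J. r j ^ (2 * CARD('n) - 1))) < emeasure lborel Box ==>
   EX x0 w. (x0, w) : Box & (x0, w) ~: B &
    (\<Sum>j\<in>hits J e R x y r x0 w. r j) <= et &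
    (ALL j:J. ALL ta:{R/4..R/2}. ~ (hit x y r x0 ((ta / norm w) *\<^sub>R w) j))"
proof -
 let ?n = "CARD('n)" and ?u = "unit_ball_vol (real CARD('n))"
 define c1 where "c1 = 5 * (R / 4) * ?u * 2 ^ ?n"
 define c2 where "c2 = 5 * (2 * R) * ?u * 2 ^ ?n * 2 ^ (?n - 1)"
 define C where "C = c2 * (?u + c1)"
 have c: "0 < c1" "0 < c2" using R by (auto simp: c1_def c2_def)
 then have C: "0 < C" by (simp add: C_def add_pos_pos)
 have n: "0 < ?n" by simp
 show thesis
 proof (rule that[OF C])
  fix J :: "nat set" and x y :: "nat => real^'n" and r :: "nat => real" and B et
  assume J: "finite J" "!!j. j : J ==> 0 < r j & r j <= R / 4" and B: "B : sets borel" and et: "0 < et"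
   and less: "emeasure lborel (B \<inter> Box) + ennreal (C * (1 + 1 / et) * (\<Sum>j\<in>J. r j ^ (2 * ?n - 1))) < emeasure lborel Box"
  let ?S = "\<Sum>j\<in>J. r j ^ (2 * ?n - 1)"
  define dj where "dj j = (if y j = 0 then e else y j /\<^sub>R norm (y j))" for j
  have dj: "norm (dj j) = 1" "y j = norm (y j) *\<^sub>R dj j" for j using e by (auto simp: dj_def)
  define T1 where "T1 j = cone (x j) e (R / 4) (r j)" for j
  define T2 where "T2 j = cone 0 (dj j) (2 * R) (2 * r j)" for j
  have meas: "T1 j : sets borel" "T2 j : sets borel" for j by (auto simp: T1_def T2_def cone_borel)
  have BoxB: "Box : sets borel" unfolding Box_def by (intro borel_Times) auto
  \<comment> \<open>Rescaling the ray so that the hit takes place at \<open>w\<close> multiplies the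
    radius by \<open>norm w / ta <= 2\<close>, so \<open>w\<close> lies in a tube around the axis
    through \<open>y j\<close>.\<close>
  have w2: "w : T2 j" if w: "(x0, w) : Box" and j: "j : J" and ta: "ta : {R/4..R/2}" and h: "norm ((ta / norm w) *\<^sub>R w - y j) < r j" for x0 w j ta
  proof -
   have wn: "R / 4 <= norm w" "norm w <= R / 2"
    using w y0 norm_triangle_ineq3[of w y0] unfolding Box_def by (auto simp: dist_norm norm_minus_commute)
   have "0 < norm w" "0 < ta" using wn(1) ta R unfolding atLeastAtMost_iff by linarith+
   then have k: "0 < norm w / ta" "norm w / ta <= 2" using wn ta R by (auto simp: pos_divide_le_eq)
   have "w - (norm w / ta) *\<^sub>R y j = (norm w / ta) *\<^sub>R ((ta / norm w) *\<^sub>R w - y j)"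
    using wn ta R by (auto simp: scaleR_right_diff_distrib)
   then have "norm (w - (norm w / ta) *\<^sub>R y j) = (norm w / ta) * norm ((ta / norm w) *\<^sub>R w - y j)" using k by (simp only: norm_scaleR abs_of_pos)
   also have "... < 2 * r j" using h k by (intro mult_le_less_imp_less) auto
   finally have 1: "dist (0 + ((norm w / ta) * norm (y j)) *\<^sub>R dj j) w < 2 * r j"
    by (metis add_0 dist_norm norm_minus_commute scaleR_scaleR dj(2))
   have "norm (y j) <= norm ((ta / norm w) *\<^sub>R w) + r j"
    using h norm_triangle_ineq2[of "y j" "(ta / norm w) *\<^sub>R w"] by (simp add: norm_minus_commute)
   moreover have "norm ((ta / norm w) *\<^sub>R w) = ta" using wn ta R by auto
   ultimately have "norm (y j) <= R" using ta J(2)[OF j] R by simp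
   then have "(norm w / ta) * norm (y j) <= 2 * R" using k by (intro mult_mono) auto
   moreover have "0 <= (norm w / ta) * norm (y j)" using k by (intro mult_nonneg_nonneg) auto
   ultimately show ?thesis using 1 R unfolding T2_def cone_def by (intro UN_I[of "(norm w / ta) * norm (y j)"]) auto
  qed
  have w1: "x0 : T1 j" if t: "t : {-R/4..R/4}" and h: "norm (x0 + t *\<^sub>R e - x j) < r j" for x0 t j
   unfolding T1_def cone_def by (rule UN_I[of "- t"]) (use t h in "auto simp: dist_norm norm_minus_commute algebra_simps")
  have m1: "emeasure lborel (T1 j) <= ennreal (c1 * r j ^ (?n - 1))" if "j : J" for j
   using cone_measure[OF e, of "r j" "R / 4" "x j"] J(2)[OF that] by (simp add: T1_def c1_def)
  have m2: "emeasure lborel (T2 j) <= ennreal (c2 * r j ^ (?n - 1))" if "j : J" for j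
   using cone_measure[OF dj(1)[of j], of "2 * r j" "2 * R" 0] J(2)[OF that] R by (simp add: T2_def c2_def power_mult_distrib mult_ac)
  show "EX x0 w. (x0, w) : Box & (x0, w) ~: B &
    (\<Sum>j\<in>hits J e R x y r x0 w. r j) <= et &
    (ALL j:J. ALL ta:{R/4..R/2}. ~ (hit x y r x0 ((ta / norm w) *\<^sub>R w) j))"
  proof (rule ccontr)
   assume neg: "~ ?thesis"
   define V where "V j = ball (x j) (r j) \<times> T2 j" for j
   define W where "W j = T1 j \<times> T2 j" for j
   have VW: "V j : sets borel" "W j : sets borel" for j unfolding V_def W_def by (auto intro!: borel_Times meas)
   \<comment> \<open>If every point of the box were bad, its indicator would be dominated by these
     sums, and integration contradicts \<open>less\<close>.\<close>
   have pt: "indicator Box p <= indicator (B \<inter> Box) p + ((\<Sum>j\<in>J. indicator (V j) p) + (\<Sum>j\<in>J. ennreal (r j / et) * indicator (W j) p))" for p :: "'n pt"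
   proof (cases "p : Box - B")
    case True
    obtain x0 w where p: "p = (x0, w)" by (cases p)
    let ?H = "hits J e R x y r x0 w"
    have xw: "(x0, w) : Box" "(x0, w) ~: B" using True p by auto
    consider "et < (\<Sum>j\<in>?H. r j)" | j ta where "j : J" "ta : {R/4..R/2}" "norm (x0 - x j) < r j" "norm ((ta / norm w) *\<^sub>R w - y j) < r j"
    proof -
     have "~ ((\<Sum>j\<in>?H. r j) <= et & (ALL j:J. ALL ta:{R/4..R/2}. ~ (hit x y r x0 ((ta / norm w) *\<^sub>R w) j)))"
      using neg xw by blast
     then show ?thesis using that by (meson not_le)
    qed
    then have "1 <= (\<Sum>j\<in>J. indicator (V j) p) + (\<Sum>j\<in>J. ennreal (r j / et) * indicator (W j) p)"
    proof cases
     case 1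
     then have "1 <= (\<Sum>j\<in>?H. r j) / et" using et by simp
     then have "ennreal 1 <= ennreal (\<Sum>j\<in>?H. r j / et)" by (intro ennreal_leI) (simp add: sum_divide_distrib)
     also have "... = (\<Sum>j\<in>?H. ennreal (r j / et))" using J(2) et by (subst sum_ennreal) (auto simp: less_imp_le)
     also have "... = (\<Sum>j\<in>?H. ennreal (r j / et) * indicator (W j) p)"
      using w1 w2[OF xw(1)] by (intro sum.cong) (fastforce simp: W_def p)+
     also have "... <= (\<Sum>j\<in>J. ennreal (r j / et) * indicator (W j) p)" using J(1) by (intro sum_mono2) auto
     finally show ?thesis by (simp add: add_increasing)
    next
     case 2
     have "p : V j" using w2[OF xw(1) 2(1,2,4)] 2(3) by (simp add: V_def p dist_norm norm_minus_commute)
     then have "1 <= (\<Sum>j\<in>J. indicator (V j) p :: ennreal)"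
      using member_le_sum[OF 2(1), of "%j. indicator (V j) p :: ennreal"] J(1) by simp
     then show ?thesis by (simp add: add_increasing2)
    qed
    then show ?thesis using True by (auto simp: indicator_def)
   next
    case False
    then show ?thesis by (auto simp: indicator_def)
   qed
   have "emeasure lborel Box = (\<integral>\<^sup>+p. indicator Box p \<partial>lborel)" using BoxB by simp
   also have "... <= (\<integral>\<^sup>+p. indicator (B \<inter> Box) p + ((\<Sum>j\<in>J. indicator (V j) p) + (\<Sum>j\<in>J. ennreal (r j / et) * indicator (W j) p)) \<partial>lborel)"
    by (rule nn_integral_mono) (rule pt)
   also have "... = emeasure lborel (B \<inter> Box) + ((\<Sum>j\<in>J. emeasure lborel (V j)) + (\<Sum>j\<in>J. ennreal (r j / et) * emeasure lborel (W j)))"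
    using B BoxB VW by (simp add: nn_integral_add nn_integral_sum nn_integral_cmult)
   also have "... <= emeasure lborel (B \<inter> Box) + ennreal (C * (1 + 1 / et) * ?S)"
   proof (rule add_left_mono)
    have p: "r j ^ (?n - 1) * r j ^ ?n = r j ^ (2 * ?n - 1)" "r j * (r j ^ (?n - 1) * r j ^ (?n - 1)) = r j ^ (2 * ?n - 1)" for j
    proof -
     obtain m where m: "?n = Suc m" using n gr0_conv_Suc by blast
     have "2 * Suc m - 1 = m + Suc m" by simp
     then show "r j ^ (?n - 1) * r j ^ ?n = r j ^ (2 * ?n - 1)" "r j * (r j ^ (?n - 1) * r j ^ (?n - 1)) = r j ^ (2 * ?n - 1)"
      unfolding m by (simp_all only: diff_Suc_1 power_add power_Suc mult_ac)
    qed
    have "(\<Sum>j\<in>J. emeasure lborel (V j)) + (\<Sum>j\<in>J. ennreal (r j / et) * emeasure lborel (W j))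
      <= (\<Sum>j\<in>J. ennreal (c2 * ?u * r j ^ (2 * ?n - 1))) + (\<Sum>j\<in>J. ennreal (1 / et * (c2 * c1) * r j ^ (2 * ?n - 1)))"
    proof (intro add_mono sum_mono)
     fix j assume j: "j : J"
     have rj: "0 < r j" using J(2)[OF j] by simp
     have "emeasure lborel (V j) = emeasure lborel (ball (x j) (r j)) * emeasure lborel (T2 j)"
      unfolding V_def by (rule emeasure_lborel_Times) (auto simp: meas)
     also have "... <= ennreal (?u * r j ^ ?n) * ennreal (c2 * r j ^ (?n - 1))"
      using m2[OF j] rj by (intro mult_mono) (auto simp: emeasure_ball)
     also have "... = ennreal (c2 * ?u * r j ^ (2 * ?n - 1))"
      unfolding p(1)[symmetric] using rj c by (subst ennreal_mult'[symmetric]) (auto simp: mult_ac)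
     finally show "emeasure lborel (V j) <= ennreal (c2 * ?u * r j ^ (2 * ?n - 1))" .
     have "emeasure lborel (W j) = emeasure lborel (T1 j) * emeasure lborel (T2 j)"
      unfolding W_def by (rule emeasure_lborel_Times) (auto simp: meas)
     also have "... <= ennreal (c1 * r j ^ (?n - 1)) * ennreal (c2 * r j ^ (?n - 1))"
      using m1[OF j] m2[OF j] by (intro mult_mono) auto
     finally have "ennreal (r j / et) * emeasure lborel (W j) <= ennreal (r j / et) * (ennreal (c1 * r j ^ (?n - 1)) * ennreal (c2 * r j ^ (?n - 1)))"
      by (rule mult_left_mono) simp
     also have "... = ennreal (1 / et * (c2 * c1) * r j ^ (2 * ?n - 1))"
      unfolding p(2)[symmetric] using rj c et by (simp add: ennreal_mult'[symmetric] mult_ac)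
     finally show "ennreal (r j / et) * emeasure lborel (W j) <= ennreal (1 / et * (c2 * c1) * r j ^ (2 * ?n - 1))" .
    qed
    also have "... = ennreal (c2 * ?u * ?S + 1 / et * (c2 * c1) * ?S)"
    proof -
     have s: "0 <= ?S" using J by (intro sum_nonneg) (auto simp: less_imp_le)
     have q: "(\<Sum>j\<in>J. ennreal (q * r j ^ (2 * ?n - 1))) = ennreal (q * ?S)" if "0 <= q" for q
      unfolding sum_distrib_left using J that by (intro sum_ennreal) (auto simp: less_imp_le)
     show ?thesis using c et s by (subst (1 2) q) (auto intro!: ennreal_plus[symmetric] mult_nonneg_nonneg)
    qed
    also have "... <= ennreal (C * (1 + 1 / et) * ?S)"
    proof (rule ennreal_leI)
     have s: "0 <= ?S" using J by (intro sum_nonneg) (auto simp: less_imp_le)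
     have "c2 * ?u + 1 / et * (c2 * c1) <= C * (1 + 1 / et)"
      using c et unfolding C_def by (simp add: field_simps)
     from mult_right_mono[OF this s] show "c2 * ?u * ?S + 1 / et * (c2 * c1) * ?S
       <= C * (1 + 1 / et) * ?S" by (simp add: distrib_right)
    qed
    finally show "(\<Sum>j\<in>J. emeasure lborel (V j)) + (\<Sum>j\<in>J. ennreal (r j / et) * emeasure lborel (W j))
      <= ennreal (C * (1 + 1 / et) * ?S)" .
   qed
   finally show False using less by simp
  qed
 qed
qed

subsection \<open>Four points near the shell\<close>

text \<open>\<open>u\<close>, \<open>u'\<close>, \<open>c\<close> are \<open>B\<close>,
  \<open>B'\<close>, \<open>C\<close> seen from \<open>A\<close>. The bounds make
  \<open>u + u'\<close> small, so \<open>|c - u|^2 + |c - u'|^2\<close> is at most about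
  \<open>2 (a^2 + b^2)\<close>; the lower bounds for it amount to
  \<open>2 m^2 = 2 (a^2 + b^2 + ka^2 l^2)\<close>. All errors controlled by \<open>th\<close> are
  small against the gap \<open>ka^2 l^2\<close>.\<close>

lemma four_points_euclid:
 fixes u u' c :: "'a::real_inner"
 assumes ka: "0 < ka" "0 < mm" "mm^2 + ka^2 = 1" "1 / 2 <= mm^2" and th: "th = ka^2 / 1600" and l: "0 < l"
  and u: "norm u <= (1 + th) * (mm * l)" "norm u' <= (1 + th) * (mm * l)" and c: "norm c <= (1 + th) * (l * ka / mm)"
  and uu: "(1 - th) * (2 * (mm * l)) <= norm (u - u')"
  and cu: "(1 - th) * (l / mm) <= norm (c - u)" "(1 - th) * (l / mm) <= norm (c - u')"
 shows False
proof -
 define a b m where "a = mm * l" and "b = l * ka / mm" and "m = l / mm"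
 have pos: "0 < a" "0 < b" "0 < m" using ka l by (auto simp: a_def b_def m_def)
 have k1: "ka^2 <= 1 / 2" using ka by linarith
 then have th1: "0 < th" "th <= 1 / 3200" unfolding th using ka(1) by auto
 have ab: "a * b = l^2 * ka" using ka(2) by (simp add: a_def b_def power2_eq_square)
 have m2: "m^2 = a^2 + b^2 + ka^2 * l^2"
 proof -
  have "m^2 * mm^2 = l^2" "b^2 * mm^2 = l^2 * ka^2" using ka(2) by (simp_all add: m_def b_def power_divide power_mult_distrib)
  moreover have "l^2 * mm^2 + l^2 * ka^2 = l^2 * (mm^2 + ka^2)" by (rule distrib_left[symmetric])
  moreover have "(a^2 + ka^2 * l^2) * mm^2 = l^2 * mm^2 * (mm^2 + ka^2)" by (simp add: a_def power_mult_distrib algebra_simps)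
  moreover have "(a^2 + b^2 + ka^2 * l^2) * mm^2 = (a^2 + ka^2 * l^2) * mm^2 + b^2 * mm^2" by (simp add: distrib_right)
  ultimately have "m^2 * mm^2 = (a^2 + b^2 + ka^2 * l^2) * mm^2" unfolding ka(3) mult_1_right by linarith
  then show ?thesis using ka(2) by simp
 qed
 have ml: "m^2 <= 2 * l^2"
 proof -
  have "l^2 * (1 / 2) <= l^2 * mm^2" using ka(4) by (intro mult_left_mono) auto
  then show ?thesis using ka(2) by (simp add: m_def power_divide pos_divide_le_eq)
 qed
 have le: "x^2 <= k^2 * y^2" if "x <= k * y" "0 <= x" for x k y :: real
  using power_mono[OF that, of 2] by (simp only: power_mult_distrib)
 have ge: "k^2 * y^2 <= x^2" if "k * y <= x" "0 <= k" "0 <= y" for x k y :: real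
  using power_mono[OF that(1) mult_nonneg_nonneg[OF that(2,3)], of 2] by (simp only: power_mult_distrib)
 have sq: "(norm u)^2 <= (1 + th)^2 * a^2" "(norm u')^2 <= (1 + th)^2 * a^2" "(norm c)^2 <= (1 + th)^2 * b^2"
  "(1 - th)^2 * (2 * a)^2 <= (norm (u - u'))^2" "(1 - th)^2 * m^2 <= (norm (c - u))^2" "(1 - th)^2 * m^2 <= (norm (c - u'))^2"
  using le[OF u(1)[folded a_def]] le[OF u(2)[folded a_def]] le[OF c[folded b_def]] ge[OF uu[folded a_def]] ge[OF cu(1)[folded m_def]]
   ge[OF cu(2)[folded m_def]] th1 pos by simp_all
 have "(norm (u + u'))^2 = 2 * (norm u)^2 + 2 * (norm u')^2 - (norm (u - u'))^2"
  by (simp add: power2_norm_eq_inner inner_add_left inner_add_right inner_diff_left inner_diff_right)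
 also have "... <= 4 * ((1 + th)^2 * a^2) - (1 - th)^2 * (2 * a)^2" using sq by linarith
 also have "... = 16 * th * a^2" by (simp add: power2_eq_square algebra_simps)
 \<comment> \<open>This is where the 1600 in \<open>th\<close> comes from: 16 times 100.\<close>
 also have "... = (ka * a / 10)^2" by (simp add: th power_divide power_mult_distrib)
 finally have s: "norm (u + u') <= ka * a / 10" by (rule power2_le_imp_le) (use ka pos in simp)
 have "\<bar>c \<bullet> (u + u')\<bar> <= norm c * norm (u + u')" by (rule Cauchy_Schwarz_ineq2)
 also have "... <= ((1 + th) * b) * (ka * a / 10)" by (rule mult_mono[OF c[folded b_def] s]) (use pos th1 in auto)
 also have "... = (1 + th) * ka^2 * l^2 / 10"
 proof -
  have "((1 + th) * b) * (ka * a / 10) = (1 + th) * ka * (a * b) / 10" by simp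
  then show ?thesis unfolding ab by (simp add: power2_eq_square mult_ac)
 qed
 finally have ip: "\<bar>c \<bullet> (u + u')\<bar> <= (1 + th) * ka^2 * l^2 / 10" .
 have "(norm (c - u))^2 + (norm (c - u'))^2 = 2 * (norm c)^2 + (norm u)^2 + (norm u')^2 - 2 * (c \<bullet> (u + u'))"
  by (simp add: power2_norm_eq_inner inner_add_left inner_add_right inner_diff_left inner_diff_right inner_commute)
 then have "(1 - th)^2 * m^2 <= (1 + th)^2 * (a^2 + b^2) + (1 + th) * ka^2 * l^2 / 10"
  using sq ip abs_le_D2[OF ip] by (simp add: distrib_left)
 also have "a^2 + b^2 = m^2 - ka^2 * l^2" using m2 by simp
 finally have "(1 + th)^2 * (ka^2 * l^2) - (1 + th) * (ka^2 * l^2) / 10 <= ((1 + th)^2 - (1 - th)^2) * m^2" by (simp add: algebra_simps)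
 also have "... = 4 * th * m^2" by (simp add: power2_eq_square algebra_simps)
 also have "... <= 4 * th * (2 * l^2)" using ml th1 by (intro mult_left_mono) auto
 also have "... = ka^2 * l^2 / 200" by (simp add: th)
 finally have "((1 + th)^2 - (1 + th) / 10) * (ka^2 * l^2) <= (1 / 200) * (ka^2 * l^2)" by (simp add: algebra_simps)
 then have "(1 + th)^2 - (1 + th) / 10 <= 1 / 200" using ka l by simp
 moreover have "1 <= (1 + th)^2" "(1 + th) / 10 <= 2 / 10" using th1 by simp_all
 ultimately show False by linarith
qed

section \<open>Estimates for the metric around one shell\<close>

context duo
begin

text \<open>The factor by which horizontal vectors are shortened in the middle of the shell. With
  \<open>kp\<close> it forms a unit vector \<open>(lam, kp)\<close>, the direction of the critical
  angle of refraction at the shell.\<close>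

definition lam where "lam = 1 / sqrt (1 + 1 / real CARD('n))"

definition kp where "kp = sqrt (1 - lam^2)"

lemma lam_sq: "lam^2 = 1 / (1 + 1 / real CARD('n))" and lam_pos: "0 < lam" "lam <= 1" and kp_pos: "0 < kp"
 and lam_kp: "lam^2 + kp^2 = 1" "3 / 4 <= lam^2"
proof -
 have n: "3 <= real CARD('n)" using dim by simp
 show l: "lam^2 = 1 / (1 + 1 / real CARD('n))" by (simp add: lam_def power_divide)
 show "0 < lam" by (simp add: lam_def add_pos_pos)
 have "0 < 1 / real CARD('n)" using n by simp
 then have "1 < 1 + 1 / real CARD('n)" by simp
 then have "lam^2 < 1" unfolding l by (subst pos_divide_less_eq, linarith, simp)
 then have "kp^2 = 1 - lam^2" unfolding kp_def by (intro real_sqrt_pow2) linarith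
 then show "lam^2 + kp^2 = 1" by simp
 show "0 < kp" using \<open>lam^2 < 1\<close> unfolding kp_def by (intro real_sqrt_gt_zero) linarith
 show "lam <= 1" using \<open>lam^2 < 1\<close> \<open>0 < lam\<close> by (simp add: abs_square_less_1)
 show "3 / 4 <= lam^2" unfolding l using n by (simp add: field_simps)
qed

context
 fixes dl :: real
 assumes ok: "ok dl"
begin

text \<open>The outer radius of the shell, from which on the bump vanishes.\<close>

definition r1 where "r1 = sqrt (rh^2 + dl)"

lemma r1: "rh < r1" "r1 <= rh + dl / rh" "r1^2 = rh^2 + dl"
proof -
 have d: "0 < dl" using ok by (simp add: ok_def)
 show sq: "r1^2 = rh^2 + dl" using d by (simp add: r1_def)
 have "sqrt (rh^2) < r1" unfolding r1_def using d by (intro real_sqrt_less_mono) simp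
 then show "rh < r1" using rh(1) by simp
 show "r1 <= rh + dl / rh" unfolding r1_def
  using rh(1) d by (intro real_le_lsqrt) (auto simp: power2_sum power_divide)
qed

lemma Dd_ge_fst: "p : Xp ==> q : Xp ==> 2 * lam * norm (fst q - fst p) <= Dd dl p q"
proof -
 assume pq: "p : Xp" "q : Xp"
 have "norm (fst q - fst p) <= (1 / (2 * lam)) * Dd dl p q"
 proof (rule rdist_ge_map[OF semi_gd[OF ok] convex_HP C1_map_fst _ _ pq])
  fix z v :: "'n pt" assume z: "z : Xp"
  have "4 * (norm (fst v))^2 * lam^2 <= hm (fst z) (fst v) (fst v) * lam^2"
   by (intro mult_right_mono hyp_metric_ge HP_D(1)[OF z]) auto
  also have "... <= gd dl z v v" using gd_bounds(3)[OF ok z, of v] by (simp add: lam_sq)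
  finally show "(norm (fst v))^2 <= (1 / (2 * lam))^2 * gd dl z v v"
   using lam_pos by (simp add: power_divide power_mult_distrib pos_le_divide_eq mult_ac)
 qed (use lam_pos in simp)
 then show ?thesis using lam_pos by (simp add: pos_le_divide_eq mult_ac)
qed

lemma D0_ge_norm: "p : Xp ==> q : Xp ==> 2 * norm (q - p) <= D0 p q"
proof -
 assume pq: "p : Xp" "q : Xp"
 have "norm (q - p) <= (1 / 2) * D0 p q"
 proof (rule rdist_ge_map[OF semi_HP convex_HP C1_map_id _ _ pq])
  fix z v :: "'n pt" assume z: "z : Xp"
  have "4 * (norm v)^2 <= g0 z v v"
   using hyp_metric_ge[OF HP_D(1)[OF z], of "fst v"] hyp_metric_ge[OF HP_D(2)[OF z], of "snd v"]
   by (simp add: hyp_prod_metric_def norm_prod_def)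
  then show "(norm v)^2 <= (1 / 2)^2 * g0 z v v" by (simp add: power_divide)
 qed simp
 then show ?thesis by simp
qed

text \<open>Before its first entry into the ball of radius \<open>r1\<close> the path is measured by the product metric,
 afterwards only its first component is used.\<close>

lemma Dd_ge_corner:
 assumes p: "p : Q" and q: "q : Q" and L: "Dd dl p q < R / 2" and n: "r1 <= norm (snd p)" "norm (snd q) <= r1"
 shows "2 * (lam * norm (fst q - fst p) + kp * (norm (snd p) - r1)) <= Dd dl p q"
proof (rule dense_ge)
 fix L' assume L': "Dd dl p q < L'"
 \<comment> \<open>The minimum with \<open>R / 2\<close> keeps the path in the ball where
   \<open>wd\<close> is the norm.\<close>
 define L where "L = min L' (R / 2)"
 have pX: "p : Xp" and qX: "q : Xp" using p q Q_sub by blast+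
 have ps: "norm (snd p) <= R / 2" using p by (auto simp: Q_def)
 have LL: "Dd dl p q < L" "L <= R / 2" unfolding L_def min_def using L' L by simp_all
 have L0: "0 <= L" using le_less_trans[OF rdist_nonneg LL(1)] by simp
 obtain c where c: "valid_path c" "c ` {0..1} \<subseteq> Xp" "c 0 = p" "c 1 = q" "path_length (gd dl) c < ennreal L"
  using short_path[OF ok semi_gd[OF ok] pX qX LL(1)] by metis
 have pts: "c t : Xp" if "t : {0..1}" for t using c(2) that by auto
 have nb: "norm (snd (c t)) < R" if t: "t : {0..1}" for t
 proof -
  have "Dd dl p (c t) < L" using path_points[OF ok semi_gd[OF ok] c(1,2,5) t] c(3) by simp
  then have "norm (snd (c t) - snd p) < L / 2" by (rule snd_close(1)[OF ok pX pts[OF t]])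
  then show ?thesis using norm_triangle_sub[of "snd (c t)" "snd p"] ps LL(2) R by simp
 qed
 define T where "T = {t : {0..1}. norm (snd (c t)) <= r1}"
 have cc: "continuous_on {0..1} c" using valid_path_imp_path[OF c(1)] by (simp add: path_def)
 have "continuous_on {0..1} (%t. norm (snd (c t)))" by (intro continuous_intros cc)
 then have "closed ({0..1} \<inter> (%t. norm (snd (c t))) -` {..r1})" by (rule continuous_closed_preimage) auto
 moreover have "{0..1} \<inter> (%t. norm (snd (c t))) -` {..r1} = T" by (auto simp: T_def)
 ultimately have "closed T" by simp
 moreover have "bounded T" by (rule bounded_subset[OF bounded_closed_interval[of 0 1]]) (auto simp: T_def)
 ultimately have cT: "compact T" using compact_eq_bounded_closed by blast
 have "1 : T" using n c by (simp add: T_def)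
 then obtain s where s: "s : T" "!!ta. ta : T ==> s <= ta" using compact_attains_inf[OF cT] by blast
 have s01: "0 <= s" "s <= 1" "s : {0..1}" using s by (auto simp: T_def)
 have p1: "plen (gd dl) c 0 s = plen g0 c 0 s"
 proof (rule plen_off[OF ok, of _ _ s])
  fix ta assume ta: "ta : {0..s}" "ta ~= s"
  then have t: "ta : {0..1}" "ta ~: T" using s01 s(2)[of ta] by auto
  then have "r1^2 <= (norm (snd (c ta)))^2" using r1(1) rh(1) by (intro power_mono) (auto simp: T_def)
  then show "sg dl (snd (c ta)) = 0" using sg_zero[OF ok, of "snd (c ta)"] W_base[OF nb[OF t(1)]] r1(3) by simp
 qed
 have "ennreal (D0 (c 0) (c s)) <= plen (gd dl) c 0 s"
  using riem_dist_le_plen[OF semi_HP c(1,2), of 0 s] p1 s01 riem_dist_eq_rdist[OF semi_HP convex_HP pts pts[OF s01(3)], of 0] by simp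
 moreover have "ennreal (Dd dl (c s) (c 1)) <= plen (gd dl) c s 1"
  using riem_dist_le_plen[OF semi_gd[OF ok] c(1,2), of s 1] s01 riem_dist_eq_rdist[OF semi_gd[OF ok] convex_HP pts[OF s01(3)] pts, of 1] by simp
 ultimately have "ennreal (D0 (c 0) (c s)) + ennreal (Dd dl (c s) (c 1)) <= plen (gd dl) c 0 s + plen (gd dl) c s 1"
  by (rule add_mono)
 also have "... = path_length (gd dl) c" using plen_add[OF semi_gd[OF ok] c(1,2), of 0 s 1] s01 by (simp add: path_length_plen)
 also have "... < ennreal L" by (rule c(5))
 finally have "D0 p (c s) + Dd dl (c s) q < L" using c(3,4) by (simp add: ennreal_plus[symmetric] ennreal_less_iff del: ennreal_plus)
 moreover have "2 * norm (c s - p) <= D0 p (c s)" by (rule D0_ge_norm[OF pX pts[OF s01(3)]])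
 moreover have "2 * lam * norm (fst q - fst (c s)) <= Dd dl (c s) q" by (rule Dd_ge_fst[OF pts[OF s01(3)] qX])
 \<comment> \<open>Cauchy-Schwarz against the unit vector \<open>(lam, kp)\<close>.\<close>
 moreover have "lam * norm (fst (c s) - fst p) + kp * norm (snd (c s) - snd p) <= norm (c s - p)"
 proof -
  let ?x = "norm (fst (c s) - fst p)" and ?y = "norm (snd (c s) - snd p)"
  have "(lam * ?x + kp * ?y)^2 + (lam * ?y - kp * ?x)^2 = (lam^2 + kp^2) * (?x^2 + ?y^2)" by (simp add: power2_eq_square algebra_simps)
  then have "(lam * ?x + kp * ?y)^2 + (lam * ?y - kp * ?x)^2 = ?x^2 + ?y^2" unfolding lam_kp(1) by simp
  then have "(lam * ?x + kp * ?y)^2 <= ?x^2 + ?y^2" using zero_le_power2[of "lam * ?y - kp * ?x"] by linarith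
  then show ?thesis by (simp add: norm_prod_def real_le_rsqrt)
 qed
 moreover have "kp * (norm (snd p) - r1) <= kp * norm (snd (c s) - snd p)"
  using s(1) norm_triangle_ineq3[of "snd p" "snd (c s)"] kp_pos by (intro mult_left_mono) (auto simp: T_def norm_minus_commute)
 moreover have "lam * norm (fst q - fst p) <= lam * norm (fst q - fst (c s)) + lam * norm (fst (c s) - fst p)"
  using lam_pos norm_triangle_ineq[of "fst q - fst (c s)" "fst (c s) - fst p"] by (simp add: distrib_left[symmetric])
 ultimately have "2 * (lam * norm (fst q - fst p) + kp * (norm (snd p) - r1)) < L" by (simp add: distrib_left)
 then show "2 * (lam * norm (fst q - fst p) + kp * (norm (snd p) - r1)) <= L'" by (simp add: L_def)
qed

text \<open>On the ball of radius \<open>R\<close> the hyperbolic norm lies between \<open>2\<close>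
  and \<open>2 * nu\<close> times the Euclidean one.\<close>

definition nu where "nu = 1 / (1 - R^2)"

lemma nu: "1 <= nu" "0 < 1 - R^2" using R2(1,2) by (auto simp: nu_def)

lemma sqrt_hyp_metric_Q: "norm x <= R ==> sqrt (hm x v v) <= 2 * nu * norm (v :: real^'n)"
proof -
 assume x: "norm x <= R"
 then have "x : HS" using R by simp
 then have "sqrt (hm x v v) = 2 * norm v / (1 - (norm x)^2)" by (rule sqrt_hyp_metric)
 also have "... <= 2 * norm v / (1 - R^2)"
 proof -
  have "(norm x)^2 <= R^2" using x by (intro power_mono) auto
  then show ?thesis using nu(2) by (intro divide_left_mono mult_pos_pos) auto
 qed
 finally show ?thesis by (simp add: nu_def)
qed

text \<open>At radius exactly \<open>rh\<close> the bump equals 1, so the full factor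
  \<open>lam\<close> is available; the second factor of the metric does not see horizontal
  vectors.\<close>

lemma horizontal_top:
 assumes "norm (fst z) <= R" "norm (snd z) = rh" shows "sqrt (gd dl z (a, 0) (a, 0)) <= 2 * lam * nu * norm a"
proof -
 have "norm (snd z) < R" using assms rh by simp
 then have "sg dl (snd z) = 1 / real CARD('n)" using sg_top[OF ok, of "snd z"] W_base[of "snd z"] assms by simp
 then have "gd dl z (a, 0) (a, 0) = lam^2 * hm (fst z) a a"
  by (simp add: gd_def fib_def nrm_def hyp_metric_def lam_sq dW_base[OF \<open>norm (snd z) < R\<close>])
 then have "sqrt (gd dl z (a, 0) (a, 0)) = lam * sqrt (hm (fst z) a a)" using lam_pos by (simp add: real_sqrt_mult)
 also have "... <= lam * (2 * nu * norm a)" using lam_pos by (intro mult_left_mono sqrt_hyp_metric_Q assms) auto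
 finally show ?thesis by (simp add: mult_ac)
qed

lemma sqrt_gd_Q:
 assumes z: "norm (fst z) <= R" "norm (snd z) <= R" and v: "fst v = 0 | snd v = 0"
 shows "sqrt (gd dl z v v) <= 3 * nu * norm v" "sg dl (snd z) = 0 ==> sqrt (gd dl z v v) <= 2 * nu * norm v"
proof -
 have zX: "z : Xp" using z R by (auto simp: hyp_prod_def mem_Times_iff)
 have h: "sqrt (g0 z v v) <= 2 * nu * norm v"
  using v sqrt_hyp_metric_Q[OF z(1), of "fst v"] sqrt_hyp_metric_Q[OF z(2), of "snd v"]
  by (auto simp: hyp_prod_metric_def hyp_metric_def norm_prod_def)
 have "sqrt (gd dl z v v) <= sqrt (2 * g0 z v v)" using gd_bounds(2)[OF ok zX] by (intro real_sqrt_le_mono)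
 also have "... = sqrt 2 * sqrt (g0 z v v)" by (simp add: real_sqrt_mult)
 also have "... <= (3 / 2) * (2 * nu * norm v)"
 proof (rule mult_mono[OF _ h])
  show "sqrt 2 <= 3 / 2" by (rule real_le_lsqrt) (auto simp: power2_eq_square)
 qed (auto simp: hyp_prod_metric_def hyp_metric_def)
 finally show "sqrt (gd dl z v v) <= 3 * nu * norm v" by (simp add: mult_ac)
 show "sqrt (gd dl z v v) <= 2 * nu * norm v" if "sg dl (snd z) = 0" using h gd_off[OF ok that] by simp
qed

text \<open>Each set of a Hausdorff cover downstairs is replaced by a product of balls around one of
  its points over \<open>Q\<close>, with radius slightly above the diameter and errors summing to at
  most \<open>si / 2\<close>. These are open, so compactness of the part of the frontier over
  \<open>Q\<close> leaves finitely many. The power of 2 in \<open>area\<close> accounts for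
  diameters being used as radii.\<close>

lemma frontier_cover:
 fixes Z :: "'n pt set set"
 assumes si: "0 < si"
  and area: "boundary_area Xp Dk (gd dl) Z < ennreal (si / 2 * unit_ball_vol (real (2 * CARD('n) - 1)) / 2 ^ (2 * CARD('n) - 1))"
 obtains J :: "nat set" and x y :: "nat => real^'n" and r :: "nat => real"
 where "finite J" "!!j. j : J ==> 0 < r j & r j <= R / 4" "(\<Sum>j\<in>J. r j ^ (2 * CARD('n) - 1)) <= si"
  "!!z. z : Q ==> orb Dk z : quot_top Xp Dk frontier_of Z ==> EX j:J. hit x y r (fst z) (snd z) j"
proof -
 let ?k = "2 * CARD('n) - 1"
 define u where "u = unit_ball_vol (real ?k)"
 have u0: "0 < u" unfolding u_def by (rule unit_ball_vol_pos) (rule of_nat_0_le_iff)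
 let ?F = "quot_top Xp Dk frontier_of Z"
 have k: "?k ~= 0" using dim by simp
 have dimk: "DIM('n pt) - 1 = ?k" by simp
 define Cs where "Cs = {C :: nat => 'n pt set set. ?F \<subseteq> (\<Union>j. C j) & (ALL j. C j \<subseteq> quot Xp Dk & ediam (qd dl) (C j) <= ennreal (R / 8))}"
 have "(INF C\<in>Cs. \<Sum>j. if C j = {} then 0 else ennreal u * (ediam (qd dl) (C j) / 2) ^ ?k) <= boundary_area Xp Dk (gd dl) Z"
  unfolding boundary_area_def hausdorff_meas_def dimk Cs_def u_def by (rule SUP_upper2[of "R / 8"]) (use R in auto)
 also have "... < ennreal (si / 2 * u / 2 ^ ?k)" by (rule area[folded u_def])
 finally obtain C where C: "C : Cs" "(\<Sum>j. if C j = {} then 0 else ennreal u * (ediam (qd dl) (C j) / 2) ^ ?k) < ennreal (si / 2 * u / 2 ^ ?k)"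
  unfolding INF_less_iff by blast
 have cov: "?F \<subseteq> (\<Union>j. C j)" "!!j. ediam (qd dl) (C j) <= ennreal (R / 8)" using C(1) by (auto simp: Cs_def)
 define d where "d j = enn2real (ediam (qd dl) (C j))" for j
 have d: "ediam (qd dl) (C j) = ennreal (d j)" "0 <= d j" "d j <= R / 8" for j
 proof -
  show "ediam (qd dl) (C j) = ennreal (d j)" unfolding d_def using cov(2)[of j] by (intro ennreal_enn2real[symmetric]) (auto intro: le_less_trans)
  then show "d j <= R / 8" using cov(2)[of j] R by simp
 qed (simp add: d_def)
 have "EX r. d j < r & r <= R / 4 & r ^ ?k < d j ^ ?k + si / 2 * (1 / 2) ^ Suc j" for j
 proof -
  have "((%r. r ^ ?k) \<longlongrightarrow> d j ^ ?k) (at_right (d j))" by (intro tendsto_intros)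
  then have "\<forall>\<^sub>F r in at_right (d j). r ^ ?k < d j ^ ?k + si / 2 * (1 / 2) ^ Suc j"
   by (rule order_tendstoD) (use si in simp)
  moreover have "\<forall>\<^sub>F r in at_right (d j). r : {d j<..<R / 4}" by (rule eventually_at_right_real) (use d[of j] R in simp)
  ultimately have "\<forall>\<^sub>F r in at_right (d j). d j < r & r <= R / 4 & r ^ ?k < d j ^ ?k + si / 2 * (1 / 2) ^ Suc j"
   by eventually_elim auto
  then show ?thesis by (rule eventually_happens'[rotated]) simp
 qed
 then obtain r where r: "!!j. d j < r j" "!!j. r j <= R / 4" "!!j. r j ^ ?k < d j ^ ?k + si / 2 * (1 / 2) ^ Suc j" by metis
 define P where "P = {z : Q. orb Dk z : ?F}"
 define c where "c j = (SOME z. z : P & orb Dk z : C j)" for j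
 define I where "I = {j. EX z:P. orb Dk z : C j}"
 have c: "c j : P" "orb Dk (c j) : C j" if "j : I" for j
  using someI_ex[of "%z. z : P & orb Dk z : C j"] that by (auto simp: I_def c_def)
 have close: "norm (fst z - fst (c j)) < r j & norm (snd z - snd (c j)) < r j" if j: "j : I" and z: "z : P" "orb Dk z : C j" for j z
 proof -
  have zc: "z : Q" "c j : Q" "z : Xp" "c j : Xp" using z c[OF j] Q_sub by (auto simp: P_def)
  have "qd dl (orb Dk (c j)) (orb Dk z) <= ediam (qd dl) (C j)"
   unfolding ediam_def using c[OF j] z by (intro SUP_upper2[of "orb Dk (c j)"] SUP_upper) auto
  then have "qd dl (orb Dk (c j)) (orb Dk z) < ennreal (r j)" using r(1)[of j] d[of j] by (auto simp: ennreal_lessI intro: le_less_trans)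
  then have "Dd dl (c j) z < r j" by (rule quot_less[OF ok zc(2,1)]) (use r(2)[of j] R in linarith)
  \<comment> \<open>The factor 2 lost here between the two distances is regained from
    \<open>hdist_ge_norm\<close>.\<close>
  then have "D0 (c j) z < 2 * r j" using D0_le_Dd[OF ok zc(4,3)] mult_right_mono[of "sqrt 2" 2 "Dd dl (c j) z"] sqrt2_less_2 by simp
  then show ?thesis
   using D0_ge_hdist[OF zc(4,3)] hdist_ge_norm[OF HP_D(1)[OF zc(4)] HP_D(1)[OF zc(3)]]
    hdist_ge_norm[OF HP_D(2)[OF zc(4)] HP_D(2)[OF zc(3)]] by simp
 qed
 define U where "U j = ball (fst (c j)) (r j) \<times> ball (snd (c j)) (r j)" for j
 have U: "z : U j \<longleftrightarrow> norm (fst z - fst (c j)) < r j & norm (snd z - snd (c j)) < r j" for z j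
  by (cases z) (auto simp: U_def dist_norm norm_minus_commute)
 have "compact P"
 proof -
  have "closedin (top_of_set Xp) {z : topspace (top_of_set Xp). orb Dk z : ?F}"
   by (rule closedin_continuous_map_preimage[OF continuous_map_orb closedin_frontier_of])
  then obtain T where T: "closed T" "{z : Xp. orb Dk z : ?F} = Xp \<inter> T" by (auto simp: closedin_closed)
  have "P = Q \<inter> T" using T(2) Q_sub by (auto simp: P_def)
  moreover have "compact Q" unfolding Q_def by (intro compact_Times compact_cball)
  ultimately show ?thesis using T(1) by (simp add: compact_Int_closed)
 qed
 moreover have "P \<subseteq> (\<Union>j\<in>I. U j)"
 proof
  fix z assume z: "z : P"
  then obtain j where j: "orb Dk z : C j" using cov(1) by (auto simp: P_def)
  then have "j : I" using z by (auto simp: I_def)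
  then show "z : (\<Union>j\<in>I. U j)" using close[OF _ z j] U by blast
 qed
 moreover have "open (U j)" for j unfolding U_def by (intro open_Times open_ball)
 ultimately obtain J where J: "J \<subseteq> I" "finite J" "P \<subseteq> (\<Union>j\<in>J. U j)" by (metis compactE_image)
 show thesis
 proof (rule that[of J r "%j. fst (c j)" "%j. snd (c j)"])
  show "finite J" by (rule J(2))
  show "0 < r j & r j <= R / 4" for j using r(1,2)[of j] d(2)[of j] by simp
  show "EX j:J. norm (fst z - fst (c j)) < r j & norm (snd z - snd (c j)) < r j" if "z : Q" "orb Dk z : ?F" for z
  proof -
   have "z : P" using that by (simp add: P_def)
   then obtain j where "j : J" "z : U j" using J(3) by blast
   then show ?thesis using U by blast
  qed
  have ne: "C j ~= {}" if "j : J" for j using that J(1) c(2) by blast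
  have "ennreal (u / 2 ^ ?k * (\<Sum>j\<in>J. d j ^ ?k)) = (\<Sum>j\<in>J. if C j = {} then 0 else ennreal u * (ediam (qd dl) (C j) / 2) ^ ?k)"
  proof -
   have "(\<Sum>j\<in>J. if C j = {} then 0 else ennreal u * (ediam (qd dl) (C j) / 2) ^ ?k) = (\<Sum>j\<in>J. ennreal (u / 2 ^ ?k * d j ^ ?k))"
   proof (rule sum.cong[OF refl])
    fix j assume j: "j : J"
    have eq: "ediam (qd dl) (C j) / 2 = ennreal (d j / 2)" unfolding d(1) using d(2)[of j] by (simp add: divide_ennreal[symmetric] flip: ennreal_numeral)
    have *: "ennreal v * ennreal (d j / 2) ^ m = ennreal (v / 2 ^ m * d j ^ m)" if "0 <= v" for v m
     using d(2)[of j] that by (simp add: ennreal_power ennreal_mult'[symmetric] power_divide)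
    from *[OF less_imp_le[OF u0], of ?k] show "(if C j = {} then 0 else ennreal u * (ediam (qd dl) (C j) / 2) ^ ?k) = ennreal (u / 2 ^ ?k * d j ^ ?k)"
     unfolding eq if_not_P[OF ne[OF j]] .
   qed
   also have "... = ennreal (u / 2 ^ ?k * (\<Sum>j\<in>J. d j ^ ?k))"
    unfolding sum_distrib_left using d(2) u0 by (intro sum_ennreal) auto
   finally show ?thesis by simp
  qed
  also have "... <= (\<Sum>j. if C j = {} then 0 else ennreal u * (ediam (qd dl) (C j) / 2) ^ ?k)"
   by (rule sum_le_suminf) (use J(2) in auto)
  also have "... < ennreal (si / 2 * u / 2 ^ ?k)" by (rule C(2))
  finally have "u / 2 ^ ?k * (\<Sum>j\<in>J. d j ^ ?k) <= u / 2 ^ ?k * (si / 2)"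
   using d(2) u0 by (simp add: ennreal_less_iff sum_nonneg mult_ac)
  then have 1: "(\<Sum>j\<in>J. d j ^ ?k) <= si / 2" by (rule mult_left_le_imp_le) (use u0 in simp)
  have "(\<Sum>j\<in>J. (1 / 2 :: real) ^ Suc j) <= (\<Sum>j. (1 / 2) ^ Suc j)" by (rule sum_le_suminf) (use J(2) power_half_series sums_summable in auto)
  also have "... = 1" by (rule sums_unique[OF power_half_series, symmetric])
  finally have 2: "si / 2 * (\<Sum>j\<in>J. (1 / 2) ^ Suc j) <= si / 2" using si by simp
  have "(\<Sum>j\<in>J. r j ^ ?k) <= (\<Sum>j\<in>J. d j ^ ?k + si / 2 * (1 / 2) ^ Suc j)" using r(3) by (intro sum_mono) (simp add: less_imp_le)
  also have "... = (\<Sum>j\<in>J. d j ^ ?k) + si / 2 * (\<Sum>j\<in>J. (1 / 2) ^ Suc j)" by (simp only: sum.distrib sum_distrib_left)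
  finally show "(\<Sum>j\<in>J. r j ^ ?k) <= si" using 1 2 by linarith
 qed
qed

text \<open>\<open>Q\<close> injects into the quotient, and the volume density is at least 1 on
  it.\<close>

lemma lborel_le_quot_vol:
 assumes Z: "closedin (quot_top Xp Dk) Z"
 shows "emeasure lborel {z : Q. orb Dk z : Z} <= emeasure (quot_vol Xp Dk (gd dl)) Z" and "{z : Q. orb Dk z : Z} : sets borel"
proof -
 have "closedin (top_of_set Xp) {z : topspace (top_of_set Xp). orb Dk z : Z}"
  by (rule closedin_continuous_map_preimage[OF continuous_map_orb Z])
 then obtain T where T: "closed T" "{z : Xp. orb Dk z : Z} = Xp \<inter> T" by (auto simp: closedin_closed)
 have QT: "{z : Q. orb Dk z : Z} = Q \<inter> T" using T(2) Q_sub by auto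
 have Qc: "closed Q" unfolding Q_def by (intro closed_Times closed_cball)
 then show meas: "{z : Q. orb Dk z : Z} : sets borel" unfolding QT using T(1) by (intro borel_closed closed_Int)
 have Qs: "Q : sets (riem_vol Xp (gd dl))" using Qc Q_sub by (simp add: sets_riem_vol open_HP borel_closed)
 have "emeasure lborel {z : Q. orb Dk z : Z} = (\<integral>\<^sup>+z. indicator {z : Q. orb Dk z : Z} z \<partial>lborel)" using meas by simp
 also have "... <= (\<integral>\<^sup>+z. ennreal (dens (fst z) * dens (snd z)) * indicator {z : Q. orb Dk z : Z} z \<partial>lborel)"
 proof (intro nn_integral_mono)
  fix z :: "'n pt"
  have d1: "1 <= dens x" if "norm x <= R / 2" for x :: "real^'n"
  proof -
   have "norm x < 1" using that R by simp
   then have "0 < 1 - (norm x)^2" using norm_sq_less_1 by simp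
   then have "1 <= 2 / (1 - (norm x)^2)" by (simp add: pos_le_divide_eq order.trans[OF _ zero_le_power2])
   then show ?thesis unfolding dens_def by (rule one_le_power)
  qed
  show "indicator {z : Q. orb Dk z : Z} z <= ennreal (dens (fst z) * dens (snd z)) * indicator {z : Q. orb Dk z : Z} z"
  proof (cases "z : Q")
   case True
   then have "1 <= dens (fst z)" "1 <= dens (snd z)" using d1 by (auto simp: Q_def)
   then have "1 * 1 <= dens (fst z) * dens (snd z)" by (intro mult_mono) auto
   then show ?thesis by (simp add: indicator_def)
  qed (simp add: indicator_def)
 qed
 also have "... = emeasure pvol {z : Q. orb Dk z : Z}" by (rule emeasure_pvol[OF meas, symmetric]) (use Q_sub in auto)
 also have "... <= emeasure (quot_vol Xp Dk (gd dl)) Z"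
  using emeasure_le_quot_vol[OF open_HP Z Qs inj_on_orb_Q] by (simp add: riem_vol_gd[OF ok])
 finally show "emeasure lborel {z : Q. orb Dk z : Z} <= emeasure (quot_vol Xp Dk (gd dl)) Z" .
qed

end

end

section \<open>Four points in the complement of a removed region\<close>

locale four = duo Gm\<^sub>1 Gm R rh c0
 for Gm\<^sub>1 Gm :: "((real^'n::finite) => real^'n) set" and R rh c0 :: real +
 assumes rhR: "rh = R / 4"
begin

definition el where "el = R / 32"

text \<open>With this height the direction from \<open>C\<close> to \<open>B\<close> is
  \<open>(lam, kp)\<close>, so the lower bound \<open>lam * el + kp * hh\<close> of
  \<open>Dd_ge_corner\<close> equals \<open>el / lam\<close>, the length of the straight segment:
  the shell shortens \<open>A B\<close> by the factor \<open>lam\<close>, but leaves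
  \<open>C B\<close> as it is.\<close>

definition hh where "hh = el * kp / lam"

lemma el_pos: "0 < el" and hh_pos: "0 < hh" "hh <= el" and corner: "lam * el + kp * hh = el / lam"
proof -
 show e: "0 < el" using R by (simp add: el_def)
 show "0 < hh" using e kp_pos lam_pos by (simp add: hh_def)
 have "kp^2 <= lam^2" using lam_kp by linarith
 then have "kp <= lam" by (rule power2_le_imp_le) (use lam_pos in simp)
 then show "hh <= el" using e lam_pos by (simp add: hh_def pos_divide_le_eq)
 have "(lam * el + kp * hh) * lam = el * (lam^2 + kp^2)" using lam_pos by (simp add: hh_def power2_eq_square algebra_simps)
 then show "lam * el + kp * hh = el / lam" using lam_kp lam_pos by (simp add: eq_divide_eq)
qed

text \<open>The factors 2 stem from the conformal factor 4 at the origin; \<open>nu\<close> and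
  \<open>ze\<close> are errors. The bound for \<open>B B'\<close> is about twice that for
  \<open>A B\<close> and \<open>A B'\<close>, which makes \<open>A\<close> nearly a
  midpoint.\<close>

definition skew :: "('n pt set => 'n pt set => ennreal) => real => 'n pt set => 'n pt set => 'n pt set => 'n pt set => bool" where
 "skew d ze A B B' C \<longleftrightarrow> d A B <= ennreal (2 * lam * nu * el + ze) & d A B' <= ennreal (2 * lam * nu * el + ze) &
  d A C <= ennreal (2 * nu * hh + ze) & ennreal (4 * lam * el) <= d B B' &
  ennreal (2 * el / lam - ze) <= d C B & ennreal (2 * el / lam - ze) <= d C B'"

text \<open>In a slice from \<open>slice_exists\<close> the frontier lies in squares of small total
  size. Lines missing all squares exist close to the desired positions, and the path along the shell
  from \<open>A\<close> to \<open>B\<close> is repaired by \<open>detour\<close>. Lower bounds come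
  from the unrestricted quotient distance, which the intrinsic distance of a subset can only
  exceed.\<close>

lemma four_points_exist:
 assumes ze: "0 < ze"
 obtains et where "0 < et"
  "!!dl Z. ok dl ==> dl < et ==> closedin (quot_top Xp Dk) Z ==> emeasure (quot_vol Xp Dk (gd dl)) Z < ennreal et ==>
   boundary_area Xp Dk (gd dl) Z < ennreal et ==>
   EX A B B' C. {A, B, B', C} \<subseteq> quot Xp Dk - Z & skew (intrinsic_dist (quot_top Xp Dk) (qd dl) (quot Xp Dk - Z)) ze A B B' C"
proof -
 define u where "u = unit_ball_vol (real (2 * CARD('n) - 1))"
 have u0: "0 < u" unfolding u_def by (rule unit_ball_vol_pos) (rule of_nat_0_le_iff)
 have "ok (rh^2 / 4)" using rh by (simp add: ok_def)
 then have nu1: "1 <= nu" by (rule nu(1))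
 define e1 where "e1 = (axis undefined 1 :: real^'n)"
 have e1: "norm e1 = 1" by (simp add: e1_def norm_axis_1)
 define y0 where "y0 = (3 * R / 8) *\<^sub>R e1"
 have y0: "norm y0 = 3 * R / 8" using e1 R by (simp add: y0_def)
 define Box where "Box = cball (0 :: real^'n) (R / 16) \<times> cball y0 (R / 16)"
 define m0 where "m0 = (unit_ball_vol (real CARD('n)) * (R / 16) ^ CARD('n)) * (unit_ball_vol (real CARD('n)) * (R / 16) ^ CARD('n))"
 have m0: "0 < m0" using R by (simp add: m0_def)
 have Boxm: "emeasure lborel Box = ennreal m0"
  unfolding Box_def m0_def by (subst emeasure_lborel_Times) (use R in "auto simp: emeasure_cball ennreal_mult'")
 show thesis
 proof (rule slice_exists[OF R(1) y0 e1, folded Box_def], goal_cases)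
 case C: (1 C)
 \<comment> \<open>In \<open>horiz'\<close> the detours and the displaced end points cost at most
   \<open>54 + 28\<close> times \<open>nu * et1\<close>, hence the 100; \<open>R / 300\<close> keeps
   everything inside the window.\<close>
 define et1 where "et1 = min (R / 300) (ze / (100 * nu))"
 have et1: "0 < et1" "et1 <= R / 300" "100 * nu * et1 <= ze"
 proof -
  show "0 < et1" "et1 <= R / 300" using R ze nu1 by (auto simp: et1_def)
  have "et1 <= ze / (100 * nu)" by (simp add: et1_def)
  then show "100 * nu * et1 <= ze" using nu1 by (simp add: pos_le_divide_eq mult_ac)
 qed
 \<comment> \<open>Bounds the contribution of the frontier in \<open>slice_exists\<close> by a
   quarter of the box, while the removed volume takes less than a half.\<close>
 define si where "si = m0 / (4 * (C * (1 + 1 / et1)))"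
 have C1: "0 < C * (1 + 1 / et1)" using C(1) et1 by (simp add: add_pos_pos)
 have "0 < m0 / (4 * K)" "K * (m0 / (4 * K)) = m0 / 4" if "0 < K" for K using m0 that by simp_all
 from this[OF C1] have si: "0 < si" "C * (1 + 1 / et1) * si = m0 / 4" by (simp_all only: si_def)
 \<comment> \<open>In this order: the boundary area, the removed volume, and the thickness of the
   shell measured against \<open>ze\<close> and against \<open>hh\<close>.\<close>
 define et where "et = Min {si / 2 * u / 2 ^ (2 * CARD('n) - 1), m0 / 4, rh * ze / (2 * nu), rh * hh}"
 have etpos: "0 < et" using si m0 rh ze nu1 hh_pos u0 by (simp add: et_def)
 show thesis
 proof (rule that[OF etpos])
  fix dl Z
  assume ok: "ok dl" and dl: "dl < et" and Z: "closedin (quot_top Xp Dk) Z"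
   and vol: "emeasure (quot_vol Xp Dk (gd dl)) Z < ennreal et" and area: "boundary_area Xp Dk (gd dl) Z < ennreal et"
  let ?d = "intrinsic_dist (quot_top Xp Dk) (qd dl) (quot Xp Dk - Z)"
  have etle: "et <= si / 2 * u / 2 ^ (2 * CARD('n) - 1)" "et <= m0 / 4" "et <= rh * ze / (2 * nu)" "et <= rh * hh" by (simp_all add: et_def)
  have dr: "2 * nu * (dl / rh) <= ze" "dl / rh <= hh"
  proof -
   have "dl <= rh * ze / (2 * nu)" "dl <= rh * hh" using dl etle by auto
   then show "2 * nu * (dl / rh) <= ze" "dl / rh <= hh" using nu1 rh(1) by (simp_all add: pos_le_divide_eq pos_divide_le_eq mult_ac)
  qed
  define s1 where "s1 = r1 dl"
  have s1: "rh < s1" "s1 <= rh + hh" "2 * nu * (s1 - rh) <= ze" "2 * (s1 - rh) <= ze"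
  proof -
   show "rh < s1" unfolding s1_def by (rule r1(1)[OF ok])
   have le: "s1 - rh <= dl / rh" using r1(2)[OF ok] by (simp add: s1_def)
   then show "s1 <= rh + hh" using dr by simp
   have "2 * nu * (s1 - rh) <= 2 * nu * (dl / rh)" using le nu1 by (intro mult_left_mono) auto
   then show *: "2 * nu * (s1 - rh) <= ze" using dr by simp
   have "1 * (s1 - rh) <= nu * (s1 - rh)" using nu1 \<open>rh < s1\<close> by (intro mult_right_mono) auto
   then show "2 * (s1 - rh) <= ze" using * by simp
  qed
  define Bad where "Bad = {z. orb Dk z : quot_top Xp Dk frontier_of Z}"
  have area': "boundary_area Xp Dk (gd dl) Z < ennreal (si / 2 * unit_ball_vol (real (2 * CARD('n) - 1)) / 2 ^ (2 * CARD('n) - 1))"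
   using order.strict_trans2[OF area ennreal_leI[OF etle(1)]] unfolding u_def .
  show "EX A B B' C. {A, B, B', C} \<subseteq> quot Xp Dk - Z & skew ?d ze A B B' C"
  proof (rule frontier_cover[OF ok si(1) area'], goal_cases)
  case J: (1 J x y r)
  define BZ where "BZ = {z : Q. orb Dk z : Z}"
  have BZ: "emeasure lborel (BZ \<inter> Box) < ennreal (m0 / 2)" "BZ : sets borel"
  proof -
   show BZs: "BZ : sets borel" unfolding BZ_def by (rule lborel_le_quot_vol(2)[OF ok Z])
   have "emeasure lborel (BZ \<inter> Box) <= emeasure lborel BZ" by (rule emeasure_mono) (use BZs in auto)
   also have "... <= emeasure (quot_vol Xp Dk (gd dl)) Z" unfolding BZ_def by (rule lborel_le_quot_vol(1)[OF ok Z])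
   also have "... < ennreal et" by (rule vol)
   also have "... <= ennreal (m0 / 2)" using etle(2) m0 by (intro ennreal_leI) simp
   finally show "emeasure lborel (BZ \<inter> Box) < ennreal (m0 / 2)" .
  qed
  have "emeasure lborel (BZ \<inter> Box) + ennreal (C * (1 + 1 / et1) * (\<Sum>j\<in>J. r j ^ (2 * CARD('n) - 1))) < emeasure lborel Box"
  proof -
   have "C * (1 + 1 / et1) * (\<Sum>j\<in>J. r j ^ (2 * CARD('n) - 1)) <= m0 / 4" using mult_left_mono[OF J(3), of "C * (1 + 1 / et1)"] C1 si(2) by simp
   then have "emeasure lborel (BZ \<inter> Box) + ennreal (C * (1 + 1 / et1) * (\<Sum>j\<in>J. r j ^ (2 * CARD('n) - 1))) <= ennreal (m0 / 2) + ennreal (m0 / 4)"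
    using BZ(1) by (intro add_mono ennreal_leI) auto
   also have "... = ennreal (m0 / 2 + m0 / 4)" using m0 by (intro ennreal_plus[symmetric]) auto
   also have "... < emeasure lborel Box" unfolding Boxm using m0 by (intro ennreal_lessI) auto
   finally show ?thesis .
  qed
  from C(2)[OF J(1,2) BZ(2) et1(1) this]
  obtain x0 w where xw: "(x0, w) : Box" "(x0, w) ~: BZ"
   and hits: "(\<Sum>j\<in>hits J e1 R x y r x0 w. r j) <= et1"
   and free0: "!!j ta. j : J ==> ta : {R/4..R/2} ==> ~ (hit x y r x0 ((ta / norm w) *\<^sub>R w) j)"
   by blast
  have x0: "norm x0 <= R / 16" and wn: "R / 4 <= norm w" "norm w <= R / 2"
   using xw(1) y0 norm_triangle_ineq3[of w y0] unfolding Box_def by (auto simp: dist_norm norm_minus_commute)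
  have w0: "0 < norm w" using wn(1) R by linarith
  \<comment> \<open>On \<open>Win\<close> a Euclidean isometry onto the window of the slice;
    \<open>snd q\<close> is the norm of the second component, so the middle of the shell is the line
    at height \<open>rh\<close>.\<close>
  define Ps where "Ps q = (x0 + fst q *\<^sub>R e1, (snd q / norm w) *\<^sub>R w)" for q :: "real \<times> real"
  define Win where "Win = {-R/4..R/4} \<times> {R/4..R/2}"
  have Ps: "norm (fst (Ps q)) <= R / 2" "norm (snd (Ps q)) = snd q" "Ps q : Q" "Ps q : Xp" if q: "q : Win" for q
  proof -
   have f: "\<bar>fst q\<bar> <= R / 4" "R / 4 <= snd q" "snd q <= R / 2" using q by (auto simp: Win_def)
   have "norm (x0 + fst q *\<^sub>R e1) <= norm x0 + \<bar>fst q\<bar>" using norm_triangle_ineq[of x0 "fst q *\<^sub>R e1"] e1 by simp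
   then show 1: "norm (fst (Ps q)) <= R / 2" using f x0 R by (simp add: Ps_def)
   show 2: "norm (snd (Ps q)) = snd q" using f w0 R by (simp add: Ps_def)
   then show "Ps q : Q" using 1 f by (simp add: Q_def mem_Times_iff)
   then show "Ps q : Xp" using Q_sub by blast
  qed
  define H where "H = hits J e1 R x y r x0 w"
  have "ALL j:H. EX p. hit x y r (fst (Ps p)) (snd (Ps p)) j" by (fastforce simp: H_def Ps_def)
  then obtain p where p: "!!j. j : H ==> norm (fst (Ps (p j)) - x j) < r j & norm (snd (Ps (p j)) - y j) < r j" by metis
  \<comment> \<open>Two points of the slice that hit the same ball differ by less than
    \<open>2 r j\<close> in each coordinate, so an open square of half side \<open>3 r j\<close>
    around one hit contains all of them.\<close>
  define S0 where "S0 = (%j. (p j, 3 * r j)) ` H"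
  have S0: "finite S0" "!!s. s : S0 ==> 0 < snd s" using J(1,2) by (auto simp: S0_def H_def)
  have S0sum: "sum snd S0 <= 3 * et1"
  proof -
   have "sum snd S0 <= (\<Sum>j\<in>H. snd (p j, 3 * r j))"
    unfolding S0_def using sum_image_le[of H snd "%j. (p j, 3 * r j)"] J(1,2) by (auto simp: H_def less_imp_le o_def)
   also have "... = 3 * (\<Sum>j\<in>H. r j)" by (simp add: sum_distrib_left)
   also have "... <= 3 * et1" using hits by (simp add: H_def)
   finally show ?thesis .
  qed
  have cover: "q : osqs S0" if q: "q : Win" "Ps q : Bad" for q
  proof -
   obtain j where j: "j : J" "norm (fst (Ps q) - x j) < r j" "norm (snd (Ps q) - y j) < r j" using J(4)[OF Ps(3)[OF q(1)] q(2)[unfolded Bad_def mem_Collect_eq]] by blast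
   have q': "fst q : {-R/4..R/4}" "snd q : {R/4..R/2}" using q(1) by (auto simp: Win_def)
   have "j : H" unfolding H_def mem_Collect_eq using j by (intro conjI bexI[OF _ q'(1)] bexI[OF _ q'(2)]) (simp_all add: Ps_def)
   have d1: "norm (fst (Ps q) - fst (Ps (p j))) < 2 * r j" "norm (snd (Ps q) - snd (Ps (p j))) < 2 * r j"
    using j p[OF \<open>j : H\<close>] norm_triangle_ineq4[of "fst (Ps q) - x j" "fst (Ps (p j)) - x j"]
     norm_triangle_ineq4[of "snd (Ps q) - y j" "snd (Ps (p j)) - y j"] by simp_all
   have "fst (Ps q) - fst (Ps (p j)) = (fst q - fst (p j)) *\<^sub>R e1" by (simp add: Ps_def scaleR_left_diff_distrib)
   then have a: "\<bar>fst q - fst (p j)\<bar> < 2 * r j" using d1(1) e1 by simp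
   have "snd (Ps q) - snd (Ps (p j)) = ((snd q - snd (p j)) / norm w) *\<^sub>R w" by (simp add: Ps_def scaleR_left_diff_distrib diff_divide_distrib)
   then have b: "\<bar>snd q - snd (p j)\<bar> < 2 * r j" using d1(2) w0 by simp
   have "q : osq (p j, 3 * r j)" using a b J(2)[OF j(1)] by (auto simp: osq_def)
   then show ?thesis using \<open>j : H\<close> by (auto simp: S0_def)
  qed
  obtain S where S: "finite S" "!!s. s : S ==> 0 < snd s" "osqs S0 \<subseteq> osqs S" "sum snd S <= sum snd S0"
   "!!s s'. s : S ==> s' : S ==> s ~= s' ==> csq s \<inter> csq s' = {}"
   using merge_squares[OF S0] by metis
  have Ssum: "sum snd S <= 3 * et1" using S(4) S0sum by simp
  have free: "Ps q ~: Bad" if "q : Win" "q ~: osqs S" for q using cover that S(3) by blast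
  define E where "E p q c \<longleftrightarrow> joined Xp (gd dl) Bad (Ps p) (Ps q) c" for p q c
  note sm = semi_gd[OF ok]
  have Etrans: "E p r (c + d)" if "E p q c" "E q r d" "0 <= c" "0 <= d" for p q r c d
   using joined_trans[OF sm] that unfolding E_def by blast
  have Emono: "E p q d" if "E p q c" "c <= d" for p q c d using joined_mono that unfolding E_def by blast
  have Esym: "E q p c" if "E p q c" for p q c using joined_sym[OF sm] that unfolding E_def by blast
  have seg: "E p q K" if s: "!!q'. q' : closed_segment p q ==> q' : Win & Ps q' ~: Bad"
   and K: "!!q'. q' : closed_segment p q ==> sqrt (gd dl (Ps q') (Ps q - Ps p) (Ps q - Ps p)) <= K" for p q K
  proof -
   have img: "EX q':closed_segment p q. z = Ps q'" if zs: "z : closed_segment (Ps p) (Ps q)" for z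
   proof -
    obtain u where u: "0 <= u" "u <= 1" "z = (1 - u) *\<^sub>R Ps p + u *\<^sub>R Ps q" using zs by (auto simp: in_segment)
    have "z = Ps ((1 - u) *\<^sub>R p + u *\<^sub>R q)"
     unfolding u(3) Ps_def by (simp add: algebra_simps add_divide_distrib diff_divide_distrib)
    moreover have "(1 - u) *\<^sub>R p + u *\<^sub>R q : closed_segment p q" unfolding in_segment using u by blast
    ultimately show ?thesis by blast
   qed
   show ?thesis unfolding E_def
   proof (rule joined_segment)
    show "closed_segment (Ps p) (Ps q) \<subseteq> Xp - Bad" using img s Ps(4) by blast
    show "sqrt (gd dl z (Ps q - Ps p) (Ps q - Ps p)) <= K" if "z : closed_segment (Ps p) (Ps q)" for z using img[OF that] K by blast
   qed
  qed
  have n: "norm (fst (Ps q')) <= R" "norm (snd (Ps q')) <= R" if "q' : Win" for q' using Ps(1,2)[OF that] that R by (auto simp: Win_def)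
  have hor: "E (a, ta) (b, ta) (3 * nu * (b - a))" "ta = rh ==> E (a, ta) (b, ta) (2 * lam * nu * (b - a))"
   if ab: "a <= b" "!!t. t : {a..b} ==> (t, ta) : Win & Ps (t, ta) ~: Bad" for a b ta
  proof -
   have s: "EX t:{a..b}. q' = (t, ta)" if zs: "q' : closed_segment (a, ta) (b, ta)" for q'
    using closed_segment_PairD[of "fst q'" "snd q'" a ta b ta] zs ab(1) by (cases q') (auto simp: closed_segment_eq_real_ivl)
   have v: "Ps (b, ta) - Ps (a, ta) = ((b - a) *\<^sub>R e1, 0)" by (simp add: Ps_def scaleR_left_diff_distrib)
   have nv: "norm ((b - a) *\<^sub>R e1) = b - a" "norm ((b - a) *\<^sub>R e1, 0 :: real^'n) = b - a" using ab(1) e1 by (simp_all add: norm_Pair)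
   show "E (a, ta) (b, ta) (3 * nu * (b - a))"
   proof (rule seg, use s ab(2) in blast)
    fix q' assume "q' : closed_segment (a, ta) (b, ta)"
    then have "q' : Win" using s ab(2) by blast
    from sqrt_gd_Q(1)[OF ok n[OF this], of "((b - a) *\<^sub>R e1, 0)"]
    show "sqrt (gd dl (Ps q') (Ps (b, ta) - Ps (a, ta)) (Ps (b, ta) - Ps (a, ta))) <= 3 * nu * (b - a)" unfolding v nv(2) by simp
   qed
   assume ta: "ta = rh"
   show "E (a, ta) (b, ta) (2 * lam * nu * (b - a))"
   proof (rule seg, use s ab(2) in blast)
    fix q' assume q': "q' : closed_segment (a, ta) (b, ta)"
    then have qW: "q' : Win" "snd q' = rh" using s ab(2) ta by fastforce+
    have "norm (snd (Ps q')) = rh" using Ps(2)[OF qW(1)] qW(2) by simp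
    from horizontal_top[OF ok n(1)[OF qW(1)] this, of "(b - a) *\<^sub>R e1"]
    show "sqrt (gd dl (Ps q') (Ps (b, ta) - Ps (a, ta)) (Ps (b, ta) - Ps (a, ta))) <= 2 * lam * nu * (b - a)" unfolding v nv(1) .
   qed
  qed
  have ver: "E (t, a) (t, b) (3 * nu * (b - a))" "s1 <= a ==> E (t, a) (t, b) (2 * nu * (b - a))"
   if ab: "a <= b" "!!ta. ta : {a..b} ==> (t, ta) : Win & Ps (t, ta) ~: Bad" for a b t
  proof -
   have s: "EX ta:{a..b}. q' = (t, ta)" if zs: "q' : closed_segment (t, a) (t, b)" for q'
    using closed_segment_PairD[of "fst q'" "snd q'" t a t b] zs ab(1) by (cases q') (auto simp: closed_segment_eq_real_ivl)
   have v: "Ps (t, b) - Ps (t, a) = (0, ((b - a) / norm w) *\<^sub>R w)" by (simp add: Ps_def scaleR_left_diff_distrib diff_divide_distrib)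
   have nv: "norm (0 :: real^'n, ((b - a) / norm w) *\<^sub>R w) = b - a" using ab(1) w0 by (simp add: norm_Pair)
   show "E (t, a) (t, b) (3 * nu * (b - a))"
   proof (rule seg, use s ab(2) in blast)
    fix q' assume "q' : closed_segment (t, a) (t, b)"
    then have "q' : Win" using s ab(2) by blast
    from sqrt_gd_Q(1)[OF ok n[OF this], of "(0, ((b - a) / norm w) *\<^sub>R w)"]
    show "sqrt (gd dl (Ps q') (Ps (t, b) - Ps (t, a)) (Ps (t, b) - Ps (t, a))) <= 3 * nu * (b - a)" unfolding v nv by simp
   qed
   assume a: "s1 <= a"
   show "E (t, a) (t, b) (2 * nu * (b - a))"
   proof (rule seg, use s ab(2) in blast)
    fix q' assume q': "q' : closed_segment (t, a) (t, b)"
    then have qW: "q' : Win" "s1 <= snd q'" using s ab(2) a by fastforce+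
    have nn: "norm (snd (Ps q')) = snd q'" "norm (snd (Ps q')) < R" using Ps(2)[OF qW(1)] qW(1) R by (auto simp: Win_def)
    have "s1^2 <= (snd q')^2" using qW(2) s1(1) rh(1) by (intro power_mono) auto
    then have "sg dl (snd (Ps q')) = 0"
     using sg_zero[OF ok, of "snd (Ps q')"] W_base[OF nn(2)] nn(1) r1(3)[OF ok] by (simp add: s1_def)
    from sqrt_gd_Q(2)[OF ok n[OF qW(1)] _ this, of "(0, ((b - a) / norm w) *\<^sub>R w)"]
    show "sqrt (gd dl (Ps q') (Ps (t, b) - Ps (t, a)) (Ps (t, b) - Ps (t, a))) <= 2 * nu * (b - a)" unfolding v nv by simp
   qed
  qed
  \<comment> \<open>More than twice the total half side \<open>3 * et1\<close>, as
    \<open>exists_outside\<close> demands.\<close>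
  define L1 where "L1 = 7 * et1"
  have L1: "2 * sum snd S < L1" "0 < L1" "L1 <= R / 32" using Ssum et1 R by (auto simp: L1_def)
  have out: "EX t. a <= t & t <= a + L1 & (ALL s:S. snd s <= \<bar>t - c s\<bar>)" for a and c :: "(real \<times> real) \<times> real => real"
   using exists_outside[OF S(1,2) L1(1), where a = a and c = c] by auto
  obtain tA where tA: "0 <= tA" "tA <= 0 + L1" "ALL s:S. snd s <= \<bar>tA - fst (fst s)\<bar>" using out[of 0 "%s. fst (fst s)"] by (elim exE conjE)
  \<comment> \<open>Shifted outwards by \<open>L1\<close>, so that \<open>tB - tA\<close> lies
    between \<open>el\<close> and \<open>el + 2 * L1\<close> wherever \<open>tA\<close> falls in
    \<open>{0..L1}\<close>; likewise for \<open>tB'\<close> on the other side.\<close>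
  obtain tB where tB: "el + L1 <= tB" "tB <= el + L1 + L1" "ALL s:S. snd s <= \<bar>tB - fst (fst s)\<bar>" using out[of "el + L1" "%s. fst (fst s)"] by (elim exE conjE)
  obtain tB' where tB': "- el - L1 <= tB'" "tB' <= - el - L1 + L1" "ALL s:S. snd s <= \<bar>tB' - fst (fst s)\<bar>" using out[of "- el - L1" "%s. fst (fst s)"] by (elim exE conjE)
  obtain tas where tas: "R / 4 <= tas" "tas <= R / 4 + L1" "ALL s:S. snd s <= \<bar>tas - snd (fst s)\<bar>" using out[of "R / 4" "%s. snd (fst s)"] by (elim exE conjE)
  have elR: "el = R / 32" "hh <= R / 32" using hh_pos by (auto simp: el_def)
  have lineA: "(tA, ta) ~: osqs S" and lineB: "(tB, ta) ~: osqs S" and lineB': "(tB', ta) ~: osqs S"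
   and lines: "(t, tas) ~: osqs S" for t ta
   using tA(3) tB(3) tB'(3) tas(3) by (fastforce simp: osq_def)+
  have win: "(t, ta) : Win" if "- R / 4 <= t" "t <= R / 4" "R / 4 <= ta" "ta <= R / 2" for t ta using that by (simp add: Win_def)
  have ranges: "- R / 4 <= tA" "tA <= R / 4" "- R / 4 <= tB" "tB <= R / 4" "- R / 4 <= tB'" "tB' <= R / 4" "R / 4 <= tas" "tas <= R / 2"
   "rh + hh <= R / 2" "tA <= tB" "tB' <= tA"
   using tA(1,2) tB(1,2) tB'(1,2) tas(1,2) L1(2,3) elR R rhR by linarith+
  define A where "A = Ps (tA, rh)"
  define B where "B = Ps (tB, rh)"
  define B' where "B' = Ps (tB', rh)"
  define C' where "C' = Ps (tA, rh + hh)"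
  have rhW: "R / 4 <= rh" "rh <= R / 2" using rhR R by auto
  have hpos: "0 < hh" by (rule hh_pos)
  have W4: "(tA, rh) : Win" "(tB, rh) : Win" "(tB', rh) : Win" "(tA, rh + hh) : Win"
   using ranges rhW hpos by (auto intro!: win)
  have verA: "(tA, ta) : Win & Ps (tA, ta) ~: Bad" if "ta : {R/4..R/2}" for ta
  proof
   show "(tA, ta) : Win" using that ranges by (intro win) auto
   then show "Ps (tA, ta) ~: Bad" by (rule free[OF _ lineA])
  qed
  \<comment> \<open>This line is free by the choice of the slice, whereas the other lines are free
    because they miss all squares.\<close>
  have ver0: "(0, ta) : Win & Ps (0, ta) ~: Bad" if ta: "ta : {R/4..R/2}" for ta
  proof
   show m: "(0, ta) : Win" using ta R by (intro win) auto
   show "Ps (0, ta) ~: Bad"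
   proof
    assume "Ps (0, ta) : Bad"
    then obtain j where "j : J" "norm (fst (Ps (0, ta)) - x j) < r j" "norm (snd (Ps (0, ta)) - y j) < r j" using J(4)[OF Ps(3)[OF m]] unfolding Bad_def by blast
    then show False using free0[OF _ ta] by (auto simp: Ps_def)
   qed
  qed
  have start: "Ps (0, norm w) = (x0, w)" using w0 by (simp add: Ps_def)
  have in0: "orb Dk (Ps (0, norm w)) ~: Z"
   using xw(2) Ps(3)[of "(0, norm w)"] win[of 0 "norm w"] wn R unfolding start BZ_def by auto
  have conn: "EX c. E (t, a) (t, b) c & 0 <= c" if "!!ta. ta : {R/4..R/2} ==> (t, ta) : Win & Ps (t, ta) ~: Bad" "a : {R/4..R/2}" "b : {R/4..R/2}" for t a b
  proof (cases "a <= b")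
   case True
   then show ?thesis using ver(1)[OF True, of t] that nu1 by (intro exI[of _ "3 * nu * (b - a)"]) auto
  next
   case False
   then show ?thesis using Esym[OF ver(1)[of b a t]] that nu1 by (intro exI[of _ "3 * nu * (a - b)"]) auto
  qed
  \<comment> \<open>From the point \<open>(x0, w)\<close> outside \<open>Z\<close> along its free
    ray, across at the free height \<open>tas\<close>, and along the line over \<open>tA\<close> to
    \<open>A\<close>. The length does not matter: the path only shows that \<open>A\<close> lies
    outside \<open>Z\<close>.\<close>
  obtain ca where ca: "E (0, norm w) (0, tas) ca" "0 <= ca" using conn[OF ver0, of "norm w" tas] wn ranges by auto
  have cb: "E (0, tas) (tA, tas) (3 * nu * (tA - 0))"
  proof (rule hor(1)[OF tA(1)])
   fix t assume t: "t : {0..tA}"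
   show "(t, tas) : Win & Ps (t, tas) ~: Bad"
   proof
    show "(t, tas) : Win" using t ranges R by (intro win) auto
    then show "Ps (t, tas) ~: Bad" by (rule free[OF _ lines])
   qed
  qed
  obtain cc where cc: "E (tA, tas) (tA, rh) cc" "0 <= cc" using conn[OF verA, of tas rh] rhW ranges by auto
  have "E (0, norm w) (tA, rh) (ca + 3 * nu * (tA - 0) + cc)"
   using ca(2) cc(2) tA(1) nu1 by (intro Etrans[OF Etrans[OF ca(1) cb] cc(1)]) auto
  then have AZ: "orb Dk A ~: Z"
   using joined_intrinsic(1)[OF orb_self sm, of Z "Ps (0, norm w)" A] in0 unfolding E_def Bad_def A_def by blast
  \<comment> \<open>On the sphere of radius \<open>rh\<close> the rate is
    \<open>2 * lam * nu\<close>; the detours leave it and are charged at the crude rate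
    \<open>3 * nu\<close>.\<close>
  have horiz: "E (a, rh) (b, rh) (2 * lam * nu * (b - a) + 6 * (3 * nu) * sum snd (meets S a b rh))"
   if ab: "- R / 4 <= a" "a <= b" "b <= R / 4" "(a, rh) ~: osqs S" "(b, rh) ~: osqs S" for a b
  proof (rule detour[OF S(1,2,5), where H = "6 * et1" and al = "- R / 4" and be = "R / 4"])
   have H: "rh + 6 * et1 <= R / 2" using et1(2) rhR R by linarith
   show "2 * snd s <= 6 * et1" if s: "s : S" for s
   proof -
    have "snd s <= sum snd S" by (rule member_le_sum[OF s]) (use S(1,2) in "auto simp: less_imp_le")
    then show ?thesis using Ssum by simp
   qed
   show "E (a, rh) (b, rh) (2 * lam * nu * (b - a))" if "- R / 4 <= a" "a <= b" "b <= R / 4" "!!t. t : {a..b} ==> (t, rh) ~: osqs S" for a b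
   proof (rule hor(2)[OF that(2) _ refl])
    fix t assume t: "t : {a..b}"
    have "(t, rh) : Win" using t that rhW by (intro win) auto
    then show "(t, rh) : Win & Ps (t, rh) ~: Bad" using free that(4)[OF t] by blast
   qed
   show "E (a, ta) (b, ta) (3 * nu * (b - a))" if "- R / 4 <= a" "a <= b" "b <= R / 4" "rh <= ta" "ta <= rh + 6 * et1" "!!t. t : {a..b} ==> (t, ta) ~: osqs S" for a b ta
   proof (rule hor(1)[OF that(2)])
    fix t assume t: "t : {a..b}"
    have "(t, ta) : Win" using t that rhW H by (intro win) auto
    then show "(t, ta) : Win & Ps (t, ta) ~: Bad" using free that(6)[OF t] by blast
   qed
   show "E (t, rh) (t, ta) (3 * nu * (ta - rh)) & E (t, ta) (t, rh) (3 * nu * (ta - rh))"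
    if "- R / 4 <= t" "t <= R / 4" "rh <= ta" "ta <= rh + 6 * et1" "!!ta'. ta' : {rh..ta} ==> (t, ta') ~: osqs S" for t ta
   proof -
    have "E (t, rh) (t, ta) (3 * nu * (ta - rh))"
    proof (rule ver(1)[OF that(3)])
     fix ta' assume t: "ta' : {rh..ta}"
     have "(t, ta') : Win" using t that rhW H by (intro win) auto
     then show "(t, ta') : Win & Ps (t, ta') ~: Bad" using free that(5)[OF t] by blast
    qed
    then show ?thesis using Esym by blast
   qed
  qed (use Etrans Emono ab nu1 lam_pos in auto)
  have horiz': "E (a, rh) (b, rh) (2 * lam * nu * el + ze)"
   if ab: "- R / 4 <= a" "a <= b" "b <= R / 4" "(a, rh) ~: osqs S" "(b, rh) ~: osqs S" "b - a <= el + 2 * L1" for a b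
  proof (rule Emono[OF horiz[OF ab(1-5)]])
   have "sum snd (meets S a b rh) <= sum snd S" by (rule sum_mono2) (use S(1,2) in "auto simp: less_imp_le")
   then have "18 * nu * sum snd (meets S a b rh) <= 18 * nu * (3 * et1)" using Ssum nu1 by (intro mult_left_mono) auto
   have "2 * lam * nu * (b - a) <= 2 * lam * nu * (el + 2 * L1)" using ab(6) lam_pos nu1 by (intro mult_left_mono) auto
   have "2 * nu * (2 * L1) * lam <= 2 * nu * (2 * L1) * 1" using lam_pos nu1 L1 by (intro mult_left_mono) auto
   show "2 * lam * nu * (b - a) + 6 * (3 * nu) * sum snd (meets S a b rh) <= 2 * lam * nu * el + ze"
   proof -
    have "18 * nu * (3 * et1) = 54 * (nu * et1)" "2 * nu * (2 * L1) * 1 = 28 * (nu * et1)"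
     "2 * lam * nu * (el + 2 * L1) = 2 * lam * nu * el + 2 * nu * (2 * L1) * lam" "100 * nu * et1 = 100 * (nu * et1)"
     by (simp_all add: L1_def algebra_simps)
    moreover have "6 * (3 * nu) * z = 18 * nu * z" for z by simp
    moreover have "0 <= nu * et1" using nu1 et1(1) by simp
    ultimately show ?thesis using et1(3) \<open>18 * nu * sum snd (meets S a b rh) <= 18 * nu * (3 * et1)\<close>
      \<open>2 * lam * nu * (b - a) <= 2 * lam * nu * (el + 2 * L1)\<close> \<open>2 * nu * (2 * L1) * lam <= 2 * nu * (2 * L1) * 1\<close>
     by (simp only:)
   qed
  qed
  have EAB: "E (tA, rh) (tB, rh) (2 * lam * nu * el + ze)"
   by (rule horiz'[OF ranges(1,10,4) lineA lineB]) (use tA tB in linarith)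
  have EAB': "E (tA, rh) (tB', rh) (2 * lam * nu * el + ze)"
   by (rule Esym[OF horiz'[OF ranges(5,11,2) lineB' lineA]]) (use tA tB' in linarith)
  have EAC: "E (tA, rh) (tA, rh + hh) (2 * nu * hh + ze)"
  proof (rule Emono)
   \<comment> \<open>The crude rate up to the outer edge \<open>s1\<close>, beyond it that of the
     product metric.\<close>
   show "E (tA, rh) (tA, rh + hh) (3 * nu * (s1 - rh) + 2 * nu * (rh + hh - s1))"
    using s1 nu1 verA rhW ranges(9) by (intro Etrans[OF ver(1) ver(2)]) auto
   have "nu * (s1 - rh) <= ze" using s1 nu1 mult_nonneg_nonneg[of nu "s1 - rh"] by simp
   then show "3 * nu * (s1 - rh) + 2 * nu * (rh + hh - s1) <= 2 * nu * hh + ze" by (simp add: algebra_simps)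
  qed
  have fromA: "orb Dk (Ps q) ~: Z" "?d (orb Dk A) (orb Dk (Ps q)) <= ennreal c" if "E (tA, rh) q c" for q c
  proof -
   have j: "joined Xp (gd dl) {x. orb Dk x : quot_top Xp Dk frontier_of Z} A (Ps q) c"
    using that unfolding E_def Bad_def A_def .
   show "orb Dk (Ps q) ~: Z" by (rule joined_intrinsic(1)[OF orb_self sm j AZ])
   show "?d (orb Dk A) (orb Dk (Ps q)) <= ennreal c" by (rule joined_intrinsic(2)[OF orb_self sm j AZ])
  qed
  note dAB = fromA[OF EAB, folded B_def] and dAB' = fromA[OF EAB', folded B'_def] and dAC = fromA[OF EAC, folded C'_def]
  note AQ = Ps(3,4)[OF W4(1), folded A_def] and BQ = Ps(3,4)[OF W4(2), folded B_def]
   and B'Q = Ps(3,4)[OF W4(3), folded B'_def] and CQ = Ps(3,4)[OF W4(4), folded C'_def]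
  \<comment> \<open>Intrinsic distance dominates quotient distance, and below \<open>R / 2\<close>
    the latter can be read off in \<open>Q\<close>; beyond that the assumption on \<open>X\<close>
    decides.\<close>
  have lower: "ennreal X <= ?d (orb Dk p) (orb Dk q)"
   if pq: "p : Q" "q : Q" and X: "X <= R / 2" "Dd dl p q < R / 2 ==> X <= Dd dl p q" for p q X
  proof (rule ccontr)
   assume "~ ?thesis"
   then have "qd dl (orb Dk p) (orb Dk q) < ennreal X" unfolding not_le by (rule le_less_trans[OF le_intrinsic_dist])
   then have less: "Dd dl p q < X" by (rule quot_less[OF ok pq _ X(1)])
   then have "X <= Dd dl p q" using X(1) by (intro X(2)) linarith
   then show False using less by simp
  qed
  have "lam * lam <= lam * 1" using lam_pos by (intro mult_left_mono) auto
  then have "3 / 4 <= lam" using lam_kp(2) unfolding power2_eq_square by linarith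
  note lam1 = lam_pos(2) this
  have "ennreal (4 * lam * el) <= ?d (orb Dk B) (orb Dk B')"
  proof (rule lower[OF BQ(1) B'Q(1)])
   have "lam * el <= 1 * el" using lam1 el_pos by (intro mult_right_mono) auto
   moreover have "4 * lam * el = 4 * (lam * el)" by simp
   ultimately show "4 * lam * el <= R / 2" using elR R by linarith
   have "fst B' - fst B = (tB' - tB) *\<^sub>R e1" by (simp add: B_def B'_def Ps_def scaleR_left_diff_distrib)
   then have "norm (fst B' - fst B) = tB - tB'" using e1 ranges by simp
   then have "2 * lam * (tB - tB') <= Dd dl B B'" using Dd_ge_fst[OF ok BQ(2) B'Q(2)] by simp
   moreover have "2 * lam * (2 * el) <= 2 * lam * (tB - tB')" using tB tB' lam1 L1 by (intro mult_left_mono) auto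
   ultimately show "4 * lam * el <= Dd dl B B'" by simp
  qed
  moreover have corner': "ennreal (2 * el / lam - ze) <= ?d (orb Dk C') (orb Dk (Ps (t, rh)))"
   if t: "(t, rh) : Win" "el <= \<bar>t - tA\<bar>" for t
  proof (rule lower[OF CQ(1) Ps(3)[OF t(1)]])
   have "el / lam <= el / (3 / 4)" using lam1 el_pos by (intro divide_left_mono) auto
   also have "el / (3 / 4) = el * (4 / 3)" by simp
   finally have "el / lam <= el * (4 / 3)" .
   moreover have "2 * el / lam = 2 * (el / lam)" by simp
   ultimately show "2 * el / lam - ze <= R / 2" using ze elR R by linarith
   assume less: "Dd dl C' (Ps (t, rh)) < R / 2"
   have sn: "norm (snd C') = rh + hh" "norm (snd (Ps (t, rh))) = rh" using Ps(2)[OF W4(4)] Ps(2)[OF t(1)] by (simp_all add: C'_def)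
   have "fst (Ps (t, rh)) - fst C' = (t - tA) *\<^sub>R e1" by (simp add: C'_def Ps_def scaleR_left_diff_distrib)
   then have fn: "norm (fst (Ps (t, rh)) - fst C') = \<bar>t - tA\<bar>" using e1 by simp
   \<comment> \<open>The corner estimate sees only the height \<open>rh + hh - s1\<close> above the
     outer edge; the difference to \<open>hh\<close> costs at most \<open>ze\<close>.\<close>
   have ge: "2 * (lam * \<bar>t - tA\<bar> + kp * (rh + hh - s1)) <= Dd dl C' (Ps (t, rh))"
    using Dd_ge_corner[OF ok CQ(1) Ps(3)[OF t(1)] less] s1 sn fn by (simp add: s1_def)
   have "lam * el <= lam * \<bar>t - tA\<bar>" using t(2) lam1 by (intro mult_left_mono) auto
   have "kp^2 <= 1^2" using lam_kp(1) zero_le_power2[of lam] unfolding one_power2 by linarith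
   then have "kp <= 1" by (rule power2_le_imp_le) simp
   then have "kp * (s1 - rh) <= 1 * (s1 - rh)" using s1 by (intro mult_right_mono) auto
   show "2 * el / lam - ze <= Dd dl C' (Ps (t, rh))"
    proof -
    have "2 * (lam * \<bar>t - tA\<bar> + kp * (rh + hh - s1)) = 2 * (lam * \<bar>t - tA\<bar>) + 2 * (kp * hh) - 2 * (kp * (s1 - rh))"
     "2 * el / lam = 2 * (el / lam)" by (simp_all add: algebra_simps)
    then show ?thesis
     using ge corner s1(4) \<open>lam * el <= lam * \<bar>t - tA\<bar>\<close> \<open>kp * (s1 - rh) <= 1 * (s1 - rh)\<close> by linarith
   qed
  qed
  moreover have "ennreal (2 * el / lam - ze) <= ?d (orb Dk C') (orb Dk B)"
   unfolding B_def by (rule corner'[OF W4(2)]) (use tA tB in linarith)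
  moreover have "ennreal (2 * el / lam - ze) <= ?d (orb Dk C') (orb Dk B')"
   unfolding B'_def by (rule corner'[OF W4(3)]) (use tA tB' in linarith)
  moreover have "{orb Dk A, orb Dk B, orb Dk B', orb Dk C'} \<subseteq> quot Xp Dk - Z"
   using AZ dAB(1) dAB'(1) dAC(1) AQ(2) BQ(2) B'Q(2) CQ(2) by (auto simp: quot_def)
  ultimately show ?case using dAB(2) dAB'(2) dAC(2) unfolding skew_def by blast
  qed
 qed
 qed
qed

end

section \<open>Contradiction with the almost Euclidean product metric\<close>

context four
begin

text \<open>The images of the four points are lifted next to a lift of \<open>f A\<close>, which
  isometries move to the origin. There the product distance is twice the Euclidean one up to the
  factor \<open>nu\<close>, and the six bounds become those of \<open>four_points_euclid\<close>
  with \<open>l = el\<close>.\<close>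

lemma no_approximation:
 assumes th: "th = kp^2 / 1600" and nu_le: "nu <= 1 + th / 4" and ze: "ze = th * hh / 8"
  and gh: "gh_approximation ze Y d (quot Xp Dk) (quot_dist Xp Dk g0) f"
  and Y: "{A, B, B', C} \<subseteq> Y"
  and sk: "skew d ze A B B' C"
 shows False
proof -
 have up: "d A B <= ennreal (2 * lam * nu * el + ze)" "d A B' <= ennreal (2 * lam * nu * el + ze)" "d A C <= ennreal (2 * nu * hh + ze)"
  and low: "ennreal (4 * lam * el) <= d B B'" "ennreal (2 * el / lam - ze) <= d C B" "ennreal (2 * el / lam - ze) <= d C B'"
  using sk unfolding skew_def by blast+
 let ?q = "quot_dist Xp Dk g0"
 have ok0: "ok (rh^2 / 4)" using rh by (simp add: ok_def)
 have nu1: "1 <= nu" and R1: "0 < 1 - R^2" using nu[OF ok0] by auto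
 have "lam * lam <= lam * 1" using lam_pos by (intro mult_left_mono) auto
 then have lam34: "3 / 4 <= lam" using lam_kp(2) unfolding power2_eq_square by linarith
 have k4: "kp^2 <= 1 / 4" using lam_kp by linarith
 have th1: "0 < th" "th <= 1" using kp_pos k4 by (auto simp: th)
 have ze0: "0 < ze" using th1 hh_pos by (simp add: ze)
 have zeel: "8 * ze <= th * el" using mult_left_mono[OF hh_pos(2), of th] th1 by (simp add: ze)
 have fY: "f A : quot Xp Dk" "f B : quot Xp Dk" "f B' : quot Xp Dk" "f C : quot Xp Dk"
  using gh Y by (auto simp: gh_approximation_def)
 have gh1: "?q (f x) (f x') <= d x x' + ennreal ze" and gh2: "d x x' <= ?q (f x) (f x') + ennreal ze" if "x : Y" "x' : Y" for x x'
  using gh that by (auto simp: gh_approximation_def)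
 obtain a where a: "a : Xp" "f A = orb Dk a" using fY(1) by (auto simp: quot_def)
 \<comment> \<open>\<open>3 * ze\<close> and not \<open>2 * ze\<close>: a quotient distance is an
   infimum, so lifting requires a strict inequality.\<close>
 have lift: "EX b:Xp. orb Dk b = f x & D0 a b < l + 3 * ze" if "x : Y" "f x : quot Xp Dk" "d A x <= ennreal (l + ze)" "0 <= l" for x l
 proof -
  have "?q (orb Dk a) (f x) <= d A x + ennreal ze" using gh1[of A x] that Y a(2) by simp
  also have "... <= ennreal (l + ze) + ennreal ze" using that(3) by (rule add_right_mono)
  also have "... = ennreal (l + ze + ze)" using that(4) ze0 by (intro ennreal_plus[symmetric]) auto
  also have "... < ennreal (l + 3 * ze)" using that(4) ze0 by (intro ennreal_lessI) auto
  finally show ?thesis by (rule lift_close[OF a(1) that(2)]) blast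
 qed
 have nn: "0 <= 2 * lam * nu * el" "0 <= 2 * nu * hh" using lam_pos nu1 el_pos hh_pos by auto
 obtain b where b: "b : Xp" "orb Dk b = f B" "D0 a b < 2 * lam * nu * el + 3 * ze" using lift[OF _ fY(2) up(1) nn(1)] Y by auto
 obtain b' where b': "b' : Xp" "orb Dk b' = f B'" "D0 a b' < 2 * lam * nu * el + 3 * ze" using lift[OF _ fY(3) up(2) nn(1)] Y by auto
 obtain c where c: "c : Xp" "orb Dk c = f C" "D0 a c < 2 * nu * hh + 3 * ze" using lift[OF _ fY(4) up(3) nn(2)] Y by auto
 have below: "l <= D0 p q + ze" if "x : Y" "x' : Y" "p : Xp" "q : Xp" "orb Dk p = f x" "orb Dk q = f x'" "ennreal l <= d x x'" for l p q x x'
 proof -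
  have "ennreal l <= ?q (f x) (f x') + ennreal ze" using gh2[OF that(1,2)] that(7) by simp
  also have "... <= ennreal (D0 p q) + ennreal ze"
   using quot_dist_le[OF semi_HP that(3,4)] unfolding that(5,6) by (rule add_right_mono)
  also have "... = ennreal (D0 p q + ze)" using ze0 by (intro ennreal_plus[symmetric]) auto
  finally show ?thesis by (rule iffD1[OF ennreal_le_iff, rotated]) (use ze0 in auto)
 qed
 obtain f1 where f1: "f1 : hyp_isom" "f1 (fst a) = 0" using hyp_transitive[OF HP_D(1)[OF a(1)]] by metis
 obtain f2 where f2: "f2 : hyp_isom" "f2 (snd a) = 0" using hyp_transitive[OF HP_D(2)[OF a(1)]] by metis
 let ?f = "map_prod f1 f2"
 have fX: "?f z : Xp" if "z : Xp" for z using map_prod_image[OF f1(1) f2(1)] that by blast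
 have fiso: "D0 (?f z) (?f w) = D0 z w" if "z : Xp" "w : Xp" for z w by (rule hyp_prod_isometry[OF f1(1) f2(1) that])
 have fa: "?f a = 0" using f1(2) f2(2) by (cases a) (simp add: zero_prod_def)
 have nrm: "2 * norm (?f z) <= D0 a z" if "z : Xp" for z
  using D0_ge_norm[OF ok0 fX[OF a(1)] fX[OF that]] fiso[OF a(1) that] fa by simp
 have upper: "D0 p q <= 2 * nu * norm (q - p)" if "norm p <= R" "norm q <= R" for p q :: "'n pt"
 proof (rule rdist_le_segment)
  have seg: "closed_segment p q \<subseteq> cball 0 R" using that by (intro closed_segment_subset) auto
  have comp: "norm (fst z) <= R" "norm (snd z) <= R" if "z : closed_segment p q" for z
   using seg that norm_fst_le[of "fst z" "snd z"] norm_snd_le[of "snd z" "fst z"] by (auto intro: order.trans)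
  show "closed_segment p q \<subseteq> Xp"
  proof
   fix z assume "z : closed_segment p q"
   then show "z : Xp" using comp[of z] R by (simp add: hyp_prod_def mem_Times_iff)
  qed
  fix z assume z: "z : closed_segment p q"
  let ?v = "q - p"
  have sq: "hm x v v <= (2 * nu)^2 * (norm v)^2" if "norm x <= R" for x v :: "real^'n"
   using power_mono[OF sqrt_hyp_metric_Q[OF ok0 that, of v], of 2] by (simp add: power_mult_distrib hyp_metric_nonneg)
  have "g0 z ?v ?v <= (2 * nu)^2 * (norm (fst ?v))^2 + (2 * nu)^2 * (norm (snd ?v))^2"
   unfolding hyp_prod_metric_def by (intro add_mono sq comp[OF z])
  also have "... = (2 * nu * norm ?v)^2" by (simp add: norm_prod_def power_mult_distrib distrib_left)
  finally show "sqrt (g0 z ?v ?v) <= 2 * nu * norm ?v" using nu1 by (intro real_le_lsqrt) auto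
 qed (use nu1 in auto)
 have step: "(1 + th / 4) * y + 3 * ze / 2 <= (1 + th) * y" if "ze * 2 <= th * y" for y using that by (simp add: algebra_simps)
 \<comment> \<open>Since \<open>hh <= el\<close> and \<open>lam >= 3/4\<close>, one
   \<open>ze\<close> proportional to \<open>hh\<close> is small against all lengths
   involved.\<close>
 have zey: "ze * 2 <= th * (lam * el)" "ze * 2 <= th * hh"
 proof -
  have "el * (3 / 4) <= el * lam" using lam34 el_pos by (intro mult_left_mono) auto
  then have "th * (el * (3 / 4)) <= th * (el * lam)" by (rule mult_left_mono[OF _ less_imp_le[OF th1(1)]])
  then have "(th * el) * (3 / 4) <= th * (lam * el)" by (simp only: mult_ac)
  then show "ze * 2 <= th * (lam * el)" using zeel ze0 by linarith
  show "ze * 2 <= th * hh" using mult_pos_pos[OF th1(1) hh_pos(1)] by (simp add: ze)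
 qed
 have half: "norm (?f z) <= (1 + th) * y" if "z : Xp" "D0 a z < 2 * nu * y + 3 * ze" "0 <= y" "ze * 2 <= th * y" for z y
 proof -
  have "nu * y <= (1 + th / 4) * y" using nu_le that(3) by (rule mult_right_mono)
  then show ?thesis using nrm[OF that(1)] that(2) step[OF that(4)] by simp
 qed
 have u: "norm (?f b) <= (1 + th) * (lam * el)" "norm (?f b') <= (1 + th) * (lam * el)" "norm (?f c) <= (1 + th) * hh"
  by (rule half; use b b' c lam_pos el_pos hh_pos zey in "simp add: mult_ac")+
 have "(1 + th) * y <= R" if "0 <= y" "y <= el" for y
 proof -
  have "(1 + th) * y <= 2 * el" using that th1 by (intro mult_mono) auto
  then show ?thesis using R by (simp add: el_def)
 qed
 from this[of "lam * el"] this[of hh] have small: "norm (?f b) <= R" "norm (?f b') <= R" "norm (?f c) <= R"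
  using u hh_pos lam_pos el_pos mult_right_mono[OF lam_pos(2), of el] by auto
 \<comment> \<open>A quarter of \<open>th\<close> pays for \<open>nu\<close>; the remaining
   \<open>3/4 * th\<close> absorbs the errors \<open>ze\<close>.\<close>
 have nut: "nu * (1 - th) <= 1 - 3 / 4 * th"
 proof -
  have "nu * (1 - th) <= (1 + th / 4) * (1 - th)" using nu_le th1 by (intro mult_right_mono) auto
  also have "... <= 1 - 3 / 4 * th" using th1 by (simp add: algebra_simps)
  finally show ?thesis .
 qed
 have far: "(1 - th) * y <= norm (?f w - ?f z)"
  if "z : Xp" "w : Xp" "norm (?f z) <= R" "norm (?f w) <= R" "2 * y <= D0 z w + 2 * ze" "0 <= y" "4 * ze <= 3 * th * y" for z w y
 proof -
  have "2 * y - 2 * ze <= 2 * nu * norm (?f w - ?f z)" using upper[OF that(3,4)] fiso[OF that(1,2)] that(5) by simp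
  moreover have "nu * (1 - th) * y <= (1 - 3 / 4 * th) * y" using nut that(6) by (rule mult_right_mono)
  moreover have "(1 - 3 / 4 * th) * y = y - 3 / 4 * (th * y)" "2 * nu * norm (?f w - ?f z) = 2 * (nu * norm (?f w - ?f z))" "nu * (1 - th) * y = nu * ((1 - th) * y)" "3 * th * y = 3 * (th * y)"
   by (simp_all add: algebra_simps)
  ultimately have "nu * ((1 - th) * y) <= nu * norm (?f w - ?f z)" using that(7) by linarith
  then show ?thesis using nu1 by simp
 qed
 have "4 * lam * el <= D0 b' b + ze" using below[OF _ _ b(1) b'(1) b(2) b'(2) low(1)] Y D0_sym[of b b'] by simp
 then have 1: "(1 - th) * (2 * (lam * el)) <= norm (?f b - ?f b')"
  using b b' small lam_pos el_pos zey ze0 th1 by (intro far) auto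
 have zel: "4 * ze <= 3 * th * (el / lam)"
 proof -
  have "el / 1 <= el / lam" using lam_pos el_pos by (intro divide_left_mono) auto
  from mult_left_mono[OF this, of th] show ?thesis using th1 zeel ze0 by simp
 qed
 have low': "2 * el / lam - ze <= D0 b c + ze" "2 * el / lam - ze <= D0 b' c + ze"
  using below[OF _ _ c(1) b(1) c(2) b(2) low(2)] below[OF _ _ c(1) b'(1) c(2) b'(2) low(3)] Y D0_sym[of c] by auto
 have 2: "(1 - th) * (el / lam) <= norm (?f c - ?f b)" "(1 - th) * (el / lam) <= norm (?f c - ?f b')"
  by (rule far; use low' b b' c small lam_pos el_pos zel in simp)+
 show False
  by (rule four_points_euclid[OF kp_pos lam_pos(1) lam_kp(1) _ th el_pos u(1,2) u(3)[unfolded hh_def] 1 2]) (use lam_kp(2) in simp)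
qed

end

theorem theoremA:
  fixes \<Gamma>\<^sub>1 \<Gamma>\<^sub>2 :: "((real ^ 'n::finite) \<Rightarrow> (real ^ 'n)) set"
  assumes "CARD('n) \<ge> 3"
    and "cocompact_lattice hyp_space hyp_metric \<Gamma>\<^sub>1"
    and "torsion_free (isom_group hyp_space hyp_metric) \<Gamma>\<^sub>1"
    and "cocompact_lattice hyp_space hyp_metric \<Gamma>\<^sub>2"
    and "torsion_free (isom_group hyp_space hyp_metric) \<Gamma>\<^sub>2"
  shows "let X = hyp_prod; D = prod_action \<Gamma>\<^sub>1 \<Gamma>\<^sub>2; M = quot X D; g\<^sub>0 = hyp_prod_metric in
    \<exists>g :: nat \<Rightarrow> ((real ^ 'n) \<times> (real ^ 'n)) tensor2.
      (\<forall>i. quot_riemannian_metric X D (g i)) \<and>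
      (\<forall>i. emeasure (quot_vol X D (g i)) M = emeasure (quot_vol X D g\<^sub>0) M) \<and>
      (\<lambda>i. volume_entropy X (g i)) \<longlonglongrightarrow> volume_entropy X g\<^sub>0 \<and>
      \<not> (\<exists>Z. (\<forall>i. smooth_region X D (Z i)) \<and>
             (\<lambda>i. emeasure (quot_vol X D (g i)) (Z i)) \<longlonglongrightarrow> 0 \<and>
             (\<lambda>i. boundary_area X D (g i) (Z i)) \<longlonglongrightarrow> 0 \<and>
             mgh_converges
               (\<lambda>i. M - Z i)
               (\<lambda>i. intrinsic_dist (quot_top X D) (quot_dist X D (g i)) (M - Z i))
               (\<lambda>i. restrict_space (quot_vol X D (g i)) (M - Z i))
               M (quot_dist X D g\<^sub>0) (quot_vol X D g\<^sub>0))"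
proof -
 interpret L1: lattice \<Gamma>\<^sub>1 using assms(2,3) by unfold_locales
 interpret L2: lattice \<Gamma>\<^sub>2 using assms(4,5) by unfold_locales
 obtain c1 where c1: "0 < c1" "!!ga z. ga : \<Gamma>\<^sub>1 ==> ga ~= L1.e ==> z : HS ==> c1 <= hdist z (ga z)"
  using L1.injectivity_radius by blast
 obtain c2 where c2: "0 < c2" "!!ga z. ga : \<Gamma>\<^sub>2 ==> ga ~= L2.e ==> z : HS ==> c2 <= hdist z (ga z)"
  using L2.injectivity_radius by blast
 define c0 where "c0 = min c1 c2"
 \<comment> \<open>This is \<open>kp^2 / 1600\<close>, written out because \<open>R\<close> depends
   on it and \<open>kp\<close> belongs to a locale that is interpreted only after \<open>R\<close>
   is chosen.\<close>
 define th where "th = (1 - 1 / (1 + 1 / real CARD('n))) / 1600"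
 have n: "3 <= real CARD('n)" using assms(1) by simp
 have "1 - 1 / (1 + 1 / real CARD('n)) = 1 / (real CARD('n) + 1)" using n by (simp add: field_simps)
 then have th: "0 < th" "th <= 1" using n by (simp_all add: th_def field_simps)
 \<comment> \<open>\<open>c0 / 8\<close> serves the disjointness of the balls around the orbit and
   the embedding of \<open>Q\<close>; \<open>th / 8\<close> gives
   \<open>nu <= 1 + th / 4\<close>.\<close>
 define R where "R = min (c0 / 8) (th / 8)"
 have R: "0 < R" "R <= th / 8" "8 * R <= c0" using c1(1) c2(1) th by (auto simp: R_def c0_def)
 then have R8: "R <= th / 8" by simp
 have R14: "R <= 1 / 4" using R(2) th(2) by linarith
 have R16: "R^2 <= 1 / 16" using power_mono[OF R14, of 2] R(1) by (simp add: power_divide)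
 interpret four \<Gamma>\<^sub>1 \<Gamma>\<^sub>2 R "R / 4" c0
 proof unfold_locales
  show "0 < R" "R <= 1 / 4" "8 * R <= c0" "3 <= CARD('n)" using R R14 assms(1) by auto
  show "0 < R / 4" "2 * (R / 4) <= R" "R / 4 = R / 4" using R by auto
  show "c0 <= hdist z (ga z)" if "ga : \<Gamma>\<^sub>1" "ga ~= L1.e" "z : HS" for ga z using c1(2)[OF that] by (simp add: c0_def)
  show c2': "c0 <= hdist z (ga z)" if "ga : \<Gamma>\<^sub>2" "ga ~= L2.e" "z : HS" for ga z using c2(2)[OF that] by (simp add: c0_def)
  show "ga = L2.e" if g: "ga : \<Gamma>\<^sub>2" "norm y < R" "norm (ga y) < R" for ga y
  proof (rule ccontr)
   assume "ga ~= L2.e"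
   then have "c0 <= hdist y (ga y)" using c2' g R14 by simp
   also have "... <= 2 / (1 - R^2) * norm (ga y - y)" by (rule hdist_le_cball) (use g R14 in auto)
   also have "... <= 3 * (2 * R)"
   proof (rule mult_mono)
    show "2 / (1 - R^2) <= 3" using R16 by (simp add: pos_divide_le_eq)
    show "norm (ga y - y) <= 2 * R" using norm_triangle_ineq4[of "ga y" y] g by simp
   qed auto
   finally show False using R by simp
  qed
 qed
 have nu_le: "nu <= 1 + th / 4"
 proof -
  have ok0: "ok ((R / 4)^2 / 4)" using R by (simp add: ok_def)
  have "R^2 <= (th / 8)^2" by (rule power_mono[OF R8]) (use R(1) in simp)
  also have "... <= th / 8" using th by (simp add: power2_eq_square)
  finally have "R^2 <= th / 8" .
  moreover have "th * R^2 <= 1 * R^2" by (rule mult_right_mono[OF th(2)]) simp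
  moreover have "(1 + th / 4) * (1 - R^2) = 1 + th / 4 - R^2 - th * R^2 / 4" by (simp add: algebra_simps)
  ultimately have "1 <= (1 + th / 4) * (1 - R^2)" using th(1) by linarith
  then show ?thesis unfolding nu_def[OF ok0] using R16 by (simp add: pos_divide_le_eq)
 qed
 have thkp: "th = kp^2 / 1600" using lam_kp(1) lam_sq by (simp add: th_def)
 \<comment> \<open>Starts at the largest width that \<open>ok\<close> admits for
   \<open>rh = R / 4\<close>.\<close>
 define dl where "dl i = (R / 4)^2 / 4 * inverse (real (Suc i))" for i
 have dl: "ok (dl i)" for i
  using R by (auto simp: ok_def dl_def field_simps)
 have dl0: "dl \<longlonglongrightarrow> 0"
  unfolding dl_def using tendsto_mult_left[OF LIMSEQ_inverse_real_of_nat, of "(R / 4)^2 / 4"] by simp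
 define ze where "ze = th * hh / 8"
 have ze: "0 < ze" using th hh_pos by (simp add: ze_def)
 show ?thesis
  unfolding Let_def
 proof (intro exI[of _ "%i. gd (dl i)"] conjI allI notI, goal_cases)
  case (1 i)
  show ?case by (rule quot_riemannian_gd[OF dl])
 next
  case (2 i)
  \<comment> \<open>The volume measures upstairs are equal, so the quotient measures are the same by
    definition.\<close>
  show ?case unfolding quot_vol_def riem_vol_gd[OF dl] ..
 next
  case 3
  show ?case by (rule entropy_converges[OF dl dl0])
 next
  case 4
  then show ?case
  proof (elim exE conjE, goal_cases)
   case Z: (1 Z)
  obtain f where f: "\<forall>\<^sub>F i in sequentially. gh_approximation ze (quot Xp Dk - Z i)
    (intrinsic_dist (quot_top Xp Dk) (qd (dl i)) (quot Xp Dk - Z i)) (quot Xp Dk) (quot_dist Xp Dk g0) (f i)"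
   using Z(4) ze unfolding mgh_converges_def by blast
  show ?case
  proof (rule four_points_exist[OF ze], goal_cases)
   case ex: (1 et)
   note et = ex(1)
   have "\<forall>\<^sub>F i in sequentially. dl i < et" using dl0 et by (rule order_tendstoD(2))
   moreover have "\<forall>\<^sub>F i in sequentially. emeasure (quot_vol Xp Dk (gd (dl i))) (Z i) < ennreal et"
    using Z(2) et by (intro order_tendstoD(2)) auto
   moreover have "\<forall>\<^sub>F i in sequentially. boundary_area Xp Dk (gd (dl i)) (Z i) < ennreal et"
    using Z(3) et by (intro order_tendstoD(2)) auto
   ultimately have "\<forall>\<^sub>F i in sequentially. False"
    using f
   proof eventually_elim
    case (elim i)
    have "closedin (quot_top Xp Dk) (Z i)" using Z(1) by (simp add: smooth_region_def)
    from ex(2)[OF dl elim(1) this elim(2,3)] show False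
    proof (elim exE conjE, goal_cases)
     case (1 A B B' C)
     show False by (rule no_approximation[OF thkp nu_le ze_def elim(4) 1])
    qed
   qed
   then show False by simp
  qed
  qed
 qed
qed

end
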